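(* Let $\mu$ be a Fourier transformable measure supported inside a Meyer set $\Gamma\subset\mathbb{R}^d$. Then there exist a Meyer set $\Lambda\subset\mathbb{R}^d$ and a bounded function $c:\Lambda\to\mathbb{C}$ such that: (a) $\mu_{0a}=\sum_{x\in\Lambda}c(x)\,\delta_x$. (b) $\lim_{\|x\|\to\infty}|c(x)|=0$ (the limit being over $x\in\Lambda$). (c) If there exists some $f\in L^1_{\mathrm{loc}}(\mathbb{R}^d)\cap L^\infty(\mathbb{R}^d)$ such that $(\widehat{\mu})_{\mathrm{ac}}=f\lambda$, then $\sum_{x\in\Lambda}|c(x)|^2<\infty$.
   Context: $\lambda$ is Lebesgue measure on $\mathbb{R}^d$. Measures are complex Radon measures on $\mathbb{R}^d$; a measure $\mu$ is translation bounded if $\sup_t|\mu|(t+K)<\infty$ for every compact $K$. A set $\Lambda\subset\mathbb{R}^d$ is relatively dense if $\Lambda+K=\mathbb{R}^d$ for some compact $K$; uniformly discrete if there is an open neighbourhood $U$ of $0$ with $(x+U)\cap(y+U)=\varnothing$ for all distinct $x,y\in\Lambda$; a Meyer set if it is relatively dense and $\Lambda-\Lambda=\{x-y:x,y\in\Lambda\}$ is uniformly discrete. $\widehat f(x)=\int e^{-2\pi i x\cdot y}f(y)\,dy$, $\check f(x)=\widehat f(-x)$, $\widetilde f(x)=\overline{f(-x)}$, and $\widehat\omega(f)=\omega(\widehat f)$ for tempered distributions. A measure $\mu$ is Fourier transformable if there is a measure $\widehat\mu$ with $\check\varphi\in L^2(|\widehat\mu|)$ and $\mu(\varphi*\widetilde\varphi)=\int|\check\varphi|^2d\widehat\mu$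 for all compactly supported continuous $\varphi$; it is known that then $\widehat\mu$ is translation bounded and coincides with the Fourier transform of $\mu$ as a tempered distribution. $(\widehat\mu)_{\mathrm{ac}}$ is the absolutely continuous part of $\widehat\mu$ with respect to Lebesgue measure, and $\mu_{0a}$ denotes the unique tempered distribution with $\widehat{\mu_{0a}}=(\widehat\mu)_{\mathrm{ac}}$. *)

theory Defs
  imports "HOL-Analysis.Analysis"
begin

section \<open>Complex Radon measures\<close>

text \<open>
  A complex Radon measure on a Euclidean space is a countably additive complex-valued set function
  on the bounded Borel sets. In general it has no value on unbounded sets, so, to make equality of
  measures coincide with equality of functions, it is set to 0 outside its domain.
\<close>

definition bounded_borel :: "'a::euclidean_space set set" where
  "bounded_borel = {A. A \<in> sets borel \<and> bounded A}"

definition complex_radon :: "('a::euclidean_space set \<Rightarrow> complex) \<Rightarrow> bool" where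
  "complex_radon \<mu> \<longleftrightarrow>
     (\<forall>A. A \<notin> bounded_borel \<longrightarrow> \<mu> A = 0) \<and>
     (\<forall>A :: nat \<Rightarrow> 'a set. disjoint_family A \<and> range A \<subseteq> sets borel \<and> bounded (\<Union>i. A i)
        \<longrightarrow> (\<lambda>i. \<mu> (A i)) sums \<mu> (\<Union>i. A i))"

definition total_variation :: "('a::euclidean_space set \<Rightarrow> complex) \<Rightarrow> 'a measure" where
  "total_variation \<mu> = measure_of UNIV (sets borel)
     (\<lambda>A. SUP P \<in> {P. finite P \<and> disjoint P \<and> P \<subseteq> bounded_borel \<and> \<Union>P \<subseteq> A}.
            \<Sum>B\<in>P. ennreal (norm (\<mu> B)))"

text \<open>
  The polar decomposition \<open>d\<mu> = h d|\<mu>|\<close>, with \<open>|h| = 1\<close>, determines \<open>h\<close> up to \<open>|\<mu>|\<close>-null sets,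
  so the integral below does not depend on the choice of \<open>h\<close>.
\<close>

definition polar_density :: "('a::euclidean_space set \<Rightarrow> complex) \<Rightarrow> ('a \<Rightarrow> complex) \<Rightarrow> bool" where
  "polar_density \<mu> h \<longleftrightarrow> h \<in> borel_measurable borel \<and> (\<forall>x. norm (h x) = 1) \<and>
     (\<forall>A\<in>bounded_borel. \<mu> A = (LINT x:A|total_variation \<mu>. h x))"

definition radon_integral :: "('a::euclidean_space set \<Rightarrow> complex) \<Rightarrow> ('a \<Rightarrow> complex) \<Rightarrow> complex" where
  "radon_integral \<mu> f =
     (LINT x|total_variation \<mu>. f x * (SOME h. polar_density \<mu> h) x)"

definition radon_support :: "('a::euclidean_space set \<Rightarrow> complex) \<Rightarrow> 'a set" where
  "radon_support \<mu> = {x. \<forall>U. open U \<and> x \<in> U \<longrightarrow> emeasure (total_variation \<mu>) U \<noteq> 0}"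

definition lebesgue_ac :: "('a::euclidean_space set \<Rightarrow> complex) \<Rightarrow> bool" where
  "lebesgue_ac \<mu> \<longleftrightarrow> absolutely_continuous lborel (total_variation \<mu>)"

definition lebesgue_singular :: "('a::euclidean_space set \<Rightarrow> complex) \<Rightarrow> bool" where
  "lebesgue_singular \<mu> \<longleftrightarrow> (\<exists>N\<in>null_sets lborel. - N \<in> null_sets (total_variation \<mu>))"

text \<open>The absolutely continuous part in the (unique) Lebesgue decomposition.\<close>

definition ac_part :: "('a::euclidean_space set \<Rightarrow> complex) \<Rightarrow> ('a set \<Rightarrow> complex)" where
  "ac_part \<mu> = (THE \<alpha>. complex_radon \<alpha> \<and> lebesgue_ac \<alpha> \<and>
     (\<exists>\<sigma>. complex_radon \<sigma> \<and> lebesgue_singular \<sigma> \<and> (\<forall>A. \<mu> A = \<alpha> A + \<sigma> A)))"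

definition locally_integrable :: "('a::euclidean_space \<Rightarrow> complex) \<Rightarrow> bool" where
  "locally_integrable f \<longleftrightarrow> f \<in> borel_measurable borel \<and>
     (\<forall>K. compact K \<longrightarrow> set_integrable lborel K f)"

definition essentially_bounded :: "('a::euclidean_space \<Rightarrow> complex) \<Rightarrow> bool" where
  "essentially_bounded f \<longleftrightarrow> f \<in> borel_measurable borel \<and> (\<exists>C. AE x in lborel. norm (f x) \<le> C)"

text \<open>The measure \<open>f\<lambda>\<close> for a locally integrable \<open>f\<close>.\<close>

definition lebesgue_density :: "('a::euclidean_space \<Rightarrow> complex) \<Rightarrow> ('a set \<Rightarrow> complex)" where
  "lebesgue_density f = (\<lambda>A. if A \<in> bounded_borel then (LINT x:A|lborel. f x) else 0)"


section \<open>Fourier transforms of functions and measures\<close>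

definition fourier :: "('a::euclidean_space \<Rightarrow> complex) \<Rightarrow> ('a \<Rightarrow> complex)" where
  "fourier f = (\<lambda>x. LINT y|lborel. exp (- 2 * of_real pi * \<i> * of_real (x \<bullet> y)) * f y)"

definition inv_fourier :: "('a::euclidean_space \<Rightarrow> complex) \<Rightarrow> ('a \<Rightarrow> complex)" where
  "inv_fourier f = (\<lambda>x. fourier f (- x))"

definition reflect_cnj :: "('a::euclidean_space \<Rightarrow> complex) \<Rightarrow> ('a \<Rightarrow> complex)" where
  "reflect_cnj f = (\<lambda>x. cnj (f (- x)))"

definition convolve ::
  "('a::euclidean_space \<Rightarrow> complex) \<Rightarrow> ('a \<Rightarrow> complex) \<Rightarrow> ('a \<Rightarrow> complex)" where
  "convolve f g = (\<lambda>x. LINT y|lborel. f y * g (x - y))"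

definition cont_compact_supp :: "('a::euclidean_space \<Rightarrow> complex) \<Rightarrow> bool" where
  "cont_compact_supp \<phi> \<longleftrightarrow> continuous_on UNIV \<phi> \<and> compact (closure {x. \<phi> x \<noteq> 0})"

definition is_fourier_transform ::
  "('a::euclidean_space set \<Rightarrow> complex) \<Rightarrow> ('a set \<Rightarrow> complex) \<Rightarrow> bool" where
  "is_fourier_transform \<mu> \<nu> \<longleftrightarrow> complex_radon \<nu> \<and>
     (\<forall>\<phi>. cont_compact_supp \<phi> \<longrightarrow>
        inv_fourier \<phi> \<in> borel_measurable borel \<and>
        integrable (total_variation \<nu>) (\<lambda>x. (norm (inv_fourier \<phi> x))\<^sup>2) \<and>
        radon_integral \<mu> (convolve \<phi> (reflect_cnj \<phi>))
          = radon_integral \<nu> (\<lambda>x. of_real ((norm (inv_fourier \<phi> x))\<^sup>2)))"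

definition fourier_transformable :: "('a::euclidean_space set \<Rightarrow> complex) \<Rightarrow> bool" where
  "fourier_transformable \<mu> \<longleftrightarrow> (\<exists>\<nu>. is_fourier_transform \<mu> \<nu>)"

text \<open>The transform of a Fourier transformable measure is unique.\<close>

definition fourier_measure :: "('a::euclidean_space set \<Rightarrow> complex) \<Rightarrow> ('a set \<Rightarrow> complex)" where
  "fourier_measure \<mu> = (THE \<nu>. is_fourier_transform \<mu> \<nu>)"


section \<open>Tempered distributions\<close>

definition iter_deriv ::
  "'a::euclidean_space list \<Rightarrow> ('a \<Rightarrow> complex) \<Rightarrow> ('a \<Rightarrow> complex)" where
  "iter_deriv bs f = foldr (\<lambda>b g x. frechet_derivative g (at x) b) bs f"

text \<open>
  Lists of basis vectors play the role of multi-indices. If all iterated partial derivatives are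
  (totally) differentiable everywhere, the function is infinitely differentiable.
\<close>

definition schwartz :: "('a::euclidean_space \<Rightarrow> complex) \<Rightarrow> bool" where
  "schwartz f \<longleftrightarrow> (\<forall>bs. set bs \<subseteq> Basis \<longrightarrow>
     (\<forall>x. iter_deriv bs f differentiable (at x)) \<and>
     (\<forall>k::nat. bounded (range (\<lambda>x. (1 + norm x) ^ k * norm (iter_deriv bs f x)))))"

definition schwartz_norm :: "nat \<Rightarrow> ('a::euclidean_space \<Rightarrow> complex) \<Rightarrow> real" where
  "schwartz_norm n f = (\<Sum>bs \<in> {bs. set bs \<subseteq> Basis \<and> length bs \<le> n}.
     SUP x. (1 + norm x) ^ n * norm (iter_deriv bs f x))"

text \<open>
  As with measures, values outside the domain are normalised to 0. The seminorms
  \<^const>\<open>schwartz_norm\<close> are increasing in \<open>n\<close> on Schwartz functions and generate the usual topology.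
\<close>

definition tempered_distribution :: "(('a::euclidean_space \<Rightarrow> complex) \<Rightarrow> complex) \<Rightarrow> bool" where
  "tempered_distribution T \<longleftrightarrow>
     (\<forall>\<phi>. \<not> schwartz \<phi> \<longrightarrow> T \<phi> = 0) \<and>
     (\<forall>\<phi> \<psi>. schwartz \<phi> \<longrightarrow> schwartz \<psi> \<longrightarrow> T (\<lambda>x. \<phi> x + \<psi> x) = T \<phi> + T \<psi>) \<and>
     (\<forall>a \<phi>. schwartz \<phi> \<longrightarrow> T (\<lambda>x. a * \<phi> x) = a * T \<phi>) \<and>
     (\<exists>C n. \<forall>\<phi>. schwartz \<phi> \<longrightarrow> norm (T \<phi>) \<le> C * schwartz_norm n \<phi>)"

definition fourier_distribution ::
  "(('a::euclidean_space \<Rightarrow> complex) \<Rightarrow> complex) \<Rightarrow> (('a \<Rightarrow> complex) \<Rightarrow> complex)" where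
  "fourier_distribution T = (\<lambda>\<phi>. if schwartz \<phi> then T (fourier \<phi>) else 0)"

text \<open>
  Equality of a tempered distribution and a measure. The measures to which this is applied below are
  translation bounded, hence integrate all Schwartz functions.
\<close>

definition distribution_is_measure ::
  "(('a::euclidean_space \<Rightarrow> complex) \<Rightarrow> complex) \<Rightarrow> ('a set \<Rightarrow> complex) \<Rightarrow> bool" where
  "distribution_is_measure T \<mu> \<longleftrightarrow>
     (\<forall>\<phi>. schwartz \<phi> \<longrightarrow> integrable (total_variation \<mu>) \<phi> \<and> T \<phi> = radon_integral \<mu> \<phi>)"

text \<open>The unique tempered distribution \<open>\<mu>\<^sub>0\<^sub>a\<close> whose Fourier transform is the absolutely continuous
  part of the transform of \<open>\<mu>\<close>.\<close>

definition mu_0a :: "('a::euclidean_space set \<Rightarrow> complex) \<Rightarrow> (('a \<Rightarrow> complex) \<Rightarrow> complex)" where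
  "mu_0a \<mu> = (THE T. tempered_distribution T \<and>
     distribution_is_measure (fourier_distribution T) (ac_part (fourier_measure \<mu>)))"

text \<open>
  Equality of a tempered distribution with \<open>\<Sum>x\<in>\<Lambda>. c x \<delta>\<^sub>x\<close>, where \<open>\<delta>\<^sub>x(\<phi>) = \<phi>(x)\<close>; the sum
  converges unconditionally, i.e. absolutely.
\<close>

definition distribution_is_comb ::
  "(('a::euclidean_space \<Rightarrow> complex) \<Rightarrow> complex) \<Rightarrow> 'a set \<Rightarrow> ('a \<Rightarrow> complex) \<Rightarrow> bool" where
  "distribution_is_comb T \<Lambda> c \<longleftrightarrow>
     (\<forall>\<phi>. schwartz \<phi> \<longrightarrow> ((\<lambda>x. c x * \<phi> x) has_sum T \<phi>) \<Lambda>)"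


section \<open>Meyer sets\<close>

definition relatively_dense :: "'a::euclidean_space set \<Rightarrow> bool" where
  "relatively_dense \<Lambda> \<longleftrightarrow> (\<exists>K. compact K \<and> {x + k | x k. x \<in> \<Lambda> \<and> k \<in> K} = UNIV)"

text \<open>The library notion of uniform discreteness agrees with the one by neighbourhoods of 0.\<close>

lemma uniform_discrete_iff_neighbourhood:
  fixes \<Lambda> :: "'a::euclidean_space set"
  shows "uniform_discrete \<Lambda> \<longleftrightarrow>
    (\<exists>U. open U \<and> 0 \<in> U \<and> (\<forall>x\<in>\<Lambda>. \<forall>y\<in>\<Lambda>. x \<noteq> y \<longrightarrow> ((+) x ` U) \<inter> ((+) y ` U) = {}))"
    (is "?L \<longleftrightarrow> ?R")
proof
  assume ?L
  then obtain e where e: "e > 0" "\<And>x y. x \<in> \<Lambda> \<Longrightarrow> y \<in> \<Lambda> \<Longrightarrow> dist x y < e \<Longrightarrow> x = y"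
    unfolding uniform_discrete_def by blast
  have "((+) x ` ball 0 (e/2)) \<inter> ((+) y ` ball 0 (e/2)) = {}"
    if xy: "x \<in> \<Lambda>" "y \<in> \<Lambda>" "x \<noteq> y" for x y
  proof (rule ccontr)
    assume "\<not> ?thesis"
    then obtain u v where "x + u = y + v" "u \<in> ball 0 (e/2)" "v \<in> ball 0 (e/2)" by blast
    then have uv: "x + u = y + v" "norm u < e/2" "norm v < e/2" by simp_all
    then have "x - y = v - u" by (simp add: algebra_simps)
    then have "dist x y \<le> norm v + norm u" by (simp add: dist_norm norm_triangle_ineq4)
    then show False using uv e(2)[of x y] xy by linarith
  qed
  then show ?R using e(1) by (intro exI[of _ "ball 0 (e/2)"]) auto
next
  assume ?R
  then obtain U where U: "open U" "0 \<in> U"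
    "\<And>x y. x \<in> \<Lambda> \<Longrightarrow> y \<in> \<Lambda> \<Longrightarrow> x \<noteq> y \<Longrightarrow> ((+) x ` U) \<inter> ((+) y ` U) = {}" by blast
  then obtain e where e: "e > 0" "ball 0 e \<subseteq> U" using open_contains_ball by blast
  have "x = y" if xy: "x \<in> \<Lambda>" "y \<in> \<Lambda>" "dist x y < e" for x y
  proof (rule ccontr)
    assume "x \<noteq> y"
    have "y - x \<in> U" using xy e by (auto simp: dist_norm norm_minus_commute)
    then have "x + (y - x) \<in> (+) x ` U" by (rule imageI)
    moreover have "y + 0 \<in> (+) y ` U" using U(2) by (rule imageI)
    ultimately show False using U(3)[OF xy(1,2) \<open>x \<noteq> y\<close>] by auto
  qed
  then show ?L using e(1) unfolding uniform_discrete_def by blast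
qed

definition meyer_set :: "'a::euclidean_space set \<Rightarrow> bool" where
  "meyer_set \<Lambda> \<longleftrightarrow> relatively_dense \<Lambda> \<and> uniform_discrete {x - y | x y. x \<in> \<Lambda> \<and> y \<in> \<Lambda>}"

end

theory Submission
  imports Defs "HOL-Probability.Characteristic_Functions" "HOL-Probability.Sinc_Integral"
begin

text \<open>
  Let \<open>\<nu>\<close> be the transform of \<open>\<mu>\<close> and let \<open>f\<close> be the density of its absolutely continuous part. The
  proof converts the support condition on \<open>\<mu>\<close> into approximate periods of \<open>f\<close>, and these back into a
  support condition on the distribution \<open>T\<close> with transform \<open>f\<close>.

  A Meyer set \<open>\<Gamma>\<close> has many approximate periods: the set \<open>S\<close> of all \<open>\<xi>\<close> such that \<open>\<xi> \<bullet> x\<close> is within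
  \<open>\<epsilon>\<close> of an integer for every \<open>x \<in> \<Gamma>\<close> is relatively dense (\<open>meyer_almost_periods\<close>). Conversely, the
  set \<open>\<Lambda>\<close> of all \<open>x\<close> such that \<open>\<xi> \<bullet> x\<close> is within \<open>2\<epsilon>\<close> of an integer for every \<open>\<xi> \<in> S\<close> is again a
  Meyer set (\<open>meyer_extension\<close>). It contains \<open>\<Gamma>\<close> and depends on \<open>\<Gamma>\<close> only.

  Choose a function of period 1 with absolutely convergent Fourier series \<open>\<Sum>k. a k * cis (2\<pi> * n k * \<theta>)\<close>
  that vanishes within distance \<open>\<epsilon>\<close> of the integers and is \<open>- 1\<close> beyond distance \<open>2\<epsilon>\<close>
  (\<open>trapezoid_series\<close>). For \<open>\<xi> \<in> S\<close> its value at \<open>\<theta> = \<xi> \<bullet> x\<close> vanishes on the support of \<open>\<mu>\<close>, so that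
  on the Fourier side \<open>\<Sum>k. a k * \<nu> (\<cdot> - n k *\<^sub>R \<xi>) = 0\<close>. Countably many translates of a Lebesgue
  null set are still a Lebesgue null set, so \<open>f\<close> satisfies the same relation
  (\<open>density_translate_relation\<close>). This is the point where the absolutely continuous part separates
  from the singular part. Read backwards, the relation says that \<open>T\<close> does not change when a test function
  is multiplied by a factor that vanishes wherever \<open>\<xi> \<bullet> x\<close> is far from the integers
  (\<open>cutoff_step\<close>); finitely many such factors kill any test function whose compact support misses
  \<open>\<Lambda>\<close> (\<open>pairing_eq_0\<close>).

  A distribution supported on a discrete set could involve derivatives of point masses. They are excluded by
  the bound \<open>|T v| \<le> C * (\<Sum>x\<in>\<Lambda>. |v x|)\<close> (\<open>sampling_bound\<close>): smoothing \<open>T\<close> at scale \<open>r\<close> gives a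
  function of size \<open>O(r powr - d)\<close>, because \<open>f\<close> is translation bounded, and it lives within distance
  \<open>O(r)\<close> of \<open>\<Lambda>\<close>. Testing with small tents around the points of \<open>\<Lambda>\<close> identifies the coefficients \<open>c\<close>,
  and the bound applied to remainders gives the sum formula (\<open>comb_has_sum\<close>).

  The coefficient \<open>c x\<close> is the inner product of \<open>f\<close> with the character of \<open>x\<close> in the weighted space
  \<open>L\<^sup>2(\<kappa> \<lambda>)\<close> for a Fejer kernel \<open>\<kappa>\<close>. Its transform is a tent that vanishes at all nonzero differences of
  \<open>\<Lambda>\<close>, so these characters are orthogonal, and Bessel's inequality bounds \<open>\<Sum>|c x|\<^sup>2\<close> when \<open>f\<close> is
  bounded (\<open>bessel\<close>). In general, truncating \<open>f\<close> changes all coefficients by arbitrarily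
  little, which leaves only finitely many coefficients above any given size
  (\<open>coefficients_vanish\<close>).
\<close>

lemmas lint_add = Bochner_Integration.integral_add
 and lint_cong = Bochner_Integration.integral_cong
 and lint_diff = Bochner_Integration.integral_diff
 and lint_sum = Bochner_Integration.integral_sum
 and lintable_add = Bochner_Integration.integrable_add
 and lintable_bound = Bochner_Integration.integrable_bound
 and lintable_diff = Bochner_Integration.integrable_diff
 and lintable_sum = Bochner_Integration.integrable_sum

abbreviation abs_density :: "('a::euclidean_space \<Rightarrow> complex) \<Rightarrow> 'a measure" where
 "abs_density f \<equiv> density lborel (\<lambda>x. ennreal (norm (f x)))"

section \<open>Total variation and polar decomposition\<close>

lemma bounded_borelD:
 assumes "A \<in> bounded_borel" shows "A \<in> sets borel" "bounded A"
 using assms by (auto simp: bounded_borel_def)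

lemma bounded_borel_Int [intro]: "A \<in> bounded_borel \<Longrightarrow> B \<in> sets borel \<Longrightarrow> A \<inter> B \<in> bounded_borel"
 by (auto simp: bounded_borel_def bounded_Int)

lemma bounded_borel_Diff [intro]: "A \<in> bounded_borel \<Longrightarrow> B \<in> sets borel \<Longrightarrow> A - B \<in> bounded_borel"
 by (auto simp: bounded_borel_def bounded_diff)

lemma bounded_borel_ball [simp]: "ball x r \<in> bounded_borel" "cball x r \<in> bounded_borel"
 by (auto simp: bounded_borel_def)

lemma radon_sums:
 assumes "complex_radon \<mu>" "disjoint_family A" "\<And>i. A i \<in> sets borel" "bounded (\<Union>i. A i)"
 shows "(\<lambda>i. \<mu> (A i)) sums \<mu> (\<Union>i. A i)"
 using assms unfolding complex_radon_def by blast

lemma radon_empty [simp]: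
 assumes "complex_radon \<mu>" shows "\<mu> {} = 0"
proof -
 have "(\<lambda>i::nat. \<mu> {}) sums \<mu> {}"
  using radon_sums[OF assms, of "\<lambda>_. {}"] by (simp add: disjoint_family_on_def)
 then have "summable (\<lambda>i::nat. \<mu> {})" by (rule sums_summable)
 then show ?thesis by (simp add: summable_const_iff)
qed

lemma radon_Un:
 assumes "complex_radon \<mu>" "A \<in> bounded_borel" "B \<in> bounded_borel" "A \<inter> B = {}"
 shows "\<mu> (A \<union> B) = \<mu> A + \<mu> B"
proof -
 have "(\<lambda>i. \<mu> (binaryset A B i)) sums \<mu> (\<Union>i. binaryset A B i)"
 proof (rule radon_sums[OF assms(1)])
  show "disjoint_family (binaryset A B)"
   using assms(4) by (auto simp: disjoint_family_on_def binaryset_def)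
  show "binaryset A B i \<in> sets borel" for i
   using assms by (auto simp: binaryset_def bounded_borel_def)
  show "bounded (\<Union>i. binaryset A B i)"
   using assms by (auto simp: UN_binaryset_eq bounded_borel_def)
 qed
 moreover have "(\<lambda>i. \<mu> (binaryset A B i)) sums (\<mu> A + \<mu> B)"
  by (rule binaryset_sums) (simp add: assms(1))
 ultimately show ?thesis by (simp add: UN_binaryset_eq sums_unique2)
qed

lemma radon_UN:
 assumes "complex_radon \<mu>" "finite I" "disjoint_family_on B I" "\<And>i. i \<in> I \<Longrightarrow> B i \<in> bounded_borel"
 shows "\<mu> (\<Union>i\<in>I. B i) = (\<Sum>i\<in>I. \<mu> (B i)) \<and> (\<Union>i\<in>I. B i) \<in> bounded_borel"
 using assms(2-)
proof (induction I rule: finite_induct)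
 case empty then show ?case using assms(1) by (auto simp: bounded_borel_def)
next
 case (insert i I)
 have IH: "\<mu> (\<Union>i\<in>I. B i) = (\<Sum>i\<in>I. \<mu> (B i))" "(\<Union>i\<in>I. B i) \<in> bounded_borel"
  using insert by (auto simp: disjoint_family_on_def)
 have "B i \<inter> (\<Union>i\<in>I. B i) = {}" using insert by (fastforce simp: disjoint_family_on_def)
 then have "\<mu> (B i \<union> (\<Union>i\<in>I. B i)) = \<mu> (B i) + \<mu> (\<Union>i\<in>I. B i)"
  using insert IH by (intro radon_Un assms(1)) auto
 then show ?case using insert IH by (auto simp: bounded_borel_def)
qed

definition variation :: "('a::euclidean_space set \<Rightarrow> complex) \<Rightarrow> 'a set \<Rightarrow> ennreal" where
 "variation \<mu> A = (SUP P \<in> {P. finite P \<and> disjoint P \<and> P \<subseteq> bounded_borel \<and> \<Union>P \<subseteq> A}.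
      \<Sum>B\<in>P. ennreal (norm (\<mu> B)))"

lemma variation_upper:
 assumes "complex_radon \<mu>" "finite I" "disjoint_family_on B I" "\<And>i. i \<in> I \<Longrightarrow> B i \<in> bounded_borel"
  "\<And>i. i \<in> I \<Longrightarrow> B i \<subseteq> A"
 shows "(\<Sum>i\<in>I. ennreal (norm (\<mu> (B i)))) \<le> variation \<mu> A"
proof -
 define J where "J = {i\<in>I. B i \<noteq> {}}"
 have inj: "inj_on B J"
  using assms(3) by (fastforce simp: J_def inj_on_def disjoint_family_on_def)
 have "(\<Sum>i\<in>I. ennreal (norm (\<mu> (B i)))) = (\<Sum>i\<in>J. ennreal (norm (\<mu> (B i))))"
  using assms(1,2) by (intro sum.mono_neutral_right) (auto simp: J_def)
 also have "\<dots> = (\<Sum>C\<in>B ` J. ennreal (norm (\<mu> C)))" by (simp add: sum.reindex[OF inj])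
 also have "\<dots> \<le> variation \<mu> A"
  unfolding variation_def
 proof (rule SUP_upper, intro CollectI conjI)
  show "finite (B ` J)" using assms(2) by (simp add: J_def)
  show "disjoint (B ` J)"
   using disjoint_family_on_disjoint_image[of B J] assms(3)
   by (simp add: J_def disjoint_family_on_def)
 qed (use assms(4,5) in \<open>auto simp: J_def\<close>)
 finally show ?thesis .
qed

lemma variation_mono: "A \<subseteq> B \<Longrightarrow> variation \<mu> A \<le> variation \<mu> B"
 unfolding variation_def by (rule SUP_subset_mono) auto

lemma variation_superadditive:
 assumes \<mu>: "complex_radon \<mu>" and "A \<inter> B = {}"
 shows "variation \<mu> A + variation \<mu> B \<le> variation \<mu> (A \<union> B)"
proof -
 let ?X = "\<lambda>A. {P. finite P \<and> disjoint P \<and> P \<subseteq> bounded_borel \<and> \<Union>P \<subseteq> A}"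
 have ne: "?X A \<noteq> {}" for A :: "'a set" by (auto intro!: exI[of _ "{}"] simp: disjoint_def)
 have *: "(\<Sum>B\<in>P. ennreal (norm (\<mu> B))) + (\<Sum>B\<in>Q. ennreal (norm (\<mu> B))) \<le> variation \<mu> (A \<union> B)"
  if P: "P \<in> ?X A" and Q: "Q \<in> ?X B" for P Q
 proof -
  have z: "(\<Sum>B\<in>P \<inter> Q. ennreal (norm (\<mu> B))) = 0"
  proof (rule sum.neutral, rule ballI)
   fix C assume "C \<in> P \<inter> Q"
   then have "C = {}" using P Q assms(2) by blast
   then show "ennreal (norm (\<mu> C)) = 0" using \<mu> by simp
  qed
  have "(\<Sum>B\<in>P. ennreal (norm (\<mu> B))) + (\<Sum>B\<in>Q. ennreal (norm (\<mu> B)))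
   = (\<Sum>B\<in>P \<union> Q. ennreal (norm (\<mu> B)))"
   using sum.union_inter[of P Q "\<lambda>B. ennreal (norm (\<mu> B))"] P Q z by simp
  also have "\<dots> \<le> variation \<mu> (A \<union> B)"
  proof (rule variation_upper[OF \<mu>, where B = "\<lambda>x. x"])
   show "disjoint_family_on (\<lambda>x. x) (P \<union> Q)"
    unfolding disjoint_family_on_def
   proof (intro ballI impI)
    fix C D assume CD: "C \<in> P \<union> Q" "D \<in> P \<union> Q" "C \<noteq> D"
    have sub: "C \<in> P \<Longrightarrow> C \<subseteq> A" "D \<in> P \<Longrightarrow> D \<subseteq> A" "C \<in> Q \<Longrightarrow> C \<subseteq> B" "D \<in> Q \<Longrightarrow> D \<subseteq> B"
     using P Q by auto
    have "C \<in> P \<Longrightarrow> D \<in> P \<Longrightarrow> C \<inter> D = {}" "C \<in> Q \<Longrightarrow> D \<in> Q \<Longrightarrow> C \<inter> D = {}"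
     using P Q CD(3) by (auto simp: disjoint_def)
    with CD sub assms(2) show "C \<inter> D = {}" by blast
   qed
  qed (use P Q in auto)
  finally show ?thesis .
 qed
 have "variation \<mu> A + variation \<mu> B
  = (SUP P\<in>?X A. (\<Sum>B\<in>P. ennreal (norm (\<mu> B))) + variation \<mu> B)"
  unfolding variation_def[of \<mu> A] using ne by (subst ennreal_SUP_add_left) auto
 also have "\<dots> \<le> variation \<mu> (A \<union> B)"
 proof (rule SUP_least)
  fix P assume P: "P \<in> ?X A"
  have "(\<Sum>B\<in>P. ennreal (norm (\<mu> B))) + variation \<mu> B
   = (SUP Q\<in>?X B. (\<Sum>B\<in>P. ennreal (norm (\<mu> B))) + (\<Sum>B\<in>Q. ennreal (norm (\<mu> B))))"
   unfolding variation_def using ne by (subst ennreal_SUP_add_right) auto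
  also have "\<dots> \<le> variation \<mu> (A \<union> B)" by (rule SUP_least) (use *[OF P] in auto)
  finally show "(\<Sum>B\<in>P. ennreal (norm (\<mu> B))) + variation \<mu> B \<le> variation \<mu> (A \<union> B)" .
 qed
 finally show ?thesis .
qed

lemma ennreal_norm_sums_le:
 fixes f :: "nat \<Rightarrow> 'b::real_normed_vector"
 assumes "f sums s"
 shows "ennreal (norm s) \<le> (\<Sum>i. ennreal (norm (f i)))"
proof (rule LIMSEQ_le_const2)
 show "(\<lambda>n. ennreal (norm (\<Sum>i<n. f i))) \<longlonglongrightarrow> ennreal (norm s)"
  using assms unfolding sums_def by (intro tendsto_ennrealI tendsto_norm)
 have "ennreal (norm (\<Sum>i<n. f i)) \<le> (\<Sum>i. ennreal (norm (f i)))" for n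
 proof -
  have "ennreal (norm (\<Sum>i<n. f i)) \<le> ennreal (\<Sum>i<n. norm (f i))"
   by (intro ennreal_leI norm_sum)
  also have "\<dots> = (\<Sum>i<n. ennreal (norm (f i)))" by simp
  also have "\<dots> \<le> (\<Sum>i. ennreal (norm (f i)))" by (rule sum_le_suminf) auto
  finally show ?thesis .
 qed
 then show "\<exists>N. \<forall>n\<ge>N. ennreal (norm (\<Sum>i<n. f i)) \<le> (\<Sum>i. ennreal (norm (f i)))" by blast
qed

lemma variation_countably_additive:
 assumes \<mu>: "complex_radon \<mu>"
 shows "countably_additive (sets borel) (variation \<mu>)"
proof (rule countably_additiveI)
 fix A :: "nat \<Rightarrow> 'a set"
 assume A: "range A \<subseteq> sets borel" "disjoint_family A"
 have "variation \<mu> (\<Union>i. A i) \<le> (\<Sum>i. variation \<mu> (A i))"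
  unfolding variation_def[of \<mu> "\<Union>i. A i"]
 proof (rule SUP_least)
  fix P assume P: "P \<in> {P. finite P \<and> disjoint P \<and> P \<subseteq> bounded_borel \<and> \<Union> P \<subseteq> (\<Union>i. A i)}"
  have "ennreal (norm (\<mu> B)) \<le> (\<Sum>i. ennreal (norm (\<mu> (B \<inter> A i))))" if "B \<in> P" for B
  proof -
   have U: "(\<Union>i. B \<inter> A i) = B" using P that by blast
   have "(\<lambda>i. \<mu> (B \<inter> A i)) sums \<mu> (\<Union>i. B \<inter> A i)"
   proof (rule radon_sums[OF \<mu>])
    show "disjoint_family (\<lambda>i. B \<inter> A i)" using A(2) by (auto simp: disjoint_family_on_def)
    show "B \<inter> A i \<in> sets borel" for i
     using P that A(1) by (auto simp: bounded_borel_def)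
    show "bounded (\<Union>i. B \<inter> A i)" using P that unfolding U by (auto simp: bounded_borel_def)
   qed
   then show ?thesis unfolding U by (rule ennreal_norm_sums_le)
  qed
  then have "(\<Sum>B\<in>P. ennreal (norm (\<mu> B))) \<le> (\<Sum>B\<in>P. \<Sum>i. ennreal (norm (\<mu> (B \<inter> A i))))"
   by (rule sum_mono)
  also have "\<dots> = (\<Sum>i. \<Sum>B\<in>P. ennreal (norm (\<mu> (B \<inter> A i))))"
   by (rule suminf_sum[symmetric]) auto
  also have "\<dots> \<le> (\<Sum>i. variation \<mu> (A i))"
  proof (rule suminf_le)
   fix i
   show "(\<Sum>B\<in>P. ennreal (norm (\<mu> (B \<inter> A i)))) \<le> variation \<mu> (A i)"
   proof (rule variation_upper[OF \<mu>])
    show "disjoint_family_on (\<lambda>B. B \<inter> A i) P"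
     using P by (auto simp: disjoint_family_on_def disjoint_def)
    show "B \<inter> A i \<in> bounded_borel" if "B \<in> P" for B
     using P that A(1) by (intro bounded_borel_Int) auto
   qed (use P in auto)
  qed auto
  finally show "(\<Sum>B\<in>P. ennreal (norm (\<mu> B))) \<le> (\<Sum>i. variation \<mu> (A i))" .
 qed
 moreover have "(\<Sum>i. variation \<mu> (A i)) \<le> variation \<mu> (\<Union>i. A i)"
  unfolding suminf_eq_SUP
 proof (rule SUP_least)
  fix n
  have "(\<Sum>i<n. variation \<mu> (A i)) \<le> variation \<mu> (\<Union>i<n. A i)"
  proof (induction n)
   case (Suc n)
   have "(\<Sum>i<Suc n. variation \<mu> (A i)) \<le> variation \<mu> (\<Union>i<n. A i) + variation \<mu> (A n)"
    using Suc by (simp add: add_right_mono)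
   also have "\<dots> \<le> variation \<mu> ((\<Union>i<n. A i) \<union> A n)"
   proof (rule variation_superadditive[OF \<mu>])
    have "A i \<inter> A n = {}" if "i < n" for i
     using A(2) that by (auto simp: disjoint_family_on_def)
    then show "(\<Union>i<n. A i) \<inter> A n = {}" by blast
   qed
   finally show ?case by (simp add: lessThan_Suc Un_commute)
  qed simp
  also have "\<dots> \<le> variation \<mu> (\<Union>i. A i)" by (rule variation_mono) auto
  finally show "(\<Sum>i<n. variation \<mu> (A i)) \<le> variation \<mu> (\<Union>i. A i)" .
 qed
 ultimately show "(\<Sum>i. variation \<mu> (A i)) = variation \<mu> (\<Union>i. A i)" by simp
qed

lemma variation_empty: "complex_radon \<mu> \<Longrightarrow> variation \<mu> {} = 0"
 unfolding variation_def by (rule antisym, rule SUP_least)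
  (auto simp del: sum_ennreal intro!: sum.neutral)

lemma sets_total_variation [simp, measurable_cong]: "sets (total_variation \<mu>) = sets borel"
 unfolding total_variation_def using sets.sigma_sets_eq[of borel] by (simp add: sets_measure_of)

lemma space_total_variation [simp]: "space (total_variation \<mu>) = UNIV"
 unfolding total_variation_def by (simp add: space_measure_of)

lemma emeasure_total_variation:
 assumes "complex_radon \<mu>" "A \<in> sets borel"
 shows "emeasure (total_variation \<mu>) A = variation \<mu> A"
proof (rule emeasure_measure_of[OF total_variation_def[folded variation_def]])
 show "positive (sets (total_variation \<mu>)) (variation \<mu>)"
  using assms(1) by (simp add: positive_def variation_empty)
 show "countably_additive (sets (total_variation \<mu>)) (variation \<mu>)"
  using assms(1) by (simp add: variation_countably_additive)
qed (use assms in auto)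

lemma norm_radon_le_variation:
 assumes "complex_radon \<mu>" "A \<in> bounded_borel"
 shows "ennreal (norm (\<mu> A)) \<le> emeasure (total_variation \<mu>) A"
 using variation_upper[of \<mu> "{()}" "\<lambda>_. A" A] assms
 by (simp add: emeasure_total_variation bounded_borel_def disjoint_family_on_def)

text \<open>Among the four subsums over terms with positive or negative real or imaginary part, one
 carries a quarter of the total.\<close>

lemma large_subsum:
 fixes z :: "'i \<Rightarrow> complex"
 assumes "finite I"
 obtains J where "J \<subseteq> I" "(\<Sum>i\<in>I. norm (z i)) \<le> 4 * norm (\<Sum>i\<in>J. z i)"
proof -
 let ?s = "\<lambda>P. \<Sum>i\<in>{i\<in>I. P (z i)}. z i"
 have split: "(\<Sum>i\<in>I. \<bar>g i\<bar>) = (\<Sum>i\<in>{i\<in>I. g i > 0}. g i) - (\<Sum>i\<in>{i\<in>I. g i < 0}. g i)"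
  for g :: "'i \<Rightarrow> real"
 proof -
  have "(\<Sum>i\<in>I. \<bar>g i\<bar>) = (\<Sum>i\<in>I. (if g i > 0 then g i else 0) - (if g i < 0 then g i else 0))"
   by (rule sum.cong) auto
  then show ?thesis using assms by (simp add: sum_subtractf sum.inter_filter)
 qed
 have "(\<Sum>i\<in>I. norm (z i)) \<le> (\<Sum>i\<in>I. \<bar>Re (z i)\<bar> + \<bar>Im (z i)\<bar>)"
  by (intro sum_mono cmod_le)
 also have "\<dots> = Re (?s (\<lambda>z. Re z > 0)) - Re (?s (\<lambda>z. Re z < 0))
   + (Im (?s (\<lambda>z. Im z > 0)) - Im (?s (\<lambda>z. Im z < 0)))"
  by (simp add: sum.distrib split)
 also have "\<dots> \<le> norm (?s (\<lambda>z. Re z > 0)) + norm (?s (\<lambda>z. Re z < 0))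
   + (norm (?s (\<lambda>z. Im z > 0)) + norm (?s (\<lambda>z. Im z < 0)))"
  using complex_Re_le_cmod[of "?s (\<lambda>z. Re z > 0)"] complex_Re_le_cmod[of "- ?s (\<lambda>z. Re z < 0)"]
   abs_Im_le_cmod[of "?s (\<lambda>z. Im z > 0)"] abs_Im_le_cmod[of "?s (\<lambda>z. Im z < 0)"]
  unfolding norm_minus_cancel uminus_complex.simps by linarith
 finally have "(\<Sum>i\<in>I. norm (z i)) \<le> 4 * norm (?s (\<lambda>z. Re z > 0)) \<or> (\<Sum>i\<in>I. norm (z i)) \<le> 4 * norm (?s (\<lambda>z. Re z < 0))
  \<or> (\<Sum>i\<in>I. norm (z i)) \<le> 4 * norm (?s (\<lambda>z. Im z > 0)) \<or> (\<Sum>i\<in>I. norm (z i)) \<le> 4 * norm (?s (\<lambda>z. Im z < 0))"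
  by linarith
 then show ?thesis
  using that[of "{i\<in>I. Re (z i) > 0}"] that[of "{i\<in>I. Re (z i) < 0}"]
   that[of "{i\<in>I. Im (z i) > 0}"] that[of "{i\<in>I. Im (z i) < 0}"] by auto
qed

text \<open>A subsum of norm far above \<open>|\<mu> E|\<close> has a union \<open>A\<close> such that both \<open>A\<close> and \<open>E - A\<close> have values of norm
 above 1, and one of the two carries infinite variation. Iterating this contradicts countable
 additivity.\<close>

lemma infinite_variation_split:
 assumes \<mu>: "complex_radon \<mu>" and E: "E \<in> bounded_borel" "variation \<mu> E = \<infinity>"
 shows "\<exists>A\<subseteq>E. A \<in> bounded_borel \<and> variation \<mu> (E - A) = \<infinity> \<and> norm (\<mu> A) > 1"
proof -
 (* The factor 4 compensates for the loss in passing to a subsum; the surplus 2 leaves a value of norm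
   above 1 on both A and E - A. *)
 define t where "t = 4 * (norm (\<mu> E) + 2)"
 have "ennreal t < variation \<mu> E" using E(2) by simp
 then obtain P where P: "finite P" "disjoint P" "P \<subseteq> bounded_borel" "\<Union>P \<subseteq> E"
  and t: "ennreal t < (\<Sum>B\<in>P. ennreal (norm (\<mu> B)))"
  unfolding variation_def less_SUP_iff by auto
 have t': "t < (\<Sum>B\<in>P. norm (\<mu> B))"
 proof -
  have "0 \<le> t" by (simp add: t_def)
  then show ?thesis using t by (simp add: ennreal_less_iff)
 qed
 obtain Q where Q: "Q \<subseteq> P" "(\<Sum>B\<in>P. norm (\<mu> B)) \<le> 4 * norm (\<Sum>B\<in>Q. \<mu> B)"
  using large_subsum[OF P(1)] by blast
 have UQ: "\<mu> (\<Union>B\<in>Q. B) = (\<Sum>B\<in>Q. \<mu> B) \<and> (\<Union>B\<in>Q. B) \<in> bounded_borel"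
 proof (rule radon_UN[OF \<mu>])
  show "finite Q" using P Q by (auto intro: finite_subset)
  show "disjoint_family_on (\<lambda>B. B) Q"
   using P(2) Q(1) unfolding disjoint_family_on_def disjoint_def by blast
 qed (use P Q in auto)
 define A where "A = \<Union>Q"
 have A: "A \<in> bounded_borel" "A \<subseteq> E" "norm (\<mu> A) > norm (\<mu> E) + 2"
  using UQ P(4) Q t' by (auto simp: A_def t_def)
 have B: "E - A \<in> bounded_borel" using E A by (auto simp: bounded_borel_def bounded_diff)
 have "\<mu> (A \<union> (E - A)) = \<mu> A + \<mu> (E - A)" by (rule radon_Un[OF \<mu> A(1) B]) auto
 then have "\<mu> A = \<mu> E - \<mu> (E - A)" using A(2) by (simp add: Un_absorb1)
 then have "norm (\<mu> A) \<le> norm (\<mu> E) + norm (\<mu> (E - A))" by (simp add: norm_triangle_ineq4)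
 then have nB: "norm (\<mu> (E - A)) > 1" using A(3) by simp
 have "variation \<mu> A + variation \<mu> (E - A) = variation \<mu> E"
  using plus_emeasure[of A "total_variation \<mu>" "E - A"] A B \<mu> E
  by (auto simp: emeasure_total_variation bounded_borel_def Un_absorb1)
 then consider "variation \<mu> A = \<infinity>" | "variation \<mu> (E - A) = \<infinity>"
  using E(2) by (auto simp: ennreal_add_eq_top)
 then show ?thesis
 proof cases
  case 1
  have "E - (E - A) = A" using A(2) by auto
  then show ?thesis using 1 B nB by (intro exI[of _ "E - A"]) auto
 next
  case 2
  moreover have "norm (\<mu> A) > 1" using A(3) norm_ge_zero[of "\<mu> E"] by linarith
  ultimately show ?thesis using A by (intro exI[of _ A]) auto
 qed
qed

lemma total_variation_finite:
 assumes \<mu>: "complex_radon \<mu>" and E: "E \<in> bounded_borel"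
 shows "emeasure (total_variation \<mu>) E < \<infinity>"
proof (rule ccontr)
 assume "\<not> ?thesis"
 then have inf: "variation \<mu> E = \<infinity>"
  using E \<mu> by (simp add: emeasure_total_variation bounded_borel_def not_less top_unique)
 let ?P = "\<lambda>E. E \<in> bounded_borel \<and> variation \<mu> E = \<infinity>"
 have "\<exists>F. \<forall>n. ?P (F n) \<and> (F (Suc n) \<subseteq> F n \<and> norm (\<mu> (F n - F (Suc n))) > 1 \<and> F n \<subseteq> E)"
 proof -
  have "\<exists>F. \<forall>n. (?P (F n) \<and> F n \<subseteq> E) \<and> (F (Suc n) \<subseteq> F n \<and> norm (\<mu> (F n - F (Suc n))) > 1)"
  proof (rule dependent_nat_choice)
   show "\<exists>F. ?P F \<and> F \<subseteq> E" using E inf by blast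
   fix F and n :: nat assume F: "?P F \<and> F \<subseteq> E"
   then obtain A where A: "A \<subseteq> F" "A \<in> bounded_borel" "variation \<mu> (F - A) = \<infinity>" "norm (\<mu> A) > 1"
    using infinite_variation_split[OF \<mu>] by blast
   then have "F - (F - A) = A" by auto
   then show "\<exists>G. (?P G \<and> G \<subseteq> E) \<and> G \<subseteq> F \<and> norm (\<mu> (F - G)) > 1"
    using A F by (intro exI[of _ "F - A"]) (auto simp: bounded_borel_def bounded_diff)
  qed
  then show ?thesis by blast
 qed
 then obtain F where F: "\<And>n. F n \<in> bounded_borel" "\<And>n. F (Suc n) \<subseteq> F n"
  "\<And>n. norm (\<mu> (F n - F (Suc n))) > 1" "\<And>n. F n \<subseteq> E" by blast
 have dec: "m \<le> n \<Longrightarrow> F n \<subseteq> F m" for m n using F(2) by (rule lift_Suc_antimono_le)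
 (* A convergent series whose terms all have norm above 1. *)
 have "(\<lambda>i. \<mu> (F i - F (Suc i))) sums \<mu> (\<Union>i. F i - F (Suc i))"
 proof (rule radon_sums[OF \<mu>])
  show "disjoint_family (\<lambda>i. F i - F (Suc i))"
   unfolding disjoint_family_on_def
  proof (intro ballI impI)
   fix m n :: nat assume "m \<noteq> n"
   then have "Suc m \<le> n \<or> Suc n \<le> m" by linarith
   then show "(F m - F (Suc m)) \<inter> (F n - F (Suc n)) = {}" using dec by blast
  qed
  show "F i - F (Suc i) \<in> sets borel" for i
   using F(1) by (auto simp: bounded_borel_def)
  have "(\<Union>i. F i - F (Suc i)) \<subseteq> E" using F(4) by blast
  then show "bounded (\<Union>i. F i - F (Suc i))"
   using E bounded_subset by (auto simp: bounded_borel_def)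
 qed
 then have "(\<lambda>i. \<mu> (F i - F (Suc i))) \<longlonglongrightarrow> 0" by (intro summable_LIMSEQ_zero sums_summable)
 from LIMSEQ_D[OF this, of 1] obtain N where "norm (\<mu> (F N - F (Suc N)) - 0) < 1" by auto
 then show False using F(3)[of N] by simp
qed

definition locally_finite :: "'a::euclidean_space measure \<Rightarrow> bool" where
 "locally_finite M \<longleftrightarrow> sets M = sets borel \<and> (\<forall>A\<in>bounded_borel. emeasure M A < \<infinity>)"

lemma locally_finite_sets: "locally_finite M \<Longrightarrow> sets M = sets borel"
 by (simp add: locally_finite_def)

lemma locally_finite_space: "locally_finite M \<Longrightarrow> space M = UNIV"
 using sets_eq_imp_space_eq[of M borel] by (simp add: locally_finite_def)

lemma locally_finite_total_variation: "complex_radon \<mu> \<Longrightarrow> locally_finite (total_variation \<mu>)"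
 using total_variation_finite by (auto simp: locally_finite_def)

lemma locally_finite_lborel: "locally_finite lborel"
 using emeasure_bounded_finite by (auto simp: locally_finite_def bounded_borel_def)

lemma sigma_finite_locally_finite:
 assumes "locally_finite M" shows "sigma_finite_measure M"
proof
 let ?A = "range (\<lambda>n::nat. cball (0::'a) (real n))"
 have "(\<Union>n::nat. cball (0::'a) (real n)) = UNIV"
  using real_arch_simple by (auto simp: set_eq_iff)
 moreover have "emeasure M (cball 0 (real n)) \<noteq> \<infinity>" for n
  using assms unfolding locally_finite_def by (metis bounded_borel_ball(2) less_irrefl)
 ultimately show "\<exists>A. countable A \<and> A \<subseteq> sets M \<and> \<Union>A = space M \<and> (\<forall>a\<in>A. emeasure M a \<noteq> \<infinity>)"
  using assms by (intro exI[of _ ?A]) (auto simp: locally_finite_sets locally_finite_space)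
qed

lemma AE_cball_nat:
 fixes P :: "'a::euclidean_space \<Rightarrow> bool"
 assumes "\<And>n::nat. AE x in M. norm x \<le> real n \<longrightarrow> P x"
 shows "AE x in M. P x"
proof -
 have "AE x in M. \<forall>n::nat. norm x \<le> real n \<longrightarrow> P x" unfolding AE_all_countable using assms by blast
 then show ?thesis
 proof eventually_elim
  case (elim x)
  then show ?case using real_arch_simple[of "norm x"] by blast
 qed
qed

lemma locally_finite_RN_density:
 assumes R: "locally_finite R" and M: "locally_finite M" and ac: "absolutely_continuous R M"
 obtains r :: "'a::euclidean_space \<Rightarrow> real" where "r \<in> borel_measurable borel" "\<And>x. 0 \<le> r x"
  "M = density R (\<lambda>x. ennreal (r x))"
proof -
 note [simp, measurable_cong] = locally_finite_sets[OF R]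
 note [simp] = locally_finite_sets[OF M]
 interpret sigma_finite_measure R by (rule sigma_finite_locally_finite[OF R])
 obtain k where k [measurable]: "k \<in> borel_measurable R" and Mk: "density R k = M"
  using Radon_Nikodym[OF ac] by auto
 have fin: "AE x in R. k x \<noteq> \<infinity>"
 proof (rule AE_cball_nat)
  fix n :: nat
  have [measurable]: "cball (0::'a) (real n) \<in> sets borel" by simp
  have "AE x in R. k x * indicator (cball 0 (real n)) x \<noteq> \<infinity>"
  proof (rule nn_integral_PInf_AE)
   have "(\<integral>\<^sup>+x. k x * indicator (cball 0 (real n)) x \<partial>R) = emeasure M (cball 0 (real n))"
    unfolding Mk[symmetric] by (simp add: emeasure_density)
   also have "\<dots> < \<infinity>" using M bounded_borel_ball(2) unfolding locally_finite_def by blast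
   finally show "(\<integral>\<^sup>+x. k x * indicator (cball 0 (real n)) x \<partial>R) \<noteq> \<infinity>" by simp
  qed measurable
  then show "AE x in R. norm x \<le> real n \<longrightarrow> k x \<noteq> \<infinity>"
   by eventually_elim (auto simp: indicator_def)
 qed
 show ?thesis
 proof (rule that[of "\<lambda>x. enn2real (k x)"])
  show "(\<lambda>x. enn2real (k x)) \<in> borel_measurable borel" using k by (simp cong: measurable_cong_sets)
  show "M = density R (\<lambda>x. ennreal (enn2real (k x)))"
   unfolding Mk[symmetric] using fin by (intro density_cong) (auto simp: less_top elim!: AE_mp)
 qed simp
qed

lemma AE_eq_of_set_integrals_bounded:
 fixes f g :: "'a::euclidean_space \<Rightarrow> complex"
 assumes M: "locally_finite M"
  and f: "\<And>A. A \<in> bounded_borel \<Longrightarrow> set_integrable M A f"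
  and g: "\<And>A. A \<in> bounded_borel \<Longrightarrow> set_integrable M A g"
  and eq: "\<And>A. A \<in> bounded_borel \<Longrightarrow> (LINT x:A|M. f x) = (LINT x:A|M. g x)"
 shows "AE x in M. f x = g x"
proof (rule AE_cball_nat)
 fix n :: nat
 interpret sigma_finite_measure M by (rule sigma_finite_locally_finite[OF M])
 let ?I = "\<lambda>f x. indicator (cball 0 (real n)) x *\<^sub>R f x"
 have *: "(LINT x:A|M. ?I k x) = (LINT x:A \<inter> cball 0 (real n)|M. k x)" for A and k :: "'a \<Rightarrow> complex"
  unfolding set_lebesgue_integral_def by (rule lint_cong) (auto simp: indicator_def)
 have "AE x in M. ?I f x = ?I g x"
 proof (rule density_unique_banach)
  show "integrable M (?I f)" "integrable M (?I g)"
   using f[of "cball 0 (real n)"] g[of "cball 0 (real n)"] by (auto simp: set_integrable_def)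
  fix A assume "A \<in> sets M"
  then have "A \<inter> cball 0 (real n) \<in> bounded_borel"
   using M by (auto simp: bounded_borel_def bounded_Int locally_finite_sets)
  then show "(LINT x:A|M. ?I f x) = (LINT x:A|M. ?I g x)" unfolding * by (rule eq)
 qed
 then show "AE x in M. norm x \<le> real n \<longrightarrow> f x = g x"
  by eventually_elim (auto simp: indicator_def)
qed

lemma ennreal_suminf_swap: "(\<Sum>i. \<Sum>j. f i j :: ennreal) = (\<Sum>j. \<Sum>i. f i j)"
proof -
 have "(\<Sum>i. \<Sum>j. f i j) = (\<integral>\<^sup>+i. (\<Sum>j. f i j) \<partial>count_space UNIV)"
  by (simp add: nn_integral_count_space_nat)
 also have "\<dots> = (\<Sum>j. \<integral>\<^sup>+i. f i j \<partial>count_space UNIV)" by (rule nn_integral_suminf) simp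
 finally show ?thesis by (simp add: nn_integral_count_space_nat)
qed

text \<open>A real set function dominated by a measure becomes positive when the measure is added to it,
 so that the Radon-Nikodym theorem for positive measures applies.\<close>

lemma dominated_set_function_density:
 fixes \<rho> :: "'a::euclidean_space set \<Rightarrow> real"
 assumes M: "locally_finite M"
  and dom: "\<And>A. A \<in> bounded_borel \<Longrightarrow> \<bar>\<rho> A\<bar> \<le> measure M A"
  and add: "\<And>A :: nat \<Rightarrow> 'a set. disjoint_family A \<Longrightarrow> (\<And>i. A i \<in> sets borel) \<Longrightarrow>
    bounded (\<Union>i. A i) \<Longrightarrow> (\<lambda>i. \<rho> (A i)) sums \<rho> (\<Union>i. A i)"
 obtains g :: "'a \<Rightarrow> real" where "g \<in> borel_measurable borel"
  "\<And>A. A \<in> bounded_borel \<Longrightarrow> set_integrable M A g"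
  "\<And>A. A \<in> bounded_borel \<Longrightarrow> \<rho> A = (LINT x:A|M. g x)"
proof -
 note [simp, measurable_cong] = locally_finite_sets[OF M]
 note [simp] = locally_finite_space[OF M]
 interpret sigma_finite_measure M by (rule sigma_finite_locally_finite[OF M])
 define R where "R = disjointed (\<lambda>n. cball (0::'a) (real n))"
 have R: "R n \<in> bounded_borel" for n
 proof -
  have "range R \<subseteq> sets borel" unfolding R_def by (rule sets.range_disjointed_sets) auto
  moreover have "R n \<subseteq> cball 0 (real n)" unfolding R_def by (rule disjointed_subset)
  ultimately show ?thesis
   by (auto simp: bounded_borel_def intro: bounded_subset[OF bounded_cball])
 qed
 have Rd: "disjoint_family R" unfolding R_def by (rule disjoint_family_disjointed)
 have RU: "(\<Union>n. R n) = UNIV"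
  unfolding R_def UN_disjointed_eq using real_arch_simple by (auto simp: set_eq_iff)
 have disjoint_family_Int: "disjoint_family (\<lambda>n. A \<inter> R n)" for A
  using Rd by (auto simp: disjoint_family_on_def)
 define k where "k A = measure M A + \<rho> A" for A
 have k0: "0 \<le> k A" if "A \<in> bounded_borel" for A using dom[OF that] by (simp add: k_def)
 have ksums: "(\<lambda>i. k (A i)) sums k (\<Union>i. A i)"
  if "disjoint_family A" "\<And>i. A i \<in> sets borel" "bounded (\<Union>i. A i)" for A :: "nat \<Rightarrow> 'a set"
  unfolding k_def
 proof (intro sums_add add that measure_UNION)
  have "(\<Union>i. A i) \<in> bounded_borel" using that by (auto simp: bounded_borel_def)
  then show "emeasure M (\<Union>i. A i) \<noteq> \<infinity>" using M by (force simp: locally_finite_def)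
 qed (use that in auto)
 have ksuminf: "(\<Sum>i. ennreal (k (A i))) = ennreal (k (\<Union>i. A i))"
  if A: "disjoint_family A" "\<And>i. A i \<in> sets borel" "bounded (\<Union>i. A i)" for A :: "nat \<Rightarrow> 'a set"
 proof (rule suminf_ennreal_eq[OF _ ksums[OF A]])
  show "0 \<le> k (A i)" for i
   using A(2) bounded_subset[OF A(3)] by (intro k0) (auto simp: bounded_borel_def)
 qed
 define m where "m A = (\<Sum>n. ennreal (k (A \<inter> R n)))" for A
 have mk: "m A = ennreal (k A)" if A: "A \<in> bounded_borel" for A
 proof -
  have "(\<Union>n. A \<inter> R n) = A" using RU by auto
  then show ?thesis
   unfolding m_def using ksuminf[of "\<lambda>n. A \<inter> R n", OF disjoint_family_Int]
    sets.Int[OF bounded_borelD(1)[OF A] bounded_borelD(1)[OF R]] bounded_borelD(2)[OF A] by simp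
 qed
 define N where "N = measure_of UNIV (sets borel) m"
 have [simp]: "sets N = sets borel"
  unfolding N_def using sets.sigma_sets_eq[of borel] by (simp add: sets_measure_of)
 have N: "emeasure N A = m A" if "A \<in> sets borel" for A
 proof (rule emeasure_measure_of[OF N_def])
  show "positive (sets N) m" using mk[of "{}"] ksums[of "\<lambda>_. {}"] summable_const_iff[of "k {}"]
   by (auto simp: positive_def bounded_borel_def disjoint_family_on_def dest!: sums_summable)
  show "countably_additive (sets N) m"
  proof (rule countably_additiveI)
   fix A :: "nat \<Rightarrow> 'a set" assume A: "range A \<subseteq> sets N" "disjoint_family A"
   have "(\<Sum>i. m (A i)) = (\<Sum>n. \<Sum>i. ennreal (k (A i \<inter> R n)))"
    unfolding m_def by (rule ennreal_suminf_swap)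
   also have "\<dots> = (\<Sum>n. ennreal (k (\<Union>i. A i \<inter> R n)))"
   proof (rule suminf_cong, rule ksuminf)
    fix n
    show "disjoint_family (\<lambda>i. A i \<inter> R n)" using A(2) by (auto simp: disjoint_family_on_def)
    show "A i \<inter> R n \<in> sets borel" for i using A(1) R[of n] by (auto simp: bounded_borel_def)
    show "bounded (\<Union>i. A i \<inter> R n)"
     by (rule bounded_subset[of "R n"]) (use R[of n] in \<open>auto simp: bounded_borel_def\<close>)
   qed
   also have "\<dots> = m (\<Union>i. A i)"
   proof -
    have "(\<Union>i. A i \<inter> R n) = (\<Union>i. A i) \<inter> R n" for n by blast
    then show ?thesis unfolding m_def by presburger
   qed
   finally show "(\<Sum>i. m (A i)) = m (\<Union>i. A i)" .
  qed
 qed (use that in auto)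
 have "absolutely_continuous M N"
  unfolding absolutely_continuous_def
 proof
  fix A assume A: "A \<in> null_sets M"
  have "k (A \<inter> R n) = 0" for n
  proof -
   have "A \<inter> R n \<in> null_sets M" using A R[of n] by (auto simp: bounded_borel_def null_sets_def intro: emeasure_eq_0)
   then have "measure M (A \<inter> R n) = 0" by (simp add: measure_eq_0_null_sets)
   moreover have "A \<inter> R n \<in> bounded_borel" using A R[of n] by (auto simp: bounded_borel_def bounded_Int)
   ultimately show ?thesis using dom[of "A \<inter> R n"] by (simp add: k_def)
  qed
  then have "m A = 0" by (simp add: m_def)
  then show "A \<in> null_sets N" using A by (auto simp: null_sets_def N)
 qed
 moreover have "locally_finite N"
  by (simp add: locally_finite_def bounded_borel_def N mk)
 ultimately obtain f where f: "f \<in> borel_measurable borel" "\<And>x. 0 \<le> f x" "N = density M (\<lambda>x. ennreal (f x))"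
  using locally_finite_RN_density[OF M, of N] by blast
 note [measurable] = f(1)
 have b: "has_bochner_integral M (\<lambda>x. indicator A x *\<^sub>R f x) (k A)" if A: "A \<in> bounded_borel" for A
 proof (rule has_bochner_integral_nn_integral)
  have [measurable]: "A \<in> sets borel" using A by (rule bounded_borelD)
  show "(\<lambda>x. indicator A x *\<^sub>R f x) \<in> borel_measurable M" by measurable
  have "(\<integral>\<^sup>+x. ennreal (indicator A x *\<^sub>R f x) \<partial>M) = emeasure N A"
   unfolding f(3) by (simp add: emeasure_density) (auto intro!: nn_integral_cong simp: indicator_def)
  then show "(\<integral>\<^sup>+x. ennreal (indicator A x *\<^sub>R f x) \<partial>M) = ennreal (k A)"
   by (simp add: N mk[OF A])
 qed (auto simp: k0[OF A] f(2))
 have one: "has_bochner_integral M (\<lambda>x. indicator A x *\<^sub>R (1::real)) (measure M A)" if "A \<in> bounded_borel" for A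
  using has_bochner_integral_real_indicator[of A M] that M by (auto simp: locally_finite_def bounded_borel_def)
 have d: "has_bochner_integral M (\<lambda>x. indicator A x *\<^sub>R (f x - 1)) (\<rho> A)" if "A \<in> bounded_borel" for A
  using has_bochner_integral_diff[OF b[OF that] one[OF that]] by (simp add: k_def algebra_simps)
 show ?thesis
 proof (rule that[of "\<lambda>x. f x - 1"])
  show "(\<lambda>x. f x - 1) \<in> borel_measurable borel"
   by measurable
  show "set_integrable M A (\<lambda>x. f x - 1)" if "A \<in> bounded_borel" for A
   using d[OF that] unfolding set_integrable_def by (rule integrable.intros)
  show "\<rho> A = (LINT x:A|M. f x - 1)" if "A \<in> bounded_borel" for A
   using d[OF that] unfolding set_lebesgue_integral_def by (simp add: has_bochner_integral_integral_eq)
 qed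
qed

lemma radon_density_exists:
 fixes \<mu> :: "'a::euclidean_space set \<Rightarrow> complex"
 assumes \<mu>: "complex_radon \<mu>"
 obtains h where "h \<in> borel_measurable borel"
  "\<And>A. A \<in> bounded_borel \<Longrightarrow> set_integrable (total_variation \<mu>) A h"
  "\<And>A. A \<in> bounded_borel \<Longrightarrow> \<mu> A = (LINT x:A|total_variation \<mu>. h x)"
proof -
 note M = locally_finite_total_variation[OF \<mu>]
 have le: "norm (\<mu> A) \<le> measure (total_variation \<mu>) A" if "A \<in> bounded_borel" for A
  using norm_radon_le_variation[OF \<mu> that] total_variation_finite[OF \<mu> that]
  by (simp add: emeasure_eq_ennreal_measure)
 obtain u where u: "u \<in> borel_measurable borel"
  "\<And>A. A \<in> bounded_borel \<Longrightarrow> set_integrable (total_variation \<mu>) A u"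
  "\<And>A. A \<in> bounded_borel \<Longrightarrow> Re (\<mu> A) = (LINT x:A|total_variation \<mu>. u x)"
 proof (rule dominated_set_function_density[OF M, of "\<lambda>A. Re (\<mu> A)"])
  show "\<bar>Re (\<mu> A)\<bar> \<le> measure (total_variation \<mu>) A" if "A \<in> bounded_borel" for A
   using le[OF that] abs_Re_le_cmod[of "\<mu> A"] by linarith
  show "(\<lambda>i. Re (\<mu> (A i))) sums Re (\<mu> (\<Union>i. A i))"
   if "disjoint_family A" "\<And>i. A i \<in> sets borel" "bounded (\<Union>i. A i)" for A :: "nat \<Rightarrow> 'a set"
   using radon_sums[OF \<mu> that] by (rule sums_Re)
 qed blast
 obtain v where v: "v \<in> borel_measurable borel"
  "\<And>A. A \<in> bounded_borel \<Longrightarrow> set_integrable (total_variation \<mu>) A v"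
  "\<And>A. A \<in> bounded_borel \<Longrightarrow> Im (\<mu> A) = (LINT x:A|total_variation \<mu>. v x)"
 proof (rule dominated_set_function_density[OF M, of "\<lambda>A. Im (\<mu> A)"])
  show "\<bar>Im (\<mu> A)\<bar> \<le> measure (total_variation \<mu>) A" if "A \<in> bounded_borel" for A
   using le[OF that] abs_Im_le_cmod[of "\<mu> A"] by linarith
  show "(\<lambda>i. Im (\<mu> (A i))) sums Im (\<mu> (\<Union>i. A i))"
   if "disjoint_family A" "\<And>i. A i \<in> sets borel" "bounded (\<Union>i. A i)" for A :: "nat \<Rightarrow> 'a set"
   using radon_sums[OF \<mu> that] by (rule sums_Im)
 qed blast
 define h where "h x = of_real (u x) + \<i> * of_real (v x)" for x
 have eq: "indicator A x *\<^sub>R h x = of_real (indicator A x *\<^sub>R u x) + \<i> * of_real (indicator A x *\<^sub>R v x)" for A x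
  by (simp add: h_def indicator_def)
 show ?thesis
 proof (rule that[of h])
  show "h \<in> borel_measurable borel" unfolding h_def using u(1) v(1) by measurable
  fix A :: "'a set" assume A: "A \<in> bounded_borel"
  have iu: "integrable (total_variation \<mu>) (\<lambda>x. indicator A x *\<^sub>R u x)"
   and iv: "integrable (total_variation \<mu>) (\<lambda>x. indicator A x *\<^sub>R v x)"
   using u(2)[OF A] v(2)[OF A] by (auto simp: set_integrable_def)
  show "set_integrable (total_variation \<mu>) A h"
   unfolding set_integrable_def eq using iu iv by (intro lintable_add integrable_mult_right integrable_of_real)
  have "(LINT x:A|total_variation \<mu>. h x) = of_real (Re (\<mu> A)) + \<i> * of_real (Im (\<mu> A))"
   unfolding set_lebesgue_integral_def eq u(3)[OF A] v(3)[OF A] using iu iv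
   by (subst lint_add)
    (auto simp: set_lebesgue_integral_def simp del: of_real_mult real_scaleR_def)
  then show "\<mu> A = (LINT x:A|total_variation \<mu>. h x)" by (simp add: complex_eq_iff)
 qed
qed

lemma total_variation_le_density:
 fixes g :: "'a::euclidean_space \<Rightarrow> complex"
 assumes \<mu>: "complex_radon \<mu>" and M: "locally_finite M" and g: "g \<in> borel_measurable borel"
  and int: "\<And>A. A \<in> bounded_borel \<Longrightarrow> set_integrable M A g"
  and eq: "\<And>A. A \<in> bounded_borel \<Longrightarrow> \<mu> A = (LINT x:A|M. g x)"
  and A: "A \<in> sets borel"
 shows "emeasure (total_variation \<mu>) A \<le> (\<integral>\<^sup>+x\<in>A. ennreal (norm (g x)) \<partial>M)"
 unfolding emeasure_total_variation[OF \<mu> A] variation_def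
proof (rule SUP_least)
 note [measurable_cong] = locally_finite_sets[OF M]
 note [measurable] = g
 fix P assume P: "P \<in> {P. finite P \<and> disjoint P \<and> P \<subseteq> bounded_borel \<and> \<Union> P \<subseteq> A}"
 have "(\<Sum>B\<in>P. ennreal (norm (\<mu> B))) \<le> (\<Sum>B\<in>P. \<integral>\<^sup>+x\<in>B. ennreal (norm (g x)) \<partial>M)"
 proof (rule sum_mono)
  fix B assume "B \<in> P"
  then have B: "B \<in> bounded_borel" using P by auto
  have "ennreal (norm (\<mu> B)) \<le> (\<integral>\<^sup>+x. ennreal (norm (indicator B x *\<^sub>R g x)) \<partial>M)"
   using int[OF B] unfolding eq[OF B] set_lebesgue_integral_def set_integrable_def
   by (rule integral_norm_bound_ennreal)
  also have "\<dots> = (\<integral>\<^sup>+x\<in>B. ennreal (norm (g x)) \<partial>M)"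
   by (rule nn_integral_cong) (auto simp: indicator_def)
  finally show "ennreal (norm (\<mu> B)) \<le> (\<integral>\<^sup>+x\<in>B. ennreal (norm (g x)) \<partial>M)" .
 qed
 also have "\<dots> = (\<integral>\<^sup>+x. (\<Sum>B\<in>P. ennreal (norm (g x)) * indicator B x) \<partial>M)"
  using P by (intro nn_integral_sum[symmetric]) (auto simp: bounded_borel_def)
 also have "\<dots> \<le> (\<integral>\<^sup>+x\<in>A. ennreal (norm (g x)) \<partial>M)"
 proof (rule nn_integral_mono)
  fix x
  have "(\<Sum>B\<in>P. indicator B x) = (indicator (\<Union>P) x :: ennreal)"
  proof -
   have "disjoint_family_on (\<lambda>B. B) P" using P by (auto simp: disjoint_family_on_def disjoint_def)
   then have "indicator (\<Union>((\<lambda>B. B) ` P)) x = (\<Sum>B\<in>P. indicator B x :: ennreal)"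
    using P by (intro indicator_UN_disjoint) auto
   then show ?thesis by simp
  qed
  then have "(\<Sum>B\<in>P. ennreal (norm (g x)) * indicator B x) = ennreal (norm (g x)) * indicator (\<Union>P) x"
   by (simp add: sum_distrib_left[symmetric])
  also have "\<dots> \<le> ennreal (norm (g x)) * indicator A x"
   using P by (auto simp: indicator_def)
  finally show "(\<Sum>B\<in>P. ennreal (norm (g x)) * indicator B x) \<le> ennreal (norm (g x)) * indicator A x" .
 qed
 finally show "(\<Sum>B\<in>P. ennreal (norm (\<mu> B))) \<le> (\<integral>\<^sup>+x\<in>A. ennreal (norm (g x)) \<partial>M)" .
qed

text \<open>The averages of the density over sets have norm at most 1, so the density does; it cannot be smaller
 on a set of positive measure, as that set would then have too little variation.\<close>

lemma polar_density_exists: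
 fixes \<mu> :: "'a::euclidean_space set \<Rightarrow> complex"
 assumes \<mu>: "complex_radon \<mu>"
 shows "\<exists>h. polar_density \<mu> h"
proof -
 let ?M = "total_variation \<mu>"
 note M = locally_finite_total_variation[OF \<mu>]
 interpret sigma_finite_measure ?M by (rule sigma_finite_locally_finite[OF M])
 obtain h where h [measurable]: "h \<in> borel_measurable borel"
  and int: "\<And>A. A \<in> bounded_borel \<Longrightarrow> set_integrable ?M A h"
  and eq: "\<And>A. A \<in> bounded_borel \<Longrightarrow> \<mu> A = (LINT x:A|?M. h x)"
  using radon_density_exists[OF \<mu>] by blast
 have le: "AE x in ?M. norm (h x) \<le> 1"
 proof (rule AE_cball_nat)
  fix n :: nat
  let ?h = "\<lambda>x. indicator (cball 0 (real n)) x *\<^sub>R h x"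
  have "AE x in ?M. ?h x \<in> cball 0 1"
  proof (rule averaging_theorem)
   show "integrable ?M ?h" using int[of "cball 0 (real n)"] by (simp add: set_integrable_def)
   fix A assume A: "A \<in> sets ?M" "0 < measure ?M A"
   then have B: "A \<inter> cball 0 (real n) \<in> bounded_borel" by (auto simp: bounded_borel_def bounded_Int)
   have "(LINT x:A|?M. ?h x) = (LINT x:A \<inter> cball 0 (real n)|?M. h x)"
    unfolding set_lebesgue_integral_def by (rule lint_cong) (auto simp: indicator_def)
   also have "\<dots> = \<mu> (A \<inter> cball 0 (real n))" by (rule eq[OF B, symmetric])
   also have "norm \<dots> \<le> measure ?M (A \<inter> cball 0 (real n))"
    using norm_radon_le_variation[OF \<mu> B] total_variation_finite[OF \<mu> B]
    by (simp add: emeasure_eq_ennreal_measure)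
   also have "\<dots> \<le> measure ?M A"
   proof (rule measure_mono_fmeasurable)
    have "emeasure ?M A \<noteq> \<infinity>" using A(2) by (auto simp: measure_def)
    then show "A \<in> fmeasurable ?M" using A(1) by (auto simp: fmeasurable_def less_top)
   qed (use A in auto)
   finally show "(1 / measure ?M A) *\<^sub>R (LINT x:A|?M. ?h x) \<in> cball 0 1"
    using A(2) by (simp add: divide_simps)
  qed simp
  then show "AE x in ?M. norm x \<le> real n \<longrightarrow> norm (h x) \<le> 1"
   by eventually_elim (auto simp: indicator_def)
 qed
 have "density ?M (\<lambda>x. ennreal (norm (h x))) = density ?M (\<lambda>_. 1)"
 proof (rule measure_eqI)
  fix A assume "A \<in> sets (density ?M (\<lambda>x. ennreal (norm (h x))))"
  then have A: "A \<in> sets borel" by simp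
  have "(\<integral>\<^sup>+x\<in>A. ennreal (norm (h x)) \<partial>?M) \<le> (\<integral>\<^sup>+x\<in>A. 1 \<partial>?M)"
   using le by (intro nn_integral_mono_AE) (auto elim!: AE_mp simp: indicator_def)
  moreover have "(\<integral>\<^sup>+x\<in>A. 1 \<partial>?M) \<le> (\<integral>\<^sup>+x\<in>A. ennreal (norm (h x)) \<partial>?M)"
   using total_variation_le_density[OF \<mu> M h int eq A] A by simp
  ultimately show "emeasure (density ?M (\<lambda>x. ennreal (norm (h x)))) A = emeasure (density ?M (\<lambda>_. 1)) A"
   using A by (simp add: emeasure_density antisym)
 qed simp
 then have one: "AE x in ?M. ennreal (norm (h x)) = 1"
  by (intro density_unique) auto
 define h' where "h' x = (if norm (h x) = 1 then h x else 1)" for x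
 have AE: "AE x in ?M. h' x = h x" using one by eventually_elim (auto simp: h'_def)
 have [measurable]: "h' \<in> borel_measurable borel" unfolding h'_def by measurable
 have "polar_density \<mu> h'"
  unfolding polar_density_def
 proof (intro conjI allI ballI)
  show "norm (h' x) = 1" for x by (simp add: h'_def)
  fix A :: "'a set" assume A: "A \<in> bounded_borel"
  then have [measurable]: "A \<in> sets borel" by (rule bounded_borelD)
  have "(LINT x:A|?M. h x) = (LINT x:A|?M. h' x)"
   unfolding set_lebesgue_integral_def
  proof (rule integral_cong_AE)
   show "AE x in ?M. indicator A x *\<^sub>R h x = indicator A x *\<^sub>R h' x" using AE by eventually_elim simp
  qed measurable
  then show "\<mu> A = (LINT x:A|?M. h' x)" by (simp add: eq[OF A])
 qed measurable
 then show ?thesis by blast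
qed

lemma complex_radon_of_density:
 fixes g :: "'a::euclidean_space \<Rightarrow> complex"
 assumes M: "locally_finite M" and int: "\<And>A. A \<in> bounded_borel \<Longrightarrow> set_integrable M A g"
 shows "complex_radon (\<lambda>A. if A \<in> bounded_borel then LINT x:A|M. g x else 0)"
 unfolding complex_radon_def
proof (intro conjI allI impI)
 note [measurable_cong] = locally_finite_sets[OF M]
 fix A :: "nat \<Rightarrow> 'a set"
 assume A: "disjoint_family A \<and> range A \<subseteq> sets borel \<and> bounded (\<Union>i. A i)"
 then have U: "(\<Union>i. A i) \<in> bounded_borel" by (auto simp: bounded_borel_def)
 have Ai: "A i \<in> bounded_borel" for i
  using A bounded_subset[of "\<Union>i. A i" "A i"] by (auto simp: bounded_borel_def)
 have "(\<lambda>n. LINT x|M. (\<Sum>i<n. indicator (A i) x) *\<^sub>R g x) \<longlonglongrightarrow> (LINT x|M. indicator (\<Union>i. A i) x *\<^sub>R g x)"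
 proof (rule integral_dominated_convergence)
  have g: "(\<lambda>x. indicator (A i) x *\<^sub>R g x) \<in> borel_measurable M" for i
   using int[OF Ai] unfolding set_integrable_def by (rule borel_measurable_integrable)
  show "(\<lambda>x. (\<Sum>i<n. indicator (A i) x) *\<^sub>R g x) \<in> borel_measurable M" for n
   unfolding scaleR_sum_left by (intro borel_measurable_sum g)
  have "integrable M (\<lambda>x. indicator (\<Union>i. A i) x *\<^sub>R g x)" using int[OF U] by (simp add: set_integrable_def)
  then show "integrable M (\<lambda>x. norm (indicator (\<Union>i. A i) x *\<^sub>R g x))" "(\<lambda>x. indicator (\<Union>i. A i) x *\<^sub>R g x) \<in> borel_measurable M"
   by (rule integrable_norm, rule borel_measurable_integrable)
  have s: "(\<Sum>i<n. indicator (A i) x) = (indicator (\<Union>i<n. A i) x :: real)" for n x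
   using A by (intro indicator_UN_disjoint[symmetric]) (auto simp: disjoint_family_on_def)
  have "(\<lambda>n. (indicator (\<Union>i<n. A i) x :: real)) \<longlonglongrightarrow> indicator (\<Union>i. A i) x" for x
   by (rule LIMSEQ_indicator_UN)
  then show "AE x in M. (\<lambda>n. (\<Sum>i<n. indicator (A i) x) *\<^sub>R g x) \<longlonglongrightarrow> indicator (\<Union>i. A i) x *\<^sub>R g x"
   unfolding s by (intro AE_I2 tendsto_intros)
  show "AE x in M. norm ((\<Sum>i<n. indicator (A i) x) *\<^sub>R g x) \<le> norm (indicator (\<Union>i. A i) x *\<^sub>R g x)" for n
   unfolding s by (auto simp: indicator_def)
 qed
 moreover have "(LINT x|M. (\<Sum>i<n. indicator (A i) x) *\<^sub>R g x) = (\<Sum>i<n. LINT x:A i|M. g x)" for n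
  unfolding scaleR_sum_left set_lebesgue_integral_def using int[OF Ai]
  by (intro lint_sum) (simp add: set_integrable_def)
 ultimately show "(\<lambda>i. if A i \<in> bounded_borel then LINT x:A i|M. g x else 0) sums
  (if (\<Union>i. A i) \<in> bounded_borel then LINT x:(\<Union>i. A i)|M. g x else 0)"
  using U Ai by (simp add: sums_def set_lebesgue_integral_def)
qed simp

text \<open>Every representation by a density against a positive measure determines the polar
 decomposition, so that the total variation and all integrals can be computed from it.\<close>

lemma radon_representation:
 fixes g :: "'a::euclidean_space \<Rightarrow> complex"
 assumes \<mu>: "complex_radon \<mu>" and M: "locally_finite M" and g: "g \<in> borel_measurable borel"
  and int: "\<And>A. A \<in> bounded_borel \<Longrightarrow> set_integrable M A g"
  and eq: "\<And>A. A \<in> bounded_borel \<Longrightarrow> \<mu> A = (LINT x:A|M. g x)"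
 shows total_variation_density: "total_variation \<mu> = density M (\<lambda>x. ennreal (norm (g x)))"
  and integrable_total_variation_iff: "\<And>f :: 'a \<Rightarrow> complex. f \<in> borel_measurable borel \<Longrightarrow>
   integrable (total_variation \<mu>) f \<longleftrightarrow> integrable M (\<lambda>x. f x * g x)"
  and radon_integral_density: "\<And>f. f \<in> borel_measurable borel \<Longrightarrow>
   radon_integral \<mu> f = (LINT x|M. f x * g x)"
proof -
 note [simp, measurable_cong] = locally_finite_sets[OF M]
 note [simp] = locally_finite_space[OF M]
 note [measurable] = g
 interpret sigma_finite_measure M by (rule sigma_finite_locally_finite[OF M])
 let ?T = "total_variation \<mu>"
 note le = total_variation_le_density[OF \<mu> M g int eq]
 define h where "h = (SOME h. polar_density \<mu> h)"
 have pol: "polar_density \<mu> h"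
  unfolding h_def using polar_density_exists[OF \<mu>] by (rule someI_ex)
 have [measurable]: "h \<in> borel_measurable borel" and h1: "\<And>x. norm (h x) = 1"
  and hA: "\<And>A. A \<in> bounded_borel \<Longrightarrow> \<mu> A = (LINT x:A|?T. h x)"
  using pol by (auto simp: polar_density_def)
 have "absolutely_continuous M ?T"
  unfolding absolutely_continuous_def
 proof
  fix A assume A: "A \<in> null_sets M"
  then have [measurable]: "A \<in> sets borel" by auto
  have "AE x in M. x \<notin> A" using A by (rule AE_not_in)
  then have "(\<integral>\<^sup>+x\<in>A. ennreal (norm (g x)) \<partial>M) = 0"
   by (subst nn_integral_0_iff_AE) (auto elim!: AE_mp simp: indicator_def)
  then show "A \<in> null_sets ?T" using le[of A] by (auto simp: null_sets_def)
 qed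
 then obtain r where r [measurable]: "r \<in> borel_measurable borel" and r0: "\<And>x. 0 \<le> r x"
  and Tr: "?T = density M (\<lambda>x. ennreal (r x))"
  using locally_finite_RN_density[OF M locally_finite_total_variation[OF \<mu>]] by blast
 have hint: "set_integrable M A (\<lambda>x. r x *\<^sub>R h x)" if A: "A \<in> bounded_borel" for A
 proof -
  have [measurable]: "A \<in> sets borel" using A by (rule bounded_borelD)
  have "integrable ?T (\<lambda>x. indicator A x *\<^sub>R h x)"
  proof (rule lintable_bound)
   show "integrable ?T (indicat_real A)"
    using total_variation_finite[OF \<mu> A] by (intro integrable_real_indicator) auto
  qed (auto simp: h1 indicator_def)
  then show ?thesis
   unfolding Tr set_integrable_def
   by (subst (asm) integrable_density) (auto simp: r0 mult.commute scaleR_left_commute)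
 qed
 have AE: "AE x in M. g x = r x *\<^sub>R h x"
 proof (rule AE_eq_of_set_integrals_bounded[OF M int hint])
  fix A :: "'a set" assume A: "A \<in> bounded_borel"
  have [measurable]: "A \<in> sets borel" using A by (rule bounded_borelD)
  have "(LINT x:A|?T. h x) = (LINT x:A|M. r x *\<^sub>R h x)"
   unfolding Tr set_lebesgue_integral_def
   by (subst integral_density) (auto simp: r0 mult.commute)
  then show "(LINT x:A|M. g x) = (LINT x:A|M. r x *\<^sub>R h x)"
   using eq[OF A] hA[OF A] by simp
 qed
 show "?T = density M (\<lambda>x. ennreal (norm (g x)))"
  unfolding Tr using AE by (intro density_cong) (auto simp: h1 r0 elim!: AE_mp)
 fix f :: "'a \<Rightarrow> complex" assume [measurable]: "f \<in> borel_measurable borel"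
 have AE1: "AE x in M. r x *\<^sub>R (f x * h x) = f x * g x" using AE by eventually_elim simp
 have "integrable ?T f \<longleftrightarrow> integrable M (\<lambda>x. r x *\<^sub>R f x)"
  unfolding Tr by (rule integrable_density) (auto simp: r0)
 also have "\<dots> \<longleftrightarrow> integrable M (\<lambda>x. f x * g x)"
 proof -
  have "AE x in M. norm (r x *\<^sub>R f x) = norm (f x * g x)"
   using AE by eventually_elim (simp add: norm_mult h1)
  then have *: "AE x in M. norm (r x *\<^sub>R f x) \<le> norm (f x * g x)" "AE x in M. norm (f x * g x) \<le> norm (r x *\<^sub>R f x)"
   by (auto elim!: AE_mp)
  show ?thesis
   by (auto intro: lintable_bound[OF _ _ *(1)] lintable_bound[OF _ _ *(2)])
 qed
 finally show "integrable ?T f \<longleftrightarrow> integrable M (\<lambda>x. f x * g x)" .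
 have "radon_integral \<mu> f = (LINT x|?T. f x * h x)" by (simp add: radon_integral_def h_def)
 also have "\<dots> = (LINT x|M. r x *\<^sub>R (f x * h x))"
  unfolding Tr by (rule integral_density) (auto simp: r0)
 also have "\<dots> = (LINT x|M. f x * g x)" by (rule integral_cong_AE[OF _ _ AE1]) measurable
 finally show "radon_integral \<mu> f = (LINT x|M. f x * g x)" .
qed

lemma polar_set_integrable:
 assumes \<mu>: "complex_radon \<mu>" and h: "polar_density \<mu> h" and A: "A \<in> bounded_borel"
 shows "set_integrable (total_variation \<mu>) A h"
 unfolding set_integrable_def
proof (rule lintable_bound)
 have [measurable]: "A \<in> sets borel" "h \<in> borel_measurable borel" and h1: "\<And>x. norm (h x) = 1"
  using A h by (auto simp: bounded_borel_def polar_density_def)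
 show "integrable (total_variation \<mu>) (indicat_real A)"
  using total_variation_finite[OF \<mu> A] by (intro integrable_real_indicator) auto
 show "(\<lambda>x. indicator A x *\<^sub>R h x) \<in> borel_measurable (total_variation \<mu>)" by measurable
 show "AE x in total_variation \<mu>. norm (indicator A x *\<^sub>R h x) \<le> norm (indicat_real A x)"
  by (auto simp: h1 indicator_def)
qed

lemma radon_integral_polar:
 assumes \<mu>: "complex_radon \<mu>" and h: "polar_density \<mu> h" and f: "f \<in> borel_measurable borel"
 shows "radon_integral \<mu> f = (LINT x|total_variation \<mu>. f x * h x)"
 using h by (intro radon_integral_density[OF \<mu> locally_finite_total_variation[OF \<mu>] _ polar_set_integrable[OF \<mu> h] _ f])
  (auto simp: polar_density_def)

section \<open>Lebesgue decomposition\<close>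

lemma set_integrable_lborelD:
 assumes "locally_integrable f" "A \<in> bounded_borel" shows "set_integrable lborel A f"
proof (rule set_integrable_subset)
 have "compact (closure A)" using bounded_closure[of A] assms(2) by (simp add: bounded_borel_def compact_eq_bounded_closed)
 then show "set_integrable lborel (closure A) f" using assms(1) by (simp add: locally_integrable_def)
qed (use assms(2) closure_subset[of A] in \<open>simp_all add: bounded_borel_def\<close>)

lemma locally_integrableI:
 assumes "f \<in> borel_measurable borel" "\<And>A. A \<in> bounded_borel \<Longrightarrow> set_integrable lborel A f"
 shows "locally_integrable f"
 unfolding locally_integrable_def
proof (intro conjI allI impI assms)
 fix K :: "'a set" assume "compact K"
 then show "K \<in> bounded_borel" by (simp add: bounded_borel_def compact_imp_bounded compact_imp_closed)
qed

lemma complex_radon_lebesgue_density: "locally_integrable f \<Longrightarrow> complex_radon (lebesgue_density f)"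
 unfolding lebesgue_density_def
 by (rule complex_radon_of_density[OF locally_finite_lborel]) (rule set_integrable_lborelD)

lemma lebesgue_density_representation:
 fixes f :: "'a::euclidean_space \<Rightarrow> complex"
 assumes "locally_integrable f"
 shows "total_variation (lebesgue_density f) = abs_density f"
  and "\<And>\<phi> :: 'a \<Rightarrow> complex. \<phi> \<in> borel_measurable borel \<Longrightarrow>
   integrable (total_variation (lebesgue_density f)) \<phi> \<longleftrightarrow> integrable lborel (\<lambda>x. \<phi> x * f x)"
  and "\<And>\<phi>. \<phi> \<in> borel_measurable borel \<Longrightarrow>
   radon_integral (lebesgue_density f) \<phi> = (LINT x|lborel. \<phi> x * f x)"
proof -
 have f: "f \<in> borel_measurable borel" using assms by (simp add: locally_integrable_def)
 have eq: "lebesgue_density f A = (LINT x:A|lborel. f x)" if "A \<in> bounded_borel" for A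
  using that by (simp add: lebesgue_density_def)
 note R = radon_representation[OF complex_radon_lebesgue_density[OF assms] locally_finite_lborel f
   set_integrable_lborelD[OF assms] eq]
 show "total_variation (lebesgue_density f) = abs_density f"
  by (intro R(1))
 fix \<phi> :: "'a \<Rightarrow> complex" assume \<phi>: "\<phi> \<in> borel_measurable borel"
 show "integrable (total_variation (lebesgue_density f)) \<phi> \<longleftrightarrow> integrable lborel (\<lambda>x. \<phi> x * f x)"
  using \<phi> by (intro R(2)) auto
 show "radon_integral (lebesgue_density f) \<phi> = (LINT x|lborel. \<phi> x * f x)"
  using \<phi> by (intro R(3)) auto
qed

lemma lebesgue_density_eq_AE:
 assumes "locally_integrable f" "locally_integrable g" "lebesgue_density f = lebesgue_density g"
 shows "AE x in lborel. f x = g x"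
proof (rule AE_eq_of_set_integrals_bounded[OF locally_finite_lborel])
 show "(LINT x:A|lborel. f x) = (LINT x:A|lborel. g x)" if "A \<in> bounded_borel" for A
  using fun_cong[OF assms(3), of A] that by (simp add: lebesgue_density_def)
qed (use assms in \<open>auto intro: set_integrable_lborelD\<close>)

lemma locally_finite_add:
 assumes M: "locally_finite M" and L: "locally_finite L"
 obtains R :: "'a::euclidean_space measure" where "locally_finite R"
  "\<And>A. A \<in> sets borel \<Longrightarrow> emeasure R A = emeasure M A + emeasure L A"
proof -
 note [simp] = locally_finite_sets[OF M] locally_finite_sets[OF L]
 define R where "R = measure_of UNIV (sets borel) (\<lambda>A. emeasure M A + emeasure L A)"
 have [simp]: "sets R = sets borel"
  unfolding R_def using sets.sigma_sets_eq[of borel] by (simp add: sets_measure_of)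
 have R: "emeasure R A = emeasure M A + emeasure L A" if "A \<in> sets borel" for A
 proof (rule emeasure_measure_of[OF R_def])
  show "countably_additive (sets R) (\<lambda>A. emeasure M A + emeasure L A)"
  proof (rule countably_additiveI)
   fix A :: "nat \<Rightarrow> 'a set" assume A: "range A \<subseteq> sets R" "disjoint_family A"
   then show "(\<Sum>i. emeasure M (A i) + emeasure L (A i)) = emeasure M (\<Union>i. A i) + emeasure L (\<Union>i. A i)"
    using suminf_emeasure[of A M] suminf_emeasure[of A L]
    by (subst suminf_add[symmetric]) auto
  qed
 qed (use that in \<open>auto simp: positive_def\<close>)
 have "locally_finite R"
  using M L by (auto simp: locally_finite_def bounded_borel_def R)
 then show ?thesis using that R by blast
qed

text \<open>Outside the zero set \<open>N\<close> of the density of Lebesgue measure with respect to \<open>M + \<lambda>\<close>, the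
 measure \<open>M\<close> is absolutely continuous with respect to \<open>\<lambda>\<close>.\<close>

lemma lebesgue_decomposition_positive:
 fixes M :: "'a::euclidean_space measure"
 assumes M: "locally_finite M"
 obtains N r where "N \<in> null_sets lborel" "r \<in> borel_measurable borel" "\<And>x. 0 \<le> r x"
  "density M (indicator (- N)) = density lborel (\<lambda>x. ennreal (r x))"
proof -
 note [simp, measurable_cong] = locally_finite_sets[OF M]
 note [simp] = locally_finite_space[OF M]
 obtain R where LR: "locally_finite R"
  and R: "\<And>A. A \<in> sets borel \<Longrightarrow> emeasure R A = emeasure M A + emeasure lborel A"
  using locally_finite_add[OF M locally_finite_lborel] by blast
 note [simp, measurable_cong] = locally_finite_sets[OF LR]
 interpret R: sigma_finite_measure R by (rule sigma_finite_locally_finite[OF LR])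
 have "absolutely_continuous R lborel" by (auto simp: absolutely_continuous_def null_sets_def R)
 then obtain g where g [measurable]: "g \<in> borel_measurable R" and gR: "density R g = lborel"
  using R.Radon_Nikodym[of lborel] by auto
 define N where "N = {x. g x = 0}"
 have N [measurable]: "N \<in> sets borel"
 proof -
  have "{x \<in> space R. g x = 0} \<in> sets R" by measurable
  then show ?thesis using sets_eq_imp_space_eq[of R borel] by (simp add: N_def)
 qed
 have "emeasure lborel N = (\<integral>\<^sup>+x. g x * indicator N x \<partial>R)"
  unfolding gR[symmetric] by (rule emeasure_density) auto
 also have "\<dots> = (\<integral>\<^sup>+x. 0 \<partial>R)" by (rule nn_integral_cong) (auto simp: N_def indicator_def)
 finally have N0: "N \<in> null_sets lborel" by (auto simp: null_sets_def)
 let ?D = "density M (indicator (- N))"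
 have "absolutely_continuous lborel ?D"
  unfolding absolutely_continuous_def
 proof
  fix A :: "'a set" assume A: "A \<in> null_sets lborel"
  then have [measurable]: "A \<in> sets borel" by auto
  have "emeasure lborel (A - N) = 0" using A emeasure_eq_0[of A lborel "A - N"] by (auto simp: null_sets_def)
  then have "(\<integral>\<^sup>+x. g x * indicator (A - N) x \<partial>R) = 0"
   unfolding gR[symmetric] by (subst (asm) emeasure_density) auto
  then have "AE x in R. g x * indicator (A - N) x = 0" by (subst (asm) nn_integral_0_iff_AE) auto
  then have "AE x in R. x \<notin> A - N" by eventually_elim (auto simp: N_def indicator_def)
  then have "emeasure R (A - N) = 0"
   by (subst (asm) AE_iff_measurable[of "A - N"]) (auto simp: sets_eq_imp_space_eq[of R borel])
  then have "emeasure M (A - N) = 0" by (simp add: R)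
  then have "emeasure ?D A = 0"
   by (simp add: emeasure_density Diff_eq Int_commute flip: indicator_inter_arith)
  then show "A \<in> null_sets ?D" by (auto simp: null_sets_def)
 qed
 moreover have "locally_finite ?D"
  unfolding locally_finite_def
 proof (intro conjI ballI)
  fix A :: "'a set" assume A: "A \<in> bounded_borel"
  then have [measurable]: "A \<in> sets borel" by (rule bounded_borelD)
  have "emeasure ?D A = (\<integral>\<^sup>+x. indicator (- N) x * indicator A x \<partial>M)" by (rule emeasure_density) auto
  also have "\<dots> \<le> (\<integral>\<^sup>+x. indicator A x \<partial>M)" by (intro nn_integral_mono) (auto simp: indicator_def)
  also have "\<dots> < \<infinity>" using M A by (simp add: locally_finite_def)
  finally show "emeasure ?D A < \<infinity>" .
 qed simp
 ultimately show ?thesis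
  using locally_finite_RN_density[OF locally_finite_lborel, of ?D] that[OF N0] by metis
qed

lemma lebesgue_decomposition:
 fixes \<nu> :: "'a::euclidean_space set \<Rightarrow> complex"
 assumes \<nu>: "complex_radon \<nu>"
 obtains f N where "locally_integrable f" "N \<in> null_sets lborel"
  "\<And>\<psi>. \<psi> \<in> borel_measurable borel \<Longrightarrow> (\<And>x. x \<in> N \<Longrightarrow> \<psi> x = 0) \<Longrightarrow>
   radon_integral \<nu> \<psi> = (LINT x|lborel. \<psi> x * f x)"
  "\<And>\<phi>. \<phi> \<in> borel_measurable borel \<Longrightarrow> (\<integral>\<^sup>+x. \<phi> x * ennreal (norm (f x)) \<partial>lborel) \<le> (\<integral>\<^sup>+x. \<phi> x \<partial>total_variation \<nu>)"
proof -
 let ?M = "total_variation \<nu>"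
 note M = locally_finite_total_variation[OF \<nu>]
 obtain h where pol: "polar_density \<nu> h" using polar_density_exists[OF \<nu>] by blast
 have [measurable]: "h \<in> borel_measurable borel" and h1: "\<And>x. norm (h x) = 1"
  and hA: "\<And>A. A \<in> bounded_borel \<Longrightarrow> \<nu> A = (LINT x:A|?M. h x)"
  using pol by (auto simp: polar_density_def)
 obtain N r where N: "N \<in> null_sets lborel" and r [measurable]: "r \<in> borel_measurable borel"
  and r0: "\<And>x. 0 \<le> r x" and Dr: "density ?M (indicator (- N)) = density lborel (\<lambda>x. ennreal (r x))"
  using lebesgue_decomposition_positive[OF M] by blast
 have [measurable]: "N \<in> sets borel" using N by auto
 define f where "f x = r x *\<^sub>R h x" for x
 have [measurable]: "f \<in> borel_measurable borel" unfolding f_def by measurable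
 have nf: "norm (f x) = r x" for x by (simp add: f_def h1 r0)
 have bound: "(\<integral>\<^sup>+x. \<phi> x * ennreal (norm (f x)) \<partial>lborel) \<le> (\<integral>\<^sup>+x. \<phi> x \<partial>?M)"
  if [measurable]: "\<phi> \<in> borel_measurable borel" for \<phi>
 proof -
  have "(\<integral>\<^sup>+x. \<phi> x * ennreal (norm (f x)) \<partial>lborel) = (\<integral>\<^sup>+x. \<phi> x \<partial>density lborel (\<lambda>x. ennreal (r x)))"
   by (subst nn_integral_density) (auto simp: nf mult.commute)
  also have "\<dots> = (\<integral>\<^sup>+x. indicator (- N) x * \<phi> x \<partial>?M)"
   unfolding Dr[symmetric] by (subst nn_integral_density) auto
  also have "\<dots> \<le> (\<integral>\<^sup>+x. \<phi> x \<partial>?M)" by (intro nn_integral_mono) (auto simp: indicator_def)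
  finally show ?thesis .
 qed
 show ?thesis
 proof (rule that[of f N, OF _ N _ bound])
  show "locally_integrable f"
  proof (rule locally_integrableI)
   fix A :: "'a set" assume A: "A \<in> bounded_borel"
   then have [measurable]: "A \<in> sets borel" by (rule bounded_borelD)
   have "(\<integral>\<^sup>+x. indicator A x * ennreal (norm (f x)) \<partial>lborel) \<le> emeasure ?M A"
    using bound[of "indicator A"] by simp
   also have "\<dots> < \<infinity>" by (rule total_variation_finite[OF \<nu> A])
   also have "(\<integral>\<^sup>+x. indicator A x * ennreal (norm (f x)) \<partial>lborel) = (\<integral>\<^sup>+x. ennreal (norm (indicator A x *\<^sub>R f x)) \<partial>lborel)"
    by (rule nn_integral_cong) (auto simp: indicator_def)
   finally show "set_integrable lborel A f" unfolding set_integrable_def by (intro integrableI_bounded) auto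
  qed measurable
  fix \<psi> :: "'a \<Rightarrow> complex" assume [measurable]: "\<psi> \<in> borel_measurable borel" and \<psi>: "\<And>x. x \<in> N \<Longrightarrow> \<psi> x = 0"
  have "radon_integral \<nu> \<psi> = (LINT x|?M. \<psi> x * h x)"
   by (rule radon_integral_polar[OF \<nu> pol]) measurable
  also have "\<dots> = (LINT x|?M. indicator (- N) x *\<^sub>R (\<psi> x * h x))"
   by (rule lint_cong) (use \<psi> in \<open>auto simp: indicator_def\<close>)
  also have "\<dots> = (LINT x|density ?M (\<lambda>x. ennreal (indicator (- N) x)). \<psi> x * h x)"
   by (rule integral_density[symmetric]) auto
  also have "density ?M (\<lambda>x. ennreal (indicator (- N) x)) = density lborel (\<lambda>x. ennreal (r x))"
   unfolding Dr[symmetric] by (intro arg_cong[of _ _ "density ?M"]) (auto simp: indicator_def)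
  also have "(LINT x|density lborel (\<lambda>x. ennreal (r x)). \<psi> x * h x) = (LINT x|lborel. \<psi> x * f x)"
   unfolding f_def by (subst integral_density) (auto simp: r0)
  finally show "radon_integral \<nu> \<psi> = (LINT x|lborel. \<psi> x * f x)" .
 qed
qed

lemma radon_null: "complex_radon \<mu> \<Longrightarrow> A \<in> bounded_borel \<Longrightarrow> A \<in> null_sets (total_variation \<mu>) \<Longrightarrow> \<mu> A = 0"
 using norm_radon_le_variation[of \<mu> A] by (auto simp: null_sets_def)

text \<open>The hypotheses say that \<open>\<nu>\<close> and \<open>f\<lambda>\<close> agree off the Lebesgue null set \<open>N\<close>, so their difference lives on
 \<open>N\<close> and is the singular part.\<close>

lemma ac_part_eq:
 fixes \<nu> :: "'a::euclidean_space set \<Rightarrow> complex"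
 assumes \<nu>: "complex_radon \<nu>" and f: "locally_integrable f" and N: "N \<in> null_sets lborel"
  and eq\<psi>: "\<And>\<psi>. \<psi> \<in> borel_measurable borel \<Longrightarrow> (\<And>x. x \<in> N \<Longrightarrow> \<psi> x = 0) \<Longrightarrow>
   radon_integral \<nu> \<psi> = (LINT x|lborel. \<psi> x * f x)"
 shows "ac_part \<nu> = lebesgue_density f"
 unfolding ac_part_def
proof (rule the_equality)
 have [measurable]: "N \<in> sets borel" using N by auto
 let ?M = "total_variation \<nu>"
 note M = locally_finite_total_variation[OF \<nu>]
 obtain h where pol: "polar_density \<nu> h" using polar_density_exists[OF \<nu>] by blast
 have [measurable]: "h \<in> borel_measurable borel" and h1: "\<And>x. norm (h x) = 1"
  and hA: "\<And>A. A \<in> bounded_borel \<Longrightarrow> \<nu> A = (LINT x:A|?M. h x)"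
  using pol by (auto simp: polar_density_def)
 have eq: "\<nu> A = (LINT x:A|lborel. f x)" if A: "A \<in> bounded_borel" "A \<inter> N = {}" for A
 proof -
  have [measurable]: "A \<in> sets borel" using A by (simp add: bounded_borel_def)
  have "\<nu> A = (LINT x|?M. indicator A x * h x)"
   unfolding hA[OF A(1)] set_lebesgue_integral_def
   by (rule lint_cong) (auto simp: indicator_def)
  also have "\<dots> = radon_integral \<nu> (indicator A)" by (rule radon_integral_polar[OF \<nu> pol, symmetric]) measurable
  also have "\<dots> = (LINT x|lborel. indicator A x * f x)" using A(2) by (intro eq\<psi>) (auto simp: indicator_def)
  also have "\<dots> = (LINT x:A|lborel. f x)"
   unfolding set_lebesgue_integral_def by (rule lint_cong) (auto simp: indicator_def)
  finally show ?thesis .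
 qed
 define s where "s x = indicator N x *\<^sub>R h x" for x
 have [measurable]: "s \<in> borel_measurable borel" unfolding s_def by measurable
 have sint: "set_integrable ?M A s" if A: "A \<in> bounded_borel" for A
  unfolding set_integrable_def
 proof (rule lintable_bound)
  show "integrable ?M (indicat_real A)"
   using total_variation_finite[OF \<nu> A] A by (intro integrable_real_indicator) (auto simp: bounded_borel_def)
  show "(\<lambda>x. indicator A x *\<^sub>R s x) \<in> borel_measurable ?M"
   using bounded_borelD(1)[OF A] by measurable
 qed (auto simp: h1 s_def indicator_def)
 define \<sigma> where "\<sigma> A = (if A \<in> bounded_borel then LINT x:A|?M. s x else 0)" for A
 have \<sigma>: "complex_radon \<sigma>" unfolding \<sigma>_def by (rule complex_radon_of_density[OF M sint])
 have T: "total_variation \<sigma> = density ?M (\<lambda>x. ennreal (norm (s x)))"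
  by (rule total_variation_density[OF \<sigma> M _ sint]) (auto simp: \<sigma>_def)
 have \<sigma>A: "\<sigma> A = \<nu> (A \<inter> N)" if A: "A \<in> bounded_borel" for A
 proof -
  have AN: "A \<inter> N \<in> bounded_borel" using A by auto
  show ?thesis
   unfolding hA[OF AN] using A
   by (auto simp: \<sigma>_def s_def set_lebesgue_integral_def indicator_def intro!: lint_cong)
 qed
 let ?P = "\<lambda>\<alpha>. complex_radon \<alpha> \<and> lebesgue_ac \<alpha> \<and>
   (\<exists>\<sigma>. complex_radon \<sigma> \<and> lebesgue_singular \<sigma> \<and> (\<forall>A. \<nu> A = \<alpha> A + \<sigma> A))"
 show 1: "?P (lebesgue_density f)"
 proof (intro conjI exI[of _ \<sigma>] \<sigma> allI)
  show "complex_radon (lebesgue_density f)" by (rule complex_radon_lebesgue_density[OF f])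
  have [measurable]: "f \<in> borel_measurable borel" using f by (simp add: locally_integrable_def)
  show "lebesgue_ac (lebesgue_density f)"
   unfolding lebesgue_ac_def lebesgue_density_representation(1)[OF f]
   by (rule absolutely_continuousI_density) measurable
  show "lebesgue_singular \<sigma>"
   unfolding lebesgue_singular_def T
  proof (intro bexI[OF _ N])
   have "(\<integral>\<^sup>+x\<in>- N. ennreal (norm (s x)) \<partial>?M) = (\<integral>\<^sup>+x. 0 \<partial>?M)"
    by (rule nn_integral_cong) (auto simp: s_def indicator_def)
   then show "- N \<in> null_sets (density ?M (\<lambda>x. ennreal (norm (s x))))"
    by (auto simp: null_sets_def emeasure_density)
  qed
  fix A
  show "\<nu> A = lebesgue_density f A + \<sigma> A"
  proof (cases "A \<in> bounded_borel")
   case True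
   then have [measurable]: "A \<in> sets borel" by (rule bounded_borelD)
   have "\<nu> ((A - N) \<union> (A \<inter> N)) = \<nu> (A - N) + \<nu> (A \<inter> N)"
    using True by (intro radon_Un[OF \<nu>]) auto
   moreover have "(A - N) \<union> (A \<inter> N) = A" by auto
   moreover have "\<nu> (A - N) = (LINT x:A - N|lborel. f x)" using True by (intro eq) auto
   moreover have "(LINT x:A - N|lborel. f x) = (LINT x:A|lborel. f x)"
    unfolding set_lebesgue_integral_def
    using AE_not_in[OF N] by (intro integral_cong_AE) (auto elim!: AE_mp simp: indicator_def)
   ultimately show ?thesis using \<sigma>A[OF True] True by (simp add: lebesgue_density_def)
  next
   case False
   then show ?thesis using \<nu> by (simp add: lebesgue_density_def \<sigma>_def complex_radon_def)
  qed
 qed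
 fix \<alpha> assume 2: "?P \<alpha>"
 obtain \<sigma>1 where s1: "complex_radon \<sigma>1" "lebesgue_singular \<sigma>1" "\<And>A. \<nu> A = lebesgue_density f A + \<sigma>1 A"
  using 1 by blast
 obtain \<sigma>2 where s2: "complex_radon \<sigma>2" "lebesgue_singular \<sigma>2" "\<And>A. \<nu> A = \<alpha> A + \<sigma>2 A"
  using 2 by blast
 obtain N1 where N1: "N1 \<in> null_sets lborel" "- N1 \<in> null_sets (total_variation \<sigma>1)"
  using s1 by (auto simp: lebesgue_singular_def)
 obtain N2 where N2: "N2 \<in> null_sets lborel" "- N2 \<in> null_sets (total_variation \<sigma>2)"
  using s2 by (auto simp: lebesgue_singular_def)
 define K where "K = N1 \<union> N2"
 have K: "K \<in> null_sets lborel" using N1 N2 by (auto simp: K_def)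
 have [measurable]: "K \<in> sets borel" using K by auto
 have null: "\<beta> (A \<inter> K) = 0" if "complex_radon \<beta>" "lebesgue_ac \<beta>" "A \<in> bounded_borel" for \<beta> A
 proof (rule radon_null[OF that(1)])
  show "A \<inter> K \<in> bounded_borel" using that by auto
  have "A \<inter> K \<in> null_sets lborel"
   using that by (intro null_sets_subset[OF K]) (auto simp: bounded_borel_def)
  then show "A \<inter> K \<in> null_sets (total_variation \<beta>)"
   using that(2) by (auto simp: lebesgue_ac_def absolutely_continuous_def)
 qed
 have sing: "\<beta> (A - K) = 0" if "complex_radon \<beta>" "- L \<in> null_sets (total_variation \<beta>)" "L \<subseteq> K" "A \<in> bounded_borel" for \<beta> A L
 proof (rule radon_null[OF that(1)])
  show "A - K \<in> bounded_borel" using that by auto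
  show "A - K \<in> null_sets (total_variation \<beta>)"
   using that by (intro null_sets_subset[OF that(2)]) (auto simp: bounded_borel_def)
 qed
 show "\<alpha> = lebesgue_density f"
 proof
  fix A
  show "\<alpha> A = lebesgue_density f A"
  proof (cases "A \<in> bounded_borel")
   case True
   have split: "\<beta> A = \<beta> (A - K) + \<beta> (A \<inter> K)" if "complex_radon \<beta>" for \<beta>
    using radon_Un[OF that, of "A - K" "A \<inter> K"] True Un_Diff_Int[of A K]
    bounded_borel_Int[OF True, of K] bounded_borel_Diff[OF True, of K] by auto
   have "\<alpha> A = \<alpha> (A - K)" using split[of \<alpha>] null[of \<alpha> A] 2 True by simp
   moreover have "lebesgue_density f A = lebesgue_density f (A - K)"
    using split[of "lebesgue_density f"] null[of "lebesgue_density f" A] 1 True by simp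
   moreover have "\<sigma>1 (A - K) = 0" using sing[OF s1(1) N1(2) _ True] by (simp add: K_def)
   moreover have "\<sigma>2 (A - K) = 0" using sing[OF s2(1) N2(2) _ True] by (simp add: K_def)
   ultimately show ?thesis using s1(3)[of "A - K"] s2(3)[of "A - K"] by simp
  next
   case False
   then show ?thesis using 1 2 by (simp add: complex_radon_def)
  qed
 qed
qed

section \<open>Fourier analysis on a Euclidean space\<close>

definition wave :: "'a::euclidean_space \<Rightarrow> 'a \<Rightarrow> complex" where
 "wave x y = cis (2 * pi * (x \<bullet> y))"

lemma norm_wave [simp]: "norm (wave x y) = 1" by (simp add: wave_def)
lemma wave_add_left: "wave (x + x') y = wave x y * wave x' y"
 by (simp add: wave_def cis_mult inner_add_left distrib_left)
lemma wave_add_right: "wave x (y + y') = wave x y * wave x y'"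
 by (simp add: wave_def cis_mult inner_add_right distrib_left)
lemma wave_diff_left: "wave (x - x') y = wave x y * wave (- x') y"
 using wave_add_left[of x "- x'" y] by simp
lemma wave_commute: "wave x y = wave y x" by (simp add: wave_def inner_commute)
lemma wave_0 [simp]: "wave 0 y = 1" "wave x 0 = 1" by (simp_all add: wave_def)
lemma wave_minus: "wave (- x) y = cnj (wave x y)" by (simp add: wave_def cis_cnj)
lemma wave_minus_right: "wave x (- y) = wave (- x) y" by (simp add: wave_def)
lemma wave_scaleR: "wave (c *\<^sub>R x) y = wave x (c *\<^sub>R y)" by (simp add: wave_def)
lemma wave_minus_cancel [simp]: "wave (- x) y * wave x y = 1" "wave x y * wave (- x) y = 1"
 by (simp_all flip: wave_add_left)

lemma continuous_wave [continuous_intros]: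
 assumes "continuous_on S f" "continuous_on S g" shows "continuous_on S (\<lambda>x. wave (f x) (g x))"
 unfolding wave_def cis_conv_exp by (intro continuous_intros assms)

lemma measurable_wave [measurable]:
 assumes [measurable]: "f \<in> borel_measurable M" "g \<in> borel_measurable M"
 shows "(\<lambda>x. wave (f x) (g x)) \<in> borel_measurable M"
proof -
 have "cis \<in> borel_measurable borel"
  by (intro borel_measurable_continuous_onI) (simp add: cis_conv_exp continuous_intros)
 then show ?thesis unfolding wave_def by measurable
qed

lemma fourier_wave: "fourier f x = (LINT y|lborel. wave (- x) y * f y)"
 by (simp add: fourier_def wave_def cis_conv_exp mult_ac)

lemma inv_fourier_wave: "inv_fourier f x = (LINT y|lborel. wave x y * f y)"
 by (simp add: inv_fourier_def fourier_wave)

lemma integrable_wave_times: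
 assumes "integrable M f" "g \<in> borel_measurable M" "k \<in> borel_measurable M"
 shows "integrable M (\<lambda>x. wave (g x) (k x) * f x)"
proof (rule lintable_bound[OF assms(1)])
 show "(\<lambda>x. wave (g x) (k x) * f x) \<in> borel_measurable M"
  using assms(2,3) borel_measurable_integrable[OF assms(1)] by measurable
qed (simp add: norm_mult)

lemma integrable_wave_mult [intro]: "integrable lborel f \<Longrightarrow> integrable lborel (\<lambda>y. wave x y * f y)"
 by (rule integrable_wave_times) auto

lemma norm_fourier_le:
 assumes "integrable lborel f" shows "norm (fourier f x) \<le> (LINT y|lborel. norm (f y))"
 unfolding fourier_wave
 by (rule order_trans[OF integral_norm_bound]) (simp add: norm_mult)

lemma norm_inv_fourier_le:
 "integrable lborel f \<Longrightarrow> norm (inv_fourier f x) \<le> (LINT y|lborel. norm (f y))"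
 unfolding inv_fourier_def by (rule norm_fourier_le)

lemma isCont_inv_fourier:
 assumes f: "integrable lborel f" shows "isCont (inv_fourier f) x"
proof (rule continuous_at_sequentiallyI)
 fix u :: "nat \<Rightarrow> 'a" assume u: "u \<longlonglongrightarrow> x"
 note [measurable] = borel_measurable_integrable[OF f]
 show "(\<lambda>n. inv_fourier f (u n)) \<longlonglongrightarrow> inv_fourier f x"
  unfolding inv_fourier_wave
 proof (rule integral_dominated_convergence)
  show "integrable lborel (\<lambda>y. norm (f y))" using f by simp
  have "(\<lambda>n. wave (u n) y) \<longlonglongrightarrow> wave x y" for y
   unfolding wave_def cis_conv_exp by (intro tendsto_intros u)
  then show "AE y in lborel. (\<lambda>n. wave (u n) y * f y) \<longlonglongrightarrow> wave x y * f y"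
   by (intro AE_I2 tendsto_mult tendsto_const)
 qed (auto simp: norm_mult)
qed

lemma continuous_inv_fourier: "integrable lborel f \<Longrightarrow> continuous_on S (inv_fourier f)"
 by (intro continuous_at_imp_continuous_on ballI isCont_inv_fourier)

lemma borel_measurable_inv_fourier: "integrable lborel f \<Longrightarrow> inv_fourier f \<in> borel_measurable borel"
 by (intro borel_measurable_continuous_onI continuous_inv_fourier)

lemma fourier_eq_inv_fourier: "fourier f x = inv_fourier f (- x)"
 by (simp add: inv_fourier_def)

subsection \<open>Changes of variables and products\<close>

lemma lborel_affine_has_bochner_integral:
 fixes f :: "'a::euclidean_space \<Rightarrow> 'b::{banach, second_countable_topology}"
 assumes c: "c \<noteq> 0"
 shows "integrable lborel f \<longleftrightarrow> integrable lborel (\<lambda>x. f (t + c *\<^sub>R x))"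
  and "(LINT x|lborel. f x) = \<bar>c\<bar> ^ DIM('a) *\<^sub>R (LINT x|lborel. f (t + c *\<^sub>R x))"
proof -
 have key: "has_bochner_integral lborel f (\<bar>c\<bar> ^ DIM('a) *\<^sub>R I)"
  if c: "c \<noteq> 0" and that: "has_bochner_integral lborel (\<lambda>x. f (t + c *\<^sub>R x)) I"
  for f :: "'a \<Rightarrow> 'b" and I t and c :: real
 proof -
  have m: "(\<lambda>x. f (t + c *\<^sub>R x)) \<in> borel_measurable borel"
   using that by (auto dest: borel_measurable_has_bochner_integral)
  have "(\<lambda>x. f (t + c *\<^sub>R ((1 / c) *\<^sub>R (x - t)))) \<in> borel_measurable borel"
   by (rule measurable_compose[OF _ m]) simp
  then have [measurable]: "f \<in> borel_measurable borel" using c by simp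
  have "has_bochner_integral (density (distr lborel borel (\<lambda>x. t + c *\<^sub>R x)) (\<lambda>_. ennreal (\<bar>c\<bar> ^ DIM('a)))) f (\<bar>c\<bar> ^ DIM('a) *\<^sub>R I)"
  proof (subst has_bochner_integral_density)
   show "has_bochner_integral (distr lborel borel (\<lambda>x. t + c *\<^sub>R x)) (\<lambda>x. \<bar>c\<bar> ^ DIM('a) *\<^sub>R f x) (\<bar>c\<bar> ^ DIM('a) *\<^sub>R I)"
    using that by (intro has_bochner_integral_scaleR_right has_bochner_integral_distr) auto
  qed auto
  then show ?thesis using lborel_affine[OF c, of t] by simp
 qed
 have rev: "integrable lborel (\<lambda>x. f (t + c *\<^sub>R x))" if "integrable lborel f"
 proof -
  have "has_bochner_integral lborel (\<lambda>x. f (t + c *\<^sub>R ((- (1 / c) *\<^sub>R t) + (1 / c) *\<^sub>R x))) (integral\<^sup>L lborel f)"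
   using c that by (simp add: has_bochner_integral_integrable algebra_simps)
  from key[OF _ this] show ?thesis using c by (auto intro: integrable.intros)
 qed
 then show iff: "integrable lborel f \<longleftrightarrow> integrable lborel (\<lambda>x. f (t + c *\<^sub>R x))"
  using key[OF c has_bochner_integral_integrable, of f t] c by (auto intro: integrable.intros)
 show "(LINT x|lborel. f x) = \<bar>c\<bar> ^ DIM('a) *\<^sub>R (LINT x|lborel. f (t + c *\<^sub>R x))"
 proof (cases "integrable lborel f")
  case True
  then show ?thesis
   using key[OF c has_bochner_integral_integrable, of f t] c iff by (simp add: has_bochner_integral_integral_eq)
 next
  case False
  then show ?thesis using iff by (simp add: not_integrable_integral_eq)
 qed
qed

lemma lborel_translate:
 fixes f :: "'a::euclidean_space \<Rightarrow> 'b::{banach, second_countable_topology}"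
 shows "integrable lborel (\<lambda>x. f (t + x)) \<longleftrightarrow> integrable lborel f"
  and "(LINT x|lborel. f (t + x)) = (LINT x|lborel. f x)"
 using lborel_affine_has_bochner_integral[of 1 f t] by auto

lemma lborel_reflect:
 fixes f :: "'a::euclidean_space \<Rightarrow> 'b::{banach, second_countable_topology}"
 shows "integrable lborel (\<lambda>x. f (- x)) \<longleftrightarrow> integrable lborel f"
  and "(LINT x|lborel. f (- x)) = (LINT x|lborel. f x)"
 using lborel_affine_has_bochner_integral[of "-1" f 0] by auto

lemma lborel_integral_prod:
 fixes f :: "'a::euclidean_space \<Rightarrow> real \<Rightarrow> 'b::{real_normed_field, banach, second_countable_topology}"
 assumes f: "\<And>b. b \<in> Basis \<Longrightarrow> integrable lborel (f b)"
 shows "integrable lborel (\<lambda>x. \<Prod>b\<in>Basis. f b (x \<bullet> b))"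
  and "(LINT x|lborel. (\<Prod>b\<in>Basis. f b (x \<bullet> b))) = (\<Prod>b\<in>Basis. LINT t|lborel. f b t)"
proof -
 interpret product_sigma_finite "\<lambda>_::'a. lborel :: real measure" ..
 let ?T = "\<lambda>g. \<Sum>b\<in>Basis. g b *\<^sub>R (b::'a)"
 have T: "?T \<in> measurable (\<Pi>\<^sub>M b\<in>Basis. lborel) borel" by measurable
 have m: "f b \<in> borel_measurable borel" if "b \<in> Basis" for b
  using borel_measurable_integrable[OF f[OF that]] by simp
 have F: "(\<lambda>x. \<Prod>b\<in>Basis. f b (x \<bullet> b)) \<in> borel_measurable borel"
  by (intro borel_measurable_prod measurable_compose[OF _ m]) auto
 have eq: "(\<Prod>b\<in>Basis. f b (?T g \<bullet> b)) = (\<Prod>b\<in>Basis. f b (g b))" for g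
  by (intro prod.cong refl) (simp add: inner_sum_left_Basis)
 show "integrable lborel (\<lambda>x. \<Prod>b\<in>Basis. f b (x \<bullet> b))"
  unfolding lborel_eq[where 'a='a] integrable_distr_eq[OF T F] eq
  by (rule product_integrable_prod) (auto intro: f)
 show "(LINT x|lborel. (\<Prod>b\<in>Basis. f b (x \<bullet> b))) = (\<Prod>b\<in>Basis. LINT t|lborel. f b t)"
  unfolding lborel_eq[where 'a='a] integral_distr[OF T F] eq
  by (rule product_integral_prod) (auto intro: f)
qed

text \<open>Characters factor over the coordinates, so Fourier integrals of product functions do too.\<close>

lemma wave_prod: "wave x y = (\<Prod>b\<in>Basis. cis (2 * pi * (x \<bullet> b) * (y \<bullet> b)))"
proof -
 have "(\<Prod>b\<in>Basis. cis (2 * pi * (x \<bullet> b) * (y \<bullet> b))) = cis (\<Sum>b\<in>Basis. 2 * pi * (x \<bullet> b) * (y \<bullet> b))"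
  by (simp add: cis_conv_exp exp_sum[symmetric] sum_distrib_left)
 also have "(\<Sum>b\<in>Basis. 2 * pi * (x \<bullet> b) * (y \<bullet> b)) = 2 * pi * (x \<bullet> y)"
  by (simp add: euclidean_inner[of x y] sum_distrib_left mult.assoc)
 finally show ?thesis by (simp add: wave_def)
qed

lemma inv_fourier_prod:
 fixes f :: "real \<Rightarrow> real"
 assumes "integrable lborel f"
 shows "inv_fourier (\<lambda>x::'a::euclidean_space. of_real (\<Prod>b\<in>Basis. f (x \<bullet> b))) y
  = (\<Prod>b\<in>Basis. LINT t|lborel. cis (2 * pi * (y \<bullet> b) * t) * of_real (f t))"
proof -
 have "cis \<in> borel_measurable borel"
  by (intro borel_measurable_continuous_onI) (simp add: cis_conv_exp continuous_intros)
 then have m: "(\<lambda>t. cis (2 * pi * (y \<bullet> b) * t)) \<in> borel_measurable borel" for b by measurable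
 have int: "integrable lborel (\<lambda>t. cis (2 * pi * (y \<bullet> b) * t) * complex_of_real (f t))" for b
 proof (rule lintable_bound)
  show "integrable lborel (\<lambda>t. complex_of_real (f t))" using assms by simp
  show "(\<lambda>t. cis (2 * pi * (y \<bullet> b) * t) * complex_of_real (f t)) \<in> borel_measurable lborel"
   using m[of b] borel_measurable_integrable[OF assms] by measurable
 qed (simp add: norm_mult)
 have "inv_fourier (\<lambda>x::'a. of_real (\<Prod>b\<in>Basis. f (x \<bullet> b))) y
  = (LINT x|lborel. (\<Prod>b\<in>Basis. cis (2 * pi * (y \<bullet> b) * (x \<bullet> b)) * complex_of_real (f (x \<bullet> b))))"
  by (simp add: inv_fourier_wave wave_prod prod.distrib)
 also have "\<dots> = (\<Prod>b\<in>Basis. LINT t|lborel. cis (2 * pi * (y \<bullet> b) * t) * of_real (f t))"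
  by (rule lborel_integral_prod(2)) (rule int)
 finally show ?thesis .
qed

subsection \<open>The Gaussian and Fourier inversion\<close>

definition gauss :: "'a::euclidean_space \<Rightarrow> real" where
 "gauss x = (\<Prod>b\<in>Basis. exp (- pi * (x \<bullet> b)^2))"

lemma gauss_pos: "0 < gauss x" by (simp add: gauss_def prod_pos)
lemma gauss_le_1: "gauss x \<le> 1" by (simp add: gauss_def prod_le_1)
lemma gauss_0 [simp]: "gauss 0 = 1" by (simp add: gauss_def)
lemma continuous_gauss [continuous_intros]:
 "continuous_on S f \<Longrightarrow> continuous_on S (\<lambda>x. gauss (f x))"
 unfolding gauss_def by (intro continuous_intros)
lemma measurable_gauss [measurable]: "gauss \<in> borel_measurable borel"
 by (intro borel_measurable_continuous_onI continuous_intros)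
lemma gauss_minus [simp]: "gauss (- x) = gauss x" by (simp add: gauss_def)

lemma gauss_1D:
 "integrable lborel (\<lambda>t::real. exp (- pi * t\<^sup>2))"
 "(LINT t|lborel. cis (2 * pi * s * t) * complex_of_real (exp (- pi * t\<^sup>2))) = exp (- pi * s\<^sup>2)"
proof -
 let ?c = "sqrt (2 * pi)"
 have c: "?c > 0" "?c \<noteq> 0" by (simp_all)
 have eq: "exp (- pi * t\<^sup>2) = ?c * std_normal_density (0 + ?c * t)" for t
  by (simp add: std_normal_density_def power_mult_distrib)
 have "integrable lborel std_normal_density"
  using integrable_std_normal_moment[of 0] by simp
 then show "integrable lborel (\<lambda>t::real. exp (- pi * t\<^sup>2))"
  unfolding eq using lborel_integrable_real_affine[OF _ c(2), of std_normal_density 0]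
  by (intro integrable_mult_right) auto
 have "complex_of_real (exp (- pi * s\<^sup>2)) = char std_normal_distribution (?c * s)"
  unfolding char_std_normal_distribution by (simp add: power_mult_distrib)
 also have "\<dots> = (LINT x|lborel. std_normal_density x *\<^sub>R iexp (?c * s * x))"
  unfolding char_def by (rule integral_density) (auto simp: normal_density_nonneg)
 also have "\<dots> = ?c *\<^sub>R (LINT t|lborel. std_normal_density (0 + ?c * t) *\<^sub>R iexp (?c * s * (0 + ?c * t)))"
  using lborel_integral_real_affine[of ?c "\<lambda>x. std_normal_density x *\<^sub>R iexp (?c * s * x)" 0] c by simp
 also have "\<dots> = (LINT t|lborel. (?c * std_normal_density (0 + ?c * t)) *\<^sub>R iexp (?c * s * (0 + ?c * t)))"
  by (simp flip: integral_scaleR_right)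
 also have "\<dots> = (LINT t|lborel. cis (2 * pi * s * t) * complex_of_real (exp (- pi * t\<^sup>2)))"
 proof (intro lint_cong refl)
  fix t
  have *: "?c * s * (0 + ?c * t) = 2 * pi * s * t" by (simp add: algebra_simps)
  show "(?c * std_normal_density (0 + ?c * t)) *\<^sub>R iexp (?c * s * (0 + ?c * t))
   = cis (2 * pi * s * t) * complex_of_real (exp (- pi * t\<^sup>2))"
   by (simp only: * eq[symmetric] cis_conv_exp scaleR_conv_of_real) (simp add: mult.commute)
 qed
 finally show "(LINT t|lborel. cis (2 * pi * s * t) * complex_of_real (exp (- pi * t\<^sup>2))) = exp (- pi * s\<^sup>2)"
  by simp
qed

lemma integrable_gauss: "integrable lborel gauss"
 unfolding gauss_def[abs_def] by (rule lborel_integral_prod) (rule gauss_1D)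

lemma inv_fourier_gauss: "inv_fourier (\<lambda>x. of_real (gauss x)) y = of_real (gauss y)"
 unfolding gauss_def inv_fourier_prod[OF gauss_1D(1)] gauss_1D(2) by simp

lemma integral_gauss: "(LINT x|lborel. gauss (x::'a::euclidean_space)) = 1"
proof -
 have "complex_of_real (LINT x|lborel. gauss (x::'a)) = 1"
  using inv_fourier_gauss[of "0::'a"] by (simp add: inv_fourier_wave)
 then show ?thesis by simp
qed

lemma Fubini_dominated:
 fixes k :: "'x \<Rightarrow> 'y \<Rightarrow> 'c::{banach, second_countable_topology}"
  and f :: "'x \<Rightarrow> 'd::{banach, second_countable_topology}"
  and g :: "'y \<Rightarrow> 'e::{banach, second_countable_topology}"
 assumes M: "sigma_finite_measure M" and N: "sigma_finite_measure N"
  and k [measurable]: "(\<lambda>(x, y). k x y) \<in> borel_measurable (M \<Otimes>\<^sub>M N)"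
  and f: "integrable M f" and g: "integrable N g"
  and le: "\<And>x y. norm (k x y) \<le> norm (f x) * norm (g y)"
 shows "integrable (M \<Otimes>\<^sub>M N) (\<lambda>(x, y). k x y)"
  and "(LINT y|N. LINT x|M. k x y) = (LINT x|M. LINT y|N. k x y)"
proof -
 interpret pair_sigma_finite M N using M N by (simp add: pair_sigma_finite_def)
 have kx: "integrable N (k x)" if "x \<in> space M" for x
 proof (rule lintable_bound)
  show "integrable N (\<lambda>y. norm (f x) * norm (g y))" using integrable_norm[OF g] by simp
  show "k x \<in> borel_measurable N" using measurable_Pair2[OF k that] by simp
 qed (use le in auto)
 show int: "integrable (M \<Otimes>\<^sub>M N) (\<lambda>(x, y). k x y)"
 proof (rule Fubini_integrable)
  show "integrable M (\<lambda>x. LINT y|N. norm (case (x, y) of (x, y) \<Rightarrow> k x y))"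
  proof (rule lintable_bound)
   show "integrable M (\<lambda>x. norm (f x) * (LINT y|N. norm (g y)))" using f by simp
   show "(\<lambda>x. LINT y|N. norm (case (x, y) of (x, y) \<Rightarrow> k x y)) \<in> borel_measurable M" by measurable
   have "norm (LINT y|N. norm (k x y)) \<le> norm (norm (f x) * (LINT y|N. norm (g y)))" if "x \<in> space M" for x
   proof -
    have "(LINT y|N. norm (k x y)) \<le> (LINT y|N. norm (f x) * norm (g y))"
     using kx[OF that] integrable_norm[OF g] le by (intro integral_mono) auto
    then show ?thesis by (simp add: integral_nonneg_AE)
   qed
   then show "AE x in M. norm (LINT y|N. norm (case (x, y) of (x, y) \<Rightarrow> k x y)) \<le> norm (norm (f x) * (LINT y|N. norm (g y)))"
    by (auto intro: AE_I2)
  qed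
  show "AE x in M. integrable N (\<lambda>y. case (x, y) of (x, y) \<Rightarrow> k x y)" using kx by (auto intro: AE_I2)
 qed (rule k)
 show "(LINT y|N. LINT x|M. k x y) = (LINT x|M. LINT y|N. k x y)"
  by (rule Fubini_integral) (rule int)
qed

text \<open>The Gaussian is its own transform; scaling spreads it out in \<open>y\<close> and concentrates it in \<open>x\<close>.\<close>

lemma inv_fourier_gauss_scaled:
 fixes x :: "'a::euclidean_space"
 assumes "\<epsilon> > 0"
 shows "(LINT y|lborel. wave x y * of_real (gauss (\<epsilon> *\<^sub>R y))) = of_real (gauss ((1 / \<epsilon>) *\<^sub>R x) / \<epsilon> ^ DIM('a))"
proof -
 have "of_real (gauss ((1 / \<epsilon>) *\<^sub>R x)) = (LINT y|lborel. wave ((1 / \<epsilon>) *\<^sub>R x) y * of_real (gauss y))"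
  using inv_fourier_gauss[of "(1 / \<epsilon>) *\<^sub>R x"] by (simp add: inv_fourier_wave)
 also have "\<dots> = \<epsilon> ^ DIM('a) *\<^sub>R (LINT y|lborel. wave ((1 / \<epsilon>) *\<^sub>R x) (0 + \<epsilon> *\<^sub>R y) * of_real (gauss (0 + \<epsilon> *\<^sub>R y)))"
  using lborel_affine_has_bochner_integral(2)[of \<epsilon> "\<lambda>y. wave ((1 / \<epsilon>) *\<^sub>R x) y * complex_of_real (gauss y)" 0] assms
  by simp
 also have "\<dots> = of_real (\<epsilon> ^ DIM('a)) * (LINT y|lborel. wave x y * of_real (gauss (\<epsilon> *\<^sub>R y)))"
  using assms by (simp add: wave_scaleR scaleR_conv_of_real)
 finally show ?thesis using assms by (simp add: field_simps)
qed

lemma integrable_gauss_scaled: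
 "\<epsilon> > 0 \<Longrightarrow> integrable lborel (\<lambda>y::'a::euclidean_space. gauss (\<epsilon> *\<^sub>R y))"
 using lborel_affine_has_bochner_integral(1)[of \<epsilon> "gauss :: 'a \<Rightarrow> real" 0] integrable_gauss[where 'a='a]
 by simp

text \<open>Inserting a Gaussian in frequency amounts to averaging against a narrow Gaussian in space; letting its
 width tend to 0 gives the inversion formula.\<close>

lemma fourier_gauss_regularised:
 fixes v :: "'a::euclidean_space \<Rightarrow> complex"
 assumes v: "integrable lborel v" and \<epsilon>: "\<epsilon> > 0"
 shows "(LINT y|lborel. wave x y * fourier v y * of_real (gauss (\<epsilon> *\<^sub>R y)))
  = (LINT s|lborel. v (x + \<epsilon> *\<^sub>R s) * of_real (gauss s))"
proof -
 note [measurable] = borel_measurable_integrable[OF v]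
 let ?k = "\<lambda>z y. wave (x - z) y * v z * complex_of_real (gauss (\<epsilon> *\<^sub>R y))"
 have g: "integrable lborel (\<lambda>y::'a. complex_of_real (gauss (\<epsilon> *\<^sub>R y)))"
  using integrable_gauss_scaled[OF \<epsilon>, where 'a='a] by simp
 have "(LINT y|lborel. wave x y * fourier v y * of_real (gauss (\<epsilon> *\<^sub>R y)))
  = (LINT y|lborel. LINT z|lborel. ?k z y)"
 proof (intro lint_cong refl)
  fix y
  have "(LINT z|lborel. ?k z y) = (LINT z|lborel. (wave x y * of_real (gauss (\<epsilon> *\<^sub>R y))) * (wave (- y) z * v z))"
   by (intro lint_cong refl)
    (simp add: wave_diff_left wave_commute[of "- y"] wave_minus_right mult_ac)
  also have "\<dots> = (wave x y * of_real (gauss (\<epsilon> *\<^sub>R y))) * fourier v y"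
   unfolding fourier_wave by (rule integral_mult_right_zero)
  finally show "wave x y * fourier v y * of_real (gauss (\<epsilon> *\<^sub>R y)) = (LINT z|lborel. ?k z y)"
   by (simp add: mult_ac)
 qed
 also have "\<dots> = (LINT z|lborel. LINT y|lborel. ?k z y)"
  using v g by (intro Fubini_dominated(2)[where f = v and g = "\<lambda>y. complex_of_real (gauss (\<epsilon> *\<^sub>R y))"])
   (auto simp: norm_mult sigma_finite_lborel)
 also have "\<dots> = (LINT z|lborel. v z * of_real (gauss ((1 / \<epsilon>) *\<^sub>R (x - z)) / \<epsilon> ^ DIM('a)))"
 proof (intro lint_cong refl)
  fix z
  have "(LINT y|lborel. ?k z y) = v z * (LINT y|lborel. wave (x - z) y * of_real (gauss (\<epsilon> *\<^sub>R y)))"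
   unfolding integral_mult_right_zero[symmetric] by (intro lint_cong refl) (simp add: mult_ac)
  then show "(LINT y|lborel. ?k z y) = v z * of_real (gauss ((1 / \<epsilon>) *\<^sub>R (x - z)) / \<epsilon> ^ DIM('a))"
   unfolding inv_fourier_gauss_scaled[OF \<epsilon>] .
 qed
 also have "\<dots> = \<epsilon> ^ DIM('a) *\<^sub>R (LINT s|lborel. v (x + \<epsilon> *\<^sub>R s) * of_real (gauss ((1 / \<epsilon>) *\<^sub>R (x - (x + \<epsilon> *\<^sub>R s))) / \<epsilon> ^ DIM('a)))"
  using lborel_affine_has_bochner_integral(2)[of \<epsilon> "\<lambda>z. v z * complex_of_real (gauss ((1 / \<epsilon>) *\<^sub>R (x - z)) / \<epsilon> ^ DIM('a))" x] \<epsilon>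
  by simp
 also have "\<dots> = (LINT s|lborel. v (x + \<epsilon> *\<^sub>R s) * of_real (gauss s))"
  unfolding integral_scaleR_right[symmetric]
  using \<epsilon> by (intro lint_cong refl) (simp add: scaleR_conv_of_real)
 finally show ?thesis .
qed

lemma inverse_nat_to_0: "(\<lambda>n. inverse (real (Suc n))) \<longlonglongrightarrow> 0" by (rule LIMSEQ_inverse_real_of_nat)

theorem fourier_inversion:
 fixes v :: "'a::euclidean_space \<Rightarrow> complex"
 assumes v: "integrable lborel v" and cont: "continuous_on UNIV v" and B: "\<And>x. norm (v x) \<le> B"
  and F: "integrable lborel (fourier v)"
 shows "inv_fourier (fourier v) x = v x"
proof (rule LIMSEQ_unique)
 let ?e = "\<lambda>n. inverse (real (Suc n))"
 note [measurable] = borel_measurable_integrable[OF F]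
 have [measurable]: "v \<in> borel_measurable borel" using cont by (rule borel_measurable_continuous_onI)
 have lim: "(\<lambda>n. gauss (?e n *\<^sub>R y)) \<longlonglongrightarrow> 1" for y :: 'a
 proof -
  have "isCont (gauss :: 'a \<Rightarrow> real) 0"
   using continuous_gauss[OF continuous_on_id, of "UNIV :: 'a set"] by (simp add: continuous_on_eq_continuous_at)
  moreover have "(\<lambda>n. ?e n *\<^sub>R y) \<longlonglongrightarrow> 0"
   using tendsto_scaleR[OF inverse_nat_to_0 tendsto_const[of y]] by simp
  ultimately show ?thesis using isCont_tendsto_compose[of 0 gauss] by force
 qed
 show "(\<lambda>n. LINT y|lborel. wave x y * fourier v y * of_real (gauss (?e n *\<^sub>R y))) \<longlonglongrightarrow> inv_fourier (fourier v) x"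
  unfolding inv_fourier_wave
 proof (rule integral_dominated_convergence)
  show "integrable lborel (\<lambda>y. norm (fourier v y))" using F by simp
  have "(\<lambda>n. wave x y * fourier v y * of_real (gauss (?e n *\<^sub>R y))) \<longlonglongrightarrow> wave x y * fourier v y * of_real 1" for y
   by (intro tendsto_intros lim)
  then show "AE y in lborel. (\<lambda>n. wave x y * fourier v y * of_real (gauss (?e n *\<^sub>R y))) \<longlonglongrightarrow> wave x y * fourier v y"
   by simp
  show "AE y in lborel. norm (wave x y * fourier v y * of_real (gauss (?e n *\<^sub>R y))) \<le> norm (fourier v y)" for n
   by (intro AE_I2) (simp add: norm_mult mult_left_le gauss_le_1 gauss_pos less_imp_le)
 qed measurable
 have "(\<lambda>n. LINT s|lborel. v (x + ?e n *\<^sub>R s) * of_real (gauss s)) \<longlonglongrightarrow> (LINT s|lborel. v x * of_real (gauss (s::'a)))"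
 proof (rule integral_dominated_convergence[where w = "\<lambda>s. B * gauss s"])
  show "integrable lborel (\<lambda>s::'a. B * gauss s)" using integrable_gauss[where 'a='a] by simp
  have "(\<lambda>n. v (x + ?e n *\<^sub>R s)) \<longlonglongrightarrow> v x" for s
  proof (rule isCont_tendsto_compose[of x v])
   show "isCont v x" using cont by (simp add: continuous_on_eq_continuous_at)
   show "(\<lambda>n. x + ?e n *\<^sub>R s) \<longlonglongrightarrow> x"
    using tendsto_add[OF tendsto_const[of x] tendsto_scaleR[OF inverse_nat_to_0 tendsto_const[of s]]] by simp
  qed
  then show "AE s in lborel. (\<lambda>n. v (x + ?e n *\<^sub>R s) * of_real (gauss s)) \<longlonglongrightarrow> v x * of_real (gauss s)"
   by (intro AE_I2 tendsto_intros)
  show "AE s in lborel. norm (v (x + ?e n *\<^sub>R s) * of_real (gauss s)) \<le> B * gauss s" for n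
   by (intro AE_I2) (simp add: norm_mult mult_right_mono B gauss_pos less_imp_le)
 qed measurable
 also have "(LINT s|lborel. v x * of_real (gauss (s::'a))) = v x" by (simp add: integral_gauss)
 finally show "(\<lambda>n. LINT y|lborel. wave x y * fourier v y * of_real (gauss (?e n *\<^sub>R y))) \<longlonglongrightarrow> v x"
  by (simp add: fourier_gauss_regularised[OF v])
qed

lemma fourier_reflect: "fourier (\<lambda>x. v (- x)) y = inv_fourier v y"
 using lborel_reflect(2)[of "\<lambda>x. wave (- y) x * v (- x)"]
 by (simp add: fourier_wave inv_fourier_wave wave_minus_right)

lemma inv_fourier_inversion:
 fixes v :: "'a::euclidean_space \<Rightarrow> complex"
 assumes v: "integrable lborel v" and cont: "continuous_on UNIV v" and B: "\<And>x. norm (v x) \<le> B"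
  and F: "integrable lborel (inv_fourier v)"
 shows "fourier (inv_fourier v) x = v x"
proof -
 have *: "fourier (\<lambda>x. v (- x)) = inv_fourier v" by (rule ext) (rule fourier_reflect)
 have "inv_fourier (fourier (\<lambda>x. v (- x))) (- x) = v (- (- x))"
 proof (rule fourier_inversion)
  show "integrable lborel (\<lambda>x. v (- x))" using v by (simp add: lborel_reflect(1)[of v])
  show "continuous_on UNIV (\<lambda>x. v (- x))"
   by (rule continuous_on_compose2[OF cont]) (auto intro: continuous_intros)
 qed (use B F in \<open>simp_all add: *\<close>)
 then show ?thesis unfolding * by (simp add: fourier_eq_inv_fourier)
qed

subsection \<open>Uniqueness\<close>

text \<open>Averaging the vanishing characters against Gaussians shows that the integrals of
 Gaussian bumps in \<open>X\<close> vanish; these approximate bounded continuous functions, and those indicators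
 of open sets. Stated for a general \<open>X\<close> so that it covers sums of translates of one measure.\<close>

lemma gauss_integral_zero:
 fixes X :: "'w \<Rightarrow> 'a::euclidean_space" and G :: "'w \<Rightarrow> complex"
 assumes P: "sigma_finite_measure P" and X [measurable]: "X \<in> borel_measurable P" and G: "integrable P G"
  and zero: "\<And>t. (LINT w|P. wave t (X w) * G w) = 0" and \<epsilon>: "\<epsilon> > 0"
 shows "(LINT w|P. of_real (gauss ((1 / \<epsilon>) *\<^sub>R (X w - x))) * G w) = 0"
proof -
 note [measurable] = borel_measurable_integrable[OF G]
 let ?g = "\<lambda>y::'a. complex_of_real (gauss (\<epsilon> *\<^sub>R y))"
 have g: "integrable lborel ?g" using integrable_gauss_scaled[OF \<epsilon>, where 'a='a] by simp
 have "(LINT w|P. of_real (gauss ((1 / \<epsilon>) *\<^sub>R (X w - x)) / \<epsilon> ^ DIM('a)) * G w)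
  = (LINT w|P. LINT y|lborel. wave (X w - x) y * ?g y * G w)"
  unfolding inv_fourier_gauss_scaled[OF \<epsilon>, symmetric] by simp
 also have "\<dots> = (LINT y|lborel. LINT w|P. wave (X w - x) y * ?g y * G w)"
  by (rule Fubini_dominated(2)[symmetric, OF P sigma_finite_lborel _ G g]) (auto simp: norm_mult)
 also have "\<dots> = (LINT y|(lborel::'a measure). 0)"
 proof (intro lint_cong refl)
  fix y :: 'a
  have "(LINT w|P. wave (X w - x) y * ?g y * G w) = (LINT w|P. (wave (- x) y * ?g y) * (wave y (X w) * G w))"
   by (intro lint_cong refl) (simp add: wave_diff_left wave_commute[of y] mult_ac)
  also have "\<dots> = (wave (- x) y * ?g y) * (LINT w|P. wave y (X w) * G w)" by (rule integral_mult_right_zero)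
  finally show "(LINT w|P. wave (X w - x) y * ?g y * G w) = 0" by (simp add: zero)
 qed
 finally have "(LINT w|P. of_real (gauss ((1 / \<epsilon>) *\<^sub>R (X w - x)) / \<epsilon> ^ DIM('a)) * G w) = 0" by simp
 moreover have "(LINT w|P. of_real (gauss ((1 / \<epsilon>) *\<^sub>R (X w - x)) / \<epsilon> ^ DIM('a)) * G w)
  = (LINT w|P. of_real (1 / \<epsilon> ^ DIM('a)) * (of_real (gauss ((1 / \<epsilon>) *\<^sub>R (X w - x))) * G w))"
  by (intro lint_cong refl) simp
 ultimately show ?thesis using \<epsilon> by (simp del: of_real_divide)
qed

lemma continuous_integral_zero:
 fixes X :: "'w \<Rightarrow> 'a::euclidean_space" and G :: "'w \<Rightarrow> complex" and v :: "'a \<Rightarrow> real"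
 assumes P: "sigma_finite_measure P" and X [measurable]: "X \<in> borel_measurable P" and G: "integrable P G"
  and zero: "\<And>t. (LINT w|P. wave t (X w) * G w) = 0"
  and v: "continuous_on UNIV v" and B: "\<And>x. \<bar>v x\<bar> \<le> B"
 shows "(LINT w|P. of_real (v (X w)) * G w) = 0"
proof (rule LIMSEQ_unique)
 let ?e = "\<lambda>n. inverse (real (Suc n))"
 note [measurable] = borel_measurable_integrable[OF G]
 have [measurable]: "v \<in> borel_measurable borel" using v by (rule borel_measurable_continuous_onI)
 have B0: "0 \<le> B" using B[of 0] by linarith
 let ?k = "\<lambda>n w x. of_real (v x) * (of_real (gauss ((1 / ?e n) *\<^sub>R (X w - x))) * G w)"
 let ?I = "\<lambda>n w. LINT s|lborel. v (X w + ?e n *\<^sub>R s) * gauss s"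
 have e: "?e n > 0" for n by simp
 have shift: "(LINT x|lborel. f x * gauss ((1 / ?e n) *\<^sub>R (y - x))) = ?e n ^ DIM('a) * (LINT s|lborel. f (y + ?e n *\<^sub>R s) * gauss s)"
  for f :: "'a \<Rightarrow> real" and y n
  using lborel_affine_has_bochner_integral(2)[of "?e n" "\<lambda>x. f x * gauss ((1 / ?e n) *\<^sub>R (y - x))" y] e[of n]
  by (simp del: inverse_eq_divide)
 have zeroI: "(LINT w|P. of_real (?I n w) * G w) = 0" for n
 proof -
  interpret pair_sigma_finite P lborel using P sigma_finite_lborel by (simp add: pair_sigma_finite_def)
  have gi: "integrable lborel (\<lambda>x. gauss ((1 / ?e n) *\<^sub>R (y - x)))" for y :: 'a
   using lborel_affine_has_bochner_integral(1)[of "?e n" "\<lambda>x. gauss ((1 / ?e n) *\<^sub>R (y - x))" y]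
    integrable_gauss[where 'a='a] e[of n] by (simp del: inverse_eq_divide)
  have ki: "integrable lborel (\<lambda>x. ?k n w x)" for w
  proof (rule lintable_bound)
   show "integrable lborel (\<lambda>x. (B * norm (G w)) * gauss ((1 / ?e n) *\<^sub>R (X w - x)))"
    using gi by (rule integrable_mult_right)
   show "AE x in lborel. norm (?k n w x) \<le> norm ((B * norm (G w)) * gauss ((1 / ?e n) *\<^sub>R (X w - x)))"
   proof (rule AE_I2)
    fix x
    have "\<bar>v x\<bar> * (gauss ((1 / ?e n) *\<^sub>R (X w - x)) * norm (G w)) \<le> B * (gauss ((1 / ?e n) *\<^sub>R (X w - x)) * norm (G w))"
     by (rule mult_right_mono[OF B]) (simp add: gauss_pos less_imp_le)
    then show "norm (?k n w x) \<le> norm ((B * norm (G w)) * gauss ((1 / ?e n) *\<^sub>R (X w - x)))"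
     using B0 gauss_pos[of "(1 / ?e n) *\<^sub>R (X w - x)"] by (simp add: norm_mult abs_mult mult_ac)
   qed
  qed measurable
  have int: "integrable (P \<Otimes>\<^sub>M lborel) (\<lambda>(w, x). ?k n w x)"
  proof (rule Fubini_integrable)
   show "(\<lambda>(w, x). ?k n w x) \<in> borel_measurable (P \<Otimes>\<^sub>M lborel)" by measurable
   show "AE w in P. integrable lborel (\<lambda>x. case (w, x) of (w, x) \<Rightarrow> ?k n w x)" using ki by simp
   have "(LINT x|lborel. norm (?k n w x)) = norm (G w) * (?e n ^ DIM('a) * (LINT s|lborel. \<bar>v (X w + ?e n *\<^sub>R s)\<bar> * gauss s))" for w
   proof -
    have "(LINT x|lborel. norm (?k n w x)) = (LINT x|lborel. norm (G w) * (\<bar>v x\<bar> * gauss ((1 / ?e n) *\<^sub>R (X w - x))))"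
     by (intro lint_cong refl) (simp add: norm_mult abs_of_pos[OF gauss_pos] mult_ac)
    then show ?thesis by (simp only: shift integral_mult_right_zero)
   qed
   moreover have "integrable P (\<lambda>w. norm (G w) * (?e n ^ DIM('a) * (LINT s|lborel. \<bar>v (X w + ?e n *\<^sub>R s)\<bar> * gauss s)))"
   proof (rule lintable_bound)
    show "integrable P (\<lambda>w. norm (G w) * (?e n ^ DIM('a) * B))" using integrable_norm[OF G] by simp
    show "AE w in P. norm (norm (G w) * (?e n ^ DIM('a) * (LINT s|lborel. \<bar>v (X w + ?e n *\<^sub>R s)\<bar> * gauss s)))
     \<le> norm (norm (G w) * (?e n ^ DIM('a) * B))"
    proof (rule AE_I2)
     fix w
     have "(LINT s|lborel. \<bar>v (X w + ?e n *\<^sub>R s)\<bar> * gauss s) \<le> (LINT s|lborel. B * gauss (s::'a))"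
     proof (rule integral_mono')
      show "\<bar>v (X w + ?e n *\<^sub>R s)\<bar> * gauss s \<le> B * gauss s" for s
       by (intro mult_right_mono B) (simp add: gauss_pos less_imp_le)
     qed (auto intro!: mult_nonneg_nonneg simp: integrable_gauss gauss_pos less_imp_le B0)
     then have "(LINT s|lborel. \<bar>v (X w + ?e n *\<^sub>R s)\<bar> * gauss s) \<le> B" by (simp add: integral_gauss)
     moreover have "0 \<le> (LINT s|lborel. \<bar>v (X w + ?e n *\<^sub>R s)\<bar> * gauss s)"
      by (intro integral_nonneg_AE AE_I2) (simp add: gauss_pos less_imp_le)
     ultimately show "norm (norm (G w) * (?e n ^ DIM('a) * (LINT s|lborel. \<bar>v (X w + ?e n *\<^sub>R s)\<bar> * gauss s)))
      \<le> norm (norm (G w) * (?e n ^ DIM('a) * B))"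
      using B0 e[of n] by (auto simp: abs_mult intro!: mult_left_mono)
    qed
   qed measurable
   ultimately show "integrable P (\<lambda>w. LINT x|lborel. norm (case (w, x) of (w, x) \<Rightarrow> ?k n w x))" by simp
  qed
  have "(LINT w|P. LINT x|lborel. ?k n w x) = (LINT x|lborel. LINT w|P. ?k n w x)"
   by (rule Fubini_integral[symmetric]) (rule int)
  also have "\<dots> = 0"
   using gauss_integral_zero[OF P X G zero e[of n]] by simp
  finally have 0: "(LINT w|P. LINT x|lborel. ?k n w x) = 0" .
  have "(LINT x|lborel. ?k n w x) = of_real (?e n ^ DIM('a)) * (of_real (?I n w) * G w)" for w
  proof -
   have "(LINT x|lborel. ?k n w x) = (LINT x|lborel. of_real (v x * gauss ((1 / ?e n) *\<^sub>R (X w - x))) * G w)"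
    by (intro lint_cong refl) (simp add: mult_ac)
   also have "\<dots> = of_real (LINT x|lborel. v x * gauss ((1 / ?e n) *\<^sub>R (X w - x))) * G w"
    by (simp only: integral_mult_left_zero integral_complex_of_real)
   finally show ?thesis unfolding shift by (simp add: mult.assoc)
  qed
  with 0 have "of_real (?e n ^ DIM('a)) * (LINT w|P. of_real (?I n w) * G w) = 0"
   by (simp only: integral_mult_right_zero)
  then show ?thesis using e[of n] by (simp del: of_real_power of_real_inverse inverse_eq_divide)
 qed
 show "(\<lambda>n. LINT w|P. of_real (?I n w) * G w) \<longlonglongrightarrow> 0" unfolding zeroI by simp
 have Ile: "\<bar>?I n w\<bar> \<le> B" for n w
 proof -
  have "\<bar>?I n w\<bar> \<le> (LINT s|lborel. norm (v (X w + ?e n *\<^sub>R s) * gauss s))"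
   using integral_norm_bound[of lborel "\<lambda>s. v (X w + ?e n *\<^sub>R s) * gauss s"] by simp
  also have "\<dots> \<le> (LINT s|lborel. B * gauss (s::'a))"
  proof (rule integral_mono')
   show "norm (v (X w + ?e n *\<^sub>R s) * gauss s) \<le> B * gauss s" for s
    unfolding real_norm_def abs_mult abs_of_pos[OF gauss_pos] by (intro mult_right_mono B) (simp add: gauss_pos less_imp_le)
  qed (auto intro!: mult_nonneg_nonneg simp: integrable_gauss gauss_pos less_imp_le B0)
  finally show ?thesis by (simp add: integral_gauss)
 qed
 show "(\<lambda>n. LINT w|P. of_real (?I n w) * G w) \<longlonglongrightarrow> (LINT w|P. of_real (v (X w)) * G w)"
 proof (rule integral_dominated_convergence)
  show "integrable P (\<lambda>w. B * norm (G w))" using integrable_norm[OF G] by simp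
  show "AE w in P. norm (of_real (?I n w) * G w) \<le> B * norm (G w)" for n
   unfolding norm_mult norm_of_real by (intro AE_I2 mult_right_mono Ile) simp
  have "(\<lambda>n. ?I n w) \<longlonglongrightarrow> (LINT s|lborel. v (X w) * gauss (s::'a))" for w
  proof (rule integral_dominated_convergence)
   show "integrable lborel (\<lambda>s::'a. B * gauss s)" using integrable_gauss[where 'a='a] by simp
   have "(\<lambda>n. v (X w + ?e n *\<^sub>R s)) \<longlonglongrightarrow> v (X w)" for s
   proof (rule isCont_tendsto_compose[of "X w" v])
    show "isCont v (X w)" using v by (simp add: continuous_on_eq_continuous_at)
    show "(\<lambda>n. X w + ?e n *\<^sub>R s) \<longlonglongrightarrow> X w"
     using tendsto_add[OF tendsto_const[of "X w"] tendsto_scaleR[OF inverse_nat_to_0 tendsto_const[of s]]] by simp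
   qed
   then show "AE s in lborel. (\<lambda>n. v (X w + ?e n *\<^sub>R s) * gauss s) \<longlonglongrightarrow> v (X w) * gauss s"
    by (intro AE_I2 tendsto_intros)
   show "AE s in lborel. norm (v (X w + ?e n *\<^sub>R s) * gauss s) \<le> B * gauss s" for n
    unfolding real_norm_def abs_mult abs_of_pos[OF gauss_pos]
    by (intro AE_I2 mult_right_mono B) (simp add: gauss_pos less_imp_le)
  qed measurable
  then have "(\<lambda>n. ?I n w) \<longlonglongrightarrow> v (X w)" for w by (simp add: integral_gauss)
  then show "AE w in P. (\<lambda>n. of_real (?I n w) * G w) \<longlonglongrightarrow> of_real (v (X w)) * G w"
   by (intro AE_I2 tendsto_intros)
 qed measurable
qed

lemma open_integral_zero:
 fixes X :: "'w \<Rightarrow> 'a::euclidean_space" and G :: "'w \<Rightarrow> complex"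
 assumes P: "sigma_finite_measure P" and X [measurable]: "X \<in> borel_measurable P" and G: "integrable P G"
  and zero: "\<And>t. (LINT w|P. wave t (X w) * G w) = 0" and U: "open U"
 shows "(LINT w|P. indicator U (X w) * G w) = 0"
proof (cases "U = UNIV")
 case True
 then show ?thesis using continuous_integral_zero[OF P X G zero, of "\<lambda>_. 1" 1] by simp
next
 case False
 note [measurable] = borel_measurable_integrable[OF G] borel_open[OF U]
 define v where "v n x = min 1 (real n * infdist x (- U))" for n x
 have v: "continuous_on UNIV (v n)" for n unfolding v_def by (intro continuous_intros)
 have [measurable]: "v n \<in> borel_measurable borel" for n using v by (rule borel_measurable_continuous_onI)
 have v01: "0 \<le> v n x" "v n x \<le> 1" for n x by (auto simp: v_def infdist_nonneg)
 have lim: "(\<lambda>n. v n x) \<longlonglongrightarrow> indicator U x" for x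
 proof (cases "x \<in> U")
  case True
  have "infdist x (- U) \<noteq> 0"
   using in_closed_iff_infdist_zero[of "- U" x] U True False by auto
  then have "0 < infdist x (- U)" using infdist_nonneg[of x "- U"] by linarith
  then obtain N :: nat where N: "1 < real N * infdist x (- U)" using reals_Archimedean3 by blast
  have "v n x = 1" if "n \<ge> N" for n
  proof -
   have "real N * infdist x (- U) \<le> real n * infdist x (- U)"
    using that by (intro mult_right_mono) (auto simp: infdist_nonneg)
   then show ?thesis using N by (simp add: v_def)
  qed
  then have "eventually (\<lambda>n. v n x = 1) sequentially" unfolding eventually_sequentially by blast
  then show ?thesis using True by (simp add: tendsto_eventually)
 next
  case out: False
  then have "v n x = 0" for n by (simp add: v_def)
  then show ?thesis using out by simp
 qed
 have "(\<lambda>n. LINT w|P. complex_of_real (v n (X w)) * G w) \<longlonglongrightarrow> (LINT w|P. complex_of_real (indicator U (X w)) * G w)"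
 proof (rule integral_dominated_convergence)
  show "integrable P (\<lambda>w. norm (G w))" using G by simp
  show "AE w in P. (\<lambda>n. complex_of_real (v n (X w)) * G w) \<longlonglongrightarrow> complex_of_real (indicator U (X w)) * G w"
   by (intro AE_I2 tendsto_intros lim)
  show "AE w in P. norm (complex_of_real (v n (X w)) * G w) \<le> norm (G w)" for n
   using v01 by (intro AE_I2) (simp add: norm_mult mult_left_le_one_le)
 qed measurable
 moreover have "(LINT w|P. complex_of_real (v n (X w)) * G w) = 0" for n
  by (rule continuous_integral_zero[OF P X G zero v, where B = 1]) (use v01 in \<open>auto simp: abs_le_iff intro: order_trans[of _ 0]\<close>)
 ultimately have "(LINT w|P. complex_of_real (indicator U (X w)) * G w) = 0"
  by (simp add: LIMSEQ_const_iff)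
 moreover have "complex_of_real (indicator U x) = indicator U x" for x by (simp add: indicator_def)
 ultimately show ?thesis by simp
qed

theorem fourier_uniqueness:
 fixes X :: "'w \<Rightarrow> 'a::euclidean_space" and G :: "'w \<Rightarrow> complex"
 assumes P: "sigma_finite_measure P" and X [measurable]: "X \<in> borel_measurable P" and G: "integrable P G"
  and zero: "\<And>t. (LINT w|P. wave t (X w) * G w) = 0" and A: "A \<in> sets borel"
 shows "(LINT w|P. indicator A (X w) * G w) = 0"
proof -
 note [measurable] = borel_measurable_integrable[OF G]
 have total: "(LINT w|P. G w) = 0" using zero[of 0] by simp
 have int: "integrable P (\<lambda>w. indicator A (X w) * G w)" if [measurable]: "A \<in> sets borel" for A
  by (rule lintable_bound[OF G]) (auto simp: indicator_def)
 have "Int_stable {S::'a set. open S}" "{S. open S} \<subseteq> Pow (UNIV :: 'a set)" by (auto simp: Int_stable_def)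
 moreover have "A \<in> sigma_sets UNIV {S. open S}" using A by (simp add: borel_def)
 ultimately show ?thesis
 proof (induct rule: sigma_sets_induct_disjoint)
  case (basic A)
  then show ?case using open_integral_zero[OF P X G zero] by simp
 next
  case empty then show ?case by simp
 next
  case (compl A)
  then have "A \<in> sets borel" by (simp add: borel_def)
  moreover have "indicator (UNIV - A) (X w) * G w = G w - indicator A (X w) * G w" for w
   by (simp add: indicator_def)
  ultimately show ?case using compl G int[of A] by (simp add: total)
 next
  case (union A)
  then have A: "A i \<in> sets borel" for i by (auto simp: borel_def)
  note [measurable] = A
  have s: "(\<Sum>i<n. indicator (A i) x) = (indicator (\<Union>i<n. A i) x :: complex)" for n x
   using union(1) by (intro indicator_UN_disjoint[symmetric]) (auto simp: disjoint_family_on_def)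
  have "(\<lambda>n. LINT w|P. (\<Sum>i<n. indicator (A i) (X w)) * G w) \<longlonglongrightarrow> (LINT w|P. indicator (\<Union>i. A i) (X w) * G w)"
   unfolding s
  proof (rule integral_dominated_convergence)
   show "integrable P (\<lambda>w. norm (G w))" using G by simp
   show "AE w in P. (\<lambda>n. indicator (\<Union>i<n. A i) (X w) * G w) \<longlonglongrightarrow> indicator (\<Union>i. A i) (X w) * G w"
    by (intro AE_I2 tendsto_intros LIMSEQ_indicator_UN)
  qed (auto simp: indicator_def)
  moreover have "(LINT w|P. (\<Sum>i<n. indicator (A i) (X w)) * G w) = 0" for n
   unfolding sum_distrib_right using union(3) int[OF A] by (subst lint_sum) auto
  ultimately show ?case by (simp add: LIMSEQ_const_iff)
 qed
qed

subsection \<open>Tent functions and Fejer kernels\<close>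

text \<open>An integrable weight that is a product over the coordinates. It serves as the scale for rapid decay
 throughout: Fejer kernels are bounded by it, and so are Schwartz functions.\<close>

definition decay :: "'a::euclidean_space \<Rightarrow> real" where
 "decay x = (\<Prod>b\<in>Basis. inverse (1 + (x \<bullet> b)^2))"

lemma decay_pos: "0 < decay x"
 unfolding decay_def by (rule prod_pos) (simp add: add_pos_nonneg)

lemma continuous_decay [continuous_intros]:
 "continuous_on S f \<Longrightarrow> continuous_on S (\<lambda>x. decay (f x))"
 unfolding decay_def
 by (intro continuous_intros) (auto simp: add_nonneg_eq_0_iff)

lemma measurable_decay [measurable]: "decay \<in> borel_measurable borel"
 by (intro borel_measurable_continuous_onI continuous_intros)

lemma integrable_decay: "integrable lborel decay"
proof -
 have "integrable lborel (\<lambda>t::real. inverse (1 + t\<^sup>2))"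
  using integrable_inverse_1_plus_square by (simp add: set_integrable_def)
 then show ?thesis unfolding decay_def[abs_def] by (intro lborel_integral_prod(1))
qed

lemma integrable_decay_scaled: "r > 0 \<Longrightarrow> integrable lborel (\<lambda>y::'a::euclidean_space. decay (r *\<^sub>R y))"
 using lborel_affine_has_bochner_integral(1)[of r "decay :: 'a \<Rightarrow> real" 0] integrable_decay[where 'a='a]
 by simp

lemma integral_decay_scaled:
 assumes "r > 0"
 shows "(LINT y|(lborel :: 'a measure). decay (r *\<^sub>R (y::'a::euclidean_space))) = (LINT y|(lborel :: 'a measure). decay y) / r ^ DIM('a)"
 using lborel_affine_has_bochner_integral(2)[of r "decay :: 'a \<Rightarrow> real" 0] assms by simp

text \<open>The Fourier transform of the tent function on \<open>[- 1, 1]\<close>.\<close>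

definition fejer :: "real \<Rightarrow> real" where "fejer s = (sinc (pi * s))^2"

lemma fejer_bounds: "0 \<le> fejer s" "fejer s \<le> 1" "fejer s \<le> 2 * inverse (1 + s\<^sup>2)"
proof -
 show "0 \<le> fejer s" by (simp only: fejer_def zero_le_power2)
 have 1: "fejer s \<le> 1"
 proof (cases "s = 0")
  case False
  have "\<bar>sin (pi * s)\<bar> \<le> \<bar>pi * s\<bar>" by (rule abs_sin_x_le_abs_x)
  then have "(sin (pi * s))^2 \<le> (pi * s)^2" by (simp only: abs_le_square_iff)
  then show ?thesis using False by (simp add: fejer_def power_divide)
 qed (simp add: fejer_def)
 then show "fejer s \<le> 1" .
 have "fejer s * s\<^sup>2 \<le> 1"
 proof (cases "s = 0")
  case False
  have "(sin (pi * s))^2 \<le> 1" by (simp add: power2_le_iff_abs_le abs_square_le_1)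
  moreover have "1 \<le> pi\<^sup>2" using pi_ge_two by (simp add: one_le_power)
  ultimately have "(sin (pi * s))^2 \<le> pi\<^sup>2" by linarith
  then show ?thesis using False by (simp add: fejer_def power_divide power_mult_distrib)
 qed simp
 with 1 have "fejer s * (1 + s\<^sup>2) \<le> 2" by (simp add: distrib_left)
 moreover have "1 + s\<^sup>2 > 0" by (simp add: add_pos_nonneg)
 ultimately show "fejer s \<le> 2 * inverse (1 + s\<^sup>2)"
  by (simp add: field_simps)
qed

lemma continuous_fejer [continuous_intros]:
 "continuous_on S f \<Longrightarrow> continuous_on S (\<lambda>x. fejer (f x))"
 unfolding fejer_def by (intro continuous_intros)

lemma fejer_pos: "\<bar>s\<bar> < 1 \<Longrightarrow> 0 < fejer s"
proof -
 assume s: "\<bar>s\<bar> < 1"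
 have "sin (pi * s) \<noteq> 0" if "s \<noteq> 0"
 proof (cases "s > 0")
  case True
  then show ?thesis using s sin_gt_zero[of "pi * s"] by auto
 next
  case False
  then have "0 < - s" using that by simp
  then have "0 < pi * (- s)" by (intro mult_pos_pos) auto
  moreover have "pi * (- s) < pi * 1" using s by (intro mult_strict_left_mono) auto
  ultimately show ?thesis using sin_gt_zero[of "pi * (- s)"] by auto
 qed
 then show ?thesis by (simp add: fejer_def)
qed

lemma fejer_0 [simp]: "fejer 0 = 1" by (simp add: fejer_def)
lemma fejer_minus [simp]: "fejer (- s) = fejer s" by (simp add: fejer_def)

lemma hat_fourier:
 "has_bochner_integral lborel (\<lambda>t. cis (2 * pi * s * t) * complex_of_real (max 0 (1 - \<bar>t\<bar>))) (of_real (fejer s))"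
proof -
 define a where "a = 2 * pi * s"
 define w where "w = \<i> * complex_of_real a"
 let ?E = "\<lambda>t. exp (w * complex_of_real t)"
 have E: "cis (2 * pi * s * t) = ?E t" for t by (simp add: cis_conv_exp w_def a_def mult_ac)
 obtain F G where FG:
  "\<And>t. (F has_vector_derivative (1 - complex_of_real t) * ?E t) (at t within {0..1})"
  "\<And>t. (G has_vector_derivative (1 + complex_of_real t) * ?E t) (at t within {-1..0})"
  "F 1 - F 0 + (G 0 - G (-1)) = of_real (fejer s)"
 proof (cases "s = 0")
  case True
  then have w0: "w = 0" by (simp add: w_def a_def)
  show ?thesis
  proof (rule that[of "\<lambda>t. of_real t - (of_real t)^2 / 2" "\<lambda>t. of_real t + (of_real t)^2 / 2"])
   show "((\<lambda>t. of_real t - (of_real t)^2 / 2) has_vector_derivative (1 - complex_of_real t) * ?E t) (at t within {0..1})" for t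
    unfolding w0 by (auto intro!: derivative_eq_intros simp: has_vector_derivative_def scaleR_conv_of_real algebra_simps)
   show "((\<lambda>t. of_real t + (of_real t)^2 / 2) has_vector_derivative (1 + complex_of_real t) * ?E t) (at t within {-1..0})" for t
    unfolding w0 by (auto intro!: derivative_eq_intros simp: has_vector_derivative_def scaleR_conv_of_real algebra_simps)
  qed (simp add: True)
 next
  case False
  then have w: "w \<noteq> 0" by (simp add: w_def a_def)
  show ?thesis
  proof (rule that[of "\<lambda>t. (1 - of_real t) * ?E t / w + ?E t / w\<^sup>2" "\<lambda>t. (1 + of_real t) * ?E t / w - ?E t / w\<^sup>2"])
   show "((\<lambda>t. (1 - of_real t) * ?E t / w + ?E t / w\<^sup>2) has_vector_derivative (1 - complex_of_real t) * ?E t) (at t within {0..1})" for t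
   proof -
    have "((\<lambda>z. (1 - z) * exp (w * z) / w + exp (w * z) / w\<^sup>2) has_field_derivative (1 - of_real t) * exp (w * of_real t)) (at (of_real t))"
     using w by (auto intro!: derivative_eq_intros simp: field_simps power2_eq_square)
    then show ?thesis by (rule has_vector_derivative_real_field[THEN has_vector_derivative_at_within])
   qed
   show "((\<lambda>t. (1 + of_real t) * ?E t / w - ?E t / w\<^sup>2) has_vector_derivative (1 + complex_of_real t) * ?E t) (at t within {-1..0})" for t
   proof -
    have "((\<lambda>z. (1 + z) * exp (w * z) / w - exp (w * z) / w\<^sup>2) has_field_derivative (1 + of_real t) * exp (w * of_real t)) (at (of_real t))"
     using w by (auto intro!: derivative_eq_intros simp: field_simps power2_eq_square)
    then show ?thesis by (rule has_vector_derivative_real_field[THEN has_vector_derivative_at_within])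
   qed
   have "complex_of_real (cos a) = (exp w + exp (- w)) / 2"
    using cos_exp_eq[of "complex_of_real a"] by (simp add: w_def cos_of_real)
   moreover have "cos a = 1 - 2 * (sin (pi * s))^2"
    using cos_double_sin[of "pi * s"] by (simp add: a_def mult.assoc)
   ultimately have "exp w + exp (- w) - 2 = - of_real (4 * (sin (pi * s))^2)"
    by (simp add: algebra_simps)
   moreover have "w\<^sup>2 = - of_real (a\<^sup>2)" by (simp add: w_def power_mult_distrib)
   ultimately have "(exp w + exp (- w) - 2) / w\<^sup>2 = of_real (4 * (sin (pi * s))^2 / a\<^sup>2)"
    by simp
   also have "4 * (sin (pi * s))^2 / a\<^sup>2 = fejer s"
    using False by (simp add: fejer_def a_def power_divide power_mult_distrib)
   finally show "(1 - of_real 1) * ?E 1 / w + ?E 1 / w\<^sup>2 - ((1 - of_real 0) * ?E 0 / w + ?E 0 / w\<^sup>2)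
     + ((1 + of_real 0) * ?E 0 / w - ?E 0 / w\<^sup>2 - ((1 + of_real (- 1)) * ?E (- 1) / w - ?E (- 1) / w\<^sup>2)) = of_real (fejer s)"
    by (simp add: add_divide_distrib diff_divide_distrib add_diff_eq)
  qed
 qed
 have 1: "has_bochner_integral lborel (\<lambda>t. indicator {0..1} t *\<^sub>R ((1 - complex_of_real t) * ?E t)) (F 1 - F 0)"
  by (rule has_bochner_integral_FTC_Icc) (auto intro!: FG continuous_intros)
 have 2: "has_bochner_integral lborel (\<lambda>t. indicator {-1..0} t *\<^sub>R ((1 + complex_of_real t) * ?E t)) (G 0 - G (-1))"
  by (rule has_bochner_integral_FTC_Icc) (auto intro!: FG continuous_intros)
 have AE0: "AE t in lborel. t \<noteq> (0::real)" by (rule AE_lborel_singleton)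
 have "has_bochner_integral lborel (\<lambda>t. ?E t * complex_of_real (max 0 (1 - \<bar>t\<bar>))) (F 1 - F 0 + (G 0 - G (-1)))"
 proof (subst has_bochner_integral_cong_AE)
  show "AE t in lborel. ?E t * complex_of_real (max 0 (1 - \<bar>t\<bar>)) =
   indicator {0..1} t *\<^sub>R ((1 - complex_of_real t) * ?E t) + indicator {-1..0} t *\<^sub>R ((1 + complex_of_real t) * ?E t)"
   using AE0 by eventually_elim (auto simp: indicator_def max_def)
 qed (use has_bochner_integral_add[OF 1 2] in auto)
 then show ?thesis unfolding FG(3) E .
qed

definition tent1 :: "real \<Rightarrow> real \<Rightarrow> real" where
 "tent1 r t = max 0 (1 - \<bar>t\<bar> / r) / r"

lemma tent1_fourier:
 assumes r: "r > 0"
 shows "integrable lborel (tent1 r)"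
  and "(LINT t|lborel. cis (2 * pi * s * t) * complex_of_real (tent1 r t)) = of_real (fejer (r * s))"
proof -
 have eq: "tent1 r (0 + r * t) = max 0 (1 - \<bar>t\<bar>) / r" for t
  using r by (simp add: tent1_def abs_mult)
 have "integrable lborel (\<lambda>t. complex_of_real (max 0 (1 - \<bar>t\<bar>)))"
  using hat_fourier[of 0] by (simp add: has_bochner_integral_iff)
 then have "integrable lborel (\<lambda>t::real. max 0 (1 - \<bar>t\<bar>))" by (simp only: complex_of_real_integrable_eq)
 then have "integrable lborel (\<lambda>t. tent1 r (0 + r * t))" unfolding eq by simp
 then show "integrable lborel (tent1 r)" using lborel_integrable_real_affine_iff[of r "tent1 r" 0] r by simp
 have "(LINT t|lborel. cis (2 * pi * s * t) * complex_of_real (tent1 r t))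
  = \<bar>r\<bar> *\<^sub>R (LINT t|lborel. cis (2 * pi * s * (0 + r * t)) * complex_of_real (tent1 r (0 + r * t)))"
  using r by (intro lborel_integral_real_affine) simp
 also have "\<dots> = (LINT t|lborel. cis (2 * pi * (r * s) * t) * complex_of_real (max 0 (1 - \<bar>t\<bar>)))"
  unfolding integral_scaleR_right[symmetric] eq using r
  by (intro lint_cong refl) (simp add: scaleR_conv_of_real mult_ac)
 also have "\<dots> = of_real (fejer (r * s))" using hat_fourier[of "r * s"] by (rule has_bochner_integral_integral_eq)
 finally show "(LINT t|lborel. cis (2 * pi * s * t) * complex_of_real (tent1 r t)) = of_real (fejer (r * s))" .
qed

definition tent :: "real \<Rightarrow> 'a::euclidean_space \<Rightarrow> real" where
 "tent r x = (\<Prod>b\<in>Basis. tent1 r (x \<bullet> b))"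

text \<open>The Fejer kernel, which is the transform of \<open>tent r\<close>. As \<open>r\<close> tends to 0 it tends to 1, so it acts as
 a summability factor; that the tents have compact support localises everything on the other side.\<close>

definition kap :: "real \<Rightarrow> 'a::euclidean_space \<Rightarrow> real" where
 "kap r y = (\<Prod>b\<in>Basis. fejer (r * (y \<bullet> b)))"

lemma tent_nonneg: "r > 0 \<Longrightarrow> 0 \<le> tent r x"
 unfolding tent_def tent1_def by (intro prod_nonneg) simp

lemma tent_0: "tent r (0::'a::euclidean_space) = 1 / r ^ DIM('a)"
 by (simp add: tent_def tent1_def power_divide)

lemma tent_le:
 fixes x :: "'a::euclidean_space"
 assumes "r > 0" shows "tent r x \<le> 1 / r ^ DIM('a)"
proof -
 have "tent r x \<le> (\<Prod>b\<in>(Basis::'a set). 1 / r)"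
  unfolding tent_def tent1_def using assms by (intro prod_mono) (auto intro!: divide_right_mono)
 then show ?thesis by (simp add: power_divide)
qed

lemma tent_eq_0: "r > 0 \<Longrightarrow> b \<in> Basis \<Longrightarrow> r \<le> \<bar>x \<bullet> b\<bar> \<Longrightarrow> tent r x = 0"
 unfolding tent_def by (rule prod_zero) (auto intro!: bexI[of _ b] simp: tent1_def max_def)

lemma tent_minus [simp]: "tent r (- x) = tent r x" by (simp add: tent_def tent1_def)

lemma continuous_tent [continuous_intros]:
 "continuous_on S f \<Longrightarrow> continuous_on S (\<lambda>x. tent r (f x))"
 unfolding tent_def tent1_def divide_inverse by (intro continuous_intros)

lemma measurable_tent [measurable]: "tent r \<in> borel_measurable borel"
 by (intro borel_measurable_continuous_onI continuous_intros)

lemma integrable_tent: "r > 0 \<Longrightarrow> integrable lborel (tent r)"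
 unfolding tent_def[abs_def] by (rule lborel_integral_prod(1)) (rule tent1_fourier(1))

lemma inv_fourier_tent: "r > 0 \<Longrightarrow> inv_fourier (\<lambda>x. of_real (tent r x)) y = of_real (kap r y)"
 unfolding tent_def by (subst inv_fourier_prod) (simp_all add: tent1_fourier kap_def)

lemma kap_nonneg: "0 \<le> kap r y" unfolding kap_def by (intro prod_nonneg) (simp add: fejer_bounds)
lemma kap_le_1: "kap r y \<le> 1" unfolding kap_def by (intro prod_le_1) (simp add: fejer_bounds)
lemma kap_0 [simp]: "kap r 0 = 1" "kap 0 y = 1" by (simp_all add: kap_def)
lemma kap_minus [simp]: "kap r (- y) = kap r y" by (simp add: kap_def)

lemma kap_le_decay: "kap r (y::'a::euclidean_space) \<le> 2 ^ DIM('a) * decay (r *\<^sub>R y)"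
proof -
 have "kap r y \<le> (\<Prod>b\<in>Basis. 2 * inverse (1 + ((r *\<^sub>R y) \<bullet> b)^2))"
  unfolding kap_def using fejer_bounds(1,3) by (intro prod_mono) auto
 then show ?thesis by (simp only: prod.distrib decay_def prod_constant)
qed

lemma kap_pos: "(\<And>b. b \<in> Basis \<Longrightarrow> \<bar>r * (y \<bullet> b)\<bar> < 1) \<Longrightarrow> 0 < kap r y"
 unfolding kap_def by (intro prod_pos) (simp add: fejer_pos)

lemma continuous_kap [continuous_intros]:
 "continuous_on S f \<Longrightarrow> continuous_on S (\<lambda>x. kap r (f x))"
 unfolding kap_def by (intro continuous_intros)

lemma measurable_kap [measurable]: "kap r \<in> borel_measurable borel"
 by (intro borel_measurable_continuous_onI continuous_intros)

lemma integrable_kap: "r > 0 \<Longrightarrow> integrable lborel (kap r :: 'a::euclidean_space \<Rightarrow> real)"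
proof (rule lintable_bound)
 assume "r > 0"
 then show "integrable lborel (\<lambda>y::'a. 2 ^ DIM('a) * decay (r *\<^sub>R y))"
  using integrable_decay_scaled[of r, where 'a='a] by simp
 show "AE y in lborel. norm (kap r y) \<le> norm (2 ^ DIM('a) * decay (r *\<^sub>R (y::'a)))"
 proof (rule AE_I2)
  fix y :: 'a
  show "norm (kap r y) \<le> norm (2 ^ DIM('a) * decay (r *\<^sub>R y))"
   using kap_le_decay[of r y] kap_nonneg[of r y] decay_pos[of "r *\<^sub>R y"] by simp
 qed
qed measurable

lemma inv_fourier_kap:
 fixes x :: "'a::euclidean_space"
 assumes r: "r > 0"
 shows "inv_fourier (\<lambda>y. of_real (kap r y)) x = of_real (tent r x)"
proof -
 let ?t = "\<lambda>x::'a. complex_of_real (tent r x)"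
 have F: "fourier ?t = (\<lambda>y. of_real (kap r y))"
  by (rule ext) (simp add: fourier_eq_inv_fourier inv_fourier_tent[OF r])
 have "inv_fourier (fourier ?t) x = ?t x"
 proof (rule fourier_inversion)
  show "integrable lborel ?t" using integrable_tent[OF r, where 'a='a] by simp
  show "continuous_on UNIV ?t" by (intro continuous_intros)
  show "norm (?t x) \<le> 1 / r ^ DIM('a)" for x
   using tent_le[OF r, of x] tent_nonneg[OF r, of x] by simp
  show "integrable lborel (fourier ?t)" unfolding F using integrable_kap[OF r, where 'a='a] by simp
 qed
 then show ?thesis unfolding F .
qed

section \<open>Translation bounded measures\<close>

definition cube :: "'a::euclidean_space \<Rightarrow> 'a set" where
 "cube t = {x. \<forall>b\<in>Basis. \<bar>(x - t) \<bullet> b\<bar> \<le> 1 / 2}"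

lemma cube_eq_cbox: "cube t = cbox (t - (1/2) *\<^sub>R One) (t + (1/2) *\<^sub>R One)"
proof -
 have "\<bar>(x - t) \<bullet> b\<bar> \<le> 1 / 2 \<longleftrightarrow>
   (t - (1/2) *\<^sub>R One) \<bullet> b \<le> x \<bullet> b \<and> x \<bullet> b \<le> (t + (1/2) *\<^sub>R One) \<bullet> b" if "b \<in> Basis" for x b
 proof -
  have "\<bar>p - q\<bar> \<le> 1 / 2 \<longleftrightarrow> q - 1 / 2 \<le> p \<and> p \<le> q + 1 / 2" for p q :: real by arith
  from this[of "x \<bullet> b" "t \<bullet> b"] show ?thesis using that by (simp add: inner_diff_left inner_add_left)
 qed
 then show ?thesis unfolding cube_def cbox_def by auto
qed

lemma emeasure_cube: "emeasure lborel (cube (t::'a::euclidean_space)) = 1"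
proof -
 have "emeasure lborel (cube t) = ennreal (\<Prod>b\<in>Basis. ((t + (1/2) *\<^sub>R One) - (t - (1/2) *\<^sub>R One)) \<bullet> b)"
  unfolding cube_eq_cbox by (rule emeasure_lborel_cbox) (simp add: inner_diff_left inner_add_left)
 also have "(\<Prod>b\<in>Basis. ((t + (1/2) *\<^sub>R One) - (t - (1/2) *\<^sub>R One)) \<bullet> b) = (\<Prod>b\<in>(Basis::'a set). 1)"
  by (rule prod.cong) (simp_all add: inner_diff_left inner_add_left)
 finally show ?thesis by simp
qed

lemma cube_commute: "x \<in> cube t \<longleftrightarrow> t \<in> cube x"
 unfolding cube_def inner_diff_left by (auto simp: abs_minus_commute)

lemma in_cube_iff_diff: "x \<in> cube t \<longleftrightarrow> x - t \<in> cube 0" by (simp add: cube_def)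

lemma cube_borel [measurable]: "cube t \<in> sets borel"
 by (simp add: cube_eq_cbox)

definition translation_bounded :: "'a::euclidean_space measure \<Rightarrow> bool" where
 "translation_bounded M \<longleftrightarrow> locally_finite M \<and> (\<exists>B\<ge>0. \<forall>t. emeasure M (cube t) \<le> ennreal B)"

lemma decay_cube:
 assumes "x \<in> cube t" "0 < r" "r \<le> 1"
 shows "decay (r *\<^sub>R (x - s)) \<le> 3 ^ DIM('a) * decay (r *\<^sub>R (t - s :: 'a::euclidean_space))"
proof -
 have "inverse (1 + ((r *\<^sub>R (x - s)) \<bullet> b)^2) \<le> 3 * inverse (1 + ((r *\<^sub>R (t - s)) \<bullet> b)^2)" if b: "b \<in> Basis" for b
 proof -
  define u where "u = (r *\<^sub>R (x - s)) \<bullet> b"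
  define v where "v = (r *\<^sub>R (t - s)) \<bullet> b"
  have "\<bar>u - v\<bar> = r * \<bar>(x - t) \<bullet> b\<bar>"
   using assms(2) by (simp add: u_def v_def inner_diff_left right_diff_distrib[symmetric] abs_mult)
  also have "\<dots> \<le> 1 * (1 / 2)"
   using assms b by (intro mult_mono) (auto simp: cube_def)
  finally have "(u - v)^2 \<le> (1/2)^2" by (simp only: power2_le_iff_abs_le)
  then have "(u - v)^2 \<le> 1/4" by (simp add: power_divide)
  moreover have "v\<^sup>2 \<le> 2 * u\<^sup>2 + 2 * (u - v)^2"
   using zero_le_power2[of "2 * u - v"] by (simp add: power2_eq_square algebra_simps)
  ultimately have "1 + v\<^sup>2 \<le> 3 * (1 + u\<^sup>2)"
  proof -
   have "1 + b \<le> 3 * (1 + a)" if "c \<le> 1/4" "b \<le> 2 * a + 2 * c" "0 \<le> a" for a b c :: real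
    using that by simp
   then show ?thesis using \<open>(u - v)\<^sup>2 \<le> 1/4\<close> \<open>v\<^sup>2 \<le> 2 * u\<^sup>2 + 2 * (u - v)^2\<close> zero_le_power2[of u] by blast
  qed
  moreover have "0 < 1 + u\<^sup>2" "0 < 1 + v\<^sup>2" by (simp_all add: add_pos_nonneg)
  ultimately show ?thesis
   unfolding u_def[symmetric] v_def[symmetric] by (simp add: field_simps)
 qed
 then have "decay (r *\<^sub>R (x - s)) \<le> (\<Prod>b\<in>Basis. 3 * inverse (1 + ((r *\<^sub>R (t - s)) \<bullet> b)^2))"
  unfolding decay_def by (intro prod_mono) (auto simp: add_nonneg_nonneg)
 then show ?thesis by (simp only: prod.distrib decay_def prod_constant)
qed

text \<open>Replacing a point mass by the uniform distribution on the unit cube around it changes the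
 slowly varying weight by a bounded factor only; this compares \<open>M\<close> with Lebesgue measure.\<close>

lemma decay_average:
 fixes s :: "'a::euclidean_space"
 assumes M: "locally_finite M" and B: "\<And>t. emeasure M (cube t) \<le> ennreal B" "0 \<le> B"
  and r: "0 < r" "r \<le> 1"
 shows "(\<integral>\<^sup>+x. ennreal (decay (r *\<^sub>R (x - s))) \<partial>M) \<le> ennreal (3 ^ DIM('a) * B * (LINT y|(lborel::'a measure). decay y) / r ^ DIM('a))"
proof -
 note [measurable_cong] = locally_finite_sets[OF M]
 interpret pair_sigma_finite M lborel
  using sigma_finite_locally_finite[OF M] sigma_finite_lborel by (simp add: pair_sigma_finite_def)
 let ?w = "\<lambda>t. 3 ^ DIM('a) * decay (r *\<^sub>R (t - s))"
 have "(\<integral>\<^sup>+x. ennreal (decay (r *\<^sub>R (x - s))) \<partial>M)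
  = (\<integral>\<^sup>+x. (\<integral>\<^sup>+t. ennreal (decay (r *\<^sub>R (x - s))) * indicator (cube 0) (x - t) \<partial>lborel) \<partial>M)"
 proof (rule nn_integral_cong)
  fix x
  have "(\<integral>\<^sup>+t. ennreal (decay (r *\<^sub>R (x - s))) * indicator (cube 0) (x - t) \<partial>lborel)
   = (\<integral>\<^sup>+t. ennreal (decay (r *\<^sub>R (x - s))) * indicator (cube x) t \<partial>lborel)"
  proof (intro nn_integral_cong)
   fix t
   have "x - t \<in> cube 0 \<longleftrightarrow> t \<in> cube x" using in_cube_iff_diff[of x t] cube_commute[of x t] by simp
   then show "ennreal (decay (r *\<^sub>R (x - s))) * indicator (cube 0) (x - t)
    = ennreal (decay (r *\<^sub>R (x - s))) * indicator (cube x) t" by (simp add: indicator_def)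
  qed
  then show "ennreal (decay (r *\<^sub>R (x - s))) = (\<integral>\<^sup>+t. ennreal (decay (r *\<^sub>R (x - s))) * indicator (cube 0) (x - t) \<partial>lborel)"
   by (simp add: nn_integral_cmult_indicator emeasure_cube)
 qed
 also have "\<dots> \<le> (\<integral>\<^sup>+x. (\<integral>\<^sup>+t. ennreal (?w t) * indicator (cube 0) (x - t) \<partial>lborel) \<partial>M)"
  using decay_cube[OF _ r, of _ _ s]
  by (intro nn_integral_mono) (auto simp: indicator_def in_cube_iff_diff[symmetric] intro!: ennreal_leI)
 also have "\<dots> = (\<integral>\<^sup>+t. (\<integral>\<^sup>+x. ennreal (?w t) * indicator (cube 0) (x - t) \<partial>M) \<partial>lborel)"
  by (rule Fubini'[symmetric]) measurable
 also have "\<dots> = (\<integral>\<^sup>+t. ennreal (?w t) * emeasure M (cube t) \<partial>lborel)"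
 proof (rule nn_integral_cong)
  fix t
  have "(\<integral>\<^sup>+x. ennreal (?w t) * indicator (cube 0) (x - t) \<partial>M) = (\<integral>\<^sup>+x. ennreal (?w t) * indicator (cube t) x \<partial>M)"
   by (intro nn_integral_cong) (auto simp: indicator_def in_cube_iff_diff[symmetric])
  then show "(\<integral>\<^sup>+x. ennreal (?w t) * indicator (cube 0) (x - t) \<partial>M) = ennreal (?w t) * emeasure M (cube t)"
   by (simp add: nn_integral_cmult_indicator)
 qed
 also have "\<dots> \<le> (\<integral>\<^sup>+t. ennreal (?w t) * ennreal B \<partial>lborel)"
  by (intro nn_integral_mono mult_left_mono B) auto
 also have "\<dots> = (\<integral>\<^sup>+t. ennreal (?w t * B) \<partial>lborel)"
  using B(2) decay_pos by (intro nn_integral_cong) (simp add: ennreal_mult'' )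
 also have "\<dots> = ennreal (LINT t|lborel. ?w t * B)"
 proof (rule nn_integral_eq_integral)
  have "integrable lborel (\<lambda>t. decay (r *\<^sub>R (- s + t)))"
   using lborel_translate(1)[of "\<lambda>t. decay (r *\<^sub>R t)" "- s"] integrable_decay_scaled[OF r(1), where 'a='a] by simp
  then show "integrable lborel (\<lambda>t. ?w t * B)" by simp
  show "AE t in lborel. 0 \<le> ?w t * B"
   using B(2) decay_pos by (intro AE_I2 mult_nonneg_nonneg) (auto intro: less_imp_le)
 qed
 also have "(LINT t|lborel. ?w t * B) = 3 ^ DIM('a) * B * (LINT y|(lborel::'a measure). decay y) / r ^ DIM('a)"
  using lborel_translate(2)[of "\<lambda>t. decay (r *\<^sub>R t)" "- s"] integral_decay_scaled[OF r(1), where 'a='a]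
  by simp
 finally show ?thesis .
qed

text \<open>Against a translation bounded measure, a Fejer kernel spread over distance \<open>1 / r\<close> picks up at most
 \<open>O(r powr - d)\<close> mass, uniformly in its position. The exponent is what makes the sampling bound scale
 correctly.\<close>

lemma kap_average:
 assumes "translation_bounded M"
 obtains C where "0 \<le> C"
  "\<And>r (s::'a::euclidean_space). 0 < r \<Longrightarrow> r \<le> 1 \<Longrightarrow> (\<integral>\<^sup>+x. ennreal (kap r (x - s)) \<partial>M) \<le> ennreal (C / r ^ DIM('a))"
proof -
 obtain B where M: "locally_finite M" and B: "0 \<le> B" "\<And>t. emeasure M (cube t) \<le> ennreal B"
  using assms by (auto simp: translation_bounded_def)
 note [measurable_cong] = locally_finite_sets[OF M]
 define C where "C = 2 ^ DIM('a) * (3 ^ DIM('a) * B * (LINT y|(lborel::'a measure). decay y))"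
 show ?thesis
 proof (rule that[of C])
  have "0 \<le> (LINT y|(lborel::'a measure). decay y)"
   by (intro integral_nonneg_AE AE_I2) (simp add: decay_pos less_imp_le)
  then show "0 \<le> C" using B(1) by (simp add: C_def)
  fix r :: real and s :: 'a assume r: "0 < r" "r \<le> 1"
  have "(\<integral>\<^sup>+x. ennreal (kap r (x - s)) \<partial>M) \<le> (\<integral>\<^sup>+x. ennreal (2 ^ DIM('a)) * ennreal (decay (r *\<^sub>R (x - s))) \<partial>M)"
   using kap_le_decay by (intro nn_integral_mono) (simp add: decay_pos less_imp_le flip: ennreal_mult)
  also have "\<dots> = ennreal (2 ^ DIM('a)) * (\<integral>\<^sup>+x. ennreal (decay (r *\<^sub>R (x - s))) \<partial>M)"
   by (rule nn_integral_cmult) measurable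
  also have "\<dots> \<le> ennreal (2 ^ DIM('a)) * ennreal (3 ^ DIM('a) * B * (LINT y|(lborel::'a measure). decay y) / r ^ DIM('a))"
   by (intro mult_left_mono decay_average[OF M B(2,1) r]) simp
  also have "\<dots> = ennreal (C / r ^ DIM('a))" by (simp add: C_def flip: ennreal_mult')
  finally show "(\<integral>\<^sup>+x. ennreal (kap r (x - s)) \<partial>M) \<le> ennreal (C / r ^ DIM('a))" .
 qed
qed

lemma bounded_support_compact:
 fixes \<phi> :: "'a::euclidean_space \<Rightarrow> complex"
 assumes "\<And>x. norm x > R \<Longrightarrow> \<phi> x = 0"
 shows "compact (closure {x. \<phi> x \<noteq> 0})"
proof -
 have "{x. \<phi> x \<noteq> 0} \<subseteq> cball 0 R" using assms by (auto simp: not_less[symmetric])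
 then have "bounded {x. \<phi> x \<noteq> 0}" by (rule bounded_subset[OF bounded_cball])
 then show ?thesis by simp
qed

lemma tent_eq_0_norm:
 assumes "r > 0" "norm (x::'a::euclidean_space) > r * real DIM('a)" shows "tent r x = 0"
proof -
 have "\<exists>b\<in>Basis. r \<le> \<bar>x \<bullet> b\<bar>"
 proof (rule ccontr)
  assume "\<not> ?thesis"
  then have "(\<Sum>b\<in>Basis. \<bar>x \<bullet> b\<bar>) \<le> (\<Sum>b\<in>(Basis::'a set). r)" by (intro sum_mono) (auto simp: not_le less_imp_le)
  then show False using assms(2) norm_le_l1[of x] by (simp add: mult.commute)
 qed
 then show ?thesis using tent_eq_0[OF assms(1)] by blast
qed

lemma inv_fourier_wave_mult: "inv_fourier (\<lambda>x. wave \<eta> x * \<phi> x) y = inv_fourier \<phi> (y + \<eta>)"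
 unfolding inv_fourier_wave wave_add_left mult.assoc by (rule refl)

text \<open>If cubes at \<open>s n\<close> had rapidly growing mass, then modulating one tent to all these places with
 summable coefficients would give a continuous function whose transform is not square integrable.
 The transforms of the summands are nonnegative, so they cannot cancel.\<close>

lemma transform_translation_bounded:
 fixes \<nu> :: "'a::euclidean_space set \<Rightarrow> complex"
 assumes \<nu>: "complex_radon \<nu>"
  and L2: "\<And>\<phi>. cont_compact_supp \<phi> \<Longrightarrow> integrable (total_variation \<nu>) (\<lambda>x. (norm (inv_fourier \<phi> x))\<^sup>2)"
 shows "translation_bounded (total_variation \<nu>)"
proof (rule ccontr)
 assume not: "\<not> ?thesis"
 have "\<exists>t. ennreal (real n * 4 ^ n) < emeasure (total_variation \<nu>) (cube t)" for n :: nat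
 proof (rule ccontr)
  assume "\<not> ?thesis"
  then have "\<forall>t. emeasure (total_variation \<nu>) (cube t) \<le> ennreal (real n * 4 ^ n)" by (simp add: not_less)
  then have "translation_bounded (total_variation \<nu>)"
   unfolding translation_bounded_def using locally_finite_total_variation[OF \<nu>]
   by (intro conjI exI[of _ "real n * 4 ^ n"]) auto
  then show False using not by simp
 qed
 then obtain s :: "nat \<Rightarrow> 'a" where s: "\<And>n. ennreal (real n * 4 ^ n) < emeasure (total_variation \<nu>) (cube (s n))"
  by metis
 obtain c where c: "0 < c" "\<And>y. y \<in> cube 0 \<Longrightarrow> c \<le> kap 1 (y::'a)"
 proof -
  have "continuous_on (cube 0) (kap 1 :: 'a \<Rightarrow> real)" by (intro continuous_intros)
  moreover have "compact (cube (0::'a))" by (simp add: cube_eq_cbox)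
  moreover have "(0::'a) \<in> cube 0" by (simp add: cube_def)
  then have "cube (0::'a) \<noteq> {}" by blast
  ultimately obtain y0 where y0: "y0 \<in> cube (0::'a)" "\<And>y. y \<in> cube 0 \<Longrightarrow> kap 1 y0 \<le> kap 1 (y::'a)"
   using continuous_attains_inf[of "cube (0::'a)" "kap 1"] by blast
  have "0 < kap 1 y0" using y0(1) by (intro kap_pos) (force simp: cube_def)
  then show ?thesis using that y0(2) by blast
 qed
 (* The square of the coefficient is 4 powr - n, which the mass n * 4 ^ n outweighs. *)
 define f where "f n x = of_real ((1/2) ^ n) * (wave (- s n) x * complex_of_real (tent 1 x))" for n x
 define \<phi> where "\<phi> x = (\<Sum>n. f n x)" for x
 have fle: "norm (f n x) \<le> (1/2) ^ n * tent 1 x" for n x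
  using tent_nonneg[of 1 x] by (simp add: f_def norm_mult norm_power)
 have fle1: "norm (f n x) \<le> (1/2) ^ n" for n x
 proof -
  have "(1/2) ^ n * tent 1 x \<le> (1/2) ^ n * 1" using tent_le[of 1 x] by (intro mult_left_mono) auto
  then show ?thesis using fle[of n x] by linarith
 qed
 have sumhalf: "summable (\<lambda>n. (1/2 :: real) ^ n)" by (rule summable_geometric) simp
 have "continuous_on UNIV \<phi>"
 proof (rule uniform_limit_theorem)
  show "uniform_limit UNIV (\<lambda>n x. \<Sum>i<n. f i x) \<phi> sequentially"
   unfolding \<phi>_def using fle1 sumhalf by (intro Weierstrass_m_test) auto
  show "\<forall>\<^sub>F n in sequentially. continuous_on UNIV (\<lambda>x. \<Sum>i<n. f i x)"
   unfolding f_def by (intro always_eventually allI continuous_intros)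
 qed simp
 moreover have "compact (closure {x. \<phi> x \<noteq> 0})"
  by (rule bounded_support_compact[of "DIM('a)"]) (simp add: \<phi>_def f_def tent_eq_0_norm)
 ultimately have ccs: "cont_compact_supp \<phi>" by (simp add: cont_compact_supp_def)
 have finv: "inv_fourier (f n) y = of_real ((1/2) ^ n * kap 1 (y - s n))" for n y
 proof -
  have "inv_fourier (f n) y = of_real ((1/2) ^ n) * inv_fourier (\<lambda>x. wave (- s n) x * complex_of_real (tent 1 x)) y"
   unfolding f_def inv_fourier_wave mult.left_commute[of "wave _ _" "of_real _"] by (rule integral_mult_right_zero)
  then show ?thesis by (simp only: inv_fourier_wave_mult inv_fourier_tent[OF zero_less_one] of_real_mult diff_conv_add_uminus)
 qed
 have inv: "inv_fourier \<phi> y = (\<Sum>n. inv_fourier (f n) y)" and summ: "summable (\<lambda>n. inv_fourier (f n) y)" for y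
 proof -
  have t: "integrable lborel (tent 1 :: 'a \<Rightarrow> real)" by (rule integrable_tent) simp
  have fi: "integrable lborel (\<lambda>x. wave y x * f n x)" for n
  proof -
   have "integrable lborel (f n)" unfolding f_def using t by (intro integrable_mult_right integrable_wave_mult) simp
   then show ?thesis by (rule integrable_wave_mult)
  qed
  have n1: "AE x in lborel. summable (\<lambda>n. norm (wave y x * f n x))"
   by (intro AE_I2 summable_comparison_test'[OF sumhalf]) (simp add: norm_mult fle1)
  have n2: "summable (\<lambda>n. LINT x|lborel. norm (wave y x * f n x))"
  proof (rule summable_comparison_test')
   show "summable (\<lambda>n. (1/2) ^ n * (LINT x|(lborel::'a measure). tent 1 x))" using sumhalf by (rule summable_mult2)
   have "(LINT x|lborel. norm (wave y x * f n x)) \<le> (LINT x|(lborel::'a measure). (1/2) ^ n * tent 1 x)" for n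
    using fi t fle by (intro integral_mono integrable_norm) (auto simp: norm_mult)
   then show "norm (LINT x|lborel. norm (wave y x * f n x)) \<le> (1/2) ^ n * (LINT x|(lborel::'a measure). tent 1 x)" for n
    by (simp add: integral_nonneg_AE)
  qed
  have "inv_fourier \<phi> y = (LINT x|lborel. (\<Sum>n. wave y x * f n x))"
   unfolding inv_fourier_wave
  proof (intro lint_cong refl)
   fix x
   have "summable (\<lambda>n. f n x)" using fle1 by (intro summable_comparison_test'[OF sumhalf]) auto
   then show "wave y x * \<phi> x = (\<Sum>n. wave y x * f n x)" by (simp add: \<phi>_def suminf_mult)
  qed
  also have "\<dots> = (\<Sum>n. inv_fourier (f n) y)"
   unfolding inv_fourier_wave by (rule integral_suminf[OF fi n1 n2])
  finally show "inv_fourier \<phi> y = (\<Sum>n. inv_fourier (f n) y)" .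
  show "summable (\<lambda>n. inv_fourier (f n) y)"
   using sums_integral[OF fi n1 n2] unfolding inv_fourier_wave by (rule sums_summable)
 qed
 have lower: "(1/2) ^ n * c \<le> norm (inv_fourier \<phi> y)" if y: "y \<in> cube (s n)" for n y
 proof -
  have "summable (\<lambda>n. (1/2) ^ n * kap 1 (y - s n))"
   using summable_Re[OF summ[of y]] by (simp add: finv)
  then have "(1/2) ^ n * kap 1 (y - s n) \<le> (\<Sum>n. (1/2) ^ n * kap 1 (y - s n))"
   using sum_le_suminf[of "\<lambda>n. (1/2) ^ n * kap 1 (y - s n)" "{n}"] by (simp add: kap_nonneg)
  also have "\<dots> = Re (inv_fourier \<phi> y)"
   unfolding inv Re_suminf[OF summ] unfolding finv by simp
  also have "\<dots> \<le> norm (inv_fourier \<phi> y)" by (rule complex_Re_le_cmod)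
  finally have "(1/2) ^ n * kap 1 (y - s n) \<le> norm (inv_fourier \<phi> y)" .
  moreover have "(1/2) ^ n * c \<le> (1/2) ^ n * kap 1 (y - s n)"
   using c(2)[of "y - s n"] y by (intro mult_left_mono) (auto simp: in_cube_iff_diff[of y])
  ultimately show ?thesis by linarith
 qed
 let ?I = "LINT x|total_variation \<nu>. (norm (inv_fourier \<phi> x))\<^sup>2"
 have "c\<^sup>2 * real n \<le> ?I" for n
 proof -
  have "ennreal (((1/2) ^ n * c)^2 * (real n * 4 ^ n)) \<le> ennreal (((1/2) ^ n * c)^2) * emeasure (total_variation \<nu>) (cube (s n))"
   using s[of n] by (simp add: ennreal_mult mult_left_mono less_imp_le)
  also have "\<dots> = (\<integral>\<^sup>+x. ennreal (((1/2) ^ n * c)^2) * indicator (cube (s n)) x \<partial>total_variation \<nu>)"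
   by (rule nn_integral_cmult_indicator[symmetric]) simp
  also have "\<dots> \<le> (\<integral>\<^sup>+x. ennreal ((norm (inv_fourier \<phi> x))^2) \<partial>total_variation \<nu>)"
   using lower c(1) by (intro nn_integral_mono) (auto simp: indicator_def intro!: ennreal_leI power_mono)
  also have "\<dots> = ennreal ?I" using L2[OF ccs] by (intro nn_integral_eq_integral) auto
  finally have "((1/2) ^ n * c)^2 * (real n * 4 ^ n) \<le> ?I" by (subst (asm) ennreal_le_iff) auto
  moreover have "((1/2) ^ n * c)^2 * (real n * 4 ^ n) = c\<^sup>2 * real n"
  proof -
   have "((1/2::real) ^ n)^2 * 4 ^ n = 1"
    by (simp add: power_mult_distrib[symmetric] power_mult[symmetric] mult.commute[of n] power_mult power2_eq_square)
   then show ?thesis by (simp add: power_mult_distrib mult_ac)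
  qed
  ultimately show ?thesis by simp
 qed
 moreover obtain n :: nat where "?I / c\<^sup>2 < real n" using reals_Archimedean2 by blast
 then have "?I < c\<^sup>2 * real n" using c(1) by (simp add: field_simps)
 ultimately show False by (meson not_less)
qed

section \<open>Consequences of the transform identity\<close>

text \<open>Two tents at distance \<open>t\<close>: the square of the absolute value of the transform contains the character of
 \<open>t\<close> as its cross term.\<close>

definition tent_pair :: "real \<Rightarrow> complex \<Rightarrow> 'a::euclidean_space \<Rightarrow> 'a \<Rightarrow> complex" where
 "tent_pair r c t x = of_real (tent r x) + c * of_real (tent r (x - t))"

lemma tent_pair_eq_0:
 assumes "r > 0" "norm (x::'a::euclidean_space) > r * real DIM('a) + norm t" shows "tent_pair r c t x = 0"
proof -
 have "norm x \<le> norm (x - t) + norm t" using norm_triangle_ineq[of "x - t" t] by simp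
 then have "norm x > r * real DIM('a)" "norm (x - t) > r * real DIM('a)" using assms(2) norm_ge_zero[of t] by linarith+
 then show ?thesis by (simp add: tent_pair_def tent_eq_0_norm[OF assms(1)])
qed

lemma tent_pair_test:
 fixes t :: "'a::euclidean_space"
 assumes r: "r > 0"
 shows continuous_tent_pair: "continuous_on UNIV (tent_pair r c t)"
  and cont_compact_supp_tent_pair: "cont_compact_supp (tent_pair r c t)"
  and integrable_tent_pair: "integrable lborel (tent_pair r c t)"
  and inv_fourier_tent_pair: "inv_fourier (tent_pair r c t) y = of_real (kap r y) * (1 + c * wave t y)"
proof -
 show c: "continuous_on UNIV (tent_pair r c t)" unfolding tent_pair_def by (intro continuous_intros)
 then show "cont_compact_supp (tent_pair r c t)"
  unfolding cont_compact_supp_def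
  using bounded_support_compact[of "r * real DIM('a) + norm t" "tent_pair r c t"] tent_pair_eq_0[OF r] by blast
 have i1: "integrable lborel (\<lambda>x::'a. complex_of_real (tent r x))"
  using integrable_tent[OF r, where 'a='a] by simp
 then have i2: "integrable lborel (\<lambda>x. complex_of_real (tent r (x - t)))"
  using lborel_translate(1)[of "\<lambda>x. complex_of_real (tent r x)" "- t"] by simp
 show "integrable lborel (tent_pair r c t)" unfolding tent_pair_def using i1 i2 by simp
 have "(LINT x|lborel. wave y x * complex_of_real (tent r (x - t))) = (LINT x|lborel. wave y (t + x) * complex_of_real (tent r (t + x - t)))"
  using lborel_translate(2)[of "\<lambda>x. wave y x * complex_of_real (tent r (x - t))" t] by simp
 also have "\<dots> = wave y t * (LINT x|lborel. wave y x * complex_of_real (tent r x))"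
  by (simp add: wave_add_right mult.assoc)
 also have "\<dots> = wave t y * of_real (kap r y)"
  using inv_fourier_tent[OF r, of y] by (simp add: inv_fourier_wave wave_commute)
 finally have shift: "(LINT x|lborel. wave y x * complex_of_real (tent r (x - t))) = wave t y * of_real (kap r y)" .
 have "inv_fourier (tent_pair r c t) y = (LINT x|lborel. wave y x * complex_of_real (tent r x) + c * (wave y x * complex_of_real (tent r (x - t))))"
  by (simp add: inv_fourier_wave tent_pair_def algebra_simps)
 also have "\<dots> = (LINT x|lborel. wave y x * complex_of_real (tent r x)) + (LINT x|lborel. c * (wave y x * complex_of_real (tent r (x - t))))"
  using i1 i2 by (intro lint_add integrable_mult_right integrable_wave_mult)
 also have "\<dots> = of_real (kap r y) + c * (wave t y * of_real (kap r y))"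
  using shift inv_fourier_tent[OF r, of y] by (simp add: inv_fourier_wave)
 finally show "inv_fourier (tent_pair r c t) y = of_real (kap r y) * (1 + c * wave t y)" by (simp add: algebra_simps)
qed

lemma polarisation:
 assumes "norm w = 1"
 shows "of_real ((norm (1 + 1 * w))^2) - \<i> * of_real ((norm (1 + \<i> * w))^2)
  - of_real ((norm (1 + (- 1) * w))^2) + \<i> * of_real ((norm (1 + (- \<i>) * w))^2) = 4 * w"
proof -
 have "(norm (1 + 1 * w))^2 - (norm (1 + (- 1) * w))^2 = 4 * Re w"
  "(norm (1 + (- \<i>) * w))^2 - (norm (1 + \<i> * w))^2 = 4 * Im w"
  by (simp_all only: cmod_power2) (simp_all add: power2_eq_square algebra_simps)
 then show ?thesis by (simp add: complex_eq_iff)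
qed

text \<open>The transform identity only concerns squares \<open>|\<phi>|\<^sup>2\<close> of transforms. Polarising it over a tent
 and a translate of it gives all characters, weighted by the square of a Fejer kernel.\<close>

lemma quadratic_zero:
 fixes X :: "'w \<Rightarrow> 'a::euclidean_space" and G :: "'w \<Rightarrow> complex"
 assumes P: "sigma_finite_measure P" and X [measurable]: "X \<in> borel_measurable P" and r: "r > 0"
  and G [measurable]: "G \<in> borel_measurable P" and int: "integrable P (\<lambda>w. of_real ((kap r (X w))^2) * G w)"
  and zero: "\<And>c t. norm c = 1 \<Longrightarrow> (LINT w|P. of_real ((norm (inv_fourier (tent_pair r c t) (X w)))^2) * G w) = 0"
  and A: "A \<in> sets borel"
 shows "(LINT w|P. indicator A (X w) * (of_real ((kap r (X w))^2) * G w)) = 0"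
proof (rule fourier_uniqueness[OF P X int _ A])
 fix t
 let ?q = "\<lambda>c w. complex_of_real ((norm (inv_fourier (tent_pair r c t) (X w)))^2) * G w"
 have q: "?q c w = of_real ((norm (1 + c * wave t (X w)))^2) * (of_real ((kap r (X w))^2) * G w)" for c w
  by (simp add: inv_fourier_tent_pair[OF r] norm_mult power_mult_distrib)
 have qi: "integrable P (?q c)" if "norm c = 1" for c
 proof (rule lintable_bound)
  show "integrable P (\<lambda>w. 4 * (of_real ((kap r (X w))^2) * G w))" using int by (rule integrable_mult_right)
  show "(\<lambda>w. ?q c w) \<in> borel_measurable P" unfolding q by measurable
  have "(norm (1 + c * wave t (X w)))^2 \<le> 2\<^sup>2" for w
   using norm_triangle_ineq[of 1 "c * wave t (X w)"] that by (intro power_mono) (auto simp: norm_mult)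
  then show "AE w in P. norm (?q c w) \<le> norm (4 * (of_real ((kap r (X w))^2) * G w))"
   unfolding q norm_mult[of _ "of_real ((kap r _)^2) * G _"]
   by (intro AE_I2 mult_right_mono) (auto simp: norm_power)
 qed
 have "wave t (X w) * (of_real ((kap r (X w))^2) * G w) = (1/4) * (?q 1 w - \<i> * ?q \<i> w - ?q (-1) w + \<i> * ?q (- \<i>) w)" for w
 proof -
  have "?q 1 w - \<i> * ?q \<i> w - ?q (-1) w + \<i> * ?q (- \<i>) w
   = (of_real ((norm (1 + 1 * wave t (X w)))^2) - \<i> * of_real ((norm (1 + \<i> * wave t (X w)))^2)
  - of_real ((norm (1 + (- 1) * wave t (X w)))^2) + \<i> * of_real ((norm (1 + (- \<i>) * wave t (X w)))^2))
   * (of_real ((kap r (X w))^2) * G w)"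
   unfolding q by (simp only: ring_distribs mult.assoc)
  then show ?thesis unfolding polarisation[OF norm_wave] by simp
 qed
 then have "(LINT w|P. wave t (X w) * (of_real ((kap r (X w))^2) * G w))
  = (LINT w|P. (1/4) * (?q 1 w - \<i> * ?q \<i> w - ?q (-1) w + \<i> * ?q (- \<i>) w))"
  by (intro lint_cong refl)
 also have "\<dots> = (1/4) * (LINT w|P. ?q 1 w - \<i> * ?q \<i> w - ?q (-1) w + \<i> * ?q (- \<i>) w)"
  by (rule integral_mult_right_zero)
 also have "(LINT w|P. ?q 1 w - \<i> * ?q \<i> w - ?q (-1) w + \<i> * ?q (- \<i>) w)
  = (LINT w|P. ?q 1 w) - (LINT w|P. \<i> * ?q \<i> w) - (LINT w|P. ?q (-1) w) + (LINT w|P. \<i> * ?q (- \<i>) w)"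
  using qi[of 1] qi[of \<i>] qi[of "-1"] qi[of "-\<i>"] by simp
 finally show "(LINT w|P. wave t (X w) * (of_real ((kap r (X w))^2) * G w)) = 0"
  using zero[of 1 t] zero[of \<i> t] zero[of "-1" t] zero[of "-\<i>" t] by simp
qed

lemma eventually_kap_pos:
 fixes x :: "'a::euclidean_space"
 obtains m :: nat where "kap (inverse (real (Suc m))) x > 0"
proof -
 obtain m :: nat where m: "norm x < real m" using reals_Archimedean2 by blast
 have "\<bar>inverse (real (Suc m)) * (x \<bullet> b)\<bar> < 1" if "b \<in> Basis" for b
 proof -
  have "\<bar>x \<bullet> b\<bar> < real (Suc m)" using Basis_le_norm[OF that, of x] m by simp
  then show ?thesis by (simp add: abs_mult field_simps)
 qed
 then show ?thesis using that[of m] by (intro that[of m] kap_pos)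
qed

text \<open>The kernels have zeros, but every point is avoided by the zeros of \<open>kap r\<close> for small \<open>r\<close>.\<close>

lemma AE_zero_of_kap:
 fixes G :: "'a::euclidean_space \<Rightarrow> complex"
 assumes R: "locally_finite R" and int: "\<And>r. 0 < r \<Longrightarrow> r \<le> 1 \<Longrightarrow> integrable R (\<lambda>x. of_real ((kap r x)^2) * G x)"
  and zero: "\<And>r A. 0 < r \<Longrightarrow> r \<le> 1 \<Longrightarrow> A \<in> sets borel \<Longrightarrow> (LINT x|R. indicator A x * (of_real ((kap r x)^2) * G x)) = 0"
 shows "AE x in R. G x = 0"
proof -
 interpret sigma_finite_measure R by (rule sigma_finite_locally_finite[OF R])
 have "AE x in R. of_real ((kap (inverse (real (Suc m))) x)^2) * G x = 0" for m
 proof (rule density_zero[OF int])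
  fix A assume "A \<in> sets R"
  then have "A \<in> sets borel" by (simp add: locally_finite_sets[OF R])
  then have "(LINT x|R. indicator A x * (of_real ((kap (inverse (real (Suc m))) x)^2) * G x)) = 0"
   by (intro zero) (auto simp: field_simps)
  moreover have "indicator A x * z = indicat_real A x *\<^sub>R z" for x and z :: complex by (simp add: indicator_def)
  ultimately show "(LINT x:A|R. of_real ((kap (inverse (real (Suc m))) x)^2) * G x) = 0"
   unfolding set_lebesgue_integral_def by simp
 qed (auto simp: field_simps)
 then have "AE x in R. \<forall>m. of_real ((kap (inverse (real (Suc m))) x)^2) * G x = 0" unfolding AE_all_countable by blast
 then show ?thesis
 proof eventually_elim
  case (elim x)
  obtain m where "kap (inverse (real (Suc m))) x > 0" by (rule eventually_kap_pos)
  then show ?case using elim[rule_format, of m] by simp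
 qed
qed

lemma radon_density_on:
 fixes \<nu> :: "'a::euclidean_space set \<Rightarrow> complex"
 assumes \<nu>: "complex_radon \<nu>" and R: "locally_finite R"
  and le: "\<And>A. A \<in> sets borel \<Longrightarrow> emeasure (total_variation \<nu>) A \<le> emeasure R A"
 obtains g where "g \<in> borel_measurable borel" "\<And>A. A \<in> bounded_borel \<Longrightarrow> set_integrable R A g"
  "\<And>A. A \<in> bounded_borel \<Longrightarrow> \<nu> A = (LINT x:A|R. g x)"
proof -
 note [measurable_cong] = locally_finite_sets[OF R]
 obtain h where h: "polar_density \<nu> h" using polar_density_exists[OF \<nu>] by blast
 then have [measurable]: "h \<in> borel_measurable borel" by (simp add: polar_density_def)
 have "absolutely_continuous R (total_variation \<nu>)"
  unfolding absolutely_continuous_def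
 proof
  fix A assume "A \<in> null_sets R"
  then show "A \<in> null_sets (total_variation \<nu>)"
   using le[of A] locally_finite_sets[OF R] by (auto simp: null_sets_def)
 qed
 then obtain r where r [measurable]: "r \<in> borel_measurable borel" and r0: "\<And>x. 0 \<le> r x"
  and T: "total_variation \<nu> = density R (\<lambda>x. ennreal (r x))"
  using locally_finite_RN_density[OF R locally_finite_total_variation[OF \<nu>]] by blast
 show ?thesis
 proof (rule that[of "\<lambda>x. r x *\<^sub>R h x"])
  fix A :: "'a set" assume A: "A \<in> bounded_borel"
  then have [measurable]: "A \<in> sets borel" by (rule bounded_borelD)
  show "set_integrable R A (\<lambda>x. r x *\<^sub>R h x)"
   using polar_set_integrable[OF \<nu> h A] unfolding T set_integrable_def
   by (subst (asm) integrable_density) (auto simp: r0 mult.commute)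
  have "\<nu> A = (LINT x:A|total_variation \<nu>. h x)" using h A by (simp add: polar_density_def)
  also have "\<dots> = (LINT x:A|R. r x *\<^sub>R h x)"
   unfolding T set_lebesgue_integral_def by (subst integral_density) (auto simp: r0 mult.commute)
  finally show "\<nu> A = (LINT x:A|R. r x *\<^sub>R h x)" .
 qed measurable
qed

text \<open>Both transforms have densities with respect to the sum of their variations, and the difference of the
 densities is annihilated by all weighted characters.\<close>

theorem fourier_transform_unique:
 fixes \<nu>1 \<nu>2 :: "'a::euclidean_space set \<Rightarrow> complex"
 assumes 1: "is_fourier_transform \<mu> \<nu>1" and 2: "is_fourier_transform \<mu> \<nu>2"
 shows "\<nu>1 = \<nu>2"
proof -
 let ?q = "\<lambda>(\<phi> :: 'a \<Rightarrow> complex) x. (norm (inv_fourier \<phi> x))\<^sup>2"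
 have \<nu>1: "complex_radon \<nu>1" and \<nu>2: "complex_radon \<nu>2" using 1 2 by (auto simp: is_fourier_transform_def)
 obtain R where R: "locally_finite R" and Re: "\<And>A. A \<in> sets borel \<Longrightarrow>
   emeasure R A = emeasure (total_variation \<nu>1) A + emeasure (total_variation \<nu>2) A"
  using locally_finite_add[OF locally_finite_total_variation[OF \<nu>1] locally_finite_total_variation[OF \<nu>2]] by blast
 note [measurable_cong] = locally_finite_sets[OF R]
 obtain g1 where g1: "g1 \<in> borel_measurable borel" "\<And>A. A \<in> bounded_borel \<Longrightarrow> set_integrable R A g1"
  "\<And>A. A \<in> bounded_borel \<Longrightarrow> \<nu>1 A = (LINT x:A|R. g1 x)"
  using radon_density_on[OF \<nu>1 R] Re by auto
 obtain g2 where g2: "g2 \<in> borel_measurable borel" "\<And>A. A \<in> bounded_borel \<Longrightarrow> set_integrable R A g2"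
  "\<And>A. A \<in> bounded_borel \<Longrightarrow> \<nu>2 A = (LINT x:A|R. g2 x)"
  using radon_density_on[OF \<nu>2 R] Re by auto
 note [measurable] = g1(1) g2(1)
 define G where "G x = g1 x - g2 x" for x
 have key: "integrable R (\<lambda>x. of_real (?q \<phi> x) * g1 x)"
   "integrable R (\<lambda>x. of_real (?q \<phi> x) * g2 x)"
   "(LINT x|R. of_real (?q \<phi> x) * G x) = 0"
  if \<phi>: "cont_compact_supp \<phi>" for \<phi>
 proof -
  have m [measurable]: "(\<lambda>x. complex_of_real (?q \<phi> x)) \<in> borel_measurable borel"
  proof -
   have [measurable]: "inv_fourier \<phi> \<in> borel_measurable borel" using 1 \<phi> by (simp add: is_fourier_transform_def)
   show ?thesis by measurable
  qed
  have "integrable (total_variation \<nu>1) (\<lambda>x. complex_of_real (?q \<phi> x))"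
   using 1 \<phi> unfolding is_fourier_transform_def by (intro integrable_of_real) auto
  then show i1: "integrable R (\<lambda>x. of_real (?q \<phi> x) * g1 x)"
   using integrable_total_variation_iff[OF \<nu>1 R g1 m] by simp
  have "integrable (total_variation \<nu>2) (\<lambda>x. complex_of_real (?q \<phi> x))"
   using 2 \<phi> unfolding is_fourier_transform_def by (intro integrable_of_real) auto
  then show i2: "integrable R (\<lambda>x. of_real (?q \<phi> x) * g2 x)"
   using integrable_total_variation_iff[OF \<nu>2 R g2 m] by simp
  have eq: "radon_integral \<nu>1 (\<lambda>x. of_real (?q \<phi> x)) = radon_integral \<nu>2 (\<lambda>x. of_real (?q \<phi> x))"
   using 1 2 \<phi> unfolding is_fourier_transform_def by metis
  show "(LINT x|R. of_real (?q \<phi> x) * G x) = 0"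
  proof -
   have "radon_integral \<nu>1 (\<lambda>x. of_real (?q \<phi> x)) = (LINT x|R. of_real (?q \<phi> x) * g1 x)"
    by (intro radon_integral_density[OF \<nu>1 R g1(1) _ _ m] g1(2,3))
   moreover have "radon_integral \<nu>2 (\<lambda>x. of_real (?q \<phi> x)) = (LINT x|R. of_real (?q \<phi> x) * g2 x)"
    by (intro radon_integral_density[OF \<nu>2 R g2(1) _ _ m] g2(2,3))
   ultimately have "(LINT x|R. of_real (?q \<phi> x) * g1 x) = (LINT x|R. of_real (?q \<phi> x) * g2 x)"
    using eq by metis
   then show ?thesis by (simp only: G_def right_diff_distrib lint_diff[OF i1 i2] diff_self)
  qed
 qed
 have "AE x in R. G x = 0"
 proof (rule AE_zero_of_kap[OF R])
  fix r :: real assume r: "0 < r" "r \<le> 1"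
  have t: "cont_compact_supp (tent_pair r 0 (0::'a))" by (rule cont_compact_supp_tent_pair[OF r(1)])
  have e: "(norm (inv_fourier (tent_pair r 0 0) x))^2 = (kap r x)^2" for x :: 'a
   by (simp add: inv_fourier_tent_pair[OF r(1)])
  show int: "integrable R (\<lambda>x. of_real ((kap r x)^2) * G x)"
   unfolding G_def right_diff_distrib using key(1,2)[OF t] unfolding e by (rule lintable_diff)
  fix A :: "'a set" assume "A \<in> sets borel"
  then show "(LINT x|R. indicator A x * (of_real ((kap r x)^2) * G x)) = 0"
   using sigma_finite_locally_finite[OF R] int r
   by (intro quadratic_zero key cont_compact_supp_tent_pair) (auto simp: G_def)
 qed
 then have eq: "AE x in R. g1 x = g2 x" by eventually_elim (simp add: G_def)
 have "\<nu>1 A = \<nu>2 A" for A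
 proof (cases "A \<in> bounded_borel")
  case True
  then have [measurable]: "A \<in> sets borel" by (rule bounded_borelD)
  have "(LINT x:A|R. g1 x) = (LINT x:A|R. g2 x)"
   unfolding set_lebesgue_integral_def using eq by (intro integral_cong_AE) (auto elim!: AE_mp)
  then show ?thesis using g1(3)[OF True] g2(3)[OF True] by simp
 next
  case False
  then show ?thesis using \<nu>1 \<nu>2 by (simp add: complex_radon_def)
 qed
 then show ?thesis by blast
qed

lemma fourier_measure_eq: "is_fourier_transform \<mu> \<nu> \<Longrightarrow> fourier_measure \<mu> = \<nu>"
 unfolding fourier_measure_def by (rule the_equality, assumption, rule fourier_transform_unique)

lemma AE_in_radon_support:
 assumes \<mu>: "complex_radon \<mu>" shows "AE x in total_variation \<mu>. x \<in> radon_support \<mu>"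
proof -
 let ?F = "{U. open U \<and> emeasure (total_variation \<mu>) U = 0}"
 obtain F' where F': "F' \<subseteq> ?F" "countable F'" "\<Union>F' = \<Union>?F"
 proof (rule Lindelof[of ?F])
  show "open U" if "U \<in> ?F" for U using that by simp
 qed
 have "(\<Union>U\<in>F'. U) \<in> null_sets (total_variation \<mu>)"
 proof (rule null_sets_UN'[OF F'(2)])
  fix U assume "U \<in> F'"
  then have "open U" "emeasure (total_variation \<mu>) U = 0" using F'(1) by auto
  then show "U \<in> null_sets (total_variation \<mu>)" by (simp add: null_sets_def)
 qed
 then have "\<Union>?F \<in> null_sets (total_variation \<mu>)" unfolding F'(3)[symmetric] by simp
 then have "AE x in total_variation \<mu>. x \<notin> \<Union>?F" by (rule AE_not_in)
 then show ?thesis by eventually_elim (auto simp: radon_support_def)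
qed

lemma autocorrelation_eq: "convolve \<phi> (reflect_cnj \<phi>) x = (LINT y|lborel. \<phi> y * cnj (\<phi> (y - x)))"
 by (simp add: convolve_def reflect_cnj_def)

lemma autocorrelation_modulate:
 "convolve (\<lambda>x. wave \<eta> x * \<phi> x) (reflect_cnj (\<lambda>x. wave \<eta> x * \<phi> x)) x
  = wave \<eta> x * convolve \<phi> (reflect_cnj \<phi>) x"
proof -
 have eq: "wave \<eta> y * \<phi> y * cnj (wave \<eta> (y - x) * \<phi> (y - x)) = wave \<eta> x * (\<phi> y * cnj (\<phi> (y - x)))" for y
 proof -
  have "wave \<eta> y * cnj (wave \<eta> (y - x)) = wave \<eta> y * wave \<eta> (- (y - x))"
   by (simp only: wave_minus wave_minus_right)
  also have "\<dots> = wave \<eta> x" by (simp flip: wave_add_right)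
  finally show ?thesis by (simp add: mult_ac)
 qed
 show ?thesis unfolding autocorrelation_eq eq by (rule integral_mult_right_zero)
qed

lemma autocorrelation_bounds:
 fixes \<phi> :: "'a::euclidean_space \<Rightarrow> complex"
 assumes c: "continuous_on UNIV \<phi>" and B: "\<And>x. norm (\<phi> x) \<le> B" and R: "\<And>x. norm x > R \<Longrightarrow> \<phi> x = 0"
  and int: "integrable lborel \<phi>"
 shows "convolve \<phi> (reflect_cnj \<phi>) \<in> borel_measurable borel"
  and "norm (convolve \<phi> (reflect_cnj \<phi>) x) \<le> (LINT y|lborel. norm (\<phi> y)) * B"
  and "norm x > 2 * R \<Longrightarrow> convolve \<phi> (reflect_cnj \<phi>) x = 0"
proof -
 have [measurable]: "\<phi> \<in> borel_measurable borel" using c by (rule borel_measurable_continuous_onI)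
 have [measurable]: "cnj \<in> borel_measurable borel"
  by (intro borel_measurable_continuous_onI continuous_intros)
 have "(\<lambda>x. LINT y|lborel. \<phi> y * cnj (\<phi> (y - x))) \<in> borel_measurable borel"
  by measurable
 then show "convolve \<phi> (reflect_cnj \<phi>) \<in> borel_measurable borel"
  by (simp add: autocorrelation_eq[abs_def])
 have "norm (convolve \<phi> (reflect_cnj \<phi>) x) \<le> (LINT y|lborel. norm (\<phi> y * cnj (\<phi> (y - x))))"
  unfolding autocorrelation_eq by (rule integral_norm_bound)
 also have "\<dots> \<le> (LINT y|lborel. norm (\<phi> y) * B)"
 proof (rule integral_mono')
  show "integrable lborel (\<lambda>y. norm (\<phi> y) * B)" using integrable_norm[OF int] by simp
 qed (auto simp: norm_mult intro!: mult_left_mono B mult_nonneg_nonneg order_trans[OF norm_ge_zero B])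
 finally show "norm (convolve \<phi> (reflect_cnj \<phi>) x) \<le> (LINT y|lborel. norm (\<phi> y)) * B" by simp
 assume x: "norm x > 2 * R"
 have eq0: "\<phi> y * cnj (\<phi> (y - x)) = 0" for y
 proof (cases "norm y > R")
  case False
  have "norm x \<le> norm y + norm (y - x)" using norm_triangle_ineq[of y "x - y"] by (simp add: norm_minus_commute)
  then have "norm (y - x) > R" using x False by linarith
  then show ?thesis by (simp add: R)
 qed (simp add: R)
 show "convolve \<phi> (reflect_cnj \<phi>) x = 0" unfolding autocorrelation_eq eq0 by simp
qed

lemma AE_summable_of_integrals:
 fixes F :: "nat \<Rightarrow> 'w \<Rightarrow> 'b::{banach, second_countable_topology}"
 assumes F: "\<And>k. integrable M (F k)" and s: "summable (\<lambda>k. LINT x|M. norm (F k x))"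
 shows "AE x in M. summable (\<lambda>k. norm (F k x))"
proof -
 note [measurable] = borel_measurable_integrable[OF F]
 have "(\<integral>\<^sup>+x. (\<Sum>k. ennreal (norm (F k x))) \<partial>M) = (\<Sum>k. \<integral>\<^sup>+x. ennreal (norm (F k x)) \<partial>M)"
  by (rule nn_integral_suminf) measurable
 also have "\<dots> = (\<Sum>k. ennreal (LINT x|M. norm (F k x)))"
  using F by (intro suminf_cong nn_integral_eq_integral) auto
 also have "\<dots> \<noteq> \<infinity>"
 proof -
  have "0 \<le> (LINT x|M. norm (F k x))" for k by (rule integral_nonneg_AE) simp
  from ennreal_suminf_neq_top[OF s this] show ?thesis by (simp only: infinity_ennreal_def not_False_eq_True)
 qed
 finally have fin: "(\<integral>\<^sup>+x. (\<Sum>k. ennreal (norm (F k x))) \<partial>M) \<noteq> \<infinity>" .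
 have "AE x in M. (\<Sum>k. ennreal (norm (F k x))) \<noteq> \<infinity>"
  by (rule nn_integral_PInf_AE[OF _ fin]) measurable
 then show ?thesis
 proof eventually_elim
  case (elim x)
  then show ?case by (intro summable_suminf_not_top) auto
 qed
qed

text \<open>If a sum of characters \<open>a k * wave (\<eta> k)\<close> vanishes on the support of \<open>\<mu>\<close>, then the
 corresponding sum of translates of the transform \<open>\<nu>\<close> vanishes as a measure. The sum of translates
 is handled as the image of one measure on \<open>\<nat> \<times> \<real>\<^sup>d\<close> under \<open>(k, x) \<mapsto> x + \<eta> k\<close>.\<close>

lemma transform_translate_relation:
 fixes \<mu> \<nu> :: "'a::euclidean_space set \<Rightarrow> complex"
 assumes \<mu>: "complex_radon \<mu>" and ft: "is_fourier_transform \<mu> \<nu>"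
  and a: "summable (\<lambda>k. norm (a k))"
  and zero: "AE x in total_variation \<mu>. (\<lambda>k. a k * wave (\<eta> k) x) sums 0"
  and r: "0 < r" "r \<le> 1" and A [measurable]: "A \<in> sets borel"
 shows "(\<Sum>k. a k * radon_integral \<nu> (\<lambda>x. indicator A (x + \<eta> k) * of_real ((kap r (x + \<eta> k))^2))) = 0"
proof -
 have \<nu>: "complex_radon \<nu>"
  and L2: "\<And>\<phi>. cont_compact_supp \<phi> \<Longrightarrow> integrable (total_variation \<nu>) (\<lambda>x. (norm (inv_fourier \<phi> x))\<^sup>2)"
  and eq: "\<And>\<phi>. cont_compact_supp \<phi> \<Longrightarrow> radon_integral \<mu> (convolve \<phi> (reflect_cnj \<phi>))
     = radon_integral \<nu> (\<lambda>x. of_real ((norm (inv_fourier \<phi> x))^2))"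
  using ft by (auto simp: is_fourier_transform_def)
 let ?M = "total_variation \<nu>"
 obtain h where hp: "polar_density \<nu> h" using polar_density_exists[OF \<nu>] by blast
 then have [measurable]: "h \<in> borel_measurable borel" and h1: "\<And>x. norm (h x) = 1"
  by (auto simp: polar_density_def)
 obtain g where gp: "polar_density \<mu> g" using polar_density_exists[OF \<mu>] by blast
 then have [measurable]: "g \<in> borel_measurable borel" and g1: "\<And>x. norm (g x) = 1"
  by (auto simp: polar_density_def)
 have tb: "translation_bounded ?M" by (rule transform_translation_bounded[OF \<nu> L2])
 obtain C where C: "0 \<le> C"
  "\<And>r (s::'a). 0 < r \<Longrightarrow> r \<le> 1 \<Longrightarrow> (\<integral>\<^sup>+x. ennreal (kap r (x - s)) \<partial>?M) \<le> ennreal (C / r ^ DIM('a))"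
  using kap_average[OF tb] by blast
 define C' where "C' = C / r ^ DIM('a)"
 have C'0: "0 \<le> C'" using C(1) r by (simp add: C'_def)
 have k2: "(kap r x)^2 \<le> kap r x" for x :: 'a
  using kap_nonneg[of r x] kap_le_1[of r x] by (simp add: power2_eq_square mult_left_le)
 have kint: "integrable ?M (\<lambda>x. (kap r (x + s))\<^sup>2)" "(LINT x|?M. (kap r (x + s))\<^sup>2) \<le> C'" for s :: 'a
 proof -
  have "(\<integral>\<^sup>+x. ennreal ((kap r (x + s))^2) \<partial>?M) \<le> (\<integral>\<^sup>+x. ennreal (kap r (x - (- s))) \<partial>?M)"
   using k2 by (intro nn_integral_mono ennreal_leI) simp
  also have "\<dots> \<le> ennreal C'" unfolding C'_def by (rule C(2)[OF r])
  finally have le: "(\<integral>\<^sup>+x. ennreal ((kap r (x + s))^2) \<partial>?M) \<le> ennreal C'" .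
  show i: "integrable ?M (\<lambda>x. (kap r (x + s))\<^sup>2)"
   using le by (intro integrableI_bounded) (auto intro: le_less_trans)
  have "ennreal (LINT x|?M. (kap r (x + s))\<^sup>2) \<le> ennreal C'"
   using le i by (subst nn_integral_eq_integral[symmetric]) auto
  then show "(LINT x|?M. (kap r (x + s))\<^sup>2) \<le> C'" using C'0 by simp
 qed
 let ?P = "count_space (UNIV :: nat set) \<Otimes>\<^sub>M ?M"
 have sfM: "sigma_finite_measure ?M"
  by (rule sigma_finite_locally_finite[OF locally_finite_total_variation[OF \<nu>]])
 interpret pair_sigma_finite "count_space (UNIV :: nat set)" ?M
  using sfM sigma_finite_measure_count_space[where 'a=nat] by (simp add: pair_sigma_finite_def)
 define X where "X = (\<lambda>(k, x). x + \<eta> k)"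
 define G where "G = (\<lambda>(k, x). a k * h x)"
 have X [measurable]: "X \<in> borel_measurable ?P"
  unfolding X_def by (rule measurable_pair_measure_countable1) auto
 have G [measurable]: "G \<in> borel_measurable ?P"
  unfolding G_def by (rule measurable_pair_measure_countable1) auto
 have int_k2: "integrable ?P (\<lambda>w. of_real ((kap r (X w))^2) * G w)"
 proof (rule Fubini_integrable)
  show "(\<lambda>w. of_real ((kap r (X w))^2) * G w) \<in> borel_measurable ?P" by measurable
  have "(LINT x|?M. norm (of_real ((kap r (X (k, x)))^2) * G (k, x))) = norm (a k) * (LINT x|?M. (kap r (x + \<eta> k))\<^sup>2)" for k
   by (simp add: X_def G_def norm_mult h1 norm_power mult.commute)
  moreover have "summable (\<lambda>k. norm (a k) * (LINT x|?M. (kap r (x + \<eta> k))\<^sup>2))"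
  proof (rule summable_comparison_test')
   show "summable (\<lambda>k. norm (a k) * C')" using a by (rule summable_mult2)
   show "norm (norm (a k) * (LINT x|?M. (kap r (x + \<eta> k))\<^sup>2)) \<le> norm (a k) * C'" for k
    using kint(2)[of "\<eta> k"] by (simp add: abs_mult mult_left_mono)
  qed
  ultimately show "integrable (count_space UNIV) (\<lambda>k. LINT x|?M. norm (of_real ((kap r (X (k, x)))^2) * G (k, x)))"
   by (subst integrable_count_space_nat_iff) (simp add: abs_mult)
  have "integrable ?M (\<lambda>x. of_real ((kap r (X (k, x)))^2) * G (k, x))" for k
   unfolding X_def G_def
   by (rule lintable_bound[OF integrable_mult_right[OF kint(1)[of "\<eta> k"], of "norm (a k)"]])
    (auto simp: norm_mult h1 norm_power mult.commute)
  then show "AE k in count_space UNIV. integrable ?M (\<lambda>x. of_real ((kap r (X (k, x)))^2) * G (k, x))" by simp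
 qed
 have bounded_integrable: "integrable ?P (\<lambda>w. b w * (of_real ((kap r (X w))^2) * G w))"
  if [measurable]: "b \<in> borel_measurable ?P" and le: "\<And>w. norm (b w) \<le> 4" for b :: "nat \<times> 'a \<Rightarrow> complex"
 proof (rule lintable_bound[OF integrable_mult_right[OF int_k2, of 4]])
  show "AE w in ?P. norm (b w * (of_real ((kap r (X w))^2) * G w)) \<le> norm (4 * (of_real ((kap r (X w))^2) * G w))"
   unfolding norm_mult[of _ "of_real ((kap r _)^2) * G _"] using le by (intro AE_I2 mult_right_mono) auto
 qed measurable
 have product_integral: "(LINT w|?P. b w * (of_real ((kap r (X w))^2) * G w))
   = (\<Sum>k. a k * radon_integral \<nu> (\<lambda>x. b (k, x) * of_real ((kap r (x + \<eta> k))^2)))"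
  if b [measurable]: "b \<in> borel_measurable ?P" and le: "\<And>w. norm (b w) \<le> 4" for b :: "nat \<times> 'a \<Rightarrow> complex"
 proof -
  note i = bounded_integrable[OF b le]
  have "(LINT w|?P. b w * (of_real ((kap r (X w))^2) * G w))
   = (LINT k|count_space UNIV. LINT x|?M. b (k, x) * (of_real ((kap r (X (k, x)))^2) * G (k, x)))"
   by (rule integral_fst'[OF i, symmetric])
  also have "\<dots> = (\<Sum>k. LINT x|?M. b (k, x) * (of_real ((kap r (X (k, x)))^2) * G (k, x)))"
   by (rule integral_count_space_nat) (rule integrable_fst'[OF i])
  also have "\<dots> = (\<Sum>k. a k * radon_integral \<nu> (\<lambda>x. b (k, x) * of_real ((kap r (x + \<eta> k))^2)))"
  proof (rule suminf_cong)
   fix k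
   have [measurable]: "(\<lambda>x. b (k, x)) \<in> borel_measurable borel"
    using measurable_Pair2[OF b, of k] by (simp cong: measurable_cong_sets)
   have "radon_integral \<nu> (\<lambda>x. b (k, x) * of_real ((kap r (x + \<eta> k))^2))
    = (LINT x|?M. b (k, x) * of_real ((kap r (x + \<eta> k))^2) * h x)"
    by (rule radon_integral_polar[OF \<nu> hp]) measurable
   then show "(LINT x|?M. b (k, x) * (of_real ((kap r (X (k, x)))^2) * G (k, x)))
    = a k * radon_integral \<nu> (\<lambda>x. b (k, x) * of_real ((kap r (x + \<eta> k))^2))"
    unfolding integral_mult_right_zero[symmetric] X_def G_def by (simp add: mult_ac)
  qed
  finally show ?thesis .
 qed
 have "(LINT w|?P. indicator A (X w) * (of_real ((kap r (X w))^2) * G w)) = 0"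
 proof (rule quadratic_zero[OF _ X r(1) G int_k2 _ A])
  show "sigma_finite_measure ?P"
   using sfM sigma_finite_measure_count_space[where 'a=nat] by (intro sigma_finite_pair_measure)
  fix c :: complex and t :: 'a assume c: "norm c = 1"
  let ?\<phi> = "tent_pair r c t"
  let ?K = "convolve ?\<phi> (reflect_cnj ?\<phi>)"
  let ?b = "\<lambda>w. complex_of_real ((norm (1 + c * wave t (X w)))^2)"
  have nb: "norm (?b w) \<le> 4" for w
  proof -
   have "(norm (1 + c * wave t (X w)))^2 \<le> 2\<^sup>2"
    using norm_triangle_ineq[of 1 "c * wave t (X w)"] c by (intro power_mono) (auto simp: norm_mult)
   then show ?thesis by (simp add: norm_power)
  qed
  have inv: "of_real ((norm (inv_fourier ?\<phi> (x + \<eta> k)))^2) = ?b (k, x) * of_real ((kap r (x + \<eta> k))^2)" for k x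
   by (simp add: inv_fourier_tent_pair[OF r(1)] norm_mult power_mult_distrib X_def mult.commute)
  have ccs: "cont_compact_supp (\<lambda>x. wave (\<eta> k) x * ?\<phi> x)" for k
   unfolding cont_compact_supp_def
  proof
   show "continuous_on UNIV (\<lambda>x. wave (\<eta> k) x * ?\<phi> x)"
    using continuous_tent_pair[OF r(1)] by (intro continuous_intros)
   show "compact (closure {x. wave (\<eta> k) x * ?\<phi> x \<noteq> 0})"
    by (rule bounded_support_compact[of "r * real DIM('a) + norm t"]) (simp add: tent_pair_eq_0[OF r(1)])
  qed
  have tr: "radon_integral \<nu> (\<lambda>x. ?b (k, x) * of_real ((kap r (x + \<eta> k))^2)) = radon_integral \<mu> (\<lambda>x. wave (\<eta> k) x * ?K x)" for k
   using eq[OF ccs[of k]] unfolding inv_fourier_wave_mult autocorrelation_modulate[abs_def] inv by simp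
  have B: "norm (?\<phi> x) \<le> 2 / r ^ DIM('a)" for x
  proof -
   have "norm (?\<phi> x) \<le> tent r x + tent r (x - t)"
    using norm_triangle_ineq[of "complex_of_real (tent r x)" "c * of_real (tent r (x - t))"] c tent_nonneg[OF r(1), of x] tent_nonneg[OF r(1), of "x - t"]
    by (simp add: tent_pair_def norm_mult)
   then show ?thesis using tent_le[OF r(1), of x] tent_le[OF r(1), of "x - t"] by simp
  qed
  have z: "?\<phi> x = 0" if "norm x > r * real DIM('a) + norm t" for x using that by (rule tent_pair_eq_0[OF r(1)])
  have K: "?K \<in> borel_measurable borel"
   "\<And>x. norm (?K x) \<le> (LINT y|lborel. norm (?\<phi> y)) * (2 / r ^ DIM('a))"
   "\<And>x. norm x > 2 * (r * real DIM('a) + norm t) \<Longrightarrow> ?K x = 0"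
   using autocorrelation_bounds[of ?\<phi> "2 / r ^ DIM('a)" "r * real DIM('a) + norm t"]
    continuous_tent_pair[OF r(1)] B z integrable_tent_pair[OF r(1)] by blast+
  define K0 where "K0 = (LINT y|lborel. norm (?\<phi> y)) * (2 / r ^ DIM('a))"
  define R0 where "R0 = 2 * (r * real DIM('a) + norm t)"
  note [measurable] = K(1)
  have Kint: "integrable (total_variation \<mu>) (\<lambda>x. ?K x * g x)"
  proof (rule lintable_bound)
   show "integrable (total_variation \<mu>) (\<lambda>x. K0 * indicat_real (cball 0 R0) x)"
    using total_variation_finite[OF \<mu>, of "cball 0 R0"] by (intro integrable_mult_right integrable_real_indicator) auto
   show "AE x in total_variation \<mu>. norm (?K x * g x) \<le> norm (K0 * indicat_real (cball 0 R0) x)"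
   proof (rule AE_I2)
    fix x
    show "norm (?K x * g x) \<le> norm (K0 * indicat_real (cball 0 R0) x)"
    proof (cases "norm x \<le> R0")
     case True
     have "norm (?K x * g x) \<le> K0" using K(2)[of x] by (simp only: norm_mult g1 K0_def mult_1_right)
     also have "K0 \<le> norm (K0 * indicat_real (cball 0 R0) x)" using True by simp
     finally show ?thesis .
    next
     case False
     then show ?thesis using K(3)[of x] by (simp add: R0_def)
    qed
   qed
  qed measurable
  let ?F = "\<lambda>k x. a k * (wave (\<eta> k) x * (?K x * g x))"
  have Fi: "integrable (total_variation \<mu>) (?F k)" for k
   by (intro integrable_mult_right integrable_wave_times Kint) auto
  have nF: "norm (?F k x) = norm (a k) * norm (?K x * g x)" for k x by (simp add: norm_mult)
  have Fs: "summable (\<lambda>k. LINT x|total_variation \<mu>. norm (?F k x))"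
   unfolding nF using a by (simp add: summable_mult2)
  have Fs': "AE x in total_variation \<mu>. summable (\<lambda>k. norm (?F k x))"
   unfolding nF using a by (intro AE_I2 summable_mult2)
  have "(LINT w|?P. of_real ((norm (inv_fourier ?\<phi> (X w)))^2) * G w) = (LINT w|?P. ?b w * (of_real ((kap r (X w))^2) * G w))"
   by (intro lint_cong refl)
    (simp add: inv_fourier_tent_pair[OF r(1)] norm_mult power_mult_distrib)
  also have "\<dots> = (\<Sum>k. a k * radon_integral \<nu> (\<lambda>x. ?b (k, x) * of_real ((kap r (x + \<eta> k))^2)))"
   by (rule product_integral[OF _ nb]) measurable
  also have "\<dots> = (\<Sum>k. LINT x|total_variation \<mu>. ?F k x)"
  proof (rule suminf_cong)
   fix k
   have "radon_integral \<mu> (\<lambda>x. wave (\<eta> k) x * ?K x) = (LINT x|total_variation \<mu>. wave (\<eta> k) x * ?K x * g x)"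
    by (rule radon_integral_polar[OF \<mu> gp]) measurable
   then show "a k * radon_integral \<nu> (\<lambda>x. ?b (k, x) * of_real ((kap r (x + \<eta> k))^2)) = (LINT x|total_variation \<mu>. ?F k x)"
    unfolding tr by (simp add: mult.assoc)
  qed
  also have "\<dots> = (LINT x|total_variation \<mu>. (\<Sum>k. ?F k x))" by (rule integral_suminf[OF Fi Fs' Fs, symmetric])
  also have "\<dots> = (LINT x|total_variation \<mu>. 0)"
  proof (rule integral_cong_AE)
   show "AE x in total_variation \<mu>. (\<Sum>k. ?F k x) = 0"
    using zero
   proof eventually_elim
    case (elim x)
    have "(\<lambda>k. a k * wave (\<eta> k) x * (?K x * g x)) sums (0 * (?K x * g x))" by (rule sums_mult2[OF elim])
    then show ?case by (simp add: sums_iff mult.assoc)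
   qed
   show "(\<lambda>x. \<Sum>k. ?F k x) \<in> borel_measurable (total_variation \<mu>)"
    using Fi by (intro borel_measurable_suminf) auto
  qed simp
  finally show "(LINT w|?P. of_real ((norm (inv_fourier ?\<phi> (X w)))^2) * G w) = 0" by simp
 qed
 also have "(LINT w|?P. indicator A (X w) * (of_real ((kap r (X w))^2) * G w))
  = (\<Sum>k. a k * radon_integral \<nu> (\<lambda>x. indicator A (X (k, x)) * of_real ((kap r (x + \<eta> k))^2)))"
  by (rule product_integral) (auto simp: indicator_def)
 finally show ?thesis by (simp add: X_def)
qed

text \<open>The absolutely continuous part is dominated by the whole measure.\<close>

lemma translation_bounded_density:
 assumes "translation_bounded M" and f: "locally_integrable f"
  and le: "\<And>\<psi>. \<psi> \<in> borel_measurable borel \<Longrightarrow> (\<integral>\<^sup>+x. \<psi> x * ennreal (norm (f x)) \<partial>lborel) \<le> (\<integral>\<^sup>+x. \<psi> x \<partial>M)"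
 shows "translation_bounded (abs_density f)"
proof -
 let ?D = "abs_density f"
 have [measurable]: "f \<in> borel_measurable borel" using f by (simp add: locally_integrable_def)
 obtain B where M: "locally_finite M" and B: "0 \<le> B" "\<And>t. emeasure M (cube t) \<le> ennreal B"
  using assms(1) by (auto simp: translation_bounded_def)
 have D: "emeasure ?D A \<le> emeasure M A" if [measurable]: "A \<in> sets borel" for A
  using le[of "indicator A"] locally_finite_sets[OF M] by (simp add: emeasure_density mult.commute)
 have "locally_finite ?D"
  using M D by (auto simp: locally_finite_def bounded_borel_def intro: le_less_trans)
 moreover have "emeasure ?D (cube t) \<le> ennreal B" for t using D[of "cube t"] B(2)[of t] by simp
 ultimately show ?thesis using B(1) by (auto simp: translation_bounded_def)
qed

text \<open>Singular parts stay singular under a sum of countably many translates, so the relation passes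
 to the density of the absolutely continuous part.\<close>

lemma density_translate_relation:
 fixes \<mu> \<nu> :: "'a::euclidean_space set \<Rightarrow> complex"
 assumes \<mu>: "complex_radon \<mu>" and ft: "is_fourier_transform \<mu> \<nu>"
  and a: "summable (\<lambda>k. norm (a k))"
  and zero: "AE x in total_variation \<mu>. (\<lambda>k. a k * wave (\<eta> k) x) sums 0"
  and f: "locally_integrable f" and tb: "translation_bounded (abs_density f)"
  and N: "N \<in> null_sets lborel"
  and fN: "\<And>\<psi>. \<psi> \<in> borel_measurable borel \<Longrightarrow> (\<And>x. x \<in> N \<Longrightarrow> \<psi> x = 0) \<Longrightarrow>
   radon_integral \<nu> \<psi> = (LINT x|lborel. \<psi> x * f x)"
 shows "AE y in lborel. (\<lambda>k. a k * f (y - \<eta> k)) sums 0"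
proof -
 have [measurable]: "f \<in> borel_measurable borel" using f by (simp add: locally_integrable_def)
 have [measurable]: "N \<in> sets borel" using N by auto
 obtain C where C: "0 \<le> C"
  "\<And>r (s::'a). 0 < r \<Longrightarrow> r \<le> 1 \<Longrightarrow> (\<integral>\<^sup>+x. ennreal (kap r (x - s)) \<partial>abs_density f) \<le> ennreal (C / r ^ DIM('a))"
  using kap_average[OF tb] by blast
 let ?F = "\<lambda>r k y. a k * (of_real ((kap r y)^2) * f (y - \<eta> k))"
 have k2: "(kap r x)^2 \<le> kap r x" for x :: 'a and r
  using kap_nonneg[of r x] kap_le_1[of r x] by (simp add: power2_eq_square mult_left_le)
 have F: "integrable lborel (\<lambda>y. of_real ((kap r y)^2) * f (y - s))"
  "(LINT y|lborel. norm (of_real ((kap r y)^2) * f (y - s))) \<le> C / r ^ DIM('a)" if r: "0 < r" "r \<le> 1" for r s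
 proof -
  have "(\<integral>\<^sup>+y. ennreal (norm (of_real ((kap r (s + y))^2) * f y)) \<partial>lborel)
   \<le> (\<integral>\<^sup>+y. ennreal (norm (f y)) * ennreal (kap r (y - (- s))) \<partial>lborel)"
  proof (rule nn_integral_mono)
   fix y
   have "norm (complex_of_real ((kap r (s + y))^2) * f y) \<le> norm (f y) * kap r (y - (- s))"
    using mult_left_mono[OF k2[of r "s + y"], of "norm (f y)"]
    by (simp add: norm_mult norm_power add.commute mult.commute)
   then show "ennreal (norm (of_real ((kap r (s + y))^2) * f y)) \<le> ennreal (norm (f y)) * ennreal (kap r (y - (- s)))"
    by (simp only: ennreal_mult[OF norm_ge_zero kap_nonneg, symmetric] ennreal_leI)
  qed
  also have "\<dots> = (\<integral>\<^sup>+x. ennreal (kap r (x - (- s))) \<partial>abs_density f)"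
   by (rule nn_integral_density[symmetric]) auto
  also have "\<dots> \<le> ennreal (C / r ^ DIM('a))" by (rule C(2)[OF r])
  finally have le: "(\<integral>\<^sup>+y. ennreal (norm (of_real ((kap r (s + y))^2) * f y)) \<partial>lborel) \<le> ennreal (C / r ^ DIM('a))" .
  have i: "integrable lborel (\<lambda>y. of_real ((kap r (s + y))^2) * f y)"
   using le by (intro integrableI_bounded) (auto intro: le_less_trans)
  have tr: "(\<lambda>y. of_real ((kap r (s + y))^2) * f y) = (\<lambda>y. (\<lambda>y. of_real ((kap r y)^2) * f (y - s)) (s + y))" by simp
  show "integrable lborel (\<lambda>y. of_real ((kap r y)^2) * f (y - s))"
   using i unfolding tr by (subst (asm) lborel_translate(1))
  have "ennreal (LINT y|lborel. norm (of_real ((kap r (s + y))^2) * f y)) \<le> ennreal (C / r ^ DIM('a))"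
   using le i by (subst nn_integral_eq_integral[symmetric]) auto
  then have "(LINT y|lborel. norm (of_real ((kap r (s + y))^2) * f y)) \<le> C / r ^ DIM('a)" using C(1) r by simp
  then show "(LINT y|lborel. norm (of_real ((kap r y)^2) * f (y - s))) \<le> C / r ^ DIM('a)"
   using lborel_translate(2)[of "\<lambda>y. norm (of_real ((kap r y)^2) * f (y - s))" s] by simp
 qed
 have Fs: "summable (\<lambda>k. LINT y|lborel. norm (?F r k y))" if r: "0 < r" "r \<le> 1" for r
 proof (rule summable_comparison_test')
  show "summable (\<lambda>k. norm (a k) * (C / r ^ DIM('a)))" using a by (rule summable_mult2)
  show "norm (LINT y|lborel. norm (?F r k y)) \<le> norm (a k) * (C / r ^ DIM('a))" for k
   unfolding norm_mult[of "a k"] using mult_left_mono[OF F(2)[OF r, of "\<eta> k"] norm_ge_zero[of "a k"]]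
   by (simp add: abs_mult)
 qed
 have Fi: "integrable lborel (?F r k)" if r: "0 < r" "r \<le> 1" for r k
  using F(1)[OF r] by (rule integrable_mult_right)
 have AEs: "AE y in lborel. summable (\<lambda>k. norm (?F r k y))" if r: "0 < r" "r \<le> 1" for r
  by (rule AE_summable_of_integrals[OF Fi[OF r] Fs[OF r]])
 have summ: "AE y in lborel. summable (\<lambda>k. norm (a k * f (y - \<eta> k)))"
 proof -
  have "AE y in lborel. \<forall>m. summable (\<lambda>k. norm (?F (inverse (real (Suc m))) k y))"
   unfolding AE_all_countable by (intro allI AEs) (auto simp: field_simps)
  then show ?thesis
  proof eventually_elim
   case (elim y)
   obtain m where m: "kap (inverse (real (Suc m))) y > 0" by (rule eventually_kap_pos)
   have "summable (\<lambda>k. norm (?F (inverse (real (Suc m))) k y) / (kap (inverse (real (Suc m))) y)^2)"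
    using elim by (intro summable_divide) blast
   moreover have "norm (?F (inverse (real (Suc m))) k y) / (kap (inverse (real (Suc m))) y)^2 = norm (a k * f (y - \<eta> k))" for k
    using m by (simp add: norm_mult norm_power del: of_nat_Suc)
   ultimately show ?case by (simp only:)
  qed
 qed
 define G where "G y = (\<Sum>k. a k * f (y - \<eta> k))" for y
 have GF: "AE y in lborel. (\<Sum>k. ?F r k y) = of_real ((kap r y)^2) * G y" for r
  using summ
 proof eventually_elim
  case (elim y)
  have "of_real ((kap r y)^2) * G y = (\<Sum>k. of_real ((kap r y)^2) * (a k * f (y - \<eta> k)))"
   unfolding G_def by (rule suminf_mult[symmetric, OF summable_norm_cancel[OF elim]])
  then show ?case by (simp add: mult_ac)
 qed
 have [measurable]: "G \<in> borel_measurable borel" unfolding G_def by measurable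
 have "AE y in lborel. G y = 0"
 proof (rule AE_zero_of_kap[OF locally_finite_lborel])
  fix r :: real assume r: "0 < r" "r \<le> 1"
  have "integrable lborel (\<lambda>y. \<Sum>k. ?F r k y)" by (rule integrable_suminf[OF Fi[OF r] AEs[OF r] Fs[OF r]])
  then show "integrable lborel (\<lambda>y. of_real ((kap r y)^2) * G y)"
   by (rule integrable_cong_AE_imp) (use GF[of r] in \<open>auto elim!: AE_mp\<close>)
  fix A :: "'a set" assume [measurable]: "A \<in> sets borel"
  define N' where "N' = (\<Union>k. (\<lambda>y. y - \<eta> k) -` N)"
  have N'm [measurable]: "N' \<in> sets borel"
  proof -
   have "(\<lambda>y. y - \<eta> k) -` N \<inter> space borel \<in> sets borel" for k by measurable
   then show ?thesis unfolding N'_def by auto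
  qed
  have AEN: "AE y in lborel. y \<notin> N'"
  proof -
   have "AE y in lborel. y - \<eta> k \<notin> N" for k
   proof -
    have "AE y in distr lborel borel ((+) (- \<eta> k)). y \<notin> N"
     unfolding lborel_distr_plus by (rule AE_not_in[OF N])
    then show ?thesis by (subst (asm) AE_distr_iff) auto
   qed
   then have "AE y in lborel. \<forall>k. y - \<eta> k \<notin> N" by (simp add: AE_all_countable)
   then show ?thesis by eventually_elim (auto simp: N'_def)
  qed
  let ?A = "A - N'"
  have "(LINT y|lborel. indicator A y * (of_real ((kap r y)^2) * G y)) = (LINT y|lborel. (\<Sum>k. indicator ?A y * ?F r k y))"
  proof (rule integral_cong_AE)
   show "AE y in lborel. indicator A y * (of_real ((kap r y)^2) * G y) = (\<Sum>k. indicator ?A y * ?F r k y)"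
    using GF[of r] AEs[OF r] AEN
   proof eventually_elim
    case (elim y)
    then show ?case by (auto simp: indicator_def suminf_mult summable_norm_cancel)
   qed
  qed measurable
  also have "\<dots> = (\<Sum>k. LINT y|lborel. indicator ?A y * ?F r k y)"
  proof (rule integral_suminf)
   show i: "integrable lborel (\<lambda>y. indicator ?A y * ?F r k y)" for k
    by (rule lintable_bound[OF Fi[OF r, of k]]) (auto simp: indicator_def)
   show "AE y in lborel. summable (\<lambda>k. norm (indicator ?A y * ?F r k y))"
    using AEs[OF r] by eventually_elim (auto simp: indicator_def)
   show "summable (\<lambda>k. LINT y|lborel. norm (indicator ?A y * ?F r k y))"
   proof (rule summable_comparison_test'[OF Fs[OF r]])
    fix k
    have "(LINT y|lborel. norm (indicator ?A y * ?F r k y)) \<le> (LINT y|lborel. norm (?F r k y))"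
     using i[of k] Fi[OF r, of k] by (intro integral_mono integrable_norm) (auto simp: indicator_def)
    then show "norm (LINT y|lborel. norm (indicator ?A y * ?F r k y)) \<le> (LINT y|lborel. norm (?F r k y))"
     by (simp add: integral_nonneg_AE)
   qed
  qed
  also have "\<dots> = (\<Sum>k. a k * radon_integral \<nu> (\<lambda>x. indicator ?A (x + \<eta> k) * of_real ((kap r (x + \<eta> k))^2)))"
  proof (rule suminf_cong)
   fix k
   have "radon_integral \<nu> (\<lambda>x. indicator ?A (x + \<eta> k) * of_real ((kap r (x + \<eta> k))^2))
    = (LINT x|lborel. indicator ?A (x + \<eta> k) * of_real ((kap r (x + \<eta> k))^2) * f x)"
    by (rule fN) (auto simp: N'_def indicator_def intro!: exI[of _ k])
   also have "\<dots> = (LINT y|lborel. indicator ?A y * of_real ((kap r y)^2) * f (y - \<eta> k))"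
    using lborel_translate(2)[of "\<lambda>y. indicator ?A y * of_real ((kap r y)^2) * f (y - \<eta> k)" "\<eta> k"]
    by (simp add: add.commute)
   finally show "(LINT y|lborel. indicator ?A y * ?F r k y)
    = a k * radon_integral \<nu> (\<lambda>x. indicator ?A (x + \<eta> k) * of_real ((kap r (x + \<eta> k))^2))"
    unfolding integral_mult_right_zero[symmetric] by (simp add: mult_ac)
  qed
  also have "\<dots> = 0" by (rule transform_translate_relation[OF \<mu> ft a zero r]) measurable
  finally show "(LINT y|lborel. indicator A y * (of_real ((kap r y)^2) * G y)) = 0" .
 qed
 with summ show ?thesis
 proof eventually_elim
  case (elim y)
  then show ?case using summable_norm_cancel[OF elim(1)] by (simp add: G_def sums_iff)
 qed
qed

section \<open>Schwartz functions\<close>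

definition pd :: "'a::euclidean_space \<Rightarrow> ('a \<Rightarrow> complex) \<Rightarrow> 'a \<Rightarrow> complex" where
 "pd b f = (\<lambda>x. frechet_derivative f (at x) b)"

lemma iter_deriv_Nil [simp]: "iter_deriv [] f = f" by (simp add: iter_deriv_def)
lemma iter_deriv_Cons: "iter_deriv (b # bs) f = pd b (iter_deriv bs f)"
 by (simp add: iter_deriv_def pd_def)
lemma iter_deriv_snoc: "iter_deriv (bs @ [b]) f = iter_deriv bs (pd b f)"
 by (simp add: iter_deriv_def pd_def)

lemma pd_eq: "(f has_derivative f') (at x) \<Longrightarrow> pd b f x = f' b"
 unfolding pd_def using frechet_derivative_at by metis

lemma has_derivative_pd: "f differentiable (at x) \<Longrightarrow> (f has_derivative (\<lambda>h. pd h f x)) (at x)"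
 unfolding pd_def by (simp add: frechet_derivative_works[symmetric])

text \<open>A class of rapidly decreasing differentiable functions that is closed under partial
 derivatives consists of Schwartz functions. All closure properties below follow by exhibiting such a class.\<close>

lemma schwartz_coinduct:
 assumes "f \<in> C" and "\<And>f x. f \<in> C \<Longrightarrow> f differentiable (at x)"
  and "\<And>f b. f \<in> C \<Longrightarrow> b \<in> Basis \<Longrightarrow> pd b f \<in> C"
  and "\<And>f k::nat. f \<in> C \<Longrightarrow> \<exists>B. \<forall>x. (1 + norm x) ^ k * norm (f x) \<le> B"
 shows "schwartz f"
proof -
 have C: "iter_deriv bs f \<in> C" if "set bs \<subseteq> Basis" for bs
  using that by (induction bs) (auto simp: iter_deriv_Cons assms)
 have "bounded (range (\<lambda>x. (1 + norm x) ^ k * norm (iter_deriv bs f x)))" if "set bs \<subseteq> Basis" for bs and k :: nat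
  using assms(4)[OF C[OF that], of k] by (auto simp: bounded_iff abs_mult)
 then show ?thesis unfolding schwartz_def using assms(2) C by blast
qed

lemma schwartz_differentiable: "schwartz f \<Longrightarrow> f differentiable (at x)"
 unfolding schwartz_def by (drule spec[of _ "[]"]) simp

lemma schwartz_rapid_iter:
 assumes "schwartz f" "set bs \<subseteq> Basis" shows "bdd_above (range (\<lambda>x. (1 + norm x) ^ k * norm (iter_deriv bs f x)))"
proof (rule bounded_imp_bdd_above)
 show "bounded (range (\<lambda>x. (1 + norm x) ^ k * norm (iter_deriv bs f x)))"
  using assms unfolding schwartz_def by blast
qed

lemma schwartz_rapid:
 assumes "schwartz f" shows "\<exists>B. \<forall>x. (1 + norm x) ^ k * norm (f x) \<le> B"
 using schwartz_rapid_iter[OF assms, of "[]" k] by (auto simp: bdd_above_def)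

lemma schwartz_pd: assumes "schwartz f" "b \<in> Basis" shows "schwartz (pd b f)"
 unfolding schwartz_def
proof (intro allI impI)
 fix bs :: "'a list" assume "set bs \<subseteq> Basis"
 then have "set (bs @ [b]) \<subseteq> Basis" using assms(2) by simp
 then show "(\<forall>x. iter_deriv bs (pd b f) differentiable at x) \<and>
  (\<forall>k. bounded (range (\<lambda>x. (1 + norm x) ^ k * norm (iter_deriv bs (pd b f) x))))"
  using assms(1) unfolding schwartz_def iter_deriv_snoc[symmetric] by blast
qed

lemma rapid_linear:
 fixes f g :: "'a::euclidean_space \<Rightarrow> complex"
 assumes "\<exists>B. \<forall>x. (1 + norm x) ^ k * norm (f x) \<le> B" "\<exists>B. \<forall>x. (1 + norm x) ^ k * norm (g x) \<le> B"
 shows "\<exists>B. \<forall>x. (1 + norm x) ^ k * norm (a * f x + b * g x) \<le> B"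
proof -
 obtain B1 B2 where B: "\<And>x. (1 + norm x) ^ k * norm (f x) \<le> B1" "\<And>x. (1 + norm x) ^ k * norm (g x) \<le> B2"
  using assms by blast
 have "(1 + norm x) ^ k * norm (a * f x + b * g x) \<le> norm a * B1 + norm b * B2" for x
 proof -
  have "norm (a * f x + b * g x) \<le> norm a * norm (f x) + norm b * norm (g x)"
   by (rule order_trans[OF norm_triangle_ineq]) (simp add: norm_mult)
  then have "(1 + norm x) ^ k * norm (a * f x + b * g x) \<le> (1 + norm x) ^ k * (norm a * norm (f x) + norm b * norm (g x))"
   by (intro mult_left_mono) auto
  also have "\<dots> = norm a * ((1 + norm x) ^ k * norm (f x)) + norm b * ((1 + norm x) ^ k * norm (g x))"
   by (simp add: algebra_simps)
  also have "\<dots> \<le> norm a * B1 + norm b * B2" by (intro add_mono mult_left_mono B) auto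
  finally show ?thesis .
 qed
 then show ?thesis by blast
qed

lemma has_derivative_linear_combination:
 assumes "schwartz \<phi>" "schwartz \<psi>"
 shows "((\<lambda>x. a * \<phi> x + b * \<psi> x) has_derivative (\<lambda>h. a * pd h \<phi> x + b * pd h \<psi> x)) (at x)"
 by (intro has_derivative_add has_derivative_mult_right has_derivative_pd schwartz_differentiable assms)

lemma schwartz_linear:
 assumes "schwartz \<phi>" "schwartz \<psi>" shows "schwartz (\<lambda>x. a * \<phi> x + b * \<psi> x)"
proof (rule schwartz_coinduct[where C = "{\<lambda>x. a * \<phi> x + b * \<psi> x | \<phi> \<psi>. schwartz \<phi> \<and> schwartz \<psi>}"])
 let ?C = "{\<lambda>x. a * \<phi> x + b * \<psi> x | \<phi> \<psi>. schwartz \<phi> \<and> schwartz \<psi>}"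
 show "(\<lambda>x. a * \<phi> x + b * \<psi> x) \<in> ?C" using assms by blast
 fix f assume "f \<in> ?C"
 then obtain \<phi> \<psi> where f: "f = (\<lambda>x. a * \<phi> x + b * \<psi> x)" and s: "schwartz \<phi>" "schwartz \<psi>" by blast
 note d = has_derivative_linear_combination[OF s, of a b]
 show "f differentiable (at x)" for x using d[of x] unfolding f differentiable_def by blast
 show "pd c f \<in> ?C" if "c \<in> Basis" for c
 proof -
  have "pd c f = (\<lambda>x. a * pd c \<phi> x + b * pd c \<psi> x)" unfolding f by (rule ext) (rule pd_eq[OF d])
  then show ?thesis using schwartz_pd[OF s(1) that] schwartz_pd[OF s(2) that] by blast
 qed
 show "\<exists>B. \<forall>x. (1 + norm x) ^ k * norm (f x) \<le> B" for k
  unfolding f by (intro rapid_linear schwartz_rapid s)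
qed

lemma schwartz_scale: "schwartz \<phi> \<Longrightarrow> schwartz (\<lambda>x. a * \<phi> x)"
 using schwartz_linear[of \<phi> \<phi> a 0] by simp

lemma schwartz_add: "schwartz \<phi> \<Longrightarrow> schwartz \<psi> \<Longrightarrow> schwartz (\<lambda>x. \<phi> x + \<psi> x)"
 using schwartz_linear[of \<phi> \<psi> 1 1] by simp

text \<open>The Leibniz rule keeps the class of functions \<open>(x \<bullet> b) * \<phi> x + \<psi> x\<close> with Schwartz \<open>\<phi>, \<psi>\<close>
 stable under partial derivatives.\<close>

lemma schwartz_coordinate:
 fixes b :: "'a::euclidean_space"
 assumes "schwartz \<phi>" shows "schwartz (\<lambda>x. of_real (x \<bullet> b) * \<phi> x)"
proof (rule schwartz_coinduct[where C = "{\<lambda>x. of_real (x \<bullet> b) * \<phi> x + \<psi> x | \<phi> \<psi>. schwartz \<phi> \<and> schwartz \<psi>}"])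
 let ?C = "{\<lambda>x. of_real (x \<bullet> b) * \<phi> x + \<psi> x | \<phi> \<psi>. schwartz \<phi> \<and> schwartz \<psi>}"
 have "schwartz (\<lambda>x. 0 * \<phi> x)" using assms by (rule schwartz_scale)
 then show "(\<lambda>x. of_real (x \<bullet> b) * \<phi> x) \<in> ?C"
  using assms by (intro CollectI exI[of _ \<phi>] exI[of _ "\<lambda>x. 0 * \<phi> x"]) simp
 fix f assume "f \<in> ?C"
 then obtain \<phi> \<psi> where f: "f = (\<lambda>x. of_real (x \<bullet> b) * \<phi> x + \<psi> x)" and s: "schwartz \<phi>" "schwartz \<psi>" by blast
 have d: "(f has_derivative (\<lambda>h. of_real (x \<bullet> b) * pd h \<phi> x + (of_real (h \<bullet> b) * \<phi> x) + pd h \<psi> x)) (at x)" for x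
  unfolding f by (intro has_derivative_add has_derivative_mult has_derivative_pd schwartz_differentiable s
    has_derivative_of_real has_derivative_inner_left has_derivative_ident)
 show "f differentiable (at x)" for x using d[of x] unfolding differentiable_def by blast
 show "pd c f \<in> ?C" if "c \<in> Basis" for c
 proof -
  have "pd c f = (\<lambda>x. of_real (x \<bullet> b) * pd c \<phi> x + (of_real (c \<bullet> b) * \<phi> x + 1 * pd c \<psi> x))"
   by (rule ext) (simp add: pd_eq[OF d])
  then show ?thesis using schwartz_pd[OF s(1) that] schwartz_linear[OF s(1) schwartz_pd[OF s(2) that]]
   by (intro CollectI exI[of _ "pd c \<phi>"] exI[of _ "\<lambda>x. of_real (c \<bullet> b) * \<phi> x + 1 * pd c \<psi> x"] conjI)
 qed
 show "\<exists>B. \<forall>x. (1 + norm x) ^ k * norm (f x) \<le> B" for k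
 proof -
  obtain B where B: "\<And>x. (1 + norm x) ^ Suc k * norm (\<phi> x) \<le> B" using schwartz_rapid[OF s(1), of "Suc k"] by blast
  have "(1 + norm x) ^ k * norm (of_real (x \<bullet> b) * \<phi> x) \<le> norm b * B" for x
  proof -
   have "\<bar>x \<bullet> b\<bar> \<le> norm b * norm x" using Cauchy_Schwarz_ineq2[of x b] by (simp add: mult.commute)
   also have "\<dots> \<le> norm b * (1 + norm x)" by (rule mult_left_mono) auto
   finally have "(1 + norm x) ^ k * (\<bar>x \<bullet> b\<bar> * norm (\<phi> x)) \<le> (1 + norm x) ^ k * (norm b * (1 + norm x) * norm (\<phi> x))"
    by (intro mult_left_mono mult_right_mono) auto
   also have "\<dots> = norm b * ((1 + norm x) ^ Suc k * norm (\<phi> x))" by (simp add: algebra_simps)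
   also have "\<dots> \<le> norm b * B" by (intro mult_left_mono B) auto
   finally show ?thesis by (simp add: norm_mult)
  qed
  then have "\<exists>B. \<forall>x. (1 + norm x) ^ k * norm (of_real (x \<bullet> b) * \<phi> x) \<le> B" by blast
  from rapid_linear[OF this schwartz_rapid[OF s(2)], of 1 1] show ?thesis unfolding f by simp
 qed
qed

lemma schwartz_reflect:
 assumes "schwartz \<phi>" shows "schwartz (\<lambda>x. \<phi> (- x))"
proof (rule schwartz_coinduct[where C = "{\<lambda>x. \<phi> (- x) | \<phi>. schwartz \<phi>}"])
 let ?C = "{\<lambda>x. \<phi> (- x) | \<phi>. schwartz \<phi>}"
 show "(\<lambda>x. \<phi> (- x)) \<in> ?C" using assms by blast
 fix f assume "f \<in> ?C"
 then obtain \<phi> where f: "f = (\<lambda>x. \<phi> (- x))" and s: "schwartz \<phi>" by blast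
 have d: "(f has_derivative (\<lambda>h. pd (- h) \<phi> (- x))) (at x)" for x
  unfolding f
  using has_derivative_compose[OF has_derivative_minus[OF has_derivative_ident] has_derivative_pd[OF schwartz_differentiable[OF s]]] .
 show "f differentiable (at x)" for x using d[of x] unfolding differentiable_def by blast
 have m: "pd (- c) \<phi> x = - 1 * pd c \<phi> x" for c x
  using linear_neg[OF has_derivative_linear[OF has_derivative_pd[OF schwartz_differentiable[OF s, of x]]], of c] by simp
 show "pd c f \<in> ?C" if "c \<in> Basis" for c
 proof -
  have "pd c f = (\<lambda>x. (\<lambda>x. - 1 * pd c \<phi> x) (- x))" by (rule ext) (simp only: pd_eq[OF d] m)
  moreover have "schwartz (\<lambda>x. - 1 * pd c \<phi> x)" by (rule schwartz_scale[OF schwartz_pd[OF s that]])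
  ultimately show ?thesis by (intro CollectI exI[of _ "\<lambda>x. - 1 * pd c \<phi> x"] conjI)
 qed
 show "\<exists>B. \<forall>x. (1 + norm x) ^ k * norm (f x) \<le> B" for k
 proof -
  obtain B where "\<And>x. (1 + norm x) ^ k * norm (\<phi> x) \<le> B" using schwartz_rapid[OF s] by blast
  from this[of "- x" for x] show ?thesis unfolding f by auto
 qed
qed

lemma continuous_schwartz: "schwartz \<phi> \<Longrightarrow> continuous_on S \<phi>"
 by (intro continuous_at_imp_continuous_on ballI differentiable_imp_continuous_within schwartz_differentiable)

lemma borel_measurable_schwartz: "schwartz \<phi> \<Longrightarrow> \<phi> \<in> borel_measurable borel"
 by (intro borel_measurable_continuous_onI continuous_schwartz)

text \<open>The weight \<open>decay\<close> dominates the power \<open>-2d\<close> of \<open>1 + |x|\<close>.\<close>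

lemma decay_lower: "inverse ((1 + norm x) ^ (2 * DIM('a))) \<le> decay (x::'a::euclidean_space)"
proof -
 have "inverse ((1 + norm x)^2) \<le> inverse (1 + (x \<bullet> b)^2)" if "b \<in> Basis" for b
 proof (rule le_imp_inverse_le)
  have "(x \<bullet> b)^2 \<le> (norm x)^2" using Basis_le_norm[OF that, of x] by (simp flip: abs_le_square_iff)
  moreover have "(1 + norm x)^2 = 1 + (norm x)^2 + 2 * norm x" by (simp add: power2_sum)
  ultimately show "1 + (x \<bullet> b)^2 \<le> (1 + norm x)^2" using norm_ge_zero[of x] by linarith
  show "0 < 1 + (x \<bullet> b)^2" by (simp add: add_pos_nonneg)
 qed
 then have "(\<Prod>b\<in>(Basis::'a set). inverse ((1 + norm x)^2)) \<le> decay x"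
  unfolding decay_def by (intro prod_mono) auto
 then show ?thesis by (simp add: power_mult[symmetric] power_inverse)
qed

lemma le_decay:
 assumes "(1 + norm x) ^ (2 * DIM('a)) * n \<le> B" "0 \<le> B"
 shows "n \<le> B * decay (x::'a::euclidean_space)"
proof -
 have p: "0 < (1 + norm x) ^ (2 * DIM('a))" by (simp add: add_pos_nonneg)
 have "n \<le> B * inverse ((1 + norm x) ^ (2 * DIM('a)))" using assms(1) p by (simp add: field_simps)
 also have "\<dots> \<le> B * decay x" by (intro mult_left_mono decay_lower assms)
 finally show ?thesis .
qed

lemma schwartz_le_decay:
 assumes "schwartz \<phi>" obtains B where "0 \<le> B" "\<And>x::'a::euclidean_space. norm (\<phi> x) \<le> B * decay x"
proof -
 obtain B where B: "\<And>x. (1 + norm x) ^ (2 * DIM('a)) * norm (\<phi> x) \<le> B" using schwartz_rapid[OF assms] by blast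
 have "0 \<le> B" using B[of 0] by (rule order_trans[rotated]) simp
 then show ?thesis using that le_decay[OF B] by blast
qed

lemma integrable_le_decay:
 fixes \<phi> :: "'a::euclidean_space \<Rightarrow> complex"
 assumes "\<phi> \<in> borel_measurable borel" "\<And>x. norm (\<phi> x) \<le> B * decay x"
 shows "integrable lborel \<phi>"
proof (rule lintable_bound)
 show "integrable lborel (\<lambda>x::'a. B * decay x)" using integrable_decay[where 'a='a] by simp
 show "AE x in lborel. norm (\<phi> x) \<le> norm (B * decay x)"
  using assms(2) by (intro AE_I2) (simp add: order_trans[OF _ abs_ge_self])
qed (use assms in simp)

lemma integrable_schwartz: "schwartz \<phi> \<Longrightarrow> integrable lborel \<phi>"
 using schwartz_le_decay borel_measurable_schwartz integrable_le_decay by metis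

subsection \<open>Differentiation and the Fourier transform\<close>

lemma iexp_remainder: "norm (iexp t - 1 - \<i> * of_real t) \<le> t\<^sup>2 / 2"
 using iexp_approx1[of t 1] by (simp add: lessThan_Suc_atMost[symmetric] numeral_2_eq_2 diff_diff_eq)

text \<open>Differentiation under the integral sign, with the second order remainder of the exponential as an
 integrable bound.\<close>

lemma has_derivative_inv_fourier:
 fixes \<psi> :: "'a::euclidean_space \<Rightarrow> complex"
 assumes s: "schwartz \<psi>"
 shows "(inv_fourier \<psi> has_derivative (\<lambda>h. inv_fourier (\<lambda>x. 2 * of_real pi * \<i> * (of_real (x \<bullet> h) * \<psi> x)) y)) (at y)"
proof -
 let ?D = "\<lambda>h x. 2 * of_real pi * \<i> * (of_real (x \<bullet> h) * \<psi> x)"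
 have Ds: "schwartz (?D h)" for h by (intro schwartz_scale schwartz_coordinate s)
 note Di = integrable_wave_mult[OF integrable_schwartz[OF Ds]]
 have lin: "linear (\<lambda>h. inv_fourier (?D h) y)"
 proof (rule linearI)
  fix h k :: 'a and c :: real
  have "wave y x * ?D (h + k) x = wave y x * ?D h x + wave y x * ?D k x" for x
   by (simp add: inner_add_right algebra_simps)
  then show "inv_fourier (?D (h + k)) y = inv_fourier (?D h) y + inv_fourier (?D k) y"
   unfolding inv_fourier_wave by (simp only: lint_add[OF Di Di])
  have "wave y x * ?D (c *\<^sub>R h) x = of_real c * (wave y x * ?D h x)" for x by (simp add: mult_ac)
  then show "inv_fourier (?D (c *\<^sub>R h)) y = c *\<^sub>R inv_fourier (?D h) y"
   unfolding inv_fourier_wave by (simp only: integral_mult_right_zero scaleR_conv_of_real)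
 qed
 have sq: "integrable lborel (\<lambda>x. (norm x)\<^sup>2 * norm (\<psi> x))"
 proof -
  have "integrable lborel (\<lambda>x. \<Sum>b\<in>Basis. norm (of_real (x \<bullet> b) * (of_real (x \<bullet> b) * \<psi> x)))"
   by (intro lintable_sum integrable_norm integrable_schwartz schwartz_coordinate s)
  moreover have "(\<Sum>b\<in>Basis. norm (of_real (x \<bullet> b) * (of_real (x \<bullet> b) * \<psi> x))) = (norm x)^2 * norm (\<psi> x)" for x
   by (simp add: norm_mult norm_power power2_norm_eq_inner euclidean_inner[of x x] sum_distrib_right mult.assoc[symmetric] flip: power2_eq_square)
  ultimately show ?thesis by simp
 qed
 define K where "K = 4 * pi\<^sup>2 * (LINT x|lborel. (norm x)\<^sup>2 * norm (\<psi> x))"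
 have K0: "0 \<le> K" unfolding K_def by (intro mult_nonneg_nonneg integral_nonneg_AE AE_I2) auto
 have rem: "norm (inv_fourier \<psi> z - inv_fourier \<psi> y - inv_fourier (?D (z - y)) y) \<le> K * (norm (z - y))^2" for z
 proof -
  define h where "h = z - y"
  have z: "z = h + y" by (simp add: h_def)
  have iz: "integrable lborel (\<lambda>x. wave z x * \<psi> x)" and iy: "integrable lborel (\<lambda>x. wave y x * \<psi> x)"
   using integrable_wave_mult[OF integrable_schwartz[OF s]] by blast+
  note izy = lintable_diff[OF iz iy]
  have ih: "integrable lborel (\<lambda>x. wave y x * ?D h x)" by (rule Di)
  note idiff = lintable_diff[OF izy ih]
  have eq: "inv_fourier \<psi> z - inv_fourier \<psi> y - inv_fourier (?D h) y
   = (LINT x|lborel. wave z x * \<psi> x - wave y x * \<psi> x - wave y x * ?D h x)"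
   unfolding inv_fourier_wave
   unfolding lint_diff[OF izy ih] lint_diff[OF iz iy] ..
  have "norm (inv_fourier \<psi> z - inv_fourier \<psi> y - inv_fourier (?D h) y)
   \<le> (LINT x|lborel. norm (wave z x * \<psi> x - wave y x * \<psi> x - wave y x * ?D h x))"
   unfolding eq by (rule integral_norm_bound)
  also have "\<dots> \<le> (LINT x|lborel. 4 * pi\<^sup>2 * (norm h)^2 * ((norm x)^2 * norm (\<psi> x)))"
  proof (rule integral_mono)
   show "integrable lborel (\<lambda>x. norm (wave z x * \<psi> x - wave y x * \<psi> x - wave y x * ?D h x))"
    by (rule integrable_norm[OF idiff])
   show "integrable lborel (\<lambda>x. 4 * pi\<^sup>2 * (norm h)^2 * ((norm x)^2 * norm (\<psi> x)))" using sq by simp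
   fix x
   define t where "t = 2 * pi * (x \<bullet> h)"
   have "norm (iexp t - 1 - \<i> * t) \<le> t\<^sup>2 / 2"
    by (rule iexp_remainder)
   also have "\<dots> \<le> t\<^sup>2" by simp
   also have "\<dots> = 4 * pi\<^sup>2 * (x \<bullet> h)^2" by (simp add: t_def power_mult_distrib)
   also have "\<dots> \<le> 4 * pi\<^sup>2 * ((norm x)^2 * (norm h)^2)"
   proof (rule mult_left_mono)
    have "\<bar>x \<bullet> h\<bar> \<le> \<bar>norm x * norm h\<bar>" using Cauchy_Schwarz_ineq2[of x h] by simp
    then show "(x \<bullet> h)^2 \<le> (norm x)^2 * (norm h)^2" by (simp only: abs_le_square_iff power_mult_distrib)
   qed simp
   finally have b: "norm (iexp t - 1 - \<i> * t) \<le> 4 * pi\<^sup>2 * ((norm x)^2 * (norm h)^2)" .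
   have "wave h x = iexp t" by (simp add: wave_def cis_conv_exp t_def inner_commute)
   then have "wave z x = iexp t * wave y x" by (simp only: z wave_add_left)
   moreover have "2 * of_real pi * \<i> * (of_real (x \<bullet> h) * \<psi> x) = \<i> * t * \<psi> x" by (simp add: t_def)
   ultimately have "wave z x * \<psi> x - wave y x * \<psi> x - wave y x * ?D h x = wave y x * (\<psi> x * (iexp t - 1 - \<i> * t))"
    by (simp only: right_diff_distrib mult_1_right mult_1_left mult_ac)
   then have "norm (wave z x * \<psi> x - wave y x * \<psi> x - wave y x * ?D h x) = norm (\<psi> x) * norm (iexp t - 1 - \<i> * t)"
    by (simp only: norm_mult norm_wave mult_1_left)
   also have "\<dots> \<le> norm (\<psi> x) * (4 * pi\<^sup>2 * ((norm x)^2 * (norm h)^2))" by (rule mult_left_mono[OF b]) simp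
   also have "\<dots> = 4 * pi\<^sup>2 * (norm h)^2 * ((norm x)^2 * norm (\<psi> x))" by (simp only: mult_ac)
   finally show "norm (wave z x * \<psi> x - wave y x * \<psi> x - wave y x * ?D h x) \<le> 4 * pi\<^sup>2 * (norm h)^2 * ((norm x)^2 * norm (\<psi> x))" .
  qed
  also have "\<dots> = K * (norm h)^2" by (simp add: K_def)
  finally show ?thesis by (simp only: h_def)
 qed
 show ?thesis
  unfolding has_derivative_iff_norm
 proof
  show "bounded_linear (\<lambda>h. inv_fourier (?D h) y)" using lin by (simp add: linear_conv_bounded_linear)
  show "((\<lambda>z. norm (inv_fourier \<psi> z - inv_fourier \<psi> y - inv_fourier (?D (z - y)) y) / norm (z - y)) \<longlongrightarrow> 0) (at y)"
  proof (rule Lim_null_comparison)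
   show "((\<lambda>z. K * norm (z - y)) \<longlongrightarrow> 0) (at y)"
    by (rule tendsto_eq_intros refl | simp)+
   have "norm (norm (inv_fourier \<psi> z - inv_fourier \<psi> y - inv_fourier (?D (z - y)) y) / norm (z - y)) \<le> K * norm (z - y)" if "z \<noteq> y" for z
    using rem[of z] that by (simp add: divide_le_eq power2_eq_square mult.assoc)
   then show "\<forall>\<^sub>F z in at y. norm (norm (inv_fourier \<psi> z - inv_fourier \<psi> y - inv_fourier (?D (z - y)) y) / norm (z - y)) \<le> K * norm (z - y)"
    by (auto simp: eventually_at_filter)
  qed
 qed
qed

lemma difference_quotient_tendsto:
 fixes g :: "real \<Rightarrow> complex"
 assumes "(g has_vector_derivative D) (at 0)"
 shows "(\<lambda>n. (g (inverse (real (Suc n))) - g 0) / of_real (inverse (real (Suc n)))) \<longlonglongrightarrow> D"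
proof -
 have "((\<lambda>u. norm (g u - g 0 - (u - 0) *\<^sub>R D) / norm (u - 0)) \<longlongrightarrow> 0) (at 0)"
  using assms unfolding has_vector_derivative_def has_derivative_iff_norm by blast
 moreover have "filterlim (\<lambda>n. inverse (real (Suc n))) (at 0) sequentially"
  using inverse_nat_to_0 by (intro filterlim_atI) auto
 ultimately have "(\<lambda>n. norm (g (inverse (real (Suc n))) - g 0 - (inverse (real (Suc n)) - 0) *\<^sub>R D) / norm (inverse (real (Suc n)) - 0)) \<longlonglongrightarrow> 0"
  by (rule filterlim_compose)
 moreover have "norm (g u - g 0 - (u - 0) *\<^sub>R D) / norm (u - 0) = norm ((g u - g 0) / of_real u - D)" if "u > 0" for u :: real
 proof -
  have "d - (u - 0) *\<^sub>R D = of_real u * (d / of_real u - D)" for d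
   using that by (simp add: scaleR_conv_of_real right_diff_distrib)
  then have "g u - g 0 - (u - 0) *\<^sub>R D = of_real u * ((g u - g 0) / of_real u - D)" .
  then show ?thesis using that by (simp only: norm_mult) simp
 qed
 ultimately have "(\<lambda>n. norm ((g (inverse (real (Suc n))) - g 0) / of_real (inverse (real (Suc n))) - D)) \<longlonglongrightarrow> 0"
  by simp
 then show ?thesis using tendsto_norm_zero_iff Lim_null by blast
qed

text \<open>Integration by parts, as the limit of difference quotients: translating the function
 multiplies the transform by a character.\<close>

lemma inv_fourier_pd:
 fixes \<psi> :: "'a::euclidean_space \<Rightarrow> complex"
 assumes s: "schwartz \<psi>" and b: "b \<in> Basis"
 shows "inv_fourier (pd b \<psi>) y = - (2 * of_real pi * \<i> * of_real (y \<bullet> b)) * inv_fourier \<psi> y"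
proof (rule LIMSEQ_unique)
 let ?t = "\<lambda>n. inverse (real (Suc n))"
 let ?q = "\<lambda>n x. (\<psi> (x + ?t n *\<^sub>R b) - \<psi> x) / of_real (?t n)"
 note i = integrable_schwartz[OF s]
 have [measurable]: "\<psi> \<in> borel_measurable borel" "pd b \<psi> \<in> borel_measurable borel"
  using s schwartz_pd[OF s b] by (auto intro: borel_measurable_schwartz)
 have d: "((\<lambda>u. \<psi> (x + u *\<^sub>R b)) has_derivative (\<lambda>h. h *\<^sub>R pd b \<psi> (x + u *\<^sub>R b))) (at u)" for x u
 proof -
  have D: "(\<psi> has_derivative (\<lambda>h. pd h \<psi> (x + u *\<^sub>R b))) (at (x + u *\<^sub>R b))"
   by (rule has_derivative_pd[OF schwartz_differentiable[OF s]])
  have "((\<lambda>u. x + u *\<^sub>R b) has_derivative (\<lambda>h. h *\<^sub>R b)) (at u)" by (auto intro!: derivative_eq_intros)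
  from has_derivative_compose[OF this D]
  show ?thesis using linear_scale[OF has_derivative_linear[OF D]] by simp
 qed
 obtain B where B0: "0 \<le> B" and B: "\<And>x. (1 + norm x) ^ (2 * DIM('a)) * norm (pd b \<psi> x) \<le> B"
 proof -
  obtain B where B: "\<And>x. (1 + norm x) ^ (2 * DIM('a)) * norm (pd b \<psi> x) \<le> B"
   using schwartz_rapid[OF schwartz_pd[OF s b]] by blast
  moreover have "0 \<le> B" using B[of 0] by (rule order_trans[rotated]) simp
  ultimately show ?thesis using that by blast
 qed
 define B' where "B' = 2 ^ (2 * DIM('a)) * B"
 have qle: "norm (?q n x) \<le> B' * decay x" for n x
 proof -
  have t: "0 < ?t n" "?t n \<le> 1" by (auto simp: field_simps)
  have "continuous_on {0..?t n} (\<lambda>u. \<psi> (x + u *\<^sub>R b))"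
   using has_derivative_continuous[OF d] by (intro continuous_at_imp_continuous_on) auto
  from mvt_general[OF t(1) this d] obtain u where u: "u \<in> {0<..<?t n}"
   and le: "norm (\<psi> (x + ?t n *\<^sub>R b) - \<psi> (x + 0 *\<^sub>R b)) \<le> norm ((?t n - 0) *\<^sub>R pd b \<psi> (x + u *\<^sub>R b))" by blast
  have "norm x \<le> norm (x + u *\<^sub>R b) + norm (u *\<^sub>R b)" using norm_triangle_ineq4[of "x + u *\<^sub>R b" "u *\<^sub>R b"] by simp
  moreover have "norm (u *\<^sub>R b) \<le> 1" using u t b by simp
  moreover have "1 + p \<le> 2 * (1 + q)" if "p \<le> q + c" "c \<le> 1" "0 \<le> q" for p q c :: real using that by simp
  ultimately have "1 + norm x \<le> 2 * (1 + norm (x + u *\<^sub>R b))" using norm_ge_zero[of "x + u *\<^sub>R b"] by blast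
  then have "(1 + norm x) ^ (2 * DIM('a)) \<le> (2 * (1 + norm (x + u *\<^sub>R b))) ^ (2 * DIM('a))"
   by (intro power_mono) auto
  then have "(1 + norm x) ^ (2 * DIM('a)) * norm (pd b \<psi> (x + u *\<^sub>R b)) \<le> (2 * (1 + norm (x + u *\<^sub>R b))) ^ (2 * DIM('a)) * norm (pd b \<psi> (x + u *\<^sub>R b))"
   by (rule mult_right_mono) simp
  also have "\<dots> = 2 ^ (2 * DIM('a)) * ((1 + norm (x + u *\<^sub>R b)) ^ (2 * DIM('a)) * norm (pd b \<psi> (x + u *\<^sub>R b)))"
   by (simp only: power_mult_distrib mult.assoc)
  also have "\<dots> \<le> B'" unfolding B'_def by (intro mult_left_mono B) simp
  finally have "norm (pd b \<psi> (x + u *\<^sub>R b)) \<le> B' * decay x"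
   by (rule le_decay) (simp add: B'_def B0)
  moreover have "norm (?q n x) \<le> norm (pd b \<psi> (x + u *\<^sub>R b))"
  proof -
   have "norm (d / complex_of_real \<tau>) \<le> norm w" if "0 < \<tau>" "norm d \<le> norm (\<tau> *\<^sub>R w)" for d w :: complex and \<tau>
    using that by (simp add: norm_divide divide_le_eq mult.commute)
   from this[OF t(1), of "\<psi> (x + ?t n *\<^sub>R b) - \<psi> x" "pd b \<psi> (x + u *\<^sub>R b)"] le show ?thesis
    by (simp only: diff_0_right scaleR_zero_left add_0_right)
  qed
  ultimately show ?thesis by linarith
 qed
 show "(\<lambda>n. LINT x|lborel. wave y x * ?q n x) \<longlonglongrightarrow> inv_fourier (pd b \<psi>) y"
  unfolding inv_fourier_wave
 proof (rule integral_dominated_convergence)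
  show "integrable lborel (\<lambda>x::'a. B' * decay x)" using integrable_decay[where 'a='a] by simp
  show "AE x in lborel. norm (wave y x * ?q n x) \<le> B' * decay x" for n
   unfolding norm_mult norm_wave mult_1_left using qle by (intro AE_I2)
  have "(\<lambda>n. ?q n x) \<longlonglongrightarrow> pd b \<psi> x" for x
  proof -
   have "((\<lambda>u. \<psi> (x + u *\<^sub>R b)) has_vector_derivative pd b \<psi> x) (at 0)"
    using d[of x 0] by (simp add: has_vector_derivative_def)
   from difference_quotient_tendsto[OF this] show ?thesis by simp
  qed
  then show "AE x in lborel. (\<lambda>n. wave y x * ?q n x) \<longlonglongrightarrow> wave y x * pd b \<psi> x"
   by (intro AE_I2 tendsto_mult tendsto_const)
 qed measurable
 have eq: "(LINT x|lborel. wave y x * ?q n x) = ((wave y (- (?t n *\<^sub>R b)) - 1) / of_real (?t n)) * inv_fourier \<psi> y" for n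
 proof -
  have i2: "integrable lborel (\<lambda>x. \<psi> (x + ?t n *\<^sub>R b))"
   using lborel_translate(1)[of \<psi> "?t n *\<^sub>R b"] i by (simp add: add.commute)
  have "(LINT x|lborel. wave y x * \<psi> (x + ?t n *\<^sub>R b)) = (LINT x|lborel. wave y (- (?t n *\<^sub>R b) + x) * \<psi> (- (?t n *\<^sub>R b) + x + ?t n *\<^sub>R b))"
   by (rule lborel_translate(2)[symmetric])
  also have "\<dots> = wave y (- (?t n *\<^sub>R b)) * inv_fourier \<psi> y"
  proof -
   have "wave y (- c + x) * \<psi> (- c + x + c) = wave y (- c) * (wave y x * \<psi> x)" for c x
    unfolding wave_add_right by simp
   then show ?thesis unfolding inv_fourier_wave by (simp only: integral_mult_right_zero)
  qed
  finally have sh: "(LINT x|lborel. wave y x * \<psi> (x + ?t n *\<^sub>R b)) = wave y (- (?t n *\<^sub>R b)) * inv_fourier \<psi> y" .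
  have "(LINT x|lborel. wave y x * ?q n x) = (LINT x|lborel. (1 / of_real (?t n)) * (wave y x * \<psi> (x + ?t n *\<^sub>R b) - wave y x * \<psi> x))"
   by (intro lint_cong refl) (simp add: right_diff_distrib diff_divide_distrib del: of_nat_Suc)
  also have "\<dots> = (1 / of_real (?t n)) * (LINT x|lborel. wave y x * \<psi> (x + ?t n *\<^sub>R b) - wave y x * \<psi> x)"
   by (rule integral_mult_right_zero)
  also have "\<dots> = (1 / of_real (?t n)) * (wave y (- (?t n *\<^sub>R b)) * inv_fourier \<psi> y - inv_fourier \<psi> y)"
   unfolding lint_diff[OF integrable_wave_mult[OF i2] integrable_wave_mult[OF i]] sh inv_fourier_wave ..
  also have "\<dots> = ((wave y (- (?t n *\<^sub>R b)) - 1) / of_real (?t n)) * inv_fourier \<psi> y"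
  proof -
   have "(1 / c) * (w * v - v) = ((w - 1) / c) * v" for c w v :: complex by (simp add: algebra_simps diff_divide_distrib)
   then show ?thesis .
  qed
  finally show ?thesis .
 qed
 have "(\<lambda>n. (wave y (- (?t n *\<^sub>R b)) - 1) / of_real (?t n)) \<longlonglongrightarrow> - (2 * of_real pi * \<i> * of_real (y \<bullet> b))"
 proof -
  have "((\<lambda>z. exp (- (2 * of_real pi * \<i> * of_real (y \<bullet> b)) * z)) has_field_derivative - (2 * of_real pi * \<i> * of_real (y \<bullet> b))) (at (of_real 0))"
   by (auto intro!: derivative_eq_intros)
  from has_vector_derivative_real_field[OF this]
  have "((\<lambda>u. wave y (- (u *\<^sub>R b))) has_vector_derivative - (2 * of_real pi * \<i> * of_real (y \<bullet> b))) (at 0)"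
   by (simp add: wave_def cis_conv_exp mult_ac)
  from difference_quotient_tendsto[OF this] show ?thesis by simp
 qed
 then show "(\<lambda>n. LINT x|lborel. wave y x * ?q n x) \<longlonglongrightarrow> - (2 * of_real pi * \<i> * of_real (y \<bullet> b)) * inv_fourier \<psi> y"
  unfolding eq by (intro tendsto_mult tendsto_const)
qed

subsection \<open>The Fourier transform on Schwartz functions\<close>

lemma schwartz_norm_upper:
 assumes "schwartz \<psi>" "set bs \<subseteq> Basis" "length bs \<le> n"
 shows "(1 + norm x) ^ n * norm (iter_deriv bs \<psi> x) \<le> schwartz_norm n \<psi>"
proof -
 let ?S = "\<lambda>bs. SUP x. (1 + norm x) ^ n * norm (iter_deriv bs \<psi> x)"
 have up: "(1 + norm x) ^ n * norm (iter_deriv cs \<psi> x) \<le> ?S cs" if "set cs \<subseteq> Basis" for cs x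
  by (rule cSUP_upper[OF _ schwartz_rapid_iter[OF assms(1) that]]) simp
 have "0 \<le> ?S cs" if "set cs \<subseteq> Basis" for cs
  using up[OF that, of undefined] by (rule order_trans[rotated]) simp
 then have "?S bs \<le> schwartz_norm n \<psi>"
  unfolding schwartz_norm_def using assms(2,3)
  by (intro member_le_sum) (auto intro: finite_lists_length_le[OF finite_Basis])
 then show ?thesis using up[OF assms(2), of x] by linarith
qed

lemma schwartz_norm_nonneg: "schwartz \<psi> \<Longrightarrow> 0 \<le> schwartz_norm n \<psi>"
 using schwartz_norm_upper[of \<psi> "[]" n undefined] by (rule order_trans[rotated]) auto

lemma schwartz_norm_Suc:
 assumes s: "schwartz (\<psi> :: 'a::euclidean_space \<Rightarrow> complex)"
 shows "schwartz_norm n \<psi> \<le> schwartz_norm (Suc n) \<psi>"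
  and "b \<in> Basis \<Longrightarrow> schwartz_norm n (pd b \<psi>) \<le> schwartz_norm (Suc n) \<psi>"
proof -
 let ?L = "\<lambda>n. {bs :: 'a list. set bs \<subseteq> Basis \<and> length bs \<le> n}"
 let ?S = "\<lambda>n bs. SUP x. (1 + norm x) ^ n * norm (iter_deriv bs \<psi> x)"
 have fin: "finite (?L n)" for n by (rule finite_lists_length_le[OF finite_Basis])
 have mono: "?S n bs \<le> ?S (Suc n) bs" if "set bs \<subseteq> Basis" for bs
 proof (rule cSUP_mono)
  show "bdd_above (range (\<lambda>x. (1 + norm x) ^ Suc n * norm (iter_deriv bs \<psi> x)))"
   by (rule schwartz_rapid_iter[OF s that])
  show "\<exists>y\<in>UNIV. (1 + norm x) ^ n * norm (iter_deriv bs \<psi> x) \<le> (1 + norm y) ^ Suc n * norm (iter_deriv bs \<psi> y)" for x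
   by (intro bexI[of _ x] mult_right_mono power_increasing) auto
 qed simp
 have nonneg: "0 \<le> ?S n bs" if "set bs \<subseteq> Basis" for bs n
 proof -
  have "0 \<le> (1 + norm (undefined::'a)) ^ n * norm (iter_deriv bs \<psi> undefined)" by simp
  also have "\<dots> \<le> ?S n bs" by (rule cSUP_upper[OF _ schwartz_rapid_iter[OF s that]]) simp
  finally show ?thesis .
 qed
 have "schwartz_norm n \<psi> \<le> (\<Sum>bs\<in>?L n. ?S (Suc n) bs)"
  unfolding schwartz_norm_def by (intro sum_mono mono) auto
 also have "\<dots> \<le> schwartz_norm (Suc n) \<psi>"
  unfolding schwartz_norm_def by (intro sum_mono2 fin nonneg) auto
 finally show "schwartz_norm n \<psi> \<le> schwartz_norm (Suc n) \<psi>" .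
 assume b: "b \<in> Basis"
 have "schwartz_norm n (pd b \<psi>) = (\<Sum>bs\<in>?L n. ?S n (bs @ [b]))"
  unfolding schwartz_norm_def iter_deriv_snoc ..
 also have "\<dots> \<le> (\<Sum>bs\<in>?L n. ?S (Suc n) (bs @ [b]))"
  using b by (intro sum_mono mono) auto
 also have "\<dots> = (\<Sum>bs\<in>(\<lambda>bs. bs @ [b]) ` ?L n. ?S (Suc n) bs)"
  by (subst sum.reindex) (auto simp: inj_on_def)
 also have "\<dots> \<le> schwartz_norm (Suc n) \<psi>"
  unfolding schwartz_norm_def using b by (intro sum_mono2 fin nonneg) auto
 finally show "schwartz_norm n (pd b \<psi>) \<le> schwartz_norm (Suc n) \<psi>" .
qed

text \<open>Each additional factor \<open>1 + |y|\<close> costs one derivative of \<open>\<psi>\<close>, by integration by parts in the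
 coordinate directions.\<close>

lemma inv_fourier_schwartz_bound:
 shows "\<exists>C\<ge>0. \<forall>\<psi> (y::'a::euclidean_space). schwartz \<psi> \<longrightarrow>
  (1 + norm y) ^ k * norm (inv_fourier \<psi> y) \<le> C * schwartz_norm (2 * DIM('a) + k) \<psi>"
proof (induction k)
 case 0
 define I where "I = (LINT x|(lborel :: 'a measure). decay x)"
 have I0: "0 \<le> I" unfolding I_def by (intro integral_nonneg_AE AE_I2) (simp add: decay_pos less_imp_le)
 have "norm (inv_fourier \<psi> y) \<le> I * schwartz_norm (2 * DIM('a)) \<psi>" if s: "schwartz \<psi>" for \<psi> and y :: 'a
 proof -
  have le: "norm (\<psi> x) \<le> schwartz_norm (2 * DIM('a)) \<psi> * decay x" for x
   using schwartz_norm_upper[OF s, of "[]" "2 * DIM('a)" x]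
   by (intro le_decay schwartz_norm_nonneg[OF s]) simp
  have "norm (inv_fourier \<psi> y) \<le> (LINT x|lborel. norm (\<psi> x))"
   by (rule norm_inv_fourier_le[OF integrable_schwartz[OF s]])
  also have "\<dots> \<le> (LINT x|lborel. schwartz_norm (2 * DIM('a)) \<psi> * decay (x::'a))"
  proof (rule integral_mono)
   show "integrable lborel (\<lambda>x. norm (\<psi> x))" using integrable_schwartz[OF s] by simp
   show "integrable lborel (\<lambda>x::'a. schwartz_norm (2 * DIM('a)) \<psi> * decay x)"
    using integrable_decay[where 'a='a] by simp
  qed (rule le)
  finally show ?thesis by (simp add: I_def mult.commute)
 qed
 then show ?case using I0 by auto
next
 case (Suc k)
 then obtain C where C: "0 \<le> C" "\<And>\<psi> (y::'a). schwartz \<psi> \<Longrightarrow>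
   (1 + norm y) ^ k * norm (inv_fourier \<psi> y) \<le> C * schwartz_norm (2 * DIM('a) + k) \<psi>" by blast
 let ?n = "2 * DIM('a) + k"
 have "(1 + norm y) ^ Suc k * norm (inv_fourier \<psi> y) \<le> C * (1 + real DIM('a)) * schwartz_norm (Suc ?n) \<psi>"
  if s: "schwartz \<psi>" for \<psi> and y :: 'a
 proof -
  have coord: "\<bar>y \<bullet> b\<bar> * norm (inv_fourier \<psi> y) \<le> norm (inv_fourier (pd b \<psi>) y)" if b: "b \<in> Basis" for b
  proof -
   have "norm (inv_fourier (pd b \<psi>) y) = 2 * pi * (\<bar>y \<bullet> b\<bar> * norm (inv_fourier \<psi> y))"
    unfolding inv_fourier_pd[OF s b] by (simp add: norm_mult)
   moreover have "1 * (\<bar>y \<bullet> b\<bar> * norm (inv_fourier \<psi> y)) \<le> 2 * pi * (\<bar>y \<bullet> b\<bar> * norm (inv_fourier \<psi> y))"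
    using pi_ge_two by (intro mult_right_mono) auto
   ultimately show ?thesis by simp
  qed
  have "norm y * norm (inv_fourier \<psi> y) \<le> (\<Sum>b\<in>Basis. \<bar>y \<bullet> b\<bar>) * norm (inv_fourier \<psi> y)"
   by (intro mult_right_mono norm_le_l1) auto
  also have "\<dots> \<le> (\<Sum>b\<in>Basis. norm (inv_fourier (pd b \<psi>) y))"
   unfolding sum_distrib_right by (intro sum_mono coord)
  finally have "(1 + norm y) * norm (inv_fourier \<psi> y) \<le> norm (inv_fourier \<psi> y) + (\<Sum>b\<in>Basis. norm (inv_fourier (pd b \<psi>) y))"
   by (simp add: algebra_simps)
  then have "(1 + norm y) ^ k * ((1 + norm y) * norm (inv_fourier \<psi> y))
   \<le> (1 + norm y) ^ k * (norm (inv_fourier \<psi> y) + (\<Sum>b\<in>Basis. norm (inv_fourier (pd b \<psi>) y)))"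
   by (rule mult_left_mono) simp
  also have "\<dots> = (1 + norm y) ^ k * norm (inv_fourier \<psi> y) + (\<Sum>b\<in>Basis. (1 + norm y) ^ k * norm (inv_fourier (pd b \<psi>) y))"
   by (simp add: distrib_left sum_distrib_left)
  also have "\<dots> \<le> C * schwartz_norm ?n \<psi> + (\<Sum>b\<in>(Basis :: 'a set). C * schwartz_norm ?n (pd b \<psi>))"
   by (intro add_mono sum_mono C(2) s schwartz_pd)
  also have "\<dots> \<le> C * schwartz_norm (Suc ?n) \<psi> + (\<Sum>b\<in>(Basis :: 'a set). C * schwartz_norm (Suc ?n) \<psi>)"
   by (intro add_mono sum_mono mult_left_mono schwartz_norm_Suc s C(1))
  finally show ?thesis by (simp add: algebra_simps)
 qed
 then show ?case using C(1) by (intro exI[of _ "C * (1 + real DIM('a))"]) auto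
qed

lemma schwartz_inv_fourier:
 fixes \<psi> :: "'a::euclidean_space \<Rightarrow> complex"
 assumes "schwartz \<psi>" shows "schwartz (inv_fourier \<psi>)"
proof (rule schwartz_coinduct[where C = "{inv_fourier \<psi> | \<psi>. schwartz \<psi>}"])
 fix f :: "'a \<Rightarrow> complex" assume "f \<in> {inv_fourier \<psi> | \<psi>. schwartz \<psi>}"
 then obtain \<psi> where f: "f = inv_fourier \<psi>" and s: "schwartz \<psi>" by blast
 note d = has_derivative_inv_fourier[OF s]
 show "f differentiable (at x)" for x unfolding f differentiable_def using d by blast
 show "pd b f \<in> {inv_fourier \<psi> | \<psi>. schwartz \<psi>}" if "b \<in> Basis" for b
 proof -
  have "pd b f = inv_fourier (\<lambda>x. 2 * of_real pi * \<i> * (of_real (x \<bullet> b) * \<psi> x))"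
   unfolding f by (rule ext) (rule pd_eq[OF d])
  moreover have "schwartz (\<lambda>x. 2 * of_real pi * \<i> * (of_real (x \<bullet> b) * \<psi> x))"
   by (intro schwartz_scale schwartz_coordinate s)
  ultimately show ?thesis by blast
 qed
 show "\<exists>B. \<forall>x. (1 + norm x) ^ k * norm (f x) \<le> B" for k
 proof -
  obtain C where C: "\<And>\<psi> (y::'a). schwartz \<psi> \<Longrightarrow>
    (1 + norm y) ^ k * norm (inv_fourier \<psi> y) \<le> C * schwartz_norm (2 * DIM('a) + k) \<psi>"
   using inv_fourier_schwartz_bound[of k, where 'a='a] by blast
  show ?thesis unfolding f using C[OF s] by blast
 qed
next
 show "inv_fourier \<psi> \<in> {inv_fourier \<psi> | \<psi>. schwartz \<psi>}"
  using assms by (intro CollectI exI[of _ \<psi>] conjI refl)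
qed

lemma schwartz_fourier: assumes "schwartz \<psi>" shows "schwartz (fourier \<psi>)"
proof -
 have "fourier \<psi> = (\<lambda>x. inv_fourier \<psi> (- x))" by (rule ext) (rule fourier_eq_inv_fourier)
 then show ?thesis using schwartz_reflect[OF schwartz_inv_fourier[OF assms]] by simp
qed

lemma schwartz_bounded: assumes "schwartz \<psi>" obtains B where "\<And>x. norm (\<psi> x) \<le> B"
proof -
 obtain B where "\<And>x. (1 + norm x) ^ 0 * norm (\<psi> x) \<le> B" using schwartz_rapid[OF assms, of 0] by blast
 then show ?thesis using that[of B] by simp
qed

lemma schwartz_inversion:
 assumes s: "schwartz \<psi>"
 shows "inv_fourier (fourier \<psi>) x = \<psi> x" and "fourier (inv_fourier \<psi>) x = \<psi> x"
proof -
 obtain B where B: "\<And>x. norm (\<psi> x) \<le> B" using schwartz_bounded[OF s] by blast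
 show "inv_fourier (fourier \<psi>) x = \<psi> x"
  by (rule fourier_inversion[OF integrable_schwartz[OF s] continuous_schwartz[OF s] B
     integrable_schwartz[OF schwartz_fourier[OF s]]])
 show "fourier (inv_fourier \<psi>) x = \<psi> x"
  by (rule inv_fourier_inversion[OF integrable_schwartz[OF s] continuous_schwartz[OF s] B
     integrable_schwartz[OF schwartz_inv_fourier[OF s]]])
qed

subsection \<open>The distribution with a given absolutely continuous transform\<close>

text \<open>A translation bounded density pairs with every function that decays like \<open>decay\<close>; this makes it a
 tempered distribution.\<close>

lemma translation_bounded_pairing:
 fixes f :: "'a::euclidean_space \<Rightarrow> complex"
 assumes f: "locally_integrable f" and tb: "translation_bounded (abs_density f)"
 obtains C where "0 \<le> C"
  "\<And>u B. u \<in> borel_measurable borel \<Longrightarrow> 0 \<le> B \<Longrightarrow> (\<And>y. norm (u y) \<le> B * decay y) \<Longrightarrow> integrable lborel (\<lambda>y. u y * f y)"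
  "\<And>u B. u \<in> borel_measurable borel \<Longrightarrow> 0 \<le> B \<Longrightarrow> (\<And>y. norm (u y) \<le> B * decay y) \<Longrightarrow> norm (LINT y|lborel. u y * f y) \<le> C * B"
proof -
 have [measurable]: "f \<in> borel_measurable borel" using f by (simp add: locally_integrable_def)
 let ?D = "abs_density f"
 obtain K where K: "0 \<le> K" "\<And>t. emeasure ?D (cube t) \<le> ennreal K" and M: "locally_finite ?D"
  using tb unfolding translation_bounded_def by blast
 define C where "C = 3 ^ DIM('a) * K * (LINT y|(lborel::'a measure). decay y)"
 have I0: "0 \<le> (LINT y|(lborel::'a measure). decay y)"
  by (intro integral_nonneg_AE AE_I2) (simp add: decay_pos less_imp_le)
 have C0: "0 \<le> C" using K(1) I0 by (simp add: C_def)
 have D: "(\<integral>\<^sup>+x. ennreal (decay x) \<partial>?D) \<le> ennreal C"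
  using decay_average[OF M K(2,1), of 1 0] by (simp add: C_def)
 have le: "(\<integral>\<^sup>+y. ennreal (norm (u y * f y)) \<partial>lborel) \<le> ennreal (C * B)"
  if [measurable]: "u \<in> borel_measurable borel" and B: "0 \<le> B" "\<And>y. norm (u y) \<le> B * decay y" for u :: "'a \<Rightarrow> complex" and B
 proof -
  have "(\<integral>\<^sup>+y. ennreal (norm (u y * f y)) \<partial>lborel) \<le> (\<integral>\<^sup>+y. ennreal (norm (f y)) * (ennreal B * ennreal (decay y)) \<partial>lborel)"
  proof (rule nn_integral_mono)
   fix y
   have "norm (u y * f y) \<le> norm (f y) * (B * decay y)"
    unfolding norm_mult by (subst mult.commute) (intro mult_left_mono B; simp)
   then have "ennreal (norm (u y * f y)) \<le> ennreal (norm (f y) * (B * decay y))" by (rule ennreal_leI)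
   then show "ennreal (norm (u y * f y)) \<le> ennreal (norm (f y)) * (ennreal B * ennreal (decay y))"
    using B(1) decay_pos[of y] by (simp add: ennreal_mult)
  qed
  also have "\<dots> = (\<integral>\<^sup>+y. ennreal B * ennreal (decay y) \<partial>?D)" by (rule nn_integral_density[symmetric]) measurable
  also have "\<dots> = ennreal B * (\<integral>\<^sup>+y. ennreal (decay y) \<partial>?D)" by (rule nn_integral_cmult) measurable
  also have "\<dots> \<le> ennreal B * ennreal C" by (rule mult_left_mono[OF D]) simp
  also have "\<dots> = ennreal (C * B)" using B(1) C0 by (simp add: ennreal_mult mult.commute)
  finally show ?thesis .
 qed
 have int: "integrable lborel (\<lambda>y. u y * f y)"
  if [measurable]: "u \<in> borel_measurable borel" and B: "0 \<le> B" "\<And>y. norm (u y) \<le> B * decay y" for u :: "'a \<Rightarrow> complex" and B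
  using le[OF that] by (intro integrableI_bounded) (auto intro: le_less_trans)
 show ?thesis
 proof (rule that[of C])
  show "0 \<le> C" by (rule C0)
  show "integrable lborel (\<lambda>y. u y * f y)"
   if "u \<in> borel_measurable borel" "0 \<le> B" "\<And>y. norm (u y) \<le> B * decay y" for u B
   using that by (rule int)
  fix u :: "'a \<Rightarrow> complex" and B
  assume u: "u \<in> borel_measurable borel" "0 \<le> B" "\<And>y. norm (u y) \<le> B * decay y"
  have "ennreal (norm (LINT y|lborel. u y * f y)) \<le> (\<integral>\<^sup>+y. ennreal (norm (u y * f y)) \<partial>lborel)"
   by (rule integral_norm_bound_ennreal[OF int[OF u]])
  also have "\<dots> \<le> ennreal (C * B)" by (rule le[OF u])
  finally show "norm (LINT y|lborel. u y * f y) \<le> C * B" using C0 u(2) by simp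
 qed
qed

text \<open>The Fourier transform is onto the Schwartz functions, so a distribution is determined by its transform.\<close>

theorem mu_0a_eq:
 fixes f :: "'a::euclidean_space \<Rightarrow> complex"
 assumes f: "locally_integrable f" and tb: "translation_bounded (abs_density f)"
  and ac: "ac_part (fourier_measure \<mu>) = lebesgue_density f"
  and s: "schwartz \<psi>"
 shows "mu_0a \<mu> \<psi> = (LINT y|lborel. inv_fourier \<psi> y * f y)"
proof -
 obtain C where C: "0 \<le> C"
  "\<And>u B. u \<in> borel_measurable borel \<Longrightarrow> 0 \<le> B \<Longrightarrow> (\<And>y. norm (u y) \<le> B * decay y) \<Longrightarrow> integrable lborel (\<lambda>y. u y * f y)"
  "\<And>u B. u \<in> borel_measurable borel \<Longrightarrow> 0 \<le> B \<Longrightarrow> (\<And>y. norm (u y) \<le> B * decay y) \<Longrightarrow> norm (LINT y|lborel. u y * f y) \<le> C * B"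
  using translation_bounded_pairing[OF f tb] by blast
 have int: "integrable lborel (\<lambda>y. \<phi> y * f y)" if s: "schwartz \<phi>" for \<phi>
 proof -
  obtain B where "0 \<le> B" "\<And>x. norm (\<phi> x) \<le> B * decay x" using schwartz_le_decay[OF s] by blast
  then show ?thesis by (rule C(2)[OF borel_measurable_schwartz[OF s]])
 qed
 define T where "T \<phi> = (if schwartz \<phi> then LINT y|lborel. inv_fourier \<phi> y * f y else 0)" for \<phi>
 let ?P = "\<lambda>T. tempered_distribution T \<and>
   distribution_is_measure (fourier_distribution T) (ac_part (fourier_measure \<mu>))"
 have "mu_0a \<mu> = T"
  unfolding mu_0a_def
 proof (rule the_equality)
  have "tempered_distribution T"
   unfolding tempered_distribution_def
  proof (intro conjI allI impI)
   fix \<phi> \<psi> :: "'a \<Rightarrow> complex" assume s: "schwartz \<phi>" "schwartz \<psi>"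
   have "inv_fourier (\<lambda>x. \<phi> x + \<psi> x) y = inv_fourier \<phi> y + inv_fourier \<psi> y" for y
    unfolding inv_fourier_wave using s by (simp add: distrib_left integrable_wave_mult integrable_schwartz)
   then show "T (\<lambda>x. \<phi> x + \<psi> x) = T \<phi> + T \<psi>"
    using s int[OF schwartz_inv_fourier] by (simp add: T_def schwartz_add distrib_right)
  next
   fix a and \<phi> :: "'a \<Rightarrow> complex" assume s: "schwartz \<phi>"
   have "inv_fourier (\<lambda>x. a * \<phi> x) y = a * inv_fourier \<phi> y" for y
    unfolding inv_fourier_wave mult.left_commute[of "wave _ _" a] by (rule integral_mult_right_zero)
   then show "T (\<lambda>x. a * \<phi> x) = a * T \<phi>"
    using s by (simp add: T_def schwartz_scale mult.assoc)
  next
   obtain K where K: "0 \<le> K" "\<And>\<phi> (y::'a). schwartz \<phi> \<Longrightarrow>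
    (1 + norm y) ^ (2 * DIM('a)) * norm (inv_fourier \<phi> y) \<le> K * schwartz_norm (2 * DIM('a) + 2 * DIM('a)) \<phi>"
    using inv_fourier_schwartz_bound[of "2 * DIM('a)", where 'a='a] by blast
   let ?n = "2 * DIM('a) + 2 * DIM('a)"
   have "norm (T \<phi>) \<le> (C * K) * schwartz_norm ?n \<phi>" if s: "schwartz \<phi>" for \<phi>
   proof -
    have K0: "0 \<le> K * schwartz_norm ?n \<phi>" using K(1) schwartz_norm_nonneg[OF s] by simp
    have "norm (LINT y|lborel. inv_fourier \<phi> y * f y) \<le> C * (K * schwartz_norm ?n \<phi>)"
     using borel_measurable_schwartz[OF schwartz_inv_fourier[OF s]] K0
     by (rule C(3)) (rule le_decay[OF K(2)[OF s] K0])
    then show ?thesis using s by (simp add: T_def mult.assoc)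
   qed
   then show "\<exists>C n. \<forall>\<phi>. schwartz \<phi> \<longrightarrow> norm (T \<phi>) \<le> C * schwartz_norm n \<phi>" by blast
  qed (simp add: T_def)
  moreover have "distribution_is_measure (fourier_distribution T) (lebesgue_density f)"
   unfolding distribution_is_measure_def
  proof (intro allI impI conjI)
   fix \<phi> :: "'a \<Rightarrow> complex" assume s: "schwartz \<phi>"
   note R = lebesgue_density_representation(2,3)[OF f borel_measurable_schwartz[OF s]]
   show "integrable (total_variation (lebesgue_density f)) \<phi>" unfolding R(1) by (rule int[OF s])
   show "fourier_distribution T \<phi> = radon_integral (lebesgue_density f) \<phi>"
    unfolding R(2) using s by (simp add: fourier_distribution_def T_def schwartz_fourier schwartz_inversion)
  qed
  ultimately show "?P T" by (simp add: ac)
  fix T' assume T': "?P T'"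
  have "T' \<phi> = T \<phi>" for \<phi>
  proof (cases "schwartz \<phi>")
   case True
   note s = schwartz_inv_fourier[OF True]
   have inv: "fourier (inv_fourier \<phi>) = \<phi>" by (rule ext) (rule schwartz_inversion(2)[OF True])
   have "fourier_distribution T' (inv_fourier \<phi>) = radon_integral (lebesgue_density f) (inv_fourier \<phi>)"
    using T' s unfolding ac distribution_is_measure_def by blast
   then show ?thesis
    using s True inv by (simp add: fourier_distribution_def T_def
      lebesgue_density_representation(3)[OF f borel_measurable_schwartz])
  next
   case False
   then show ?thesis using T' by (simp add: T_def tempered_distribution_def)
  qed
  then show "T' = T" by blast
 qed
 then show ?thesis using s by (simp add: T_def)
qed

section \<open>Meyer sets and their almost-periods\<close>

definition near_int :: "real \<Rightarrow> real \<Rightarrow> bool" where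
 "near_int \<delta> z \<longleftrightarrow> (\<exists>n::int. \<bar>z - n\<bar> \<le> \<delta>)"

lemma near_intI: "\<bar>z - of_int n\<bar> \<le> \<delta> \<Longrightarrow> near_int \<delta> z"
 unfolding near_int_def by blast

lemma near_int_add: assumes "near_int a y" "near_int b z" shows "near_int (a + b) (y + z)"
proof -
 obtain m n :: int where "\<bar>y - m\<bar> \<le> a" "\<bar>z - n\<bar> \<le> b" using assms unfolding near_int_def by blast
 then have "\<bar>(y + z) - of_int (m + n)\<bar> \<le> a + b" by simp
 then show ?thesis by (rule near_intI)
qed

lemma near_int_minus: assumes "near_int a y" shows "near_int a (- y)"
proof -
 obtain m :: int where "\<bar>y - m\<bar> \<le> a" using assms unfolding near_int_def by blast
 then have "\<bar>- y - of_int (- m)\<bar> \<le> a" by simp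
 then show ?thesis by (rule near_intI)
qed

lemma near_int_diff: assumes "near_int a y" "near_int b z" shows "near_int (a + b) (y - z)"
 using near_int_add[OF assms(1) near_int_minus[OF assms(2)]] by simp

lemma near_int_mono: "near_int a y \<Longrightarrow> a \<le> b \<Longrightarrow> near_int b y"
 unfolding near_int_def by (meson order_trans)

lemma near_int_abs: "\<bar>z\<bar> \<le> \<delta> \<Longrightarrow> near_int \<delta> z"
 by (rule near_intI[of _ 0]) simp

lemma near_int_add_int: "near_int \<delta> (z + of_int n) \<longleftrightarrow> near_int \<delta> z"
proof
 assume "near_int \<delta> (z + of_int n)"
 then obtain m :: int where "\<bar>z + of_int n - m\<bar> \<le> \<delta>" unfolding near_int_def by blast
 then have "\<bar>z - of_int (m - n)\<bar> \<le> \<delta>" by (simp add: algebra_simps)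
 then show "near_int \<delta> z" by (rule near_intI)
next
 assume "near_int \<delta> z"
 then obtain m :: int where "\<bar>z - m\<bar> \<le> \<delta>" unfolding near_int_def by blast
 then have "\<bar>z + of_int n - of_int (m + n)\<bar> \<le> \<delta>" by simp
 then show "near_int \<delta> (z + of_int n)" by (rule near_intI)
qed

text \<open>A quantity that is always close to some integer and moves in small steps stays close to the same
 integer.\<close>

lemma near_int_jump:
 assumes n: "near_int \<delta> (v::real)" and u: "\<bar>u\<bar> \<le> \<delta>" and d: "\<bar>v - u\<bar> \<le> 2 * \<delta>" "4 * \<delta> < 1"
 shows "\<bar>v\<bar> \<le> \<delta>"
proof -
 obtain m :: int where m: "\<bar>v - m\<bar> \<le> \<delta>" using n unfolding near_int_def by blast
 have "\<bar>real_of_int m\<bar> < 1" using m u d by linarith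
 then have "m = 0" by linarith
 then show ?thesis using m by simp
qed

subsection \<open>Almost additive sequences\<close>

text \<open>A sequence that is additive up to \<open>\<delta>\<close> is within \<open>\<delta>\<close> of a linear one.\<close>

lemma almost_additive_slope:
 fixes g :: "nat \<Rightarrow> real"
 assumes add: "\<And>i j. \<bar>g (i + j) - g i - g j\<bar> \<le> \<delta>" and g0: "g 0 = 0"
 obtains \<eta> where "\<And>i. \<bar>g i - real i * \<eta>\<bar> \<le> \<delta>"
proof -
 have d: "0 \<le> \<delta>" using add[of 0 0] g0 by simp
 have mult: "\<bar>g (j * i) - real j * g i\<bar> \<le> real j * \<delta>" for i j
 proof (induction j)
  case (Suc j)
  have "g (Suc j * i) - real (Suc j) * g i = (g (j * i) - real j * g i) + (g (i + j * i) - g i - g (j * i))"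
   by (simp add: algebra_simps)
  also have "\<bar>\<dots>\<bar> \<le> real j * \<delta> + \<delta>" by (intro order_trans[OF abs_triangle_ineq] add_mono Suc add)
  finally show ?case by (simp add: algebra_simps)
 qed (simp add: g0)
 have cross: "(g i - \<delta>) / real i \<le> (g j + \<delta>) / real j" if "0 < i" "0 < j" for i j
 proof -
  have "\<bar>g (j * i) - real j * g i\<bar> \<le> real j * \<delta>" "\<bar>g (j * i) - real i * g j\<bar> \<le> real i * \<delta>"
   using mult[of j i] mult[of i j] by (simp_all add: mult.commute)
  then have "real j * g i - real i * g j \<le> real j * \<delta> + real i * \<delta>" by linarith
  then show ?thesis using that by (simp add: field_simps)
 qed
 (* The intervals of radius \<delta> / i around g i / i meet pairwise by cross, so they have a common point. *)
 define \<eta> where "\<eta> = (SUP i\<in>{0<..}. (g i - \<delta>) / real i)"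
 have "\<bar>g i - real i * \<eta>\<bar> \<le> \<delta>" for i
 proof (cases "i = 0")
  case False
  have "bdd_above ((\<lambda>i. (g i - \<delta>) / real i) ` {0<..})"
   using cross[of _ 1] by (intro bdd_aboveI2[of _ _ "(g 1 + \<delta>) / real 1"]) auto
  then have "(g i - \<delta>) / real i \<le> \<eta>" unfolding \<eta>_def using False by (intro cSUP_upper) auto
  moreover have "\<eta> \<le> (g i + \<delta>) / real i" unfolding \<eta>_def
   using False cross[of _ i] by (intro cSUP_least) auto
  ultimately show ?thesis using False by (simp add: field_simps abs_le_iff)
 qed (simp add: g0 d)
 then show ?thesis using that by blast
qed

text \<open>If \<open>a\<close> is almost additive modulo 1, then a lift to the reals that proceeds in almost equal steps is
 almost additive as a real sequence, because its additivity defect cannot jump from one integer to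
 another.\<close>

lemma almost_additive_mod_1:
 fixes a :: "nat \<Rightarrow> real"
 assumes a0: "a 0 = 0" and a1: "near_int \<delta> (a 1)"
  and add: "\<And>i j. near_int \<delta> (a (i + j) - a i - a j)" and d: "4 * \<delta> < 1"
 obtains \<eta> where "\<bar>\<eta>\<bar> \<le> 2 * \<delta>" "\<And>i. near_int \<delta> (a i - real i * \<eta>)"
proof -
 obtain m1 :: int where m1: "\<bar>a 1 - m1\<bar> \<le> \<delta>" using a1 unfolding near_int_def by blast
 have "\<forall>i. \<exists>m::int. \<bar>(a (i + 1) - a i - a 1) - m\<bar> \<le> \<delta>" using add[of _ 1] unfolding near_int_def by blast
 then obtain m :: "nat \<Rightarrow> int" where m: "\<And>i. \<bar>(a (i + 1) - a i - a 1) - m i\<bar> \<le> \<delta>" by metis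
 (* Subtracting k i turns each step of a into one within \<delta> of the first. *)
 define k where "k = rec_nat 0 (\<lambda>i k. k + m i + m1)"
 have k: "k 0 = 0" "\<And>i. k (Suc i) = k i + m i + m1" by (simp_all add: k_def)
 define g where "g i = a i - of_int (k i)" for i
 have d0: "0 \<le> \<delta>" using m1 by linarith
 have g0: "g 0 = 0" by (simp add: g_def a0 k)
 have m0: "m 0 = 0"
 proof -
  have "\<bar>real_of_int (m 0)\<bar> \<le> \<delta>" using m[of 0] a0 by simp
  then have "\<bar>real_of_int (m 0)\<bar> < 1" using d d0 by linarith
  then show ?thesis by linarith
 qed
 have k1: "k 1 = m1" using k(2)[of 0] by (simp add: m0 k(1))
 have g1: "\<bar>g 1\<bar> \<le> \<delta>" using m1 k1 by (simp add: g_def)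
 have step: "\<bar>g (Suc i) - g i - g 1\<bar> \<le> \<delta>" for i
  using m[of i] k1 by (simp add: g_def k(2) algebra_simps)
 have "\<bar>g (i + j) - g i - g j\<bar> \<le> \<delta>" for i j
 proof (induction j)
  case 0
  then show ?case by (simp add: g0 d0)
 next
  case (Suc j)
  show ?case
  proof (rule near_int_jump[OF _ Suc _ d])
   have "g (i + Suc j) - g i - g (Suc j) = (a (i + Suc j) - a i - a (Suc j)) + of_int (- k (i + Suc j) + k i + k (Suc j))"
    by (simp add: g_def)
   then show "near_int \<delta> (g (i + Suc j) - g i - g (Suc j))" using add by (simp only: near_int_add_int)
   have "g (i + Suc j) - g i - g (Suc j) - (g (i + j) - g i - g j)
    = (g (Suc (i + j)) - g (i + j) - g 1) - (g (Suc j) - g j - g 1)" by simp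
   also have "\<bar>\<dots>\<bar> \<le> \<delta> + \<delta>" by (intro order_trans[OF abs_triangle_ineq4] add_mono step)
   finally show "\<bar>g (i + Suc j) - g i - g (Suc j) - (g (i + j) - g i - g j)\<bar> \<le> 2 * \<delta>" by simp
  qed
 qed
 then obtain \<eta> where \<eta>: "\<And>i. \<bar>g i - real i * \<eta>\<bar> \<le> \<delta>" using almost_additive_slope[of g \<delta>, OF _ g0] by blast
 show ?thesis
 proof (rule that)
  show "\<bar>\<eta>\<bar> \<le> 2 * \<delta>" using \<eta>[of 1] g1 by simp
  show "near_int \<delta> (a i - real i * \<eta>)" for i
   using \<eta>[of i] by (intro near_intI[of _ "k i"]) (simp add: g_def algebra_simps)
 qed
qed

subsection \<open>Finite local complexity\<close>

abbreviation differences :: "'a::ab_group_add set \<Rightarrow> 'a set" where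
 "differences A \<equiv> {x - y | x y. x \<in> A \<and> y \<in> A}"

text \<open>A ball is covered by finitely many balls that contain at most one point each, and their number does not
 depend on the centre.\<close>

lemma uniform_discrete_card_ball:
 fixes D :: "'a::euclidean_space set"
 assumes "uniform_discrete D"
 obtains N :: nat where "\<And>w. finite (D \<inter> cball w T) \<and> card (D \<inter> cball w T) \<le> N"
proof -
 obtain e where e: "0 < e" "\<And>x y. x \<in> D \<Longrightarrow> y \<in> D \<Longrightarrow> dist x y < e \<Longrightarrow> x = y"
  using assms unfolding uniform_discrete_def by blast
 have "\<forall>e>0. \<exists>P. finite P \<and> cball (0::'a) T \<subseteq> (\<Union>p\<in>P. ball p e)"
  using compact_cball[of "0::'a" T, unfolded compact_eq_totally_bounded] by (rule conjunct2)
 from this[rule_format, of "e / 2"] obtain P :: "'a set"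
  where P: "finite P" "cball 0 T \<subseteq> (\<Union>p\<in>P. ball p (e / 2))" using e(1) by auto
 have "finite (D \<inter> cball w T) \<and> card (D \<inter> cball w T) \<le> card P" for w
 proof -
  have "\<forall>u\<in>D \<inter> cball w T. \<exists>p\<in>P. dist p (u - w) < e / 2"
  proof
   fix u assume "u \<in> D \<inter> cball w T"
   then have "u - w \<in> cball 0 T" by (simp add: dist_norm norm_minus_commute)
   then have "u - w \<in> (\<Union>p\<in>P. ball p (e / 2))" using P(2) by (rule subsetD[rotated])
   then show "\<exists>p\<in>P. dist p (u - w) < e / 2" unfolding UN_iff mem_ball .
  qed
  then obtain c where c: "\<And>u. u \<in> D \<inter> cball w T \<Longrightarrow> c u \<in> P \<and> dist (c u) (u - w) < e / 2" by metis
  have inj: "inj_on c (D \<inter> cball w T)"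
  proof (rule inj_onI)
   fix u v assume uv: "u \<in> D \<inter> cball w T" "v \<in> D \<inter> cball w T" "c u = c v"
   have "dist (u - w) (v - w) < e / 2 + e / 2"
    using c[OF uv(1)] c[OF uv(2)] uv(3) by (metis dist_triangle_half_r field_sum_of_halves)
   then show "u = v" using uv e(2)[of u v] by (simp add: dist_norm)
  qed
  have sub: "c ` (D \<inter> cball w T) \<subseteq> P" using c by auto
  show ?thesis using inj_on_finite[OF inj sub P(1)] card_inj_on_le[OF inj sub P(1)] by blast
 qed
 then show ?thesis using that by blast
qed

fun sumset :: "nat \<Rightarrow> 'a::ab_group_add set \<Rightarrow> 'a set" where
 "sumset 0 G = {0}" |
 "sumset (Suc n) G = (\<lambda>(h, g). h + g) ` (sumset n G \<times> G)"

lemma finite_sumset: "finite G \<Longrightarrow> finite (sumset n G)"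
 by (induction n) auto

lemma relpow_in_sumset:
 assumes "(u, v) \<in> {(u, v). u \<in> V \<and> v \<in> V \<and> v - u \<in> G} ^^ n"
 shows "v - u \<in> sumset n (G :: 'a::ab_group_add set)"
 using assms
proof (induction n arbitrary: v)
 case (Suc n)
 then obtain z where z: "(u, z) \<in> {(u, v). u \<in> V \<and> v \<in> V \<and> v - u \<in> G} ^^ n" "v - z \<in> G" by auto
 have "v - u = (\<lambda>(h, g). h + g) (z - u, v - z)" by simp
 then show ?case using Suc.IH[OF z(1)] z(2) by (metis (no_types, lifting) SigmaI image_eqI sumset.simps(2))
qed simp

lemma relatively_dense_choice:
 assumes "relatively_dense \<Gamma>"
 obtains \<gamma> :: "'a::euclidean_space \<Rightarrow> 'a" and R where "0 < R" "\<And>p. \<gamma> p \<in> \<Gamma>" "\<And>p. norm (p - \<gamma> p) \<le> R"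
proof -
 obtain K where K: "compact K" "{x + k | x k. x \<in> \<Gamma> \<and> k \<in> K} = UNIV"
  using assms unfolding relatively_dense_def by blast
 obtain R where R: "0 < R" "\<And>k. k \<in> K \<Longrightarrow> norm k \<le> R"
  using compact_imp_bounded[OF K(1)] unfolding bounded_pos by blast
 have "\<exists>x\<in>\<Gamma>. norm (p - x) \<le> R" for p
 proof -
  obtain x k where "p = x + k" "x \<in> \<Gamma>" "k \<in> K" using K(2) by blast
  then show ?thesis using R(2)[of k] by (intro bexI[of _ x]) simp_all
 qed
 then show ?thesis using that[OF R(1)] by metis
qed

text \<open>Only \<open>\<Gamma> - \<Gamma>\<close> is assumed to be uniformly discrete, but then the differences of elements of \<open>\<Gamma> - \<Gamma>\<close>
 form a locally finite set. Two nearby elements of \<open>\<Gamma> - \<Gamma>\<close>, realised at different places of \<open>\<Gamma>\<close>, are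
 joined by a chain of elements that all lie in one ball and whose successive differences come
 from a fixed finite set \<open>G\<close>. The ball contains a bounded number of elements, so the chain can
 be shortened to bounded length.\<close>

lemma differences_finite_local_complexity:
 fixes \<Gamma> :: "'a::euclidean_space set"
 assumes "meyer_set \<Gamma>"
 shows "finite {z. norm z \<le> \<rho> \<and> (\<exists>u\<in>differences \<Gamma>. \<exists>v\<in>differences \<Gamma>. z = u - v)}"
proof -
 define D where "D = differences \<Gamma>"
 have ud: "uniform_discrete D" and rd: "relatively_dense \<Gamma>" using assms by (simp_all add: meyer_set_def D_def)
 obtain R \<gamma> where R: "0 < R" "\<And>p. \<gamma> p \<in> \<Gamma>" "\<And>p. norm (p - \<gamma> p) \<le> R"
  by (rule relatively_dense_choice[OF rd]) blast
 define r where "r = 2 * R + 1 + \<bar>\<rho>\<bar>"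
 obtain N where N: "\<And>w. finite (D \<inter> cball w r) \<and> card (D \<inter> cball w r) \<le> N"
  by (rule uniform_discrete_card_ball[OF ud, of r]) blast
 define G where "G = (\<lambda>(a, b). a - b) ` ((D \<inter> cball 0 r) \<times> (D \<inter> cball 0 r))"
 have finG: "finite G" unfolding G_def using N[of 0] by (intro finite_imageI finite_cartesian_product) simp_all
 have inG: "a - b \<in> G" if "a \<in> D" "b \<in> D" "norm a \<le> r" "norm b \<le> r" for a b
  unfolding G_def by (rule image_eqI[of _ _ "(a, b)"]) (use that in auto)
 have D: "x - y \<in> D" if "x \<in> \<Gamma>" "y \<in> \<Gamma>" for x y unfolding D_def using that by blast
 have \<gamma>\<gamma>: "norm (\<gamma> p - \<gamma> q) \<le> 2 * R + norm (p - q)" for p q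
 proof -
  have "norm ((p - q) - (p - \<gamma> p) + (q - \<gamma> q)) \<le> norm (p - q) + norm (p - \<gamma> p) + norm (q - \<gamma> q)"
   by (rule order_trans[OF norm_triangle_ineq add_right_mono[OF norm_triangle_ineq4]])
  moreover have "(p - q) - (p - \<gamma> p) + (q - \<gamma> q) = \<gamma> p - \<gamma> q" by simp
  ultimately have "norm (\<gamma> p - \<gamma> q) \<le> norm (p - q) + norm (p - \<gamma> p) + norm (q - \<gamma> q)" by simp
  then show ?thesis using R(3)[of p] R(3)[of q] by simp
 qed
 have main: "z \<in> (\<Union>n\<le>N * N. sumset n G)"
  if z: "norm z \<le> \<rho>" and uD: "u \<in> D" and vD: "v \<in> D" and "z = u - v" for z u v
 proof -
  obtain x y x' y' where uv: "v = x - y" "u = x' - y'" "x \<in> \<Gamma>" "y \<in> \<Gamma>" "x' \<in> \<Gamma>" "y' \<in> \<Gamma>"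
   using uD vD unfolding D_def by (elim CollectE exE conjE) blast
  define V where "V = D \<inter> cball v r"
  have Vi: "w \<in> V" if "w \<in> D" "norm (w - v) \<le> r" for w
   unfolding V_def using that by (simp add: dist_norm norm_minus_commute)
  define E where "E = {(a, b). a \<in> V \<and> b \<in> V \<and> b - a \<in> G}"
  have V: "finite V" "card V \<le> N" using N[of v] by (simp_all add: V_def)
  have ES: "E \<subseteq> V \<times> V" unfolding E_def by blast
  have E: "finite E" using ES V(1) by (blast intro: finite_subset)
  have "card E \<le> card (V \<times> V)" using ES V(1) by (intro card_mono) auto
  also have "\<dots> \<le> N * N" using V(2) by (simp add: card_cartesian_product mult_le_mono)
  finally have cE: "card E \<le> N * N" .
  define m where "m = Suc (nat \<lceil>norm (y' - y)\<rceil>)"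
  have m: "norm (y' - y) \<le> real m" unfolding m_def by linarith
  have m0: "0 < real m" unfolding m_def by (simp only: of_nat_0_less_iff zero_less_Suc)
  (* Carry the vector v along the segment from y to y' and round both of its ends to \<Gamma>. *)
  define p where "p i = y + (real i / real m) *\<^sub>R (y' - y)" for i
  have pstep: "norm (p (Suc i) - p i) \<le> 1" for i
  proof -
   have "p (Suc i) - p i = (real (Suc i) / real m - real i / real m) *\<^sub>R (y' - y)"
    unfolding p_def scaleR_left_diff_distrib by simp
   also have "real (Suc i) / real m - real i / real m = 1 / real m" by (simp flip: diff_divide_distrib)
   finally have "norm (p (Suc i) - p i) = norm (y' - y) / real m" by simp
   then show ?thesis using m m0 by simp
  qed
  define a where "a i = \<gamma> (p i + v) - \<gamma> (p i)" for i
  have aV: "a i \<in> V" for i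
  proof -
   have "a i - v = (p i - \<gamma> (p i)) - (p i + v - \<gamma> (p i + v))" by (simp add: a_def)
   then have "norm (a i - v) \<le> norm (p i - \<gamma> (p i)) + norm (p i + v - \<gamma> (p i + v))"
    by (simp only: norm_triangle_ineq4)
   also have "\<dots> \<le> R + R" by (intro add_mono R(3))
   finally have n: "norm (a i - v) \<le> r" by (simp add: r_def)
   have "a i \<in> D" unfolding a_def by (intro D R(2))
   then show ?thesis using n by (rule Vi)
  qed
  have vV: "v \<in> V" by (rule Vi[OF vD]) (use R(1) in \<open>simp add: r_def\<close>)
  have uV: "u \<in> V"
   by (rule Vi[OF uD]) (use R(1) z \<open>z = u - v\<close> in \<open>simp add: r_def\<close>)
  (* The first and the last step only replace end points by their roundings. *)
  have e0: "(v, a 0) \<in> E"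
  proof -
   have yv: "y + v = x" by (simp add: uv(1))
   have "a 0 - v = (\<gamma> x - \<gamma> y) - (x - y)" unfolding a_def p_def by (simp add: yv) (simp add: uv(1))
   then have "a 0 - v = (\<gamma> x - x) - (\<gamma> y - y)" by simp
   moreover have "norm (\<gamma> x - x) \<le> r" "norm (\<gamma> y - y) \<le> r"
    using R(1) R(3)[of x] R(3)[of y] by (simp_all add: r_def norm_minus_commute)
   ultimately have "a 0 - v \<in> G" using inG[OF D[OF R(2) uv(3)] D[OF R(2) uv(4)], of x y] by metis
   then show ?thesis using aV vV by (simp add: E_def)
  qed
  have es: "(a i, a (Suc i)) \<in> E" for i
  proof -
   have "a (Suc i) - a i = (\<gamma> (p (Suc i) + v) - \<gamma> (p i + v)) - (\<gamma> (p (Suc i)) - \<gamma> (p i))"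
    by (simp add: a_def)
   moreover have "norm (\<gamma> (p (Suc i) + v) - \<gamma> (p i + v)) \<le> r" "norm (\<gamma> (p (Suc i)) - \<gamma> (p i)) \<le> r"
    using \<gamma>\<gamma>[of "p (Suc i) + v" "p i + v"] \<gamma>\<gamma>[of "p (Suc i)" "p i"] pstep[of i] by (simp_all add: r_def)
   ultimately have "a (Suc i) - a i \<in> G"
    using inG[OF D[OF R(2) R(2)] D[OF R(2) R(2)], of "p (Suc i) + v" "p i + v" "p (Suc i)" "p i"] by metis
   then show ?thesis using aV by (simp add: E_def)
  qed
  have em: "(a m, u) \<in> E"
  proof -
   have pm: "p m = y'" using m0 by (simp add: p_def)
   have eq: "u - a m = (x' - \<gamma> (y' + v)) - (y' - \<gamma> y')" unfolding a_def pm uv(2) by simp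
   have "norm (x' - \<gamma> (y' + v)) \<le> r"
   proof -
    have "x' - \<gamma> (y' + v) = z + (y' + v - \<gamma> (y' + v))" using \<open>z = u - v\<close> uv(2) by simp
    then have "norm (x' - \<gamma> (y' + v)) \<le> norm z + norm (y' + v - \<gamma> (y' + v))"
     by (simp only: norm_triangle_ineq)
    then show ?thesis using z R(1) R(3)[of "y' + v"] by (simp add: r_def)
   qed
   moreover have "norm (y' - \<gamma> y') \<le> r" using R(1) R(3)[of y'] by (simp add: r_def)
   ultimately have "u - a m \<in> G" unfolding eq by (intro inG D uv R(2))
   then show ?thesis using aV uV by (simp add: E_def)
  qed
  have "(v, a i) \<in> E\<^sup>*" for i
  proof (induction i)
   case 0
   show ?case using e0 by (rule r_into_rtrancl)
  next
   case (Suc i)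
   then show ?case using es by (rule rtrancl_into_rtrancl)
  qed
  then have "(v, u) \<in> E\<^sup>*" using em by (rule rtrancl_into_rtrancl)
  then obtain n where n: "n \<le> card E" "(v, u) \<in> E ^^ n"
   unfolding rtrancl_finite_eq_relpow[OF E] by (elim UN_E CollectE) (rule that)
  have "u - v \<in> sumset n G" by (rule relpow_in_sumset[where V = V]) (use n(2) in \<open>simp only: E_def\<close>)
  then show ?thesis using n(1) cE \<open>z = u - v\<close> by (intro UN_I[of n]) simp_all
 qed
 have "{z. norm z \<le> \<rho> \<and> (\<exists>u\<in>D. \<exists>v\<in>D. z = u - v)} \<subseteq> (\<Union>n\<le>N * N. sumset n G)"
 proof
  fix z assume "z \<in> {z. norm z \<le> \<rho> \<and> (\<exists>u\<in>D. \<exists>v\<in>D. z = u - v)}"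
  then show "z \<in> (\<Union>n\<le>N * N. sumset n G)" by (elim CollectE conjE bexE) (rule main)
 qed
 moreover have "finite (\<Union>n\<le>N * N. sumset n G)"
  by (intro finite_UN_I finite_atMost finite_sumset finG)
 ultimately have "finite {z. norm z \<le> \<rho> \<and> (\<exists>u\<in>D. \<exists>v\<in>D. z = u - v)}" by (rule finite_subset)
 then show ?thesis unfolding D_def .
qed

subsection \<open>Pigeonhole\<close>

text \<open>Vectors with nearly equal fractional parts of all inner products with \<open>F\<close> differ by an approximate
 period of \<open>F\<close>, and there are finitely many classes.\<close>

lemma pigeonhole_almost_periods:
 fixes F :: "'a::euclidean_space set"
 assumes F: "finite F" and d: "0 < \<delta>"
 obtains Q :: "'a set" where "finite Q" "\<And>p. \<exists>q\<in>Q. \<forall>f\<in>F. near_int \<delta> ((p - q) \<bullet> f)"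
proof -
 obtain N :: nat where N: "1 / real (Suc N) < \<delta>" using nat_approx_posE[OF d] by blast
 define M where "M = real (Suc N)"
 have M: "0 < M" "1 / M < \<delta>" using N by (simp_all add: M_def)
 define cell where "cell p = restrict (\<lambda>f. \<lfloor>M * frac (p \<bullet> f)\<rfloor>) F" for p :: 'a
 have "\<lfloor>M * frac z\<rfloor> \<in> {0..int (Suc N)}" for z
 proof -
  have "0 \<le> M * frac z" "M * frac z \<le> M" using M(1) frac_lt_1[of z] by (simp_all add: frac_ge_0)
  then have "0 \<le> \<lfloor>M * frac z\<rfloor>" "\<lfloor>M * frac z\<rfloor> \<le> \<lfloor>M\<rfloor>" by (simp add: le_floor_iff) (rule floor_mono[OF \<open>M * frac z \<le> M\<close>])
  moreover have "\<lfloor>M\<rfloor> = int (Suc N)" unfolding M_def by (rule floor_of_nat)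
  ultimately show ?thesis by simp
 qed
 then have "cell p \<in> F \<rightarrow>\<^sub>E {0..int (Suc N)}" for p
  unfolding cell_def by (rule restrict_PiE_iff[THEN iffD2, OF ballI])
 then have fin: "finite (range cell)"
  using F by (intro finite_subset[of "range cell" "F \<rightarrow>\<^sub>E {0..int (Suc N)}"] finite_PiE) auto
 define Q where "Q = (\<lambda>c. SOME q. cell q = c) ` range cell"
 have "\<exists>q\<in>Q. \<forall>f\<in>F. near_int \<delta> ((p - q) \<bullet> f)" for p
 proof (rule bexI)
  let ?q = "SOME q. cell q = cell p"
  show "?q \<in> Q" unfolding Q_def by blast
  have q: "cell ?q = cell p" by (rule someI[of _ p]) simp
  show "\<forall>f\<in>F. near_int \<delta> ((p - ?q) \<bullet> f)"
  proof
   fix f assume f: "f \<in> F"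
   have "\<lfloor>M * frac (?q \<bullet> f)\<rfloor> = \<lfloor>M * frac (p \<bullet> f)\<rfloor>"
    using fun_cong[OF q, of f] f by (simp add: cell_def)
   then have "\<bar>M * frac (p \<bullet> f) - M * frac (?q \<bullet> f)\<bar> < 1" by linarith
   then have "M * \<bar>frac (p \<bullet> f) - frac (?q \<bullet> f)\<bar> < 1"
    using M(1) by (simp add: abs_mult flip: right_diff_distrib)
   then have "\<bar>frac (p \<bullet> f) - frac (?q \<bullet> f)\<bar> < 1 / M" using M(1) by (simp add: field_simps)
   then have "near_int \<delta> (frac (p \<bullet> f) - frac (?q \<bullet> f))" using M(2) by (intro near_int_abs) simp
   then have "near_int \<delta> (frac (p \<bullet> f) - frac (?q \<bullet> f) + of_int (\<lfloor>p \<bullet> f\<rfloor> - \<lfloor>?q \<bullet> f\<rfloor>))"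
    by (simp only: near_int_add_int)
   then show "near_int \<delta> ((p - ?q) \<bullet> f)" by (simp add: frac_def inner_diff_left)
  qed
 qed
 moreover have "finite Q" unfolding Q_def using fin by simp
 ultimately show ?thesis using that by blast
qed

subsection \<open>Correcting a local almost-period to a global one\<close>

text \<open>An approximate period \<open>\<xi>\<close> of the finite set of local differences is close to an integer on each
 local pattern, but the errors may accumulate over long distances. Along each coordinate axis the
 accumulated error is almost additive, hence almost linear. Subtracting this linear part \<open>\<eta>\<close>, which is
 small, leaves an approximate period of all of \<open>\<Gamma>\<close>.\<close>

lemma linear_correction:
 fixes \<gamma> :: "'a::euclidean_space \<Rightarrow> 'a" and R \<delta> :: real
 assumes R: "0 < R" "\<And>p. \<gamma> p \<in> \<Gamma>" "\<And>p. norm (p - \<gamma> p) \<le> R"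
  and F: "\<And>x y u v. x \<in> \<Gamma> \<Longrightarrow> y \<in> \<Gamma> \<Longrightarrow> u \<in> \<Gamma> \<Longrightarrow> v \<in> \<Gamma> \<Longrightarrow> norm ((x - y) - (u - v)) \<le> 4 * R + 1 + DIM('a)
    \<Longrightarrow> near_int \<delta> (\<xi> \<bullet> ((x - y) - (u - v)))"
  and o: "near_int \<delta> (\<xi> \<bullet> \<gamma> 0)" and d: "0 \<le> \<delta>" "4 * \<delta> < 1"
 obtains \<eta> where "norm \<eta> \<le> 2 * DIM('a) * \<delta>"
  "\<And>x. x \<in> \<Gamma> \<Longrightarrow> near_int ((2 + 3 * DIM('a) + 2 * DIM('a) * DIM('a)) * \<delta>) ((\<xi> - \<eta>) \<bullet> x)"
proof -
 (* The rounding \<gamma> is additive up to the finite set on which \<xi> is almost integral. *)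
 have comp: "near_int \<delta> (\<xi> \<bullet> ((\<gamma> (p + q) - \<gamma> p) - (\<gamma> q - \<gamma> 0)))" for p q
 proof (rule F[OF R(2) R(2) R(2) R(2)])
  have "(\<gamma> (p + q) - \<gamma> p) - (\<gamma> q - \<gamma> 0) = ((p - \<gamma> p) - (p + q - \<gamma> (p + q))) + ((q - \<gamma> q) - (0 - \<gamma> 0))" by simp
  then have "norm ((\<gamma> (p + q) - \<gamma> p) - (\<gamma> q - \<gamma> 0)) \<le> norm ((p - \<gamma> p) - (p + q - \<gamma> (p + q))) + norm ((q - \<gamma> q) - (0 - \<gamma> 0))"
   by (simp only: norm_triangle_ineq)
  also have "\<dots> \<le> (norm (p - \<gamma> p) + norm (p + q - \<gamma> (p + q))) + (norm (q - \<gamma> q) + norm (0 - \<gamma> 0))"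
   by (intro add_mono norm_triangle_ineq4)
  also have "\<dots> \<le> (R + R) + (R + R)" by (intro add_mono R(3))
  finally show "norm ((\<gamma> (p + q) - \<gamma> p) - (\<gamma> q - \<gamma> 0)) \<le> 4 * R + 1 + DIM('a)" by simp
 qed
 have close: "near_int \<delta> (\<xi> \<bullet> (x - \<gamma> p))" if "x \<in> \<Gamma>" "norm (x - p) \<le> DIM('a)" for x p
 proof -
  have "norm (x - \<gamma> p) \<le> norm (x - p) + norm (p - \<gamma> p)"
   using norm_triangle_ineq[of "x - p" "p - \<gamma> p"] by simp
  also have "\<dots> \<le> DIM('a) + R" by (intro add_mono that R(3))
  finally have "norm ((x - \<gamma> p) - (\<gamma> 0 - \<gamma> 0)) \<le> 4 * R + 1 + DIM('a)" using R(1) by simp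
  from F[OF that(1) R(2) R(2) R(2) this] show ?thesis by simp
 qed
 have axis: "\<exists>h. \<bar>h\<bar> \<le> 2 * \<delta> \<and> (\<forall>i::int. near_int (2 * \<delta>) (\<xi> \<bullet> (\<gamma> (of_int i *\<^sub>R b) - \<gamma> 0) - of_int i * h))"
  if b: "b \<in> Basis" for b
 proof -
  define a where "a i = \<xi> \<bullet> (\<gamma> (real i *\<^sub>R b) - \<gamma> 0)" for i
  have "near_int \<delta> (a 1)"
  proof -
   have "\<gamma> b - \<gamma> 0 = (b - (0::'a)) + ((0 - \<gamma> 0) - (b - \<gamma> b))" by simp
   then have "norm (\<gamma> b - \<gamma> 0) \<le> norm (b - 0) + norm ((0 - \<gamma> 0) - (b - \<gamma> b))" by (simp only: norm_triangle_ineq)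
   also have "\<dots> \<le> norm (b - 0) + (norm (0 - \<gamma> 0) + norm (b - \<gamma> b))" by (intro add_left_mono norm_triangle_ineq4)
   also have "\<dots> \<le> 1 + (R + R)" using b by (intro add_mono R(3)) simp
   finally have "norm ((\<gamma> b - \<gamma> 0) - (\<gamma> 0 - \<gamma> 0)) \<le> 4 * R + 1 + DIM('a)" using R(1) by simp
   from F[OF R(2) R(2) R(2) R(2) this] show ?thesis by (simp add: a_def)
  qed
  moreover have "near_int \<delta> (a (i + j) - a i - a j)" for i j
   using comp[of "real i *\<^sub>R b" "real j *\<^sub>R b"]
   by (simp add: a_def scaleR_left_distrib inner_diff_right algebra_simps)
  ultimately obtain h where h: "\<bar>h\<bar> \<le> 2 * \<delta>" "\<And>i. near_int \<delta> (a i - real i * h)"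
   using almost_additive_mod_1[of a \<delta>] d(2) by (auto simp: a_def)
  have "near_int (2 * \<delta>) (\<xi> \<bullet> (\<gamma> (of_int i *\<^sub>R b) - \<gamma> 0) - of_int i * h)" for i :: int
  proof (cases "0 \<le> i")
   case True
   have "near_int (2 * \<delta>) (a (nat i) - real (nat i) * h)"
    by (rule near_int_mono[OF h(2)]) (use d(1) in simp)
   then show ?thesis unfolding a_def using True by simp
  next
   case False
   define n where "n = nat (- i)"
   have i: "real_of_int i = - real n" using False by (simp add: n_def)
   have "near_int \<delta> (- (\<xi> \<bullet> (\<gamma> (of_int i *\<^sub>R b) - \<gamma> 0)) - a n)"
    using comp[of "of_int i *\<^sub>R b" "real n *\<^sub>R b"] by (simp add: i a_def inner_diff_right algebra_simps)
   from near_int_minus[OF near_int_add[OF this h(2)[of n]]]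
   show ?thesis by (simp add: i add.commute)
  qed
  then show ?thesis using h(1) by blast
 qed
 then obtain h where h: "\<And>b. b \<in> Basis \<Longrightarrow> \<bar>h b\<bar> \<le> 2 * \<delta>"
  "\<And>b (i::int). b \<in> Basis \<Longrightarrow> near_int (2 * \<delta>) (\<xi> \<bullet> (\<gamma> (of_int i *\<^sub>R b) - \<gamma> 0) - of_int i * h b)"
  by metis
 (* Each axis contributes an error 2 * \<delta> of its own and \<delta> for joining it to the others. *)
 have grid: "near_int (card B * (3 * \<delta>)) (\<xi> \<bullet> (\<gamma> (\<Sum>b\<in>B. of_int (k b) *\<^sub>R b) - \<gamma> 0) - (\<Sum>b\<in>B. of_int (k b) * h b))"
  if "finite B" "B \<subseteq> Basis" for B and k :: "'a \<Rightarrow> int"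
  using that
 proof (induction B rule: finite_induct)
  case empty
  show ?case by (rule near_int_abs) simp
 next
  case (insert b B)
  let ?p = "\<Sum>b\<in>B. of_int (k b) *\<^sub>R b" and ?q = "of_int (k b) *\<^sub>R b"
  have "near_int (card B * (3 * \<delta>)) (\<xi> \<bullet> (\<gamma> ?p - \<gamma> 0) - (\<Sum>b\<in>B. of_int (k b) * h b))"
   using insert by simp
  from near_int_add[OF near_int_add[OF this h(2)[of b "k b"]] comp[of ?p ?q]] insert
  have "near_int (card B * (3 * \<delta>) + 2 * \<delta> + \<delta>)
   (\<xi> \<bullet> (\<gamma> ?p - \<gamma> 0) - (\<Sum>b\<in>B. of_int (k b) * h b) + (\<xi> \<bullet> (\<gamma> ?q - \<gamma> 0) - of_int (k b) * h b)
    + \<xi> \<bullet> ((\<gamma> (?p + ?q) - \<gamma> ?p) - (\<gamma> ?q - \<gamma> 0)))" by simp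
  moreover have "\<xi> \<bullet> (\<gamma> ?p - \<gamma> 0) - (\<Sum>b\<in>B. of_int (k b) * h b) + (\<xi> \<bullet> (\<gamma> ?q - \<gamma> 0) - of_int (k b) * h b)
    + \<xi> \<bullet> ((\<gamma> (?p + ?q) - \<gamma> ?p) - (\<gamma> ?q - \<gamma> 0))
   = \<xi> \<bullet> (\<gamma> (?p + ?q) - \<gamma> 0) - ((\<Sum>b\<in>B. of_int (k b) * h b) + of_int (k b) * h b)"
   by (simp add: inner_diff_right)
  moreover have "card B * (3 * \<delta>) + 2 * \<delta> + \<delta> = card (insert b B) * (3 * \<delta>)"
   using insert(1,2) by (simp add: algebra_simps)
  ultimately have "near_int (card (insert b B) * (3 * \<delta>))
   (\<xi> \<bullet> (\<gamma> (?p + ?q) - \<gamma> 0) - ((\<Sum>b\<in>B. of_int (k b) * h b) + of_int (k b) * h b))" by (simp only:)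
  moreover have "(\<Sum>b\<in>insert b B. of_int (k b) *\<^sub>R b) = ?p + ?q"
   "(\<Sum>b\<in>insert b B. of_int (k b) * h b) = (\<Sum>b\<in>B. of_int (k b) * h b) + of_int (k b) * h b"
   using insert(1,2) by (simp_all add: add.commute)
  ultimately show ?case by (simp only:)
 qed
 define \<eta> where "\<eta> = (\<Sum>b\<in>Basis. h b *\<^sub>R b)"
 have n\<eta>: "norm \<eta> \<le> 2 * DIM('a) * \<delta>"
 proof -
  have "norm \<eta> \<le> (\<Sum>b\<in>Basis. norm (h b *\<^sub>R (b::'a)))" unfolding \<eta>_def by (rule norm_sum)
  also have "\<dots> \<le> (\<Sum>b\<in>(Basis::'a set). 2 * \<delta>)" using h(1) by (intro sum_mono) simp
  finally show ?thesis by simp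
 qed
 have "near_int ((2 + 3 * DIM('a) + 2 * DIM('a) * DIM('a)) * \<delta>) ((\<xi> - \<eta>) \<bullet> x)" if x: "x \<in> \<Gamma>" for x
 proof -
  define k where "k b = \<lfloor>x \<bullet> b\<rfloor>" for b :: 'a
  define p where "p = (\<Sum>b\<in>Basis. of_int (k b) *\<^sub>R b :: 'a)"
  have xp: "norm (x - p) \<le> DIM('a)"
  proof -
   have "x - p = (\<Sum>b\<in>Basis. frac (x \<bullet> b) *\<^sub>R b)"
    unfolding p_def k_def frac_def scaleR_left_diff_distrib sum_subtractf by (simp add: euclidean_representation)
   then have "norm (x - p) \<le> (\<Sum>b\<in>Basis. norm (frac (x \<bullet> b) *\<^sub>R (b::'a)))" by (simp only: norm_sum)
   also have "\<dots> \<le> (\<Sum>b\<in>(Basis::'a set). 1)"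
    by (intro sum_mono) (simp add: frac_ge_0 less_imp_le[OF frac_lt_1])
   finally show ?thesis by simp
  qed
  have \<eta>p: "\<eta> \<bullet> p = (\<Sum>b\<in>Basis. of_int (k b) * h b)"
  proof -
   have "\<eta> \<bullet> b = h b" if "b \<in> Basis" for b using that by (simp add: \<eta>_def)
   then show ?thesis unfolding p_def inner_sum_right inner_scaleR_right by (intro sum.cong refl) simp
  qed
  have "\<bar>- (\<eta> \<bullet> (x - p))\<bar> \<le> 2 * DIM('a) * DIM('a) * \<delta>"
  proof -
   have "\<bar>\<eta> \<bullet> (x - p)\<bar> \<le> norm \<eta> * norm (x - p)" by (rule Cauchy_Schwarz_ineq2)
   also have "\<dots> \<le> (2 * DIM('a) * \<delta>) * DIM('a)" using d(1) by (intro mult_mono n\<eta> xp) simp_all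
   finally show ?thesis by (simp add: mult_ac)
  qed
  then have e: "near_int (2 * DIM('a) * DIM('a) * \<delta>) (- (\<eta> \<bullet> (x - p)))" by (rule near_int_abs)
  have "near_int (\<delta> + card (Basis :: 'a set) * (3 * \<delta>) + \<delta> + 2 * DIM('a) * DIM('a) * \<delta>)
   (\<xi> \<bullet> (x - \<gamma> p) + (\<xi> \<bullet> (\<gamma> p - \<gamma> 0) - (\<Sum>b\<in>Basis. of_int (k b) * h b)) + \<xi> \<bullet> \<gamma> 0 + - (\<eta> \<bullet> (x - p)))"
   using close[OF x xp] grid[of Basis k, folded p_def] by (intro near_int_add o e) simp_all
  moreover have "\<xi> \<bullet> (x - \<gamma> p) + (\<xi> \<bullet> (\<gamma> p - \<gamma> 0) - (\<Sum>b\<in>Basis. of_int (k b) * h b)) + \<xi> \<bullet> \<gamma> 0 + - (\<eta> \<bullet> (x - p))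
   = (\<xi> - \<eta>) \<bullet> x" unfolding \<eta>p[symmetric] by (simp add: inner_diff_right inner_diff_left)
  moreover have "\<delta> + card (Basis :: 'a set) * (3 * \<delta>) + \<delta> + 2 * DIM('a) * DIM('a) * \<delta>
   = (2 + 3 * DIM('a) + 2 * DIM('a) * DIM('a)) * \<delta>" by (simp add: algebra_simps)
  ultimately show ?thesis by (simp only:)
 qed
 then show ?thesis using that n\<eta> by blast
qed

lemma meyer_almost_periods:
 fixes \<Gamma> :: "'a::euclidean_space set"
 assumes \<Gamma>: "meyer_set \<Gamma>" and e: "0 < \<epsilon>" "\<epsilon> < 1"
 obtains C where "\<And>p. \<exists>\<xi>. (\<forall>x\<in>\<Gamma>. near_int \<epsilon> (\<xi> \<bullet> x)) \<and> norm (p - \<xi>) \<le> C"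
proof -
 have rd: "relatively_dense \<Gamma>" using \<Gamma> by (simp add: meyer_set_def)
 obtain R \<gamma> where R: "0 < R" "\<And>p. \<gamma> p \<in> \<Gamma>" "\<And>p. norm (p - \<gamma> p) \<le> R"
  by (rule relatively_dense_choice[OF rd]) blast
 let ?n = "2 + 3 * DIM('a) + 2 * DIM('a) * DIM('a)"
 define \<delta> where "\<delta> = \<epsilon> / real ?n"
 have n4: "4 < real ?n"
 proof -
  have "1 \<le> real DIM('a)" using DIM_positive[where 'a='a] by (simp add: Suc_le_eq)
  moreover have "0 \<le> 2 * (real DIM('a) * real DIM('a))" by simp
  moreover have "real ?n = 2 + 3 * real DIM('a) + 2 * (real DIM('a) * real DIM('a))" by simp
  ultimately show ?thesis by linarith
 qed
 have d: "0 < \<delta>" "4 * \<delta> < 1" "real ?n * \<delta> = \<epsilon>" using e n4 by (simp_all add: \<delta>_def field_simps)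
 (* The base point enters F because linear_correction controls differences only. *)
 define F where "F = insert (\<gamma> 0) {z. norm z \<le> 4 * R + 1 + DIM('a) \<and> (\<exists>u\<in>differences \<Gamma>. \<exists>v\<in>differences \<Gamma>. z = u - v)}"
 have finF: "finite F" unfolding F_def by (intro finite.insertI differences_finite_local_complexity \<Gamma>)
 obtain Q :: "'a set" where Q: "finite Q" "\<And>p. \<exists>q\<in>Q. \<forall>f\<in>F. near_int \<delta> ((p - q) \<bullet> f)"
  by (rule pigeonhole_almost_periods[OF finF d(1)]) blast
 obtain C where C: "\<And>q. q \<in> Q \<Longrightarrow> norm q \<le> C"
  using finite_imp_bounded[OF Q(1)] unfolding bounded_iff by blast
 have "\<exists>\<xi>. (\<forall>x\<in>\<Gamma>. near_int \<epsilon> (\<xi> \<bullet> x)) \<and> norm (p - \<xi>) \<le> C + 2 * DIM('a) * \<delta>" for p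
 proof -
  obtain q where q: "q \<in> Q" "\<And>f. f \<in> F \<Longrightarrow> near_int \<delta> ((p - q) \<bullet> f)" using Q(2)[of p] by blast
  have "near_int \<delta> ((p - q) \<bullet> ((x - y) - (u - v)))"
   if "x \<in> \<Gamma>" "y \<in> \<Gamma>" "u \<in> \<Gamma>" "v \<in> \<Gamma>" "norm ((x - y) - (u - v)) \<le> 4 * R + 1 + DIM('a)" for x y u v
  proof (rule q(2))
   have xy: "x - y \<in> differences \<Gamma>" and uv: "u - v \<in> differences \<Gamma>" using that by blast+
   have "\<exists>d\<in>differences \<Gamma>. \<exists>d'\<in>differences \<Gamma>. (x - y) - (u - v) = d - d'"
    by (rule bexI[OF _ xy], rule bexI[OF _ uv], rule refl)
   then show "(x - y) - (u - v) \<in> F" unfolding F_def using that(5) by (intro insertI2 CollectI conjI)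
  qed
  moreover have "near_int \<delta> ((p - q) \<bullet> \<gamma> 0)" by (rule q(2)) (simp add: F_def)
  ultimately obtain \<eta> where \<eta>: "norm \<eta> \<le> 2 * DIM('a) * \<delta>"
   "\<And>x. x \<in> \<Gamma> \<Longrightarrow> near_int (real ?n * \<delta>) ((p - q - \<eta>) \<bullet> x)"
   using linear_correction[OF R, of \<delta> "p - q"] d by (metis less_imp_le)
  have "norm (p - (p - q - \<eta>)) \<le> C + 2 * DIM('a) * \<delta>"
   using norm_triangle_ineq[of \<eta> q] C[OF q(1)] \<eta>(1) by (simp add: add.commute)
  then show ?thesis using \<eta>(2) unfolding d(3) by blast
 qed
 then show ?thesis using that by blast
qed

text \<open>A point of \<open>\<Lambda> - \<Lambda> - (\<Lambda> - \<Lambda>)\<close> that is close to 0 but nonzero would have inner product near \<open>1 / 2\<close>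
 with some element of the relatively dense set \<open>S\<close>.\<close>

theorem meyer_extension:
 fixes \<Gamma> :: "'a::euclidean_space set"
 assumes \<Gamma>: "meyer_set \<Gamma>"
 obtains S where "\<And>\<xi> x. \<xi> \<in> S \<Longrightarrow> x \<in> \<Gamma> \<Longrightarrow> near_int (1 / 32) (\<xi> \<bullet> x)"
  "meyer_set {x. \<forall>\<xi>\<in>S. near_int (1 / 16) (\<xi> \<bullet> x)}"
proof
 define S where "S = {\<xi>. \<forall>x\<in>\<Gamma>. near_int (1 / 32) (\<xi> \<bullet> x)}"
 define \<Lambda> where "\<Lambda> = {x. \<forall>\<xi>\<in>S. near_int (1 / 16) (\<xi> \<bullet> x)}"
 show "near_int (1 / 32) (\<xi> \<bullet> x)" if "\<xi> \<in> S" "x \<in> \<Gamma>" for \<xi> x using that by (simp add: S_def)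
 have "near_int (1 / 16) (\<xi> \<bullet> x)" if "\<xi> \<in> S" "x \<in> \<Gamma>" for \<xi> x
 proof (rule near_int_mono)
  show "near_int (1 / 32) (\<xi> \<bullet> x)" using that by (simp add: S_def)
 qed simp
 then have sub: "\<Gamma> \<subseteq> \<Lambda>" unfolding \<Lambda>_def by blast
 obtain K where K: "compact K" "{x + k | x k. x \<in> \<Gamma> \<and> k \<in> K} = UNIV"
  using \<Gamma> unfolding meyer_set_def relatively_dense_def by blast
 have "{x + k | x k. x \<in> \<Lambda> \<and> k \<in> K} = UNIV" using K(2) sub by blast
 then have rd: "relatively_dense \<Lambda>" using K(1) unfolding relatively_dense_def by blast
 obtain C where C: "\<And>p. \<exists>\<xi>. (\<forall>x\<in>\<Gamma>. near_int (1 / 32) (\<xi> \<bullet> x)) \<and> norm (p - \<xi>) \<le> C"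
  using meyer_almost_periods[OF \<Gamma>, of "1 / 32"] by auto
 have C0: "0 \<le> C" using C[of 0] norm_ge_zero order_trans by blast
 have sep: "w = 0" if n: "\<And>\<xi>. \<xi> \<in> S \<Longrightarrow> near_int (1 / 4) (\<xi> \<bullet> w)" and w: "norm w < 1 / (4 * (C + 1))" for w :: 'a
 proof (rule ccontr)
  assume w0: "w \<noteq> 0"
  (* Chosen so that its inner product with w is 1 / 2. *)
  define p where "p = (1 / (2 * (w \<bullet> w))) *\<^sub>R w"
  have p: "p \<bullet> w = 1 / 2" using w0 by (simp add: p_def)
  obtain \<xi> where \<xi>: "\<xi> \<in> S" "norm (p - \<xi>) \<le> C" using C[of p] by (auto simp: S_def)
  have "\<bar>(p - \<xi>) \<bullet> w\<bar> \<le> norm (p - \<xi>) * norm w" by (rule Cauchy_Schwarz_ineq2)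
  also have "\<dots> \<le> C * norm w" by (intro mult_right_mono \<xi>) simp
  also have "\<dots> \<le> (C + 1) * norm w" by (simp add: mult_right_mono)
  also have "\<dots> < 1 / 4" using w C0 by (simp add: field_simps)
  finally have b: "\<bar>1 / 2 - \<xi> \<bullet> w\<bar> < 1 / 4" by (simp add: inner_diff_left p)
  obtain m :: int where m: "\<bar>\<xi> \<bullet> w - m\<bar> \<le> 1 / 4" using n[OF \<xi>(1)] unfolding near_int_def by blast
  have "0 < real_of_int m" "real_of_int m < 1" using b m by (simp_all add: abs_if split: if_splits)
  then show False by simp
 qed
 have "uniform_discrete (differences \<Lambda>)"
  unfolding uniform_discrete_def
 proof (intro exI[of _ "1 / (4 * (C + 1))"] conjI ballI impI)
  show "0 < 1 / (4 * (C + 1))" using C0 by simp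
  fix u v assume u: "u \<in> differences \<Lambda>" and v: "v \<in> differences \<Lambda>" and uv: "dist u v < 1 / (4 * (C + 1))"
  have D: "near_int (1 / 8) (\<xi> \<bullet> z)" if z: "z \<in> differences \<Lambda>" and \<xi>: "\<xi> \<in> S" for z \<xi>
  proof -
   obtain x y where xy: "z = x - y" "x \<in> \<Lambda>" "y \<in> \<Lambda>" using z by (elim CollectE exE conjE) blast
   have "near_int (1 / 16 + 1 / 16) (\<xi> \<bullet> x - \<xi> \<bullet> y)"
    using xy \<xi> by (intro near_int_diff) (simp_all add: \<Lambda>_def)
   then show ?thesis by (simp add: xy inner_diff_right)
  qed
  have "u - v = 0"
  proof (rule sep)
   show "norm (u - v) < 1 / (4 * (C + 1))" using uv by (simp add: dist_norm)
   show "near_int (1 / 4) (\<xi> \<bullet> (u - v))" if "\<xi> \<in> S" for \<xi>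
    using near_int_diff[OF D[OF u that] D[OF v that]] by (simp add: inner_diff_right)
  qed
  then show "u = v" by simp
 qed
 then show "meyer_set {x. \<forall>\<xi>\<in>S. near_int (1 / 16) (\<xi> \<bullet> x)}"
  using rd unfolding meyer_set_def \<Lambda>_def by blast
qed

section \<open>A trapezoid with absolutely convergent Fourier series\<close>

text \<open>The dilogarithm on the closed unit disc.\<close>

definition dilog :: "complex \<Rightarrow> complex" where
 "dilog z = (\<Sum>n. inverse (of_nat n ^ 2) * z ^ n)"

lemma summable_dilog_norm: "norm z \<le> 1 \<Longrightarrow> summable (\<lambda>n. norm (inverse (of_nat n ^ 2) * z ^ n :: complex))"
proof (rule summable_comparison_test'[of "\<lambda>n. inverse (real n ^ 2)" 0])
 show "summable (\<lambda>n. inverse (real n ^ 2))" by (rule inverse_power_summable) simp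
 fix n assume "norm z \<le> 1"
 then have "norm z ^ n \<le> 1" by (intro power_le_one) auto
 then show "norm (norm (inverse (of_nat n ^ 2) * z ^ n :: complex)) \<le> inverse (real n ^ 2)"
  by (simp add: norm_mult norm_power norm_inverse mult_left_le)
qed

lemma summable_dilog: "norm z \<le> 1 \<Longrightarrow> summable (\<lambda>n. inverse (of_nat n ^ 2) * z ^ n :: complex)"
 by (rule summable_norm_cancel) (rule summable_dilog_norm)

lemma continuous_dilog: "continuous_on (cball 0 1) dilog"
proof -
 have "uniform_limit (cball 0 1) (\<lambda>n z. \<Sum>i<n. inverse (of_nat i ^ 2) * z ^ i :: complex)
   (\<lambda>z. suminf (\<lambda>i. inverse (of_nat i ^ 2) * z ^ i)) sequentially"
 proof (rule Weierstrass_m_test)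
  show "summable (\<lambda>n. inverse (real n ^ 2))" by (rule inverse_power_summable) simp
  fix n and z :: complex assume "z \<in> cball 0 1"
  then have "norm z ^ n \<le> 1" by (intro power_le_one) auto
  then show "norm (inverse (of_nat n ^ 2) * z ^ n) \<le> inverse (real n ^ 2)"
   by (simp add: norm_mult norm_power norm_inverse mult_left_le)
 qed
 then have "continuous_on (cball 0 1) (\<lambda>z. suminf (\<lambda>i. inverse (of_nat i ^ 2) * z ^ i :: complex))"
  by (rule uniform_limit_theorem[rotated]) (auto intro!: always_eventually continuous_intros)
 then show ?thesis by (simp add: dilog_def[abs_def])
qed

text \<open>The derivative involves the logarithm, whose imaginary part is bounded and linear in the angle on the
 unit circle. Hence the real part of the dilogarithm is quadratic there.\<close>

lemma dilog_derivative:
 assumes z: "norm z < 1"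
 obtains D where "(dilog has_field_derivative D) (at z)" "z * D = - Ln (1 - z)"
proof -
 let ?c = "\<lambda>n::nat. inverse (of_nat n ^ 2) :: complex"
 have "summable (\<lambda>n. ?c n * 1 ^ n)" using summable_dilog[of 1] by simp
 then have D: "((\<lambda>z. \<Sum>n. ?c n * z ^ n) has_field_derivative (\<Sum>n. diffs ?c n * z ^ n)) (at z)"
  using z by (intro termdiffs_strong[of ?c 1]) auto
 have L: "(\<lambda>n. - (z ^ n) / of_nat n) sums ln (1 - z)"
  using Ln_series'[of "- z"] z by simp
 then have "(\<lambda>n. - (z ^ Suc n) / of_nat (Suc n)) sums ln (1 - z)"
  by (subst sums_Suc_iff) simp
 then have "(\<lambda>n. - (- (z ^ Suc n) / of_nat (Suc n))) sums - ln (1 - z)" by (rule sums_minus)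
 moreover have "- (- (z ^ Suc n) / of_nat (Suc n)) = z * (diffs ?c n * z ^ n)" for n
 proof -
  have "of_nat (Suc n) * inverse (of_nat (Suc n) ^ 2) = (inverse (of_nat (Suc n)) :: complex)"
   by (simp add: power2_eq_square del: of_nat_Suc)
  then show ?thesis unfolding diffs_def by (simp add: divide_inverse mult_ac del: of_nat_Suc)
 qed
 ultimately have "(\<lambda>n. z * (diffs ?c n * z ^ n)) sums - ln (1 - z)" by simp
 moreover have "summable (\<lambda>n. diffs ?c n * z ^ n)"
  using termdiff_converges_all termdiff_converges[of z 1 ?c] z summable_dilog[of "_::complex"] by auto
 ultimately have "z * (\<Sum>n. diffs ?c n * z ^ n) = - ln (1 - z)"
  by (metis sums_unique suminf_mult)
 then show ?thesis using that D by (simp add: dilog_def[abs_def])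
qed

lemma Im_Ln_one_minus_cis:
 assumes "0 < t" "t < 2 * pi"
 shows "Im (Ln (1 - cis t)) = (t - pi) / 2"
proof -
 have s: "0 < sin (t / 2)" using assms by (intro sin_gt_zero) auto
 have "1 - cis t = of_real (2 * sin (t / 2)) * cis ((t - pi) / 2)"
 proof (rule complex_eqI)
  have "cos ((t - pi) / 2) = sin (t / 2)" "sin ((t - pi) / 2) = - cos (t / 2)"
   by (simp_all add: diff_divide_distrib cos_diff sin_diff)
  then show "Re (1 - cis t) = Re (of_real (2 * sin (t / 2)) * cis ((t - pi) / 2))"
   "Im (1 - cis t) = Im (of_real (2 * sin (t / 2)) * cis ((t - pi) / 2))"
   using cos_double_sin[of "t / 2"] sin_double[of "t / 2"] by (simp_all add: power2_eq_square)
 qed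
 also have "\<dots> = exp (Complex (ln (2 * sin (t / 2))) ((t - pi) / 2))"
  using s by (simp add: exp_eq_polar)
 finally have e: "1 - cis t = exp (Complex (ln (2 * sin (t / 2))) ((t - pi) / 2))" .
 have "Ln (1 - cis t) = Complex (ln (2 * sin (t / 2))) ((t - pi) / 2)"
  unfolding e using assms by (intro Ln_exp) (simp_all add: field_simps)
 then show ?thesis by simp
qed

text \<open>The Fourier series \<open>\<Sum>k. cos (k * t) / k\<^sup>2\<close>, with a vanishing term at \<open>k = 0\<close>.\<close>

definition cosine_series :: "real \<Rightarrow> real" where "cosine_series t = Re (dilog (cis t))"

lemma cosine_series_sums: "(\<lambda>n. cos (real n * t) / (real n)^2) sums cosine_series t"
proof -
 have "(\<lambda>n. Re (inverse (of_nat n ^ 2) * cis t ^ n)) sums Re (dilog (cis t))"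
  unfolding dilog_def by (intro sums_Re summable_sums summable_dilog) simp
 moreover have "Re (inverse (of_nat n ^ 2) * cis t ^ n) = cos (real n * t) / (real n)^2" for n
 proof -
  have "inverse (of_nat n ^ 2) * cis t ^ n = of_real (inverse (real n ^ 2)) * cis (real n * t)"
   by (simp add: Complex.DeMoivre)
  then show ?thesis by (simp only: Re_complex_of_real Re_divide complex.sel cis.sel times_complex.sel Im_complex_of_real) (simp add: divide_inverse)
 qed
 ultimately show ?thesis by (simp add: cosine_series_def)
qed

lemma continuous_cosine_series: "continuous_on UNIV cosine_series"
proof -
 have "continuous_on UNIV (\<lambda>t. dilog (cis t))"
  by (rule continuous_on_compose2[OF continuous_dilog]) (auto intro!: continuous_intros)
 then show ?thesis unfolding cosine_series_def[abs_def] by (intro continuous_intros)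
qed

text \<open>Integrate the derivative over circles of radius less than 1 and let the radius tend to 1; the imaginary
 part of the logarithm is bounded, so dominated convergence applies.\<close>

lemma cosine_series_diff:
 assumes ab: "0 < a" "a \<le> b" "b < 2 * pi"
 shows "cosine_series b - cosine_series a = ((b - pi)^2 - (a - pi)^2) / 4"
proof -
 define r where "r k = 1 - inverse (real (Suc k))" for k
 have r: "0 \<le> r k" "r k < 1" for k unfolding r_def by (simp_all add: field_simps)
 have "(\<lambda>k. inverse (real (Suc k))) \<longlonglongrightarrow> 0" by (rule LIMSEQ_inverse_real_of_nat)
 then have rlim: "r \<longlonglongrightarrow> 1" unfolding r_def[abs_def]
  using tendsto_diff[OF tendsto_const[of 1]] by fastforce
 let ?z = "\<lambda>k t. of_real (r k) * cis t"
 have nz: "norm (?z k t) < 1" for k t using r[of k] by (simp add: norm_mult)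
 have der: "((\<lambda>t. Re (dilog (?z k t))) has_vector_derivative Im (Ln (1 - ?z k t))) (at t within {a..b})" for k t
 proof -
  obtain D where D: "(dilog has_field_derivative D) (at (?z k t))" "?z k t * D = - Ln (1 - ?z k t)"
   using dilog_derivative[OF nz] by blast
  have "(cis has_vector_derivative (\<i> * cis t)) (at t within {a..b})"
   unfolding has_vector_derivative_def by (auto intro!: derivative_eq_intros simp: mult_ac scaleR_conv_of_real)
  then have "((\<lambda>t. ?z k t) has_vector_derivative (of_real (r k) * (\<i> * cis t))) (at t within {a..b})"
   by (rule has_vector_derivative_mult_right)
  from field_vector_diff_chain_within[OF this has_field_derivative_at_within[OF D(1)]]
  have "((\<lambda>t. dilog (?z k t)) has_vector_derivative (of_real (r k) * (\<i> * cis t)) * D) (at t within {a..b})"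
   by (simp add: o_def)
  moreover have "(of_real (r k) * (\<i> * cis t)) * D = - \<i> * Ln (1 - ?z k t)"
   using D(2) by (simp add: mult_ac)
  ultimately have "((\<lambda>t. dilog (?z k t)) has_vector_derivative - \<i> * Ln (1 - ?z k t)) (at t within {a..b})" by simp
  from bounded_linear.has_vector_derivative[OF bounded_linear_Re this]
  show ?thesis by simp
 qed
 have int: "((\<lambda>t. Im (Ln (1 - ?z k t))) has_integral (Re (dilog (?z k b)) - Re (dilog (?z k a)))) {a..b}" for k
  by (rule fundamental_theorem_of_calculus[OF ab(2) der])
 have lim: "(\<lambda>k. integral {a..b} (\<lambda>t. Im (Ln (1 - ?z k t)))) \<longlonglongrightarrow> integral {a..b} (\<lambda>t. (t - pi) / 2)"
 proof (rule dominated_convergence(2))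
  show "(\<lambda>t. Im (Ln (1 - ?z k t))) integrable_on {a..b}" for k using int by blast
  show "(\<lambda>_. pi) integrable_on {a..b}" by (rule integrable_const_ivl)
  show "norm (Im (Ln (1 - ?z k t))) \<le> pi" for k t
  proof -
   have "1 - ?z k t \<noteq> 0" using nz[of k t] by auto
   from mpi_less_Im_Ln[OF this] Im_Ln_le_pi[OF this] show ?thesis by simp
  qed
  fix t assume "t \<in> {a..b}"
  then have t: "0 < t" "t < 2 * pi" using ab by auto
  have "cos t < 1"
  proof -
   have "0 < sin (t / 2)" using t by (intro sin_gt_zero) auto
   then show ?thesis using cos_double_sin[of "t / 2"] by simp
  qed
  then have "1 - cis t \<notin> \<real>\<^sub>\<le>\<^sub>0" by (simp add: complex_nonpos_Reals_iff)
  moreover have "(\<lambda>k. 1 - ?z k t) \<longlonglongrightarrow> 1 - of_real 1 * cis t"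
   by (intro tendsto_intros rlim)
  ultimately have "(\<lambda>k. Ln (1 - ?z k t)) \<longlonglongrightarrow> Ln (1 - cis t)"
   by (intro tendsto_Ln) simp_all
  then show "(\<lambda>k. Im (Ln (1 - ?z k t))) \<longlonglongrightarrow> (t - pi) / 2"
   unfolding Im_Ln_one_minus_cis[OF t, symmetric] by (rule tendsto_Im)
 qed
 have dl: "(\<lambda>k. Re (dilog (?z k t))) \<longlonglongrightarrow> cosine_series t" for t
 proof -
  have "(\<lambda>k. ?z k t) \<longlonglongrightarrow> of_real 1 * cis t" by (intro tendsto_intros rlim)
  then have "(\<lambda>k. dilog (?z k t)) \<longlonglongrightarrow> dilog (cis t)"
   using nz by (intro continuous_on_tendsto_compose[OF continuous_dilog]) (auto intro!: always_eventually less_imp_le)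
  then show ?thesis unfolding cosine_series_def by (rule tendsto_Re)
 qed
 have "cosine_series b - cosine_series a = integral {a..b} (\<lambda>t. (t - pi) / 2)"
  using lim tendsto_diff[OF dl[of b] dl[of a]] unfolding integral_unique[OF int]
  by (rule LIMSEQ_unique[rotated])
 also have "((\<lambda>t. (t - pi) / 2) has_integral ((b - pi)^2 / 4 - (a - pi)^2 / 4)) {a..b}"
  by (rule fundamental_theorem_of_calculus[OF ab(2)])
   (auto intro!: derivative_eq_intros simp: has_real_derivative_iff_has_vector_derivative[symmetric])
 then have "integral {a..b} (\<lambda>t. (t - pi) / 2) = ((b - pi)^2 - (a - pi)^2) / 4"
  by (simp add: integral_unique diff_divide_distrib)
 finally show ?thesis .
qed

lemma cosine_series_minus: "cosine_series (- t) = cosine_series t"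
 by (rule sums_unique2[OF cosine_series_sums]) (use cosine_series_sums[of t] in simp)

lemma cosine_series_eq:
 assumes "\<bar>t\<bar> \<le> 2 * pi"
 shows "cosine_series t = cosine_series pi + (\<bar>t\<bar> - pi)^2 / 4"
proof -
 have *: "cosine_series s - (s - pi)^2 / 4 = cosine_series pi" if "s \<in> {0..2 * pi}" for s
 proof (rule continuous_constant_on_closure[of "{0<..<2 * pi}" "\<lambda>s. cosine_series s - (s - pi)^2 / 4"])
  show "continuous_on (closure {0<..<2 * pi}) (\<lambda>s. cosine_series s - (s - pi)^2 / 4)"
   by (intro continuous_intros continuous_on_subset[OF continuous_cosine_series]) auto
  show "s \<in> closure {0<..<2 * pi}" using that by simp
  fix x assume x: "x \<in> {0<..<2 * pi}"
  show "cosine_series x - (x - pi)^2 / 4 = cosine_series pi"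
  proof (cases "x \<le> pi")
   case True
   then show ?thesis using cosine_series_diff[of x pi] x by simp
  next
   case False
   then show ?thesis using cosine_series_diff[of pi x] x by simp
  qed
 qed
 have "cosine_series t = cosine_series \<bar>t\<bar>" by (simp add: abs_if cosine_series_minus)
 then show ?thesis using *[of "\<bar>t\<bar>"] assms by simp
qed

text \<open>Second differences of the quadratic function are constant except across its corner at 0, where they
 produce a tent.\<close>

lemma cosine_series_second_difference:
 assumes h: "0 < h" "h \<le> pi" and t: "\<bar>t\<bar> \<le> pi"
 shows "cosine_series (t + h) - 2 * cosine_series t + cosine_series (t - h) = h\<^sup>2 / 2 - pi * max 0 (h - \<bar>t\<bar>)"
proof -
 have *: "cosine_series (s + h) - 2 * cosine_series s + cosine_series (s - h) = h\<^sup>2 / 2 - pi * max 0 (h - s)"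
  if s: "0 \<le> s" "s \<le> pi" for s
 proof (cases "h \<le> s")
  case True
  have "cosine_series (s + h) = cosine_series pi + (s + h - pi)^2 / 4" "cosine_series (s - h) = cosine_series pi + (s - h - pi)^2 / 4"
   "cosine_series s = cosine_series pi + (s - pi)^2 / 4"
   using True h s cosine_series_eq[of "s + h"] cosine_series_eq[of s] cosine_series_eq[of "s - h"] by simp_all
  moreover have "(s + h - pi)^2 / 4 - 2 * ((s - pi)^2 / 4) + (s - h - pi)^2 / 4 = h\<^sup>2 / 2"
   by (simp add: power2_eq_square field_simps)
  ultimately show ?thesis using True by simp
 next
  case False
  have "cosine_series (s + h) = cosine_series pi + (s + h - pi)^2 / 4" "cosine_series (s - h) = cosine_series pi + (h - s - pi)^2 / 4"
   "cosine_series s = cosine_series pi + (s - pi)^2 / 4"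
   using False h s cosine_series_eq[of "s + h"] cosine_series_eq[of s] cosine_series_eq[of "s - h"] by simp_all
  moreover have "(s + h - pi)^2 / 4 - 2 * ((s - pi)^2 / 4) + (h - s - pi)^2 / 4 = h\<^sup>2 / 2 - pi * (h - s)"
   by (simp add: power2_eq_square field_simps)
  ultimately show ?thesis using False by simp
 qed
 show ?thesis
 proof (cases "0 \<le> t")
  case True
  then show ?thesis using *[of t] t by simp
 next
  case False
  then show ?thesis using *[of "- t"] t cosine_series_minus[of "t - h"] cosine_series_minus[of "t + h"] cosine_series_minus[of t] by simp
 qed
qed

lemma second_difference_sums:
 "(\<lambda>k. 2 * (cos (real k * h) - 1) / (real k)^2 * cos (real k * t)) sums
  (cosine_series (t + h) - 2 * cosine_series t + cosine_series (t - h))"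
proof -
 have "(\<lambda>k. cos (real k * (t + h)) / (real k)^2 - 2 * (cos (real k * t) / (real k)^2) + cos (real k * (t - h)) / (real k)^2) sums
  (cosine_series (t + h) - 2 * cosine_series t + cosine_series (t - h))"
  by (intro sums_add sums_diff sums_mult cosine_series_sums)
 moreover have "cos (real k * (t + h)) / (real k)^2 - 2 * (cos (real k * t) / (real k)^2) + cos (real k * (t - h)) / (real k)^2
  = 2 * (cos (real k * h) - 1) / (real k)^2 * cos (real k * t)" for k
  by (simp add: distrib_left right_diff_distrib cos_add cos_diff diff_divide_distrib add_divide_distrib left_diff_distrib)
 ultimately show ?thesis by simp
qed

lemma complex_sums_if:
 fixes f g :: "nat \<Rightarrow> complex"
 assumes "g sums x" "f sums y"
 shows "(\<lambda>n. if even n then f (n div 2) else g ((n - 1) div 2)) sums (x + y)"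
 using assms sums_if[of "\<lambda>n. Re (g n)" "Re x" "\<lambda>n. Re (f n)" "Re y"]
  sums_if[of "\<lambda>n. Im (g n)" "Im x" "\<lambda>n. Im (f n)" "Im y"]
 by (simp add: sums_complex_iff if_distrib[of Re] if_distrib[of Im])

text \<open>A trapezoid is the difference of two tents of widths \<open>2h\<close> and \<open>h\<close>, divided by \<open>h\<close>.\<close>

lemma trapezoid_cosine_series:
 assumes e: "0 < \<epsilon>" "\<epsilon> \<le> 1 / 8"
 obtains d :: "nat \<Rightarrow> real" where "summable (\<lambda>k. \<bar>d k\<bar>)"
  "\<And>\<theta>. \<bar>\<theta>\<bar> \<le> \<epsilon> \<Longrightarrow> (\<lambda>k. d k * cos (real k * (2 * pi * \<theta>))) sums 0"
  "\<And>\<theta>. 2 * \<epsilon> \<le> \<bar>\<theta>\<bar> \<Longrightarrow> \<bar>\<theta>\<bar> \<le> 1 / 2 \<Longrightarrow> (\<lambda>k. d k * cos (real k * (2 * pi * \<theta>))) sums (- 1)"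
proof -
 define h where "h = 2 * pi * \<epsilon>"
 have h: "0 < h" "2 * h \<le> pi" using e by (simp_all add: h_def)
 define b where "b h k = 2 * (cos (real k * h) - 1) / (real k)^2" for h k
 (* The constant term removes the constants h ^ 2 / 2 of the second differences and shifts the
   trapezoid from values 1 and 0 to values 0 and - 1. *)
 define d where "d k = (b h k - b (2 * h) k) / (pi * h) + (if k = 0 then 3 * h / (2 * pi) - 1 else 0)" for k
 let ?G = "\<lambda>h t. cosine_series (t + h) - 2 * cosine_series t + cosine_series (t - h)"
 have bound: "summable (\<lambda>k. \<bar>b h k\<bar>)" for h
 proof (rule summable_comparison_test'[of "\<lambda>k. 4 * inverse (real k ^ 2)" 0])
  show "summable (\<lambda>k. 4 * inverse (real k ^ 2))" by (intro summable_mult inverse_power_summable) simp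
  fix k
  have "\<bar>2 * (c - 1)\<bar> \<le> 4" if "\<bar>c\<bar> \<le> 1" for c :: real using that by (simp add: abs_if split: if_splits)
  from this[OF abs_cos_le_one] have "\<bar>2 * (cos (real k * h) - 1)\<bar> \<le> 4" .
  then show "norm \<bar>b h k\<bar> \<le> 4 * inverse (real k ^ 2)"
   by (simp add: b_def abs_mult divide_inverse mult_right_mono)
 qed
 have s: "summable (\<lambda>k. \<bar>d k\<bar>)"
 proof (rule summable_comparison_test'[of "\<lambda>k. (\<bar>b h k\<bar> + \<bar>b (2 * h) k\<bar>) * (1 / (pi * h))" 1])
  show "summable (\<lambda>k. (\<bar>b h k\<bar> + \<bar>b (2 * h) k\<bar>) * (1 / (pi * h)))"
   by (intro summable_mult2 summable_add bound)
  fix k :: nat assume "1 \<le> k"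
  then show "norm \<bar>d k\<bar> \<le> (\<bar>b h k\<bar> + \<bar>b (2 * h) k\<bar>) * (1 / (pi * h))"
   using h by (simp add: d_def abs_mult divide_right_mono abs_triangle_ineq4)
 qed
 have sums: "(\<lambda>k. d k * cos (real k * t)) sums ((?G h t - ?G (2 * h) t) / (pi * h) + (3 * h / (2 * pi) - 1))" for t
 proof -
  have "(\<lambda>k. if k = 0 then 3 * h / (2 * pi) - 1 else 0) sums (3 * h / (2 * pi) - 1)"
   by (rule sums_single[of 0 "\<lambda>_. 3 * h / (2 * pi) - 1"])
  moreover have "(\<lambda>k. (b h k * cos (real k * t) - b (2 * h) k * cos (real k * t)) / (pi * h)) sums ((?G h t - ?G (2 * h) t) / (pi * h))"
   unfolding b_def by (intro sums_divide sums_diff second_difference_sums)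
  ultimately have "(\<lambda>k. (b h k * cos (real k * t) - b (2 * h) k * cos (real k * t)) / (pi * h) + (if k = 0 then 3 * h / (2 * pi) - 1 else 0))
   sums ((?G h t - ?G (2 * h) t) / (pi * h) + (3 * h / (2 * pi) - 1))" by (rule sums_add[rotated])
  moreover have "(b h k * cos (real k * t) - b (2 * h) k * cos (real k * t)) / (pi * h) + (if k = 0 then 3 * h / (2 * pi) - 1 else 0) = d k * cos (real k * t)" for k
   by (simp add: d_def left_diff_distrib)
  ultimately show ?thesis by simp
 qed
 have val: "(?G h t - ?G (2 * h) t) / (pi * h) + (3 * h / (2 * pi) - 1) = (max 0 (2 * h - \<bar>t\<bar>) - max 0 (h - \<bar>t\<bar>)) / h - 1"
  if t: "\<bar>t\<bar> \<le> pi" for t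
 proof -
  have G: "?G h t = h\<^sup>2 / 2 - pi * max 0 (h - \<bar>t\<bar>)" "?G (2 * h) t = (2 * h)^2 / 2 - pi * max 0 (2 * h - \<bar>t\<bar>)"
   using h by (intro cosine_series_second_difference[OF _ _ t]; simp)+
  have "((h\<^sup>2 / 2 - pi * A) - ((2 * h)^2 / 2 - pi * B)) / (pi * h) + (3 * h / (2 * pi) - 1) = (B - A) / h - 1" for A B
   using h by (simp add: field_simps power2_eq_square)
  then show ?thesis unfolding G .
 qed
 show ?thesis
 proof (rule that[OF s])
  fix \<theta> :: real assume t: "\<bar>\<theta>\<bar> \<le> \<epsilon>"
  have t: "\<bar>2 * pi * \<theta>\<bar> \<le> h" using t by (simp add: h_def abs_mult)
  then have "\<bar>2 * pi * \<theta>\<bar> \<le> pi" using h by linarith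
  from sums[of "2 * pi * \<theta>", unfolded val[OF this]] t show "(\<lambda>k. d k * cos (real k * (2 * pi * \<theta>))) sums 0"
   using h by simp
 next
  fix \<theta> :: real assume t: "2 * \<epsilon> \<le> \<bar>\<theta>\<bar>" "\<bar>\<theta>\<bar> \<le> 1 / 2"
  have "2 * h \<le> \<bar>2 * pi * \<theta>\<bar>" "\<bar>2 * pi * \<theta>\<bar> \<le> pi"
   using t mult_left_mono[OF t(1), of "2 * pi"] mult_left_mono[OF t(2), of "2 * pi"] by (simp_all add: h_def abs_mult)
  with sums[of "2 * pi * \<theta>", unfolded val[OF this(2)]] h
  show "(\<lambda>k. d k * cos (real k * (2 * pi * \<theta>))) sums (- 1)" by simp
 qed
qed

lemma trapezoid_series:
 fixes \<epsilon> :: real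
 assumes e: "0 < \<epsilon>" "\<epsilon> \<le> 1 / 8"
 obtains a :: "nat \<Rightarrow> complex" and n :: "nat \<Rightarrow> int" where "summable (\<lambda>k. norm (a k))"
  "\<And>(\<theta>::real) (m::int). \<bar>\<theta> - m\<bar> \<le> \<epsilon> \<Longrightarrow> (\<lambda>k. a k * cis (2 * pi * (n k * \<theta>))) sums 0"
  "\<And>\<theta>::real. (\<And>m::int. 2 * \<epsilon> \<le> \<bar>\<theta> - m\<bar>) \<Longrightarrow> (\<lambda>k. a k * cis (2 * pi * (n k * \<theta>))) sums (- 1)"
proof -
 obtain d :: "nat \<Rightarrow> real" where d: "summable (\<lambda>k. \<bar>d k\<bar>)"
  "\<And>\<theta>. \<bar>\<theta>\<bar> \<le> \<epsilon> \<Longrightarrow> (\<lambda>k. d k * cos (real k * (2 * pi * \<theta>))) sums 0"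
  "\<And>\<theta>. 2 * \<epsilon> \<le> \<bar>\<theta>\<bar> \<Longrightarrow> \<bar>\<theta>\<bar> \<le> 1 / 2 \<Longrightarrow> (\<lambda>k. d k * cos (real k * (2 * pi * \<theta>))) sums (- 1)"
  using trapezoid_cosine_series[OF e] by blast
 define a where "a j = complex_of_real (d (j div 2) / 2)" for j :: nat
 define n where "n j = (if even j then int (j div 2) else - int (j div 2))" for j
 have half: "(j - 1) div 2 = j div 2" if "odd j" for j :: nat using that by presburger
 have inter: "(\<lambda>j. a j * cis (2 * pi * (n j * \<theta>))) sums of_real S"
  if S: "(\<lambda>k. d k * cos (real k * (2 * pi * \<theta>))) sums S" for \<theta> :: real and S
 proof -
  define F where "F s k = complex_of_real (d k / 2) * cis (s * (2 * pi * (real k * \<theta>)))" for s k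
  have "summable (F s)" for s
  proof (rule summable_norm_cancel)
   have "norm (F s k) = \<bar>d k\<bar> / 2" for k by (simp add: F_def norm_mult)
   then show "summable (\<lambda>k. norm (F s k))" using summable_divide[OF d(1), of 2] by (simp only:)
  qed
  then have Fs: "F s sums suminf (F s)" for s by (rule summable_sums)
  have "F 1 k + F (- 1) k = of_real (d k * cos (real k * (2 * pi * \<theta>)))" for k
   by (simp add: F_def complex_eq_iff mult_ac)
  then have "(\<lambda>k. complex_of_real (d k * cos (real k * (2 * pi * \<theta>)))) sums (suminf (F 1) + suminf (F (- 1)))"
   using sums_add[OF Fs[of 1] Fs[of "- 1"]] by simp
  then have "suminf (F (- 1)) + suminf (F 1) = of_real S"
   using sums_of_real[OF S, where 'a=complex] by (subst add.commute) (rule sums_unique2)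
  moreover have "(if even j then F 1 (j div 2) else F (- 1) ((j - 1) div 2)) = a j * cis (2 * pi * (n j * \<theta>))" for j
   using half[of j] by (auto simp: F_def a_def n_def)
  ultimately show ?thesis using complex_sums_if[OF Fs[of "- 1"] Fs[of 1]] by simp
 qed
 have per: "cis (2 * pi * (n k * (\<theta> - m))) = cis (2 * pi * (n k * \<theta>))" for k and \<theta> :: real and m :: int
 proof -
  have "cis (2 * pi * (n k * \<theta>)) = cis (2 * pi * (n k * (\<theta> - m)) + 2 * pi * of_int (n k * m))"
   by (simp add: algebra_simps)
  also have "\<dots> = cis (2 * pi * (n k * (\<theta> - m)))"
   by (simp only: cis_mult[symmetric] cis_multiple_2pi[OF Ints_of_int] mult_1_right)
  finally show ?thesis by simp
 qed
 show ?thesis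
 proof (rule that)
  have "norm (a j) = (if even j then \<bar>d (j div 2)\<bar> / 2 else \<bar>d ((j - 1) div 2)\<bar> / 2)" for j
   using half[of j] by (simp add: a_def)
  moreover have "summable (\<lambda>j. if even j then \<bar>d (j div 2)\<bar> / 2 else \<bar>d ((j - 1) div 2)\<bar> / 2)"
   using sums_if[OF summable_sums summable_sums, of "\<lambda>k. \<bar>d k\<bar> / 2" "\<lambda>k. \<bar>d k\<bar> / 2"] d(1)
   by (auto simp: sums_iff)
  ultimately show "summable (\<lambda>j. norm (a j))" by simp
 next
  fix \<theta> :: real and m :: int assume "\<bar>\<theta> - m\<bar> \<le> \<epsilon>"
  from inter[OF d(2)[OF this]] show "(\<lambda>k. a k * cis (2 * pi * (n k * \<theta>))) sums 0"
   by (simp add: per)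
 next
  fix \<theta> :: real assume *: "\<And>m::int. 2 * \<epsilon> \<le> \<bar>\<theta> - m\<bar>"
  have "\<bar>\<theta> - of_int (round \<theta>)\<bar> \<le> 1 / 2" using of_int_round_abs_le[of \<theta>] by (simp add: abs_minus_commute)
  from inter[OF d(3)[OF *[of "round \<theta>"] this]]
  show "(\<lambda>k. a k * cis (2 * pi * (n k * \<theta>))) sums (- 1)"
   by (simp add: per)
 qed
qed

section \<open>Density of an almost periodic measure\<close>

lemma series_integral:
 fixes F :: "nat \<Rightarrow> 'w \<Rightarrow> complex"
 assumes F: "\<And>k. integrable M (F k)" and le: "\<And>k. (LINT x|M. norm (F k x)) \<le> b k" and b: "summable b"
 shows "integrable M (\<lambda>x. \<Sum>k. F k x)" and "(\<lambda>k. LINT x|M. F k x) sums (LINT x|M. (\<Sum>k. F k x))"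
  and "(LINT x|M. norm (\<Sum>k. F k x)) \<le> suminf b"
proof -
 have s: "summable (\<lambda>k. LINT x|M. norm (F k x))"
  by (rule summable_comparison_test'[OF b, of 0]) (use le in \<open>simp add: abs_of_nonneg\<close>)
 note ae = AE_summable_of_integrals[OF F s]
 show i: "integrable M (\<lambda>x. \<Sum>k. F k x)" by (rule integrable_suminf[OF F ae s])
 show "(\<lambda>k. LINT x|M. F k x) sums (LINT x|M. (\<Sum>k. F k x))" by (rule sums_integral[OF F ae s])
 have N: "integrable M (\<lambda>x. norm (F k x))" for k by (rule integrable_norm[OF F])
 have ae': "AE x in M. summable (\<lambda>k. norm (norm (F k x)))" using ae by simp
 have s': "summable (\<lambda>k. LINT x|M. norm (norm (F k x)))" using s by simp
 have "(LINT x|M. norm (\<Sum>k. F k x)) \<le> (LINT x|M. (\<Sum>k. norm (F k x)))"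
  by (rule integral_mono_AE[OF integrable_norm[OF i] integrable_suminf[OF N ae' s']])
   (use ae in eventually_elim, rule summable_norm)
 also have "\<dots> = (\<Sum>k. (LINT x|M. norm (F k x)))" by (rule integral_suminf[OF N ae' s'])
 also have "\<dots> \<le> suminf b" by (rule suminf_le[OF le s b])
 finally show "(LINT x|M. norm (\<Sum>k. F k x)) \<le> suminf b" .
qed

lemma closed_near_int: "closed {z. near_int c z}"
proof -
 have "{z. near_int c z} = (\<Union>x\<in>(\<int>::real set). \<Union>y\<in>cball 0 c. {x + y})"
 proof (intro set_eqI iffI)
  fix z :: real assume "z \<in> {z. near_int c z}"
  then obtain m :: int where m: "\<bar>z - m\<bar> \<le> c" by (auto simp: near_int_def)
  have "z \<in> (\<Union>y\<in>cball 0 c. {of_int m + y})" using m by (intro UN_I[of "z - m"]) simp_all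
  then show "z \<in> (\<Union>x\<in>\<int>. \<Union>y\<in>cball 0 c. {x + y})" by (rule UN_I[rotated]) simp
 next
  fix z :: real assume "z \<in> (\<Union>x\<in>\<int>. \<Union>y\<in>cball 0 c. {x + y})"
  then obtain x y where "x \<in> \<int>" "y \<in> cball 0 c" "z = x + y" by blast
  moreover from this(1) obtain m where "x = of_int m" by (rule Ints_cases)
  ultimately show "z \<in> {z. near_int c z}" by (auto intro: near_intI[of _ m])
 qed
 then show ?thesis using closed_compact_sums[OF closed_Ints compact_cball] by simp
qed

lemma inv_fourier_translate: "inv_fourier (\<lambda>z. \<phi> (z - x)) y = wave x y * inv_fourier \<phi> y"
proof -
 have "inv_fourier (\<lambda>z. \<phi> (z - x)) y = (LINT z|lborel. wave y (x + z) * \<phi> z)"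
  unfolding inv_fourier_wave by (subst lborel_translate(2)[of _ x, symmetric]) simp
 also have "\<dots> = (LINT z|lborel. wave x y * (wave y z * \<phi> z))"
  by (simp add: wave_add_right wave_commute[of y x] mult.assoc)
 also have "\<dots> = wave x y * inv_fourier \<phi> y" unfolding inv_fourier_wave by (rule integral_mult_right_zero)
 finally show ?thesis .
qed

lemma meyer_uniform_discrete:
 assumes "meyer_set \<Lambda>" shows "uniform_discrete (\<Lambda> :: 'a::euclidean_space set)"
proof -
 obtain e where e: "0 < e" "\<And>x y. x \<in> differences \<Lambda> \<Longrightarrow> y \<in> differences \<Lambda> \<Longrightarrow> dist x y < e \<Longrightarrow> x = y"
  using assms unfolding meyer_set_def uniform_discrete_def by (elim conjE exE) blast
 have "x = y" if xy: "x \<in> \<Lambda>" "y \<in> \<Lambda>" "dist x y < e" for x y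
 proof -
  have "x - y \<in> differences \<Lambda>" "x - x \<in> differences \<Lambda>" using xy by blast+
  then have "x - y = x - x" by (rule e(2)) (use xy(3) in \<open>simp add: dist_norm\<close>)
  then show ?thesis by simp
 qed
 then show ?thesis using e(1) unfolding uniform_discrete_def by blast
qed

lemma uniform_discrete_countable:
 assumes "uniform_discrete (\<Lambda> :: 'a::euclidean_space set)" shows "countable \<Lambda>"
proof -
 have "finite (\<Lambda> \<inter> cball 0 (real m))" for m
  by (rule uniform_discrete_card_ball[OF assms, of "real m"]) blast
 then have "countable (\<Union>m. \<Lambda> \<inter> cball 0 (real m))" by (intro countable_UN countableI_type) (simp add: countable_finite)
 moreover have "(\<Union>m. \<Lambda> \<inter> cball 0 (real m)) = \<Lambda>" using real_arch_simple by auto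
 ultimately show ?thesis by simp
qed

text \<open>The counting measure on \<open>\<Lambda>\<close> is translation bounded.\<close>

lemma decay_sum_finite:
 assumes ud: "uniform_discrete (\<Lambda> :: 'a::euclidean_space set)"
 shows "(\<integral>\<^sup>+x. ennreal (decay x) \<partial>count_space \<Lambda>) < \<infinity>"
proof -
 define M where "M = distr (count_space \<Lambda>) borel (\<lambda>x. x)"
 have em: "emeasure M A = emeasure (count_space \<Lambda>) (\<Lambda> \<inter> A)" if "A \<in> sets borel" for A
  unfolding M_def using that by (subst emeasure_distr) (auto simp: Int_commute)
 have fin: "finite (\<Lambda> \<inter> cball w T)" for w T
  by (rule uniform_discrete_card_ball[OF ud, of T]) blast
 have lf: "locally_finite M"
  unfolding locally_finite_def
 proof (intro conjI ballI)
  show "sets M = sets borel" by (simp add: M_def)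
  fix A :: "'a set" assume A: "A \<in> bounded_borel"
  then obtain T where "\<And>x. x \<in> A \<Longrightarrow> norm x \<le> T" unfolding bounded_borel_def bounded_iff by blast
  then have "A \<subseteq> cball 0 T" by auto
  then have "finite (\<Lambda> \<inter> A)" using finite_subset[OF _ fin[of 0 T]] by blast
  then show "emeasure M A < \<infinity>" using A by (simp add: em bounded_borel_def of_nat_less_top)
 qed
 obtain N :: nat where N: "\<And>w. finite (\<Lambda> \<inter> cball w (real DIM('a))) \<and> card (\<Lambda> \<inter> cball w (real DIM('a))) \<le> N"
  by (rule uniform_discrete_card_ball[OF ud, of "real DIM('a)"]) blast
 have "emeasure M (cube t) \<le> ennreal (real N)" for t
 proof -
  have "cube t \<subseteq> cball t (real DIM('a))"
  proof
   fix x assume x: "x \<in> cube t"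
   have "norm (x - t) \<le> (\<Sum>b\<in>Basis. \<bar>(x - t) \<bullet> b\<bar>)" by (rule norm_le_l1)
   also have "\<dots> \<le> (\<Sum>b\<in>(Basis::'a set). 1)"
   proof (rule sum_mono)
    fix b :: 'a assume "b \<in> Basis"
    then have "\<bar>(x - t) \<bullet> b\<bar> \<le> 1 / 2" using x unfolding cube_def by blast
    then show "\<bar>(x - t) \<bullet> b\<bar> \<le> 1" by simp
   qed
   finally show "x \<in> cball t (real DIM('a))" by (simp add: dist_norm norm_minus_commute)
  qed
  then have sub: "\<Lambda> \<inter> cube t \<subseteq> \<Lambda> \<inter> cball t (real DIM('a))" by blast
  have "card (\<Lambda> \<inter> cube t) \<le> N" using card_mono[OF fin sub] N[of t] by linarith
  moreover have "finite (\<Lambda> \<inter> cube t)" by (rule finite_subset[OF sub fin])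
  ultimately show ?thesis by (simp add: em ennreal_of_nat_eq_real_of_nat)
 qed
 then have "(\<integral>\<^sup>+x. ennreal (decay (1 *\<^sub>R (x - 0))) \<partial>M)
   \<le> ennreal (3 ^ DIM('a) * real N * (LINT y|(lborel::'a measure). decay y) / 1 ^ DIM('a))"
  by (intro decay_average[OF lf]) simp_all
 also have "\<dots> < \<infinity>" by simp
 finally have "(\<integral>\<^sup>+x. ennreal (decay x) \<partial>M) < \<infinity>" by simp
 then show ?thesis unfolding M_def by (subst (asm) nn_integral_distr) simp_all
qed

lemma nn_integral_count_space_ge:
 assumes "x \<in> A" shows "g x \<le> (\<integral>\<^sup>+y. g y \<partial>count_space A)"
proof -
 have "g x = (\<integral>\<^sup>+y. g x * indicator {x} y \<partial>count_space A)"
  using assms by (subst nn_integral_cmult_indicator) auto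
 also have "\<dots> \<le> (\<integral>\<^sup>+y. g y \<partial>count_space A)" by (rule nn_integral_mono) (auto split: split_indicator)
 finally show ?thesis .
qed

lemma nn_integral_lborel_affine:
 fixes g :: "'a::euclidean_space \<Rightarrow> ennreal"
 assumes [measurable]: "g \<in> borel_measurable borel" and c: "0 < c"
 shows "(\<integral>\<^sup>+x. g x \<partial>lborel) = ennreal (c ^ DIM('a)) * (\<integral>\<^sup>+x. g (t + c *\<^sub>R x) \<partial>lborel)"
 using c by (subst lborel_affine[of c t]) (simp_all add: nn_integral_density nn_integral_distr nn_integral_cmult)

lemma nn_integral_count_space_infsum:
 fixes g :: "'b \<Rightarrow> real"
 assumes nn: "\<And>x. 0 \<le> g x" and fin: "(\<integral>\<^sup>+x. ennreal (g x) \<partial>count_space A) < \<infinity>"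
 shows "g summable_on A" and "(\<integral>\<^sup>+x. ennreal (g x) \<partial>count_space A) = ennreal (infsum g A)"
proof -
 have "integrable (count_space A) g" using nn fin by (intro integrableI_bounded) simp_all
 then have s: "Infinite_Set_Sum.abs_summable_on g A" by (simp add: Infinite_Set_Sum.abs_summable_on_def)
 then show "g summable_on A" unfolding abs_summable_equivalent[symmetric] by (rule abs_summable_summable)
 show "(\<integral>\<^sup>+x. ennreal (g x) \<partial>count_space A) = ennreal (infsum g A)"
  unfolding infsetsum_infsum[OF s, symmetric] using s nn by (rule nn_integral_conv_infsetsum)
qed

text \<open>The relation \<open>rel\<close> is all that is remembered of the measure \<open>\<mu>\<close>. The constant \<open>1 / 16\<close> is the outer
 half-width \<open>2\<epsilon>\<close> of the trapezoid.\<close>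

locale almost_periodic_density =
 fixes f :: "'a::euclidean_space \<Rightarrow> complex" and S :: "'a set" and a :: "nat \<Rightarrow> complex" and n :: "nat \<Rightarrow> int"
 assumes f: "locally_integrable f"
  and tb: "translation_bounded (abs_density f)"
  and a: "summable (\<lambda>k. norm (a k))"
  and far: "\<And>\<theta>::real. (\<And>m::int. 1 / 16 \<le> \<bar>\<theta> - m\<bar>) \<Longrightarrow> (\<lambda>k. a k * cis (2 * pi * (n k * \<theta>))) sums (- 1)"
  and rel: "\<And>\<xi>. \<xi> \<in> S \<Longrightarrow> AE y in lborel. (\<lambda>k. a k * f (y - of_int (n k) *\<^sub>R \<xi>)) sums 0"
  and meyer: "meyer_set {x. \<forall>\<xi>\<in>S. near_int (1 / 16) (\<xi> \<bullet> x)}"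
begin

definition carrier :: "'a set" where "carrier = {x. \<forall>\<xi>\<in>S. near_int (1 / 16) (\<xi> \<bullet> x)}"

lemma measurable_f [measurable]: "f \<in> borel_measurable borel" using f by (simp add: locally_integrable_def)

text \<open>The transforms \<open>h\<close> of test functions whose translates pair with \<open>f\<close> boundedly. Unlike rapid decay,
 this property survives the infinite sums of translates that multiplication by a cutoff causes.\<close>

definition admissible :: "('a \<Rightarrow> complex) \<Rightarrow> bool" where
 "admissible h \<longleftrightarrow> h \<in> borel_measurable borel \<and> (\<exists>M. \<forall>t. integrable lborel (\<lambda>y. h (y + t) * f y) \<and>
   (LINT y|lborel. norm (h (y + t) * f y)) \<le> M)"

lemma admissibleI:
 assumes [measurable]: "h \<in> borel_measurable borel" and M: "0 \<le> M"
  "\<And>t. (\<integral>\<^sup>+y. ennreal (norm (h (y + t))) \<partial>abs_density f) \<le> ennreal M"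
 shows "admissible h"
 unfolding admissible_def
proof (intro conjI exI allI)
 show "h \<in> borel_measurable borel" by measurable
 fix t
 have "(\<integral>\<^sup>+y. ennreal (norm (h (y + t) * f y)) \<partial>lborel)
   = (\<integral>\<^sup>+y. ennreal (norm (f y)) * ennreal (norm (h (y + t))) \<partial>lborel)"
  by (simp add: norm_mult ennreal_mult mult.commute)
 also have "\<dots> = (\<integral>\<^sup>+y. ennreal (norm (h (y + t))) \<partial>abs_density f)"
  by (rule nn_integral_density[symmetric]) measurable
 also have "\<dots> \<le> ennreal M" by (rule M(2))
 finally have le: "(\<integral>\<^sup>+y. ennreal (norm (h (y + t) * f y)) \<partial>lborel) \<le> ennreal M" .
 then have "(\<integral>\<^sup>+y. ennreal (norm (h (y + t) * f y)) \<partial>lborel) < \<infinity>"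
  by (rule le_less_trans) simp
 then show i: "integrable lborel (\<lambda>y. h (y + t) * f y)" by (intro integrableI_bounded) measurable
 have eq: "ennreal (LINT y|lborel. norm (h (y + t) * f y)) = (\<integral>\<^sup>+y. ennreal (norm (h (y + t) * f y)) \<partial>lborel)"
  by (rule nn_integral_eq_integral[symmetric, OF integrable_norm[OF i]]) simp
 show "(LINT y|lborel. norm (h (y + t) * f y)) \<le> M"
  using le unfolding eq[symmetric] ennreal_le_iff[OF M(1)] .
qed

definition pairing :: "('a \<Rightarrow> complex) \<Rightarrow> complex" where
 "pairing v = (LINT y|lborel. inv_fourier v y * f y)"

text \<open>The trapezoid itself, which is 1 near the integers and 0 far from them, as a function of \<open>\<xi> \<bullet> x\<close>.\<close>

definition cutoff :: "'a \<Rightarrow> 'a \<Rightarrow> complex" where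
 "cutoff \<xi> x = 1 + (\<Sum>k. a k * wave (of_int (n k) *\<^sub>R \<xi>) x)"

lemma cutoff_eq_0:
 assumes "\<not> near_int (1 / 16) (\<xi> \<bullet> x)" shows "cutoff \<xi> x = 0"
proof -
 have "1 / 16 \<le> \<bar>\<xi> \<bullet> x - of_int m\<bar>" for m :: int
  using assms unfolding near_int_def by (meson le_cases)
 from far[OF this] have "(\<lambda>k. a k * wave (of_int (n k) *\<^sub>R \<xi>) x) sums (- 1)" by (simp add: wave_def mult_ac)
 then show ?thesis unfolding cutoff_def by (simp add: sums_iff)
qed

text \<open>Multiplying \<open>v\<close> by a character translates its transform. Moving the translations over to \<open>f\<close>, all terms of
 the cutoff apart from the constant 1 add up to the relation \<open>rel\<close>.\<close>

lemma cutoff_step: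
 assumes v: "integrable lborel v" and adm: "admissible (inv_fourier v)" and \<xi>: "\<xi> \<in> S"
 shows "integrable lborel (\<lambda>x. cutoff \<xi> x * v x)" (is ?A)
  and "admissible (inv_fourier (\<lambda>x. cutoff \<xi> x * v x))" (is ?B)
  and "pairing (\<lambda>x. cutoff \<xi> x * v x) = pairing v" (is ?C)
proof -
 define \<eta> where "\<eta> k = of_int (n k) *\<^sub>R \<xi>" for k
 let ?h = "inv_fourier v"
 have [measurable]: "?h \<in> borel_measurable borel" using adm by (simp add: admissible_def)
 obtain M where M: "\<And>t. integrable lborel (\<lambda>y. ?h (y + t) * f y)" "\<And>t. (LINT y|lborel. norm (?h (y + t) * f y)) \<le> M"
  using adm unfolding admissible_def by blast
 define A where "A = (\<Sum>k. norm (a k))"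
 define g where "g k x = a k * (wave (\<eta> k) x * v x)" for k x
 have gs: "(\<Sum>k. g k x) = (\<Sum>k. a k * wave (\<eta> k) x) * v x" for x
 proof -
  have "summable (\<lambda>k. a k * wave (\<eta> k) x)" by (rule summable_norm_cancel) (simp add: norm_mult a)
  from suminf_mult2[OF this, of "v x"] show ?thesis by (simp add: g_def mult.assoc)
 qed
 have Ev: "cutoff \<xi> x * v x = v x + (\<Sum>k. g k x)" for x
  by (simp add: cutoff_def gs \<eta>_def distrib_right)
 have gi: "integrable lborel (g k)" for k
  unfolding g_def by (intro integrable_mult_right integrable_wave_mult v)
 have gle: "(LINT x|lborel. norm (g k x)) \<le> norm (a k) * (LINT x|lborel. norm (v x))" for k
  by (simp add: g_def norm_mult)
 have b: "summable (\<lambda>k. norm (a k) * (LINT x|lborel. norm (v x)))" by (intro summable_mult2 a)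
 show ?A unfolding Ev by (intro lintable_add v series_integral(1)[OF gi gle b])
 have inv: "inv_fourier (\<lambda>x. cutoff \<xi> x * v x) y = ?h y + (\<Sum>k. a k * ?h (y + \<eta> k))" for y
 proof -
  define G where "G k x = a k * (wave y x * (wave (\<eta> k) x * v x))" for k x
  have wg: "wave y x * g k x = G k x" for k x by (simp add: g_def G_def mult_ac)
  have Gi: "integrable lborel (G k)" for k
   unfolding G_def by (intro integrable_mult_right integrable_wave_mult v)
  have Gle: "(LINT x|lborel. norm (G k x)) \<le> norm (a k) * (LINT x|lborel. norm (v x))" for k
   by (simp add: G_def norm_mult)
  have "wave y x * (\<Sum>k. g k x) = (\<Sum>k. G k x)" for x
  proof -
   have "summable (\<lambda>k. g k x)" by (rule summable_norm_cancel) (simp add: g_def norm_mult summable_mult2 a)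
   from suminf_mult[OF this, of "wave y x"] show ?thesis by (simp add: wg)
  qed
  moreover have GI: "(LINT x|lborel. G k x) = a k * ?h (y + \<eta> k)" for k
   unfolding G_def integral_mult_right_zero by (simp only: inv_fourier_wave_mult[of "\<eta> k" v y, symmetric] inv_fourier_wave[symmetric])
  ultimately have "inv_fourier (\<lambda>x. cutoff \<xi> x * v x) y = (LINT x|lborel. wave y x * v x + (\<Sum>k. G k x))"
   unfolding inv_fourier_wave Ev by (simp add: distrib_left)
  also have "\<dots> = ?h y + (LINT x|lborel. (\<Sum>k. G k x))"
   unfolding inv_fourier_wave by (intro lint_add integrable_wave_mult v series_integral(1)[OF Gi Gle b])
  also have "(LINT x|lborel. (\<Sum>k. G k x)) = (\<Sum>k. (LINT x|lborel. G k x))"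
   by (rule sums_unique[OF series_integral(2)[OF Gi Gle b]])
  finally show ?thesis unfolding GI .
 qed
 define F where "F t k y = a k * (?h (y + (\<eta> k + t)) * f y)" for t k y
 have Fi: "integrable lborel (F t k)" for t k unfolding F_def by (intro integrable_mult_right M(1))
 have Fle: "(LINT y|lborel. norm (F t k y)) \<le> norm (a k) * M" for t k
 proof -
  have "(LINT y|lborel. norm (F t k y)) = norm (a k) * (LINT y|lborel. norm (?h (y + (\<eta> k + t)) * f y))"
   unfolding F_def norm_mult[of "a k"] by (rule integral_mult_right_zero)
  then show ?thesis using M(2)[of "\<eta> k + t"] by (simp add: mult_left_mono)
 qed
 have bM: "summable (\<lambda>k. norm (a k) * M)" by (intro summable_mult2 a)
 have hb: "summable (\<lambda>k. a k * ?h (y k))" for y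
 proof (rule summable_norm_cancel, rule summable_comparison_test'[of "\<lambda>k. norm (a k) * (LINT x|lborel. norm (v x))" 0])
  show "summable (\<lambda>k. norm (a k) * (LINT x|lborel. norm (v x)))" by (rule b)
  show "norm (norm (a k * ?h (y k))) \<le> norm (a k) * (LINT x|lborel. norm (v x))" for k
  proof -
   have "norm (a k) * norm (?h (y k)) \<le> norm (a k) * (LINT x|lborel. norm (v x))"
    by (rule mult_left_mono[OF norm_inv_fourier_le[OF v] norm_ge_zero])
   then show ?thesis by (simp only: norm_mult real_norm_def abs_mult abs_norm_cancel)
  qed
 qed
 have split: "inv_fourier (\<lambda>x. cutoff \<xi> x * v x) (y + t) * f y = ?h (y + t) * f y + (\<Sum>k. F t k y)" for t y
 proof -
  have "(\<Sum>k. a k * ?h (y + t + \<eta> k)) * f y = (\<Sum>k. F t k y)"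
   using suminf_mult2[OF hb[of "\<lambda>k. y + t + \<eta> k"], of "f y"] by (simp add: F_def ac_simps)
  then show ?thesis by (simp add: inv distrib_right)
 qed
 show ?B
  unfolding admissible_def
 proof (intro conjI exI allI)
  have "(\<lambda>y. ?h y + (\<Sum>k. a k * ?h (y + \<eta> k))) \<in> borel_measurable borel" by measurable
  then show "inv_fourier (\<lambda>x. cutoff \<xi> x * v x) \<in> borel_measurable borel" unfolding inv[abs_def] .
  fix t
  note I = series_integral[OF Fi[of t] Fle[of t] bM]
  show "integrable lborel (\<lambda>y. inv_fourier (\<lambda>x. cutoff \<xi> x * v x) (y + t) * f y)"
   unfolding split by (intro lintable_add M(1) I(1))
  have "(LINT y|lborel. norm (?h (y + t) * f y + (\<Sum>k. F t k y)))
   \<le> (LINT y|lborel. norm (?h (y + t) * f y) + norm (\<Sum>k. F t k y))"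
   by (intro integral_mono integrable_norm lintable_add M(1) I(1) norm_triangle_ineq)
  also have "\<dots> = (LINT y|lborel. norm (?h (y + t) * f y)) + (LINT y|lborel. norm (\<Sum>k. F t k y))"
   by (intro lint_add integrable_norm M(1) I(1))
  also have "\<dots> \<le> M + (\<Sum>k. norm (a k) * M)" by (intro add_mono M(2) I(3))
  finally show "(LINT y|lborel. norm (inv_fourier (\<lambda>x. cutoff \<xi> x * v x) (y + t) * f y)) \<le> M + (\<Sum>k. norm (a k) * M)"
   unfolding split .
 qed
 have zero: "(LINT y|lborel. (\<Sum>k. F 0 k y)) = 0"
 proof -
  define H where "H k y = ?h y * (a k * f (y - \<eta> k))" for k y
  have FH: "F 0 k ((- \<eta> k) + y) = H k y" for k y by (simp add: F_def H_def mult_ac)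
  have Hi: "integrable lborel (H k)" for k
   using Fi[of 0 k] lborel_translate(1)[of "F 0 k" "- \<eta> k"] unfolding FH by blast
  have Hle: "(LINT y|lborel. norm (H k y)) \<le> norm (a k) * M" for k
   using Fle[of 0 k] lborel_translate(2)[of "\<lambda>y. norm (F 0 k y)" "- \<eta> k"] unfolding FH by simp
  have HF: "(LINT y|lborel. H k y) = (LINT y|lborel. F 0 k y)" for k
   using lborel_translate(2)[of "F 0 k" "- \<eta> k"] unfolding FH .
  have "(LINT y|lborel. (\<Sum>k. H k y)) = (LINT y|(lborel::'a measure). 0)"
  proof (rule integral_cong_AE)
   show "(\<lambda>y. \<Sum>k. H k y) \<in> borel_measurable lborel" using series_integral(1)[OF Hi Hle bM] by simp
   show "AE y in lborel. (\<Sum>k. H k y) = 0"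
    using rel[OF \<xi>]
   proof eventually_elim
    case (elim y)
    then have "(\<lambda>k. H k y) sums (?h y * 0)" unfolding H_def \<eta>_def by (rule sums_mult)
    then show ?case by (simp add: sums_iff)
   qed
  qed simp
  moreover have "(LINT y|lborel. (\<Sum>k. H k y)) = (LINT y|lborel. (\<Sum>k. F 0 k y))"
   using series_integral(2)[OF Hi Hle bM] series_integral(2)[OF Fi[of 0] Fle[of 0] bM] unfolding HF by (rule sums_unique2)
  ultimately show ?thesis by simp
 qed
 have "pairing (\<lambda>x. cutoff \<xi> x * v x) = (LINT y|lborel. ?h (y + 0) * f y + (\<Sum>k. F 0 k y))"
  unfolding pairing_def using split[of _ 0] by simp
 also have "\<dots> = (LINT y|lborel. ?h (y + 0) * f y) + (LINT y|lborel. (\<Sum>k. F 0 k y))"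
  by (intro lint_add M(1) series_integral(1)[OF Fi Fle bM])
 finally show ?C by (simp add: zero pairing_def)
qed

text \<open>Every point of \<open>K\<close> has a neighbourhood on which some cutoff vanishes. By compactness a finite product
 of cutoffs annihilates \<open>v\<close>, while none of them changes the pairing.\<close>

lemma pairing_eq_0:
 assumes v: "integrable lborel v" "admissible (inv_fourier v)"
  and K: "compact K" "\<And>x. x \<notin> K \<Longrightarrow> v x = 0" "K \<inter> carrier = {}"
 shows "pairing v = 0"
proof -
 define U where "U \<xi> = {x. \<not> near_int (1 / 16) (\<xi> \<bullet> x)}" for \<xi> :: 'a
 have "open (U \<xi>)" for \<xi>
 proof -
  have "closed ((\<lambda>x. \<xi> \<bullet> x) -` {z. near_int (1 / 16) z})"
   by (intro continuous_closed_vimage closed_near_int) (intro continuous_intros)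
  then show ?thesis unfolding U_def closed_def by (simp add: vimage_def Collect_neg_eq)
 qed
 moreover have "K \<subseteq> (\<Union>\<xi>\<in>S. U \<xi>)" using K(3) unfolding carrier_def U_def by blast
 ultimately obtain S' where S': "S' \<subseteq> S" "finite S'" "K \<subseteq> (\<Union>\<xi>\<in>S'. U \<xi>)"
  using compactE_image[OF K(1), of S U] by metis
 have "\<exists>w. integrable lborel w \<and> admissible (inv_fourier w) \<and> pairing w = pairing v \<and>
   (\<forall>x. v x = 0 \<or> x \<in> (\<Union>\<xi>\<in>S'. U \<xi>) \<longrightarrow> w x = 0)"
  using S'(2,1)
 proof (induction S' rule: finite_induct)
  case empty
  show ?case using v by (intro exI[of _ v]) simp
 next
  case (insert \<xi> S')
  then obtain w where w: "integrable lborel w" "admissible (inv_fourier w)" "pairing w = pairing v"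
   "\<And>x. v x = 0 \<or> x \<in> (\<Union>\<xi>\<in>S'. U \<xi>) \<Longrightarrow> w x = 0" by auto
  have \<xi>: "\<xi> \<in> S" using insert by simp
  show ?case
  proof (intro exI[of _ "\<lambda>x. cutoff \<xi> x * w x"] conjI allI impI)
   fix x assume "v x = 0 \<or> x \<in> (\<Union>\<xi>\<in>insert \<xi> S'. U \<xi>)"
   then consider "w x = 0" | "x \<in> U \<xi>" using w(4) by blast
   then show "cutoff \<xi> x * w x = 0" by cases (simp_all add: U_def cutoff_eq_0)
  qed (simp_all add: cutoff_step[OF w(1,2) \<xi>] w(3))
 qed
 then obtain w where w: "pairing w = pairing v" "\<And>x. v x = 0 \<or> x \<in> (\<Union>\<xi>\<in>S'. U \<xi>) \<Longrightarrow> w x = 0" by blast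
 have "w x = 0" for x using w(2)[of x] K(2)[of x] S'(3) by blast
 then have "w = (\<lambda>x. 0)" by (rule ext)
 then show ?thesis using w(1) by (simp add: pairing_def inv_fourier_wave)
qed

lemma carrier_uniform_discrete: "uniform_discrete carrier"
 using meyer by (intro meyer_uniform_discrete) (simp add: carrier_def)

lemma inv_fourier_tent_translate:
 "0 < r \<Longrightarrow> inv_fourier (\<lambda>z. of_real (tent r (z - x))) y = wave x y * of_real (kap r y)"
 using inv_fourier_translate[of "\<lambda>z. of_real (tent r z)" x y] by (simp add: inv_fourier_tent)

lemma integrable_tent_translate: "0 < r \<Longrightarrow> integrable lborel (\<lambda>z. complex_of_real (tent r (z - x)))"
 using lborel_translate(1)[of "\<lambda>z. complex_of_real (tent r z)" "- x"] integrable_of_real[OF integrable_tent[of r], where 'a = complex] by simp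

lemma pairing_tent:
 "0 < r \<Longrightarrow> pairing (\<lambda>z. of_real (tent r (z - x))) = (LINT y|lborel. wave x y * (of_real (kap r y) * f y))"
 by (simp add: pairing_def inv_fourier_tent_translate mult.assoc)

lemma admissible_tent:
 assumes r: "0 < r" "r \<le> 1" shows "admissible (inv_fourier (\<lambda>z. of_real (tent r (z - x))))"
proof -
 obtain C where C: "0 \<le> C" "\<And>r s. 0 < r \<Longrightarrow> r \<le> 1 \<Longrightarrow>
   (\<integral>\<^sup>+y. ennreal (kap r (y - s)) \<partial>abs_density f) \<le> ennreal (C / r ^ DIM('a))"
  using kap_average[OF tb] by blast
 have "admissible (\<lambda>y. wave x y * of_real (kap r y))"
 proof (rule admissibleI)
  show "0 \<le> C / r ^ DIM('a)" using C(1) r by simp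
  fix t
  show "(\<integral>\<^sup>+y. ennreal (norm (wave x (y + t) * complex_of_real (kap r (y + t)))) \<partial>abs_density f) \<le> ennreal (C / r ^ DIM('a))"
   using C(2)[OF r, of "- t"] by (simp add: norm_mult kap_nonneg)
 qed measurable
 then show ?thesis by (simp add: inv_fourier_tent_translate[OF r(1), abs_def])
qed

lemma integrable_kap_f:
 assumes r: "0 < r" "r \<le> 1" shows "integrable lborel (\<lambda>y. of_real (kap r y) * f y)"
proof -
 have "integrable lborel (\<lambda>y. inv_fourier (\<lambda>z. of_real (tent r (z - 0))) (y + 0) * f y)"
  using admissible_tent[OF r, of 0] unfolding admissible_def by blast
 then show ?thesis unfolding inv_fourier_tent_translate[OF r(1)] by simp
qed

lemma pairing_tent_bound:
 obtains C where "0 \<le> C"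
  "\<And>r x. 0 < r \<Longrightarrow> r \<le> 1 \<Longrightarrow> norm (pairing (\<lambda>z. of_real (tent r (z - x)))) \<le> C / r ^ DIM('a)"
proof -
 obtain C where C: "0 \<le> C" "\<And>r s. 0 < r \<Longrightarrow> r \<le> 1 \<Longrightarrow>
   (\<integral>\<^sup>+y. ennreal (kap r (y - s)) \<partial>abs_density f) \<le> ennreal (C / r ^ DIM('a))"
  using kap_average[OF tb] by blast
 have "norm (pairing (\<lambda>z. of_real (tent r (z - x)))) \<le> C / r ^ DIM('a)" if r: "0 < r" "r \<le> 1" for r x
 proof -
  have "ennreal (norm (pairing (\<lambda>z. of_real (tent r (z - x))))) \<le> (\<integral>\<^sup>+y. ennreal (norm (wave x y * (of_real (kap r y) * f y))) \<partial>lborel)"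
   unfolding pairing_tent[OF r(1)]
   by (rule integral_norm_bound_ennreal) (intro integrable_wave_mult integrable_kap_f r)
  also have "\<dots> = (\<integral>\<^sup>+y. ennreal (norm (f y)) * ennreal (kap r (y - 0)) \<partial>lborel)"
   by (simp add: norm_mult kap_nonneg ennreal_mult mult.commute)
  also have "\<dots> = (\<integral>\<^sup>+y. ennreal (kap r (y - 0)) \<partial>abs_density f)"
   by (rule nn_integral_density[symmetric]) measurable
  also have "\<dots> \<le> ennreal (C / r ^ DIM('a))" by (rule C(2)[OF r])
  finally show ?thesis using C(1) r(1) by simp
 qed
 then show ?thesis using that C(1) by blast
qed

lemma pairing_tent_eq_0:
 fixes r :: real
 assumes r: "0 < r" "r \<le> 1" and far: "\<And>l. l \<in> carrier \<Longrightarrow> r * DIM('a) < norm (x - l)"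
 shows "pairing (\<lambda>z. of_real (tent r (z - x))) = 0"
proof (rule pairing_eq_0[OF integrable_tent_translate[OF r(1)] admissible_tent[OF r] compact_cball[of x "r * DIM('a)"]])
 show "complex_of_real (tent r (z - x)) = 0" if "z \<notin> cball x (r * DIM('a))" for z
  using that tent_eq_0_norm[OF r(1), of "z - x"] by (simp add: dist_norm norm_minus_commute)
 show "cball x (r * DIM('a)) \<inter> carrier = {}"
  using far by (auto simp: dist_norm not_le[symmetric])
qed

lemma decay_summable: "decay summable_on carrier"
 by (rule nn_integral_count_space_infsum(1)[OF less_imp_le[OF decay_pos] decay_sum_finite[OF carrier_uniform_discrete]])

lemma summable_le_decay:
 assumes "\<And>x. norm (v x :: complex) \<le> B * decay x" shows "(\<lambda>x. norm (v x)) summable_on carrier"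
 by (rule summable_on_comparison_test[OF summable_on_cmult_right[OF decay_summable]]) (use assms in auto)

text \<open>Inserting \<open>kap r\<close> into the pairing replaces the distribution by the function \<open>G\<close> of size
 \<open>O(r powr - d)\<close> near the carrier. Averages of \<open>|v|\<close> over balls of radius \<open>O(r)\<close> around the points of the
 carrier converge to the point values as \<open>r\<close> tends to 0, and \<open>decay\<close> dominates the sum.\<close>

lemma sampling_bound:
 obtains C where "0 \<le> C"
  "\<And>v B. continuous_on UNIV v \<Longrightarrow> (\<And>x. norm (v x) \<le> B * decay x) \<Longrightarrow> integrable lborel (\<lambda>y. inv_fourier v y * f y) \<Longrightarrow>
   norm (pairing v) \<le> C * (\<Sum>\<^sub>\<infinity>x\<in>carrier. norm (v x))"
proof -
 obtain C0 where C0: "0 \<le> C0"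
  "\<And>r x. 0 < r \<Longrightarrow> r \<le> 1 \<Longrightarrow> norm (pairing (\<lambda>z. of_real (tent r (z - x)))) \<le> C0 / r ^ DIM('a)"
  using pairing_tent_bound by blast
 define Q where "Q = cball (0::'a) (real DIM('a))"
 have [measurable]: "Q \<in> sets borel" by (simp add: Q_def)
 have Qfin: "emeasure lborel Q < \<infinity>" unfolding Q_def by (rule emeasure_lborel_cball_finite)
 define V where "V = measure lborel Q"
 have V: "emeasure lborel Q = ennreal V" "0 \<le> V" using Qfin by (simp_all add: V_def emeasure_eq_ennreal_measure)
 have d1: "1 \<le> real DIM('a)" using DIM_positive[where 'a='a] by (simp add: Suc_le_eq)
 (* The denominator keeps balls of radius r i * DIM('a) inside unit cubes, where decay varies by a
   bounded factor. *)
 define r where "r i = inverse (real (Suc i)) / (2 * DIM('a))" for i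
 have r0: "0 < r i" for i using d1 by (simp add: r_def)
 have rd: "r i * DIM('a) \<le> 1 / 2" for i
 proof -
  have "r i * DIM('a) = inverse (real (Suc i)) / 2" using d1 by (simp add: r_def del: of_nat_Suc)
  also have "\<dots> \<le> 1 / 2" by (simp add: field_simps)
  finally show ?thesis .
 qed
 have r1: "r i \<le> 1" for i
 proof -
  have "r i \<le> r i * DIM('a)" using mult_left_mono[OF d1, of "r i"] r0[of i] by simp
  then show ?thesis using rd[of i] by simp
 qed
 have rlim: "r \<longlonglongrightarrow> 0" unfolding r_def using tendsto_divide_zero[OF inverse_nat_to_0] .
 have main: "norm (pairing v) \<le> (C0 * V) * (\<Sum>\<^sub>\<infinity>x\<in>carrier. norm (v x))"
  if cv: "continuous_on UNIV v" and vB: "\<And>x. norm (v x) \<le> B * decay x" and iv: "integrable lborel (\<lambda>y. inv_fourier v y * f y)" for v B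
 proof -
  have [measurable]: "v \<in> borel_measurable borel" using cv by (rule borel_measurable_continuous_onI)
  have v: "integrable lborel v" by (rule integrable_le_decay[OF _ vB]) measurable
  have [measurable]: "inv_fourier v \<in> borel_measurable borel" by (rule borel_measurable_inv_fourier[OF v])
  have B: "0 \<le> B" using vB[of 0] decay_pos[of "0::'a"] norm_ge_zero[of "v 0"] by (meson order_trans zero_le_mult_iff not_less)
  define G where "G i x = pairing (\<lambda>z. of_real (tent (r i) (z - x)))" for i x
  have G: "G i x = (LINT y|lborel. wave x y * (of_real (kap (r i) y) * f y))" for i x
   unfolding G_def by (rule pairing_tent[OF r0])
  define P where "P i = (LINT y|lborel. inv_fourier v y * (of_real (kap (r i) y) * f y))" for i
  have Plim: "P \<longlonglongrightarrow> pairing v"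
   unfolding P_def pairing_def
  proof (rule integral_dominated_convergence[where w = "\<lambda>y. norm (inv_fourier v y * f y)"])
   show "AE y in lborel. (\<lambda>i. inv_fourier v y * (of_real (kap (r i) y) * f y)) \<longlonglongrightarrow> inv_fourier v y * f y"
   proof (rule AE_I2)
    fix y :: 'a
    have "(\<lambda>i. kap (r i) y) \<longlonglongrightarrow> (\<Prod>b\<in>Basis. fejer (0 * (y \<bullet> b)))"
     unfolding kap_def
    proof (rule tendsto_prod)
     fix b :: 'a
     have "(\<lambda>i. r i * (y \<bullet> b)) \<longlonglongrightarrow> 0 * (y \<bullet> b)" by (intro tendsto_intros rlim)
     moreover have "continuous_on UNIV fejer" by (intro continuous_fejer continuous_on_id)
     ultimately show "(\<lambda>i. fejer (r i * (y \<bullet> b))) \<longlonglongrightarrow> fejer (0 * (y \<bullet> b))"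
      by (intro continuous_on_tendsto_compose[of UNIV fejer]) auto
    qed
    then have "(\<lambda>i. inv_fourier v y * (of_real (kap (r i) y) * f y)) \<longlonglongrightarrow> inv_fourier v y * (of_real 1 * f y)"
     by (intro tendsto_intros) simp
    then show "(\<lambda>i. inv_fourier v y * (of_real (kap (r i) y) * f y)) \<longlonglongrightarrow> inv_fourier v y * f y" by simp
   qed
   show "AE y in lborel. norm (inv_fourier v y * (of_real (kap (r i) y) * f y)) \<le> norm (inv_fourier v y * f y)" for i
   proof (rule AE_I2)
    fix y
    have "kap (r i) y * norm (f y) \<le> 1 * norm (f y)" by (intro mult_right_mono kap_le_1) simp
    then show "norm (inv_fourier v y * (of_real (kap (r i) y) * f y)) \<le> norm (inv_fourier v y * f y)"
     by (simp add: norm_mult kap_nonneg mult_left_mono)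
   qed
   show "integrable lborel (\<lambda>y. norm (inv_fourier v y * f y))" using iv by (rule integrable_norm)
  qed measurable
  have PG: "P i = (LINT x|lborel. v x * G i x)" for i
  proof -
   let ?k = "\<lambda>x y. (wave y x * v x) * (of_real (kap (r i) y) * f y)"
   have "(LINT y|lborel. LINT x|lborel. ?k x y) = (LINT x|lborel. LINT y|lborel. ?k x y)"
    by (rule Fubini_dominated(2)[OF sigma_finite_lborel sigma_finite_lborel _ v integrable_kap_f[OF r0[of i] r1[of i]]])
     (measurable, simp only: norm_mult norm_wave mult_1_left order_refl)
   moreover have "(LINT x|lborel. ?k x y) = inv_fourier v y * (of_real (kap (r i) y) * f y)" for y
    unfolding inv_fourier_wave by (rule integral_mult_left_zero)
   moreover have "(LINT y|lborel. ?k x y) = v x * G i x" for x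
   proof -
    have "?k x y = v x * (wave x y * (of_real (kap (r i) y) * f y))" for y by (simp add: wave_commute[of x y] mult_ac)
    then show ?thesis unfolding G by (simp only: integral_mult_right_zero)
   qed
   ultimately show ?thesis by (simp only: P_def)
  qed
  (* The integral over the ball around l, rescaled so that the domain does not depend on i. *)
  define H where "H i l = (\<integral>\<^sup>+u. ennreal (C0 * norm (v (l + r i *\<^sub>R u))) * indicator Q u \<partial>lborel)" for i l
  have PH: "ennreal (norm (P i)) \<le> (\<integral>\<^sup>+l. H i l \<partial>count_space carrier)" for i
  proof -
   define N where "N l = cball l (r i * DIM('a))" for l :: 'a
   have [measurable]: "N l \<in> sets borel" for l by (simp add: N_def)
   let ?b = "\<lambda>l x. ennreal (norm (v x) * (C0 / r i ^ DIM('a))) * indicator (N l) x"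
   have "ennreal (norm (P i)) \<le> (\<integral>\<^sup>+x. ennreal (norm (v x * G i x)) \<partial>lborel)"
    unfolding PG by (cases "integrable lborel (\<lambda>x. v x * G i x)")
     (simp_all add: integral_norm_bound_ennreal not_integrable_integral_eq)
   also have "\<dots> \<le> (\<integral>\<^sup>+x. \<integral>\<^sup>+l. ?b l x \<partial>count_space carrier \<partial>lborel)"
   proof (rule nn_integral_mono)
    fix x
    show "ennreal (norm (v x * G i x)) \<le> (\<integral>\<^sup>+l. ?b l x \<partial>count_space carrier)"
    proof (cases "\<exists>l\<in>carrier. norm (x - l) \<le> r i * DIM('a)")
     case True
     then obtain l where l: "l \<in> carrier" "norm (x - l) \<le> r i * DIM('a)" by blast
     have "norm (v x * G i x) \<le> norm (v x) * (C0 / r i ^ DIM('a))"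
      unfolding norm_mult G_def by (intro mult_left_mono C0 r0 r1) simp
     then have "ennreal (norm (v x * G i x)) \<le> ?b l x"
      using l(2) by (simp add: N_def dist_norm norm_minus_commute ennreal_leI)
     also have "\<dots> \<le> (\<integral>\<^sup>+l. ?b l x \<partial>count_space carrier)" by (rule nn_integral_count_space_ge[OF l(1)])
     finally show ?thesis .
    next
     case False
     then have "G i x = 0" unfolding G_def by (intro pairing_tent_eq_0 r0 r1) (simp add: not_le)
     then show ?thesis by simp
    qed
   qed
   also have "\<dots> = (\<integral>\<^sup>+l. \<integral>\<^sup>+x. ?b l x \<partial>lborel \<partial>count_space carrier)"
    by (rule nn_integral_count_space_nn_integral[OF uniform_discrete_countable[OF carrier_uniform_discrete]]) measurable
   also have "\<dots> = (\<integral>\<^sup>+l. H i l \<partial>count_space carrier)"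
   proof (rule nn_integral_cong)
    fix l
    have "(\<integral>\<^sup>+x. ?b l x \<partial>lborel) = ennreal (r i ^ DIM('a)) * (\<integral>\<^sup>+u. ?b l (l + r i *\<^sub>R u) \<partial>lborel)"
     by (rule nn_integral_lborel_affine[OF _ r0]) measurable
    also have "\<dots> = (\<integral>\<^sup>+u. ennreal (r i ^ DIM('a)) * ?b l (l + r i *\<^sub>R u) \<partial>lborel)"
     by (rule nn_integral_cmult[symmetric]) measurable
    also have "\<dots> = H i l"
     unfolding H_def
    proof (rule nn_integral_cong)
     fix u
     have "indicator (N l) (l + r i *\<^sub>R u) = (indicator Q u :: ennreal)"
      using r0[of i] by (auto simp: N_def Q_def dist_norm split: split_indicator)
     moreover have "ennreal (r i ^ DIM('a)) * ennreal (norm (v (l + r i *\<^sub>R u)) * (C0 / r i ^ DIM('a))) = ennreal (C0 * norm (v (l + r i *\<^sub>R u)))"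
      using r0[of i] C0(1) by (subst ennreal_mult[symmetric]) (simp_all add: field_simps)
     ultimately show "ennreal (r i ^ DIM('a)) * ?b l (l + r i *\<^sub>R u) = ennreal (C0 * norm (v (l + r i *\<^sub>R u))) * indicator Q u"
      by (simp only: mult.assoc[symmetric])
    qed
    finally show "(\<integral>\<^sup>+x. ?b l x \<partial>lborel) = H i l" .
   qed
   finally show ?thesis .
  qed
  have bound: "norm (v (l + r i *\<^sub>R u)) \<le> B * 3 ^ DIM('a) * decay l" if "u \<in> Q" for l u i
  proof -
   have "norm (r i *\<^sub>R u) \<le> r i * DIM('a)" using that r0[of i] by (simp add: Q_def mult_left_mono)
   then have n: "norm (r i *\<^sub>R u) \<le> 1 / 2" using rd[of i] by simp
   have "l + r i *\<^sub>R u \<in> cube l"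
    unfolding cube_def
   proof (intro CollectI ballI)
    fix b :: 'a assume "b \<in> Basis"
    from order_trans[OF Basis_le_norm[OF this] n] show "\<bar>(l + r i *\<^sub>R u - l) \<bullet> b\<bar> \<le> 1 / 2"
     unfolding add_diff_cancel_left' .
   qed
   from decay_cube[OF this, of 1 0] have "decay (l + r i *\<^sub>R u) \<le> 3 ^ DIM('a) * decay l" by simp
   then have "B * decay (l + r i *\<^sub>R u) \<le> B * (3 ^ DIM('a) * decay l)" using B by (rule mult_left_mono)
   then show ?thesis using vB[of "l + r i *\<^sub>R u"] by simp
  qed
  define W where "W l = ennreal (C0 * (B * 3 ^ DIM('a) * decay l)) * ennreal V" for l :: 'a
  have HW: "H i l \<le> W l" for i l
  proof -
   have "H i l \<le> (\<integral>\<^sup>+u. ennreal (C0 * (B * 3 ^ DIM('a) * decay l)) * indicator Q u \<partial>lborel)"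
    unfolding H_def by (rule nn_integral_mono) (auto intro!: ennreal_leI mult_left_mono bound C0 split: split_indicator)
   also have "\<dots> = W l" unfolding W_def V(1)[symmetric] by (rule nn_integral_cmult_indicator) measurable
   finally show ?thesis .
  qed
  have Hlim: "(\<lambda>i. H i l) \<longlonglongrightarrow> ennreal (C0 * V * norm (v l))" for l
  proof -
   have "(\<lambda>i. H i l) \<longlonglongrightarrow> (\<integral>\<^sup>+u. ennreal (C0 * norm (v l)) * indicator Q u \<partial>lborel)"
    unfolding H_def
   proof (rule nn_integral_dominated_convergence[where w = "\<lambda>u. ennreal (C0 * (B * 3 ^ DIM('a) * decay l)) * indicator Q u"])
    show "AE u in lborel. ennreal (C0 * norm (v (l + r j *\<^sub>R u))) * indicator Q u \<le> ennreal (C0 * (B * 3 ^ DIM('a) * decay l)) * indicator Q u" for j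
     by (rule AE_I2) (auto intro!: ennreal_leI mult_left_mono bound C0 split: split_indicator)
    have "(\<integral>\<^sup>+u. ennreal (C0 * (B * 3 ^ DIM('a) * decay l)) * indicator Q u \<partial>lborel) = ennreal (C0 * (B * 3 ^ DIM('a) * decay l)) * emeasure lborel Q"
     by (rule nn_integral_cmult_indicator) measurable
    then show "(\<integral>\<^sup>+u. ennreal (C0 * (B * 3 ^ DIM('a) * decay l)) * indicator Q u \<partial>lborel) < \<infinity>"
     by (simp add: V(1) ennreal_mult_less_top)
    show "AE u in lborel. (\<lambda>i. ennreal (C0 * norm (v (l + r i *\<^sub>R u))) * indicator Q u) \<longlonglongrightarrow> ennreal (C0 * norm (v l)) * indicator Q u"
    proof (rule AE_I2)
     fix u
     have "(\<lambda>i. l + r i *\<^sub>R u) \<longlonglongrightarrow> l + 0 *\<^sub>R u" by (intro tendsto_intros rlim)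
     then have "(\<lambda>i. v (l + r i *\<^sub>R u)) \<longlonglongrightarrow> v l"
      using continuous_on_tendsto_compose[OF cv, of "\<lambda>i. l + r i *\<^sub>R u" l sequentially] by simp
     then have "(\<lambda>i. ennreal (C0 * norm (v (l + r i *\<^sub>R u)))) \<longlonglongrightarrow> ennreal (C0 * norm (v l))"
      by (intro tendsto_intros)
     then show "(\<lambda>i. ennreal (C0 * norm (v (l + r i *\<^sub>R u))) * indicator Q u) \<longlonglongrightarrow> ennreal (C0 * norm (v l)) * indicator Q u"
      by (simp split: split_indicator)
    qed
   qed measurable
   also have "(\<integral>\<^sup>+u. ennreal (C0 * norm (v l)) * indicator Q u \<partial>lborel) = ennreal (C0 * norm (v l)) * ennreal V"
    unfolding V(1)[symmetric] by (rule nn_integral_cmult_indicator) measurable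
   also have "\<dots> = ennreal (C0 * V * norm (v l))"
    using C0(1) V(2) by (subst ennreal_mult[symmetric]) (simp_all add: mult_ac)
   finally show ?thesis .
  qed
  have "(\<lambda>i. \<integral>\<^sup>+l. H i l \<partial>count_space carrier) \<longlonglongrightarrow> (\<integral>\<^sup>+l. ennreal (C0 * V * norm (v l)) \<partial>count_space carrier)"
  proof (rule nn_integral_dominated_convergence[where w = W])
   have W: "W l = ennreal (C0 * V * (B * 3 ^ DIM('a))) * ennreal (decay l)" for l
    unfolding W_def using C0(1) V(2) B decay_pos[of l]
    by (subst (1 2) ennreal_mult[symmetric]) (simp_all add: mult_ac)
   have "(\<integral>\<^sup>+l. W l \<partial>count_space carrier) = ennreal (C0 * V * (B * 3 ^ DIM('a))) * (\<integral>\<^sup>+l. ennreal (decay l) \<partial>count_space carrier)"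
    unfolding W by (rule nn_integral_cmult) simp
   then show "(\<integral>\<^sup>+l. W l \<partial>count_space carrier) < \<infinity>"
    using decay_sum_finite[OF carrier_uniform_discrete] by (simp add: ennreal_mult_less_top)
  qed (simp_all add: HW Hlim)
  moreover have "(\<lambda>i. ennreal (norm (P i))) \<longlonglongrightarrow> ennreal (norm (pairing v))"
   by (intro tendsto_intros Plim)
  ultimately have le: "ennreal (norm (pairing v)) \<le> (\<integral>\<^sup>+l. ennreal (C0 * V * norm (v l)) \<partial>count_space carrier)"
   by (rule tendsto_le[OF sequentially_bot]) (simp add: PH)
  have sm: "(\<lambda>x. norm (v x)) summable_on carrier" by (rule summable_le_decay[OF vB])
  have "(\<integral>\<^sup>+l. ennreal (norm (v l)) \<partial>count_space carrier) = ennreal (\<Sum>\<^sub>\<infinity>x\<in>carrier. norm (v x))"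
  proof (rule nn_integral_count_space_infsum(2))
   have "(\<integral>\<^sup>+l. ennreal (norm (v l)) \<partial>count_space carrier) \<le> (\<integral>\<^sup>+l. ennreal B * ennreal (decay l) \<partial>count_space carrier)"
   proof (rule nn_integral_mono)
    fix l
    have "ennreal (norm (v l)) \<le> ennreal (B * decay l)" by (rule ennreal_leI[OF vB])
    then show "ennreal (norm (v l)) \<le> ennreal B * ennreal (decay l)"
     using B decay_pos[of l] by (simp add: ennreal_mult)
   qed
   also have "\<dots> = ennreal B * (\<integral>\<^sup>+l. ennreal (decay l) \<partial>count_space carrier)" by (rule nn_integral_cmult) simp
   also have "\<dots> < \<infinity>" using decay_sum_finite[OF carrier_uniform_discrete] by (simp add: ennreal_mult_less_top)
   finally show "(\<integral>\<^sup>+l. ennreal (norm (v l)) \<partial>count_space carrier) < \<infinity>" .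
  qed simp
  moreover have "(\<integral>\<^sup>+l. ennreal (C0 * V * norm (v l)) \<partial>count_space carrier) = ennreal (C0 * V) * (\<integral>\<^sup>+l. ennreal (norm (v l)) \<partial>count_space carrier)"
   using C0(1) V(2) by (subst nn_integral_cmult[symmetric]) (simp_all add: ennreal_mult)
  ultimately have "ennreal (norm (pairing v)) \<le> ennreal ((C0 * V) * (\<Sum>\<^sub>\<infinity>x\<in>carrier. norm (v x)))"
   using le C0(1) V(2) by (simp add: ennreal_mult infsum_nonneg)
  then show ?thesis using C0(1) V(2) by (simp add: infsum_nonneg)
 qed
 show ?thesis
 proof (rule that[of "C0 * V"])
  show "0 \<le> C0 * V" using C0(1) V(2) by simp
  show "norm (pairing v) \<le> C0 * V * (\<Sum>\<^sub>\<infinity>x\<in>carrier. norm (v x))"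
   if "continuous_on UNIV v" "\<And>x. norm (v x) \<le> B * decay x" "integrable lborel (\<lambda>y. inv_fourier v y * f y)" for v B
   using that by (rule main)
 qed
qed

text \<open>The class of test functions for the sampling bound. It contains the Schwartz functions and the
 tents, so that tents can be subtracted from Schwartz functions.\<close>

definition testable :: "('a \<Rightarrow> complex) \<Rightarrow> bool" where
 "testable v \<longleftrightarrow> continuous_on UNIV v \<and> (\<exists>B. \<forall>x. norm (v x) \<le> B * decay x) \<and> integrable lborel (\<lambda>y. inv_fourier v y * f y)"

lemma testable_integrable: assumes "testable v" shows "integrable lborel v"
proof -
 obtain B where "continuous_on UNIV v" "\<And>x. norm (v x) \<le> B * decay x" using assms unfolding testable_def by blast
 then show ?thesis by (intro integrable_le_decay borel_measurable_continuous_onI)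
qed

lemma testable_diff:
 assumes v: "testable v" and w: "testable w"
 shows "testable (\<lambda>x. v x - b * w x)" and "pairing (\<lambda>x. v x - b * w x) = pairing v - b * pairing w"
proof -
 obtain B B' where B: "\<And>x. norm (v x) \<le> B * decay x" and B': "\<And>x. norm (w x) \<le> B' * decay x"
  using v w unfolding testable_def by blast
 have iv: "integrable lborel (\<lambda>y. inv_fourier v y * f y)" and iw: "integrable lborel (\<lambda>y. inv_fourier w y * f y)"
  using v w unfolding testable_def by blast+
 have inv: "inv_fourier (\<lambda>x. v x - b * w x) y = inv_fourier v y - b * inv_fourier w y" for y
 proof -
  have i: "integrable lborel (\<lambda>x. wave y x * v x)" "integrable lborel (\<lambda>x. b * (wave y x * w x))"
   by (intro integrable_mult_right integrable_wave_mult testable_integrable v w)+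
  have "inv_fourier (\<lambda>x. v x - b * w x) y = (LINT x|lborel. wave y x * v x - b * (wave y x * w x))"
   unfolding inv_fourier_wave by (simp add: right_diff_distrib mult_ac)
  also have "\<dots> = inv_fourier v y - b * inv_fourier w y"
   unfolding inv_fourier_wave lint_diff[OF i] integral_mult_right_zero ..
  finally show ?thesis .
 qed
 then have eq: "inv_fourier (\<lambda>x. v x - b * w x) y * f y = inv_fourier v y * f y - b * (inv_fourier w y * f y)" for y
  by (simp add: left_diff_distrib)
 have "norm (v x - b * w x) \<le> (B + norm b * B') * decay x" for x
 proof -
  have "norm (v x - b * w x) \<le> norm (v x) + norm b * norm (w x)"
   using norm_triangle_ineq4[of "v x" "b * w x"] by (simp add: norm_mult)
  also have "\<dots> \<le> B * decay x + norm b * (B' * decay x)" by (intro add_mono mult_left_mono B B') simp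
  finally show ?thesis by (simp add: algebra_simps)
 qed
 moreover have "continuous_on UNIV (\<lambda>x. v x - b * w x)" using v w unfolding testable_def by (intro continuous_intros) blast+
 moreover have ibw: "integrable lborel (\<lambda>y. b * (inv_fourier w y * f y))" by (intro integrable_mult_right iw)
 moreover have "integrable lborel (\<lambda>y. inv_fourier v y * f y - b * (inv_fourier w y * f y))"
  by (intro lintable_diff iv ibw)
 ultimately show "testable (\<lambda>x. v x - b * w x)" unfolding testable_def eq by blast
 show "pairing (\<lambda>x. v x - b * w x) = pairing v - b * pairing w"
  unfolding pairing_def eq lint_diff[OF iv ibw] integral_mult_right_zero ..
qed

lemma testable_tent:
 fixes r :: real
 assumes r: "0 < r" "r \<le> 1" shows "testable (\<lambda>z. of_real (tent r (z - x)))"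
 unfolding testable_def
proof (intro conjI exI allI)
 show "continuous_on UNIV (\<lambda>z. complex_of_real (tent r (z - x)))" by (intro continuous_intros)
 let ?B = "(1 + (norm x + r * DIM('a))) ^ (2 * DIM('a)) * (1 / r ^ DIM('a))"
 show "norm (complex_of_real (tent r (z - x))) \<le> ?B * decay z" for z
 proof (rule le_decay)
  show B0: "0 \<le> ?B" using r by simp
  show "(1 + norm z) ^ (2 * DIM('a)) * norm (complex_of_real (tent r (z - x))) \<le> ?B"
  proof (cases "norm (z - x) \<le> r * DIM('a)")
   case True
   then have "norm z \<le> norm x + r * DIM('a)" using norm_triangle_ineq[of x "z - x"] by simp
   then show ?thesis using r tent_le[OF r(1), of "z - x"] tent_nonneg[OF r(1), of "z - x"]
    by (intro mult_mono power_mono) simp_all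
  next
   case False
   then show ?thesis using tent_eq_0_norm[OF r(1), of "z - x"] B0 by simp
  qed
 qed
 have "integrable lborel (\<lambda>y. inv_fourier (\<lambda>z. complex_of_real (tent r (z - x))) (y + 0) * f y)"
  using admissible_tent[OF r, of x] unfolding admissible_def by blast
 then show "integrable lborel (\<lambda>y. inv_fourier (\<lambda>z. complex_of_real (tent r (z - x))) y * f y)" by simp
qed

lemma separation:
 obtains r :: real where "0 < r" "r \<le> 1" "\<And>x y. x \<in> carrier \<Longrightarrow> y \<in> carrier \<Longrightarrow> x \<noteq> y \<Longrightarrow> tent r (x - y) = 0"
proof -
 obtain e where e: "0 < e" "\<And>x y. x \<in> carrier \<Longrightarrow> y \<in> carrier \<Longrightarrow> dist x y < e \<Longrightarrow> x = y"
  using carrier_uniform_discrete unfolding uniform_discrete_def by blast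
 define r where "r = min 1 (e / (2 * DIM('a)))"
 have r: "0 < r" "r \<le> 1" using e(1) by (simp_all add: r_def)
 have "r * DIM('a) \<le> e / (2 * DIM('a)) * DIM('a)" unfolding r_def by (intro mult_right_mono) simp_all
 also have "\<dots> = e / 2" by simp
 also have "\<dots> < e" using e(1) by simp
 finally have re: "r * DIM('a) < e" .
 have "tent r (x - y) = 0" if "x \<in> carrier" "y \<in> carrier" "x \<noteq> y" for x y
 proof (rule tent_eq_0_norm[OF r(1)])
  have "e \<le> norm (x - y)" using e(2)[OF that(1,2)] that(3) unfolding dist_norm by (meson not_less)
  then show "r * real DIM('a) < norm (x - y)" using re by simp
 qed
 then show ?thesis using that r by blast
qed

text \<open>Subtracting from \<open>\<phi>\<close> its values on a finite part \<open>A\<close> of the carrier times normalised tents leaves a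
 function that vanishes on \<open>A\<close> and is unchanged on the rest of the carrier. The sampling bound turns
 this into a bound on the remainder of the series.\<close>

lemma comb_has_sum:
 assumes r: "0 < r" "r \<le> 1" and sep: "\<And>x y. x \<in> carrier \<Longrightarrow> y \<in> carrier \<Longrightarrow> x \<noteq> y \<Longrightarrow> tent r (x - y) = 0"
  and \<phi>: "testable \<phi>"
 shows "((\<lambda>x. (of_real (r ^ DIM('a)) * pairing (\<lambda>z. of_real (tent r (z - x)))) * \<phi> x) has_sum pairing \<phi>) carrier"
proof -
 define c where "c x = of_real (r ^ DIM('a)) * pairing (\<lambda>z. of_real (tent r (z - x)))" for x
 obtain C where C: "0 \<le> C"
  "\<And>v B. continuous_on UNIV v \<Longrightarrow> (\<And>x. norm (v x) \<le> B * decay x) \<Longrightarrow> integrable lborel (\<lambda>y. inv_fourier v y * f y) \<Longrightarrow>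
   norm (pairing v) \<le> C * (\<Sum>\<^sub>\<infinity>x\<in>carrier. norm (v x))"
  using sampling_bound by blast
 have bound: "norm (pairing v) \<le> C * (\<Sum>\<^sub>\<infinity>x\<in>carrier. norm (v x))" if "testable v" for v
  using that C(2) unfolding testable_def by blast
 obtain B where "\<And>x. norm (\<phi> x) \<le> B * decay x" using \<phi> unfolding testable_def by blast
 then have sm: "(\<lambda>x. norm (\<phi> x)) summable_on carrier" by (rule summable_le_decay)
 have le: "norm (pairing \<phi> - (\<Sum>x\<in>A. c x * \<phi> x)) \<le> C * ((\<Sum>\<^sub>\<infinity>x\<in>carrier. norm (\<phi> x)) - (\<Sum>x\<in>A. norm (\<phi> x)))"
  if A: "finite A" "A \<subseteq> carrier" for A
 proof -
  let ?v = "\<lambda>A z. \<phi> z - (\<Sum>x\<in>A. (\<phi> x * of_real (r ^ DIM('a))) * of_real (tent r (z - x)))"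
  have "testable (?v A) \<and> pairing (?v A) = pairing \<phi> - (\<Sum>x\<in>A. c x * \<phi> x)"
   using A(1)
  proof (induction A rule: finite_induct)
   case empty
   show ?case using \<phi> by simp
  next
   case (insert x A)
   have "?v (insert x A) = (\<lambda>z. ?v A z - (\<phi> x * of_real (r ^ DIM('a))) * of_real (tent r (z - x)))"
    using insert(1,2) by (simp add: fun_eq_iff)
   then show ?case using insert testable_diff[OF conjunct1[OF insert.IH] testable_tent[OF r], of "\<phi> x * of_real (r ^ DIM('a))" x]
    by (simp add: c_def mult_ac)
  qed
  then have n: "testable (?v A)" and p: "pairing (?v A) = pairing \<phi> - (\<Sum>x\<in>A. c x * \<phi> x)" by blast+
  have val: "?v A z = (if z \<in> A then 0 else \<phi> z)" if z: "z \<in> carrier" for z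
  proof -
   have "(\<Sum>x\<in>A. (\<phi> x * of_real (r ^ DIM('a))) * of_real (tent r (z - x))) = (\<Sum>x\<in>A. if x = z then \<phi> z else 0)"
   proof (rule sum.cong[OF refl])
    fix x assume "x \<in> A"
    then have x: "x \<in> carrier" using A(2) by blast
    show "(\<phi> x * of_real (r ^ DIM('a))) * of_real (tent r (z - x)) = (if x = z then \<phi> z else 0)"
     using sep[OF z x] r(1) by (auto simp: tent_0)
   qed
   then show ?thesis using A(1) by simp
  qed
  have "(\<Sum>\<^sub>\<infinity>x\<in>carrier. norm (?v A x)) = (\<Sum>\<^sub>\<infinity>x\<in>carrier - A. norm (\<phi> x))"
  proof (rule infsum_cong_neutral)
   show "norm (?v A x) = 0" if "x \<in> carrier - (carrier - A)" for x using that by (subst val) auto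
   show "norm (?v A x) = norm (\<phi> x)" if "x \<in> carrier \<inter> (carrier - A)" for x using that by (subst val) auto
  qed auto
  also have "\<dots> = (\<Sum>\<^sub>\<infinity>x\<in>carrier. norm (\<phi> x)) - (\<Sum>x\<in>A. norm (\<phi> x))"
   using infsum_Diff[OF sm _ A(2)] A(1) by simp
  finally show ?thesis using bound[OF n] unfolding p by simp
 qed
 have "((\<lambda>A. C * ((\<Sum>\<^sub>\<infinity>x\<in>carrier. norm (\<phi> x)) - (\<Sum>x\<in>A. norm (\<phi> x)))) \<longlongrightarrow>
   C * ((\<Sum>\<^sub>\<infinity>x\<in>carrier. norm (\<phi> x)) - (\<Sum>\<^sub>\<infinity>x\<in>carrier. norm (\<phi> x)))) (finite_subsets_at_top carrier)"
  using has_sum_infsum[OF sm] unfolding has_sum_def by (intro tendsto_intros)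
 then have z: "((\<lambda>A. C * ((\<Sum>\<^sub>\<infinity>x\<in>carrier. norm (\<phi> x)) - (\<Sum>x\<in>A. norm (\<phi> x)))) \<longlongrightarrow> 0) (finite_subsets_at_top carrier)" by simp
 have "((\<lambda>A. pairing \<phi> - (\<Sum>x\<in>A. c x * \<phi> x)) \<longlongrightarrow> 0) (finite_subsets_at_top carrier)"
  by (rule Lim_null_comparison[OF eventually_finite_subsets_at_top_weakI z]) (rule le)
 from tendsto_diff[OF tendsto_const[of "pairing \<phi>"] this]
 have "((\<lambda>A. \<Sum>x\<in>A. c x * \<phi> x) \<longlongrightarrow> pairing \<phi>) (finite_subsets_at_top carrier)" by simp
 then show ?thesis unfolding has_sum_def c_def .
qed

end

section \<open>Size of the coefficients\<close>

text \<open>The inner product of \<open>g\<close> with a character in \<open>L\<^sup>2(kap r \<lambda>)\<close>, divided by the square of the norm of the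
 character, which is \<open>tent r 0\<close>.\<close>

definition coefficient :: "real \<Rightarrow> ('a::euclidean_space \<Rightarrow> complex) \<Rightarrow> 'a \<Rightarrow> complex" where
 "coefficient r g x = of_real (r ^ DIM('a)) * (LINT y|lborel. wave x y * (of_real (kap r y) * g y))"

text \<open>Bessel's inequality: the characters of points of \<open>A\<close> are orthogonal in \<open>L\<^sup>2(kap r \<lambda>)\<close>, since
 their inner products are values of the transform \<open>tent r\<close> at differences of points.\<close>

lemma bessel:
 fixes g :: "'a::euclidean_space \<Rightarrow> complex"
 assumes r: "0 < r" and A: "finite A"
  and sep: "\<And>x y. x \<in> A \<Longrightarrow> y \<in> A \<Longrightarrow> x \<noteq> y \<Longrightarrow> tent r (x - y) = 0"
  and [measurable]: "g \<in> borel_measurable borel" and M: "AE y in lborel. norm (g y) \<le> M" "0 \<le> M"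
 shows "(\<Sum>x\<in>A. (norm (coefficient r g x))\<^sup>2) \<le> M\<^sup>2"
proof -
 define c where "c x = coefficient r g x" for x
 define s where "s = (\<Sum>x\<in>A. (norm (c x))\<^sup>2)"
 let ?d = "r ^ DIM('a)"
 have d: "0 < ?d" using r by simp
 have ik: "integrable lborel (\<lambda>y::'a. kap r y)" by (rule integrable_kap[OF r])
 have ikg: "integrable lborel (\<lambda>y. of_real (kap r y) * g y)"
 proof (rule lintable_bound)
  show "integrable lborel (\<lambda>y::'a. kap r y * M)" using ik by simp
  show "AE y in lborel. norm (of_real (kap r y) * g y) \<le> norm (kap r y * M)"
   using M(1) by eventually_elim (use M(2) in \<open>simp add: norm_mult kap_nonneg mult_left_mono\<close>)
 qed measurable
 have ikc: "integrable lborel (\<lambda>y::'a. complex_of_real (kap r y))" by (rule integrable_of_real[OF ik])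
 define Q where "Q y = (\<Sum>x\<in>A. cnj (c x) * wave x y)" for y
 have Qg: "of_real (kap r y) * (g y * Q y) = (\<Sum>x\<in>A. cnj (c x) * (wave x y * (of_real (kap r y) * g y)))" for y
  by (simp add: Q_def sum_distrib_left mult_ac)
 have iQg: "integrable lborel (\<lambda>y. of_real (kap r y) * (g y * Q y))"
  unfolding Qg by (intro lintable_sum integrable_mult_right integrable_wave_mult ikg)
 have vQg: "(LINT y|lborel. of_real (kap r y) * (g y * Q y)) = of_real (s / ?d)"
 proof -
  have "(LINT y|lborel. of_real (kap r y) * (g y * Q y)) = (\<Sum>x\<in>A. (LINT y|lborel. cnj (c x) * (wave x y * (of_real (kap r y) * g y))))"
   unfolding Qg by (intro lint_sum integrable_mult_right integrable_wave_mult ikg)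
  also have "\<dots> = (\<Sum>x\<in>A. of_real ((norm (c x))^2 / ?d))"
  proof (rule sum.cong[OF refl])
   fix x
   have "(LINT y|lborel. wave x y * (of_real (kap r y) * g y)) = c x / of_real ?d"
    using r by (simp add: c_def coefficient_def)
   then have "(LINT y|lborel. cnj (c x) * (wave x y * (of_real (kap r y) * g y))) = cnj (c x) * (c x / of_real ?d)"
    by (simp only: integral_mult_right_zero)
   also have "\<dots> = (c x * cnj (c x)) / of_real ?d" by (simp add: mult.commute)
   also have "\<dots> = of_real ((norm (c x))^2 / ?d)" by (simp only: complex_norm_square[symmetric] of_real_divide)
   finally show "(LINT y|lborel. cnj (c x) * (wave x y * (of_real (kap r y) * g y))) = of_real ((norm (c x))^2 / ?d)" .
  qed
  also have "\<dots> = of_real (s / ?d)" by (simp add: s_def sum_divide_distrib)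
  finally show ?thesis .
 qed
 have QQ: "of_real (kap r y) * (cnj (Q y) * Q y) = (\<Sum>x\<in>A. \<Sum>z\<in>A. (c x * cnj (c z)) * (wave (z - x) y * of_real (kap r y)))" for y
 proof -
  have "cnj (Q y) * Q y = (\<Sum>x\<in>A. \<Sum>z\<in>A. (c x * wave (- x) y) * (cnj (c z) * wave z y))"
   by (simp add: Q_def sum_product wave_minus)
  moreover have "wave (z - x) y = wave (- x) y * wave z y" for x z by (simp add: wave_diff_left mult.commute)
  ultimately show ?thesis by (simp add: sum_distrib_left mult_ac)
 qed
 have iQQ: "integrable lborel (\<lambda>y. of_real (kap r y) * (cnj (Q y) * Q y))"
  unfolding QQ by (intro lintable_sum integrable_mult_right integrable_wave_mult ikc)
 have vQQ: "(LINT y|lborel. of_real (kap r y) * (cnj (Q y) * Q y)) = of_real (s / ?d)"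
 proof -
  have "(LINT y|lborel. of_real (kap r y) * (cnj (Q y) * Q y))
    = (\<Sum>x\<in>A. \<Sum>z\<in>A. (c x * cnj (c z)) * (LINT y|lborel. wave (z - x) y * of_real (kap r y)))"
   unfolding QQ
   by (subst lint_sum, intro lintable_sum integrable_mult_right integrable_wave_mult ikc,
     subst lint_sum, intro integrable_mult_right integrable_wave_mult ikc,
     simp only: integral_mult_right_zero)
  also have "\<dots> = (\<Sum>x\<in>A. \<Sum>z\<in>A. if z = x then (c x * cnj (c x)) * of_real (1 / ?d) else 0)"
  proof (intro sum.cong refl)
   fix x z assume "x \<in> A" "z \<in> A"
   then show "(c x * cnj (c z)) * (LINT y|lborel. wave (z - x) y * of_real (kap r y)) = (if z = x then (c x * cnj (c x)) * of_real (1 / ?d) else 0)"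
    using inv_fourier_kap[OF r, of "z - x"] sep[of z x] by (auto simp: inv_fourier_wave tent_0)
  qed
  also have "\<dots> = (\<Sum>x\<in>A. of_real ((norm (c x))^2 / ?d))"
   using A by (intro sum.cong refl) (simp add: complex_norm_square[symmetric] flip: of_real_power)
  also have "\<dots> = of_real (s / ?d)" by (simp add: s_def sum_divide_distrib)
  finally show ?thesis .
 qed
 (* This is norm (u - cnj w) ^ 2 \<ge> 0, expanded. *)
 have pw: "2 * Re (u * w) - Re (cnj w * w) \<le> (norm u)^2" for u w :: complex
 proof -
  have "0 \<le> (Re u - Re w)^2 + (Im u + Im w)^2" by simp
  then show ?thesis unfolding cmod_power2 by (simp add: power2_eq_square algebra_simps)
 qed
 have "2 * (s / ?d) - s / ?d = Re (LINT y|lborel. 2 * (of_real (kap r y) * (g y * Q y)) - of_real (kap r y) * (cnj (Q y) * Q y))"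
 proof -
  have "(LINT y|lborel. 2 * (of_real (kap r y) * (g y * Q y)) - of_real (kap r y) * (cnj (Q y) * Q y))
   = 2 * of_real (s / ?d) - of_real (s / ?d)"
   unfolding lint_diff[OF integrable_mult_right[OF iQg] iQQ] integral_mult_right_zero vQg vQQ ..
  then show ?thesis by simp
 qed
 also have "\<dots> = (LINT y|lborel. Re (2 * (of_real (kap r y) * (g y * Q y)) - of_real (kap r y) * (cnj (Q y) * Q y)))"
  by (rule integral_Re[symmetric]) (intro lintable_diff integrable_mult_right iQg iQQ)
 also have "\<dots> \<le> (LINT y|lborel. kap r (y::'a) * M\<^sup>2)"
 proof (rule integral_mono_AE)
  show "integrable lborel (\<lambda>y. Re (2 * (of_real (kap r y) * (g y * Q y)) - of_real (kap r y) * (cnj (Q y) * Q y)))"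
   by (intro integrable_Re lintable_diff integrable_mult_right iQg iQQ)
  show "integrable lborel (\<lambda>y::'a. kap r y * M\<^sup>2)" using ik by simp
  show "AE y in lborel. Re (2 * (of_real (kap r y) * (g y * Q y)) - of_real (kap r y) * (cnj (Q y) * Q y)) \<le> kap r y * M\<^sup>2"
   using M(1)
  proof eventually_elim
   case (elim y)
   have "Re (2 * (of_real (kap r y) * (g y * Q y)) - of_real (kap r y) * (cnj (Q y) * Q y))
     = kap r y * (2 * Re (g y * Q y) - Re (cnj (Q y) * Q y))" by (simp add: algebra_simps)
   also have "\<dots> \<le> kap r y * M\<^sup>2"
    by (intro mult_left_mono order_trans[OF pw] power_mono elim norm_ge_zero kap_nonneg)
   finally show ?case .
  qed
 qed
 also have "\<dots> = M\<^sup>2 / ?d"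
 proof -
  have "complex_of_real (LINT y|lborel. kap r (y::'a)) = of_real (tent r (0::'a))"
   using inv_fourier_kap[OF r, of "0::'a"] by (simp add: inv_fourier_wave)
  then have "(LINT y|lborel. kap r (y::'a)) = 1 / ?d" by (simp only: of_real_eq_iff tent_0)
  then show ?thesis by simp
 qed
 finally have "s / ?d \<le> M\<^sup>2 / ?d" by simp
 then show ?thesis using d by (simp add: s_def c_def divide_le_cancel)
qed

context almost_periodic_density
begin

text \<open>Truncating \<open>f\<close> at height \<open>m\<close> changes all coefficients uniformly by a small amount in
 \<open>L\<^sup>1(kap r \<lambda>)\<close>, and the coefficients of the bounded truncation are square summable.\<close>

lemma coefficients_vanish:
 assumes r: "0 < r" "r \<le> 1" and sep: "\<And>x y. x \<in> carrier \<Longrightarrow> y \<in> carrier \<Longrightarrow> x \<noteq> y \<Longrightarrow> tent r (x - y) = 0"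
 shows "((\<lambda>x. norm (coefficient r f x)) \<longlongrightarrow> 0) (inf at_infinity (principal carrier))"
proof (rule tendstoI)
 fix e :: real assume e: "0 < e"
 (* The truncation at height m. *)
 define g where "g m y = (if norm (f y) \<le> real m then f y else 0)" for m y
 have [measurable]: "g m \<in> borel_measurable borel" for m unfolding g_def by measurable
 have ikf: "integrable lborel (\<lambda>y. of_real (kap r y) * f y)" by (rule integrable_kap_f[OF r])
 have ikg: "integrable lborel (\<lambda>y. of_real (kap r y) * g m y)" for m
  by (rule lintable_bound[OF ikf]) (measurable, auto simp: g_def norm_mult)
 let ?u = "\<lambda>m y. of_real (kap r y) * f y - of_real (kap r y) * g m y"
 have "(\<lambda>m. LINT y|lborel. norm (?u m y)) \<longlonglongrightarrow> (LINT y|(lborel::'a measure). 0)"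
 proof (rule integral_dominated_convergence[where w = "\<lambda>y. norm (of_real (kap r y) * f y)"])
  show "AE y in lborel. (\<lambda>m. norm (?u m y)) \<longlonglongrightarrow> 0"
  proof (rule AE_I2)
   fix y
   obtain m0 :: nat where "norm (f y) \<le> real m0" using real_arch_simple by blast
   then have "\<forall>m\<ge>m0. norm (?u m y) = 0"
    by (auto simp: g_def intro: order_trans)
   then show "(\<lambda>m. norm (?u m y)) \<longlonglongrightarrow> 0"
    by (intro tendsto_eventually) (auto simp: eventually_sequentially)
  qed
  show "AE y in lborel. norm (norm (?u m y)) \<le> norm (of_real (kap r y) * f y)" for m
   by (rule AE_I2) (simp add: g_def)
 qed (use ikf in \<open>measurable, simp_all\<close>)
 then have "(\<lambda>m. LINT y|lborel. norm (?u m y)) \<longlonglongrightarrow> 0" by simp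
 then have "\<forall>\<^sub>F m in sequentially. (LINT y|lborel. norm (?u m y)) < e / 2"
  using e by (intro order_tendstoD(2)[of _ 0]) simp_all
 then obtain m where m: "(LINT y|lborel. norm (?u m y)) < e / 2"
  unfolding eventually_sequentially by blast
 have diff: "norm (coefficient r f x - coefficient r (g m) x) < e / 2" for x
 proof -
  have "coefficient r f x - coefficient r (g m) x
    = of_real (r ^ DIM('a)) * (LINT y|lborel. wave x y * ?u m y)"
   unfolding coefficient_def right_diff_distrib[of "wave _ _"]
   by (subst lint_diff[OF integrable_wave_mult[OF ikf] integrable_wave_mult[OF ikg]]) (rule right_diff_distrib[symmetric])
  then have "norm (coefficient r f x - coefficient r (g m) x)
    = r ^ DIM('a) * norm (LINT y|lborel. wave x y * ?u m y)"
   using r by (simp add: norm_mult norm_power)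
  also have "\<dots> \<le> 1 * (LINT y|lborel. norm (?u m y))"
  proof (rule mult_mono)
   show "r ^ DIM('a) \<le> 1" using r by (intro power_le_one) simp_all
   show "norm (LINT y|lborel. wave x y * ?u m y)
     \<le> (LINT y|lborel. norm (?u m y))"
    using norm_inv_fourier_le[OF lintable_diff[OF ikf ikg], of m x] unfolding inv_fourier_wave .
  qed simp_all
  finally show ?thesis using m by simp
 qed
 define X where "X = {x \<in> carrier. e \<le> norm (coefficient r f x)}"
 have "card F \<le> nat \<lceil>(real m)\<^sup>2 / (e / 2)^2\<rceil>" if F: "F \<subseteq> X" "finite F" for F
 proof -
  have "real (card F) * (e / 2)^2 = (\<Sum>x\<in>F. (e / 2)\<^sup>2)" by simp
  also have "\<dots> \<le> (\<Sum>x\<in>F. (norm (coefficient r (g m) x))\<^sup>2)"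
  proof (rule sum_mono)
   fix x assume "x \<in> F"
   then have "e \<le> norm (coefficient r f x)" using F by (auto simp: X_def)
   also have "\<dots> \<le> norm (coefficient r f x - coefficient r (g m) x) + norm (coefficient r (g m) x)"
    using norm_triangle_ineq[of "coefficient r f x - coefficient r (g m) x" "coefficient r (g m) x"] by simp
   finally have "e / 2 \<le> norm (coefficient r (g m) x)" using diff[of x] by simp
   then show "(e / 2)^2 \<le> (norm (coefficient r (g m) x))^2" using e by (intro power_mono) simp_all
  qed
  also have "\<dots> \<le> (real m)^2"
  proof (rule bessel[OF r(1) F(2)])
   show "tent r (x - y) = 0" if "x \<in> F" "y \<in> F" "x \<noteq> y" for x y using sep that F(1) unfolding X_def by blast
   show "AE y in lborel. norm (g m y) \<le> real m" by (rule AE_I2) (simp add: g_def)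
  qed simp_all
  finally have le: "real (card F) * (e / 2)^2 \<le> (real m)^2" .
  have "0 < (e / 2)^2" using e by simp
  from le have "real (card F) \<le> (real m)^2 / (e / 2)^2" unfolding pos_le_divide_eq[OF \<open>0 < (e / 2)^2\<close>] .
  then show ?thesis by linarith
 qed
 then have "finite X" by (rule finite_if_finite_subsets_card_bdd[THEN conjunct1])
 from finite_imp_bounded[OF this] obtain b where b: "\<And>x. x \<in> X \<Longrightarrow> norm x \<le> b" unfolding bounded_iff by blast
 show "\<forall>\<^sub>F x in inf at_infinity (principal carrier). dist (norm (coefficient r f x)) 0 < e"
  unfolding eventually_inf_principal eventually_at_infinity
 proof (intro exI[of _ "b + 1"] allI impI)
  fix x assume x: "b + 1 \<le> norm x" "x \<in> carrier"
  then have "x \<notin> X" using b[of x] by auto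
  then show "dist (norm (coefficient r f x)) 0 < e" using x(2) by (simp add: X_def)
 qed
qed

lemma coefficients_square_summable:
 assumes r: "0 < r" and sep: "\<And>x y. x \<in> carrier \<Longrightarrow> y \<in> carrier \<Longrightarrow> x \<noteq> y \<Longrightarrow> tent r (x - y) = 0"
  and M: "AE y in lborel. norm (f y) \<le> M"
 shows "(\<lambda>x. (norm (coefficient r f x))\<^sup>2) summable_on carrier"
proof (rule nonneg_bdd_above_summable_on)
 have M': "AE y in lborel. norm (f y) \<le> max M 0" using M by eventually_elim simp
 have "sum (\<lambda>x. (norm (coefficient r f x))\<^sup>2) F \<le> (max M 0)^2" if "F \<subseteq> carrier" "finite F" for F
  by (rule bessel[OF r that(2) _ measurable_f M']) (use sep that(1) in \<open>blast, simp\<close>)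
 then show "bdd_above (sum (\<lambda>x. (norm (coefficient r f x))\<^sup>2) ` {F. F \<subseteq> carrier \<and> finite F})"
  by (intro bdd_aboveI2[of _ _ "(max M 0)^2"]) simp
qed simp

lemma coefficient_eq_pairing:
 "0 < r \<Longrightarrow> coefficient r f x = of_real (r ^ DIM('a)) * pairing (\<lambda>z. of_real (tent r (z - x)))"
 by (simp only: coefficient_def pairing_tent)

lemma coefficients_bounded:
 assumes r: "0 < r" "r \<le> 1" shows "bounded (coefficient r f ` carrier)"
proof -
 obtain C where C: "\<And>r x. 0 < r \<Longrightarrow> r \<le> 1 \<Longrightarrow> norm (pairing (\<lambda>z. of_real (tent r (z - x)))) \<le> C / r ^ DIM('a)"
  using pairing_tent_bound by blast
 have "norm (coefficient r f x) \<le> C" for x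
  using mult_left_mono[OF C[OF r, of x], of "r ^ DIM('a)"] r by (simp add: coefficient_eq_pairing norm_mult norm_power)
 then show ?thesis unfolding bounded_iff by blast
qed

end

theorem theorem5p16:
 fixes \<mu> :: "'a::euclidean_space set \<Rightarrow> complex" and \<Gamma> :: "'a set"
 assumes "complex_radon \<mu>"
  and "fourier_transformable \<mu>"
  and "meyer_set \<Gamma>"
  and "radon_support \<mu> \<subseteq> \<Gamma>"
 shows "\<exists>\<Lambda> (c :: 'a \<Rightarrow> complex).
  meyer_set \<Lambda> \<and> bounded (c ` \<Lambda>) \<and>
  distribution_is_comb (mu_0a \<mu>) \<Lambda> c \<and>
  ((\<lambda>x. norm (c x)) \<longlongrightarrow> 0) (inf at_infinity (principal \<Lambda>)) \<and>
  ((\<exists>f. locally_integrable f \<and> essentially_bounded f \<and>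
     ac_part (fourier_measure \<mu>) = lebesgue_density f)
   \<longrightarrow> (\<lambda>x. (norm (c x))\<^sup>2) summable_on \<Lambda>)"
proof -
 obtain \<nu> where ft: "is_fourier_transform \<mu> \<nu>" using assms(2) unfolding fourier_transformable_def by blast
 have \<nu>: "complex_radon \<nu>" using ft by (simp add: is_fourier_transform_def)
 have "translation_bounded (total_variation \<nu>)"
  using \<nu> ft by (intro transform_translation_bounded) (simp_all add: is_fourier_transform_def)
 moreover obtain f N where f: "locally_integrable f" and N: "N \<in> null_sets lborel"
  and fN: "\<And>\<psi>. \<psi> \<in> borel_measurable borel \<Longrightarrow> (\<And>x. x \<in> N \<Longrightarrow> \<psi> x = 0) \<Longrightarrow>
   radon_integral \<nu> \<psi> = (LINT x|lborel. \<psi> x * f x)"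
  and le: "\<And>\<phi>. \<phi> \<in> borel_measurable borel \<Longrightarrow> (\<integral>\<^sup>+x. \<phi> x * ennreal (norm (f x)) \<partial>lborel) \<le> (\<integral>\<^sup>+x. \<phi> x \<partial>total_variation \<nu>)"
  using lebesgue_decomposition[OF \<nu>] by blast
 ultimately have tb: "translation_bounded (abs_density f)"
  by (intro translation_bounded_density)
 have ac: "ac_part (fourier_measure \<mu>) = lebesgue_density f"
  unfolding fourier_measure_eq[OF ft] by (rule ac_part_eq[OF \<nu> f N fN])
 obtain S where S: "\<And>\<xi> x. \<xi> \<in> S \<Longrightarrow> x \<in> \<Gamma> \<Longrightarrow> near_int (1 / 32) (\<xi> \<bullet> x)"
  and meyer: "meyer_set {x. \<forall>\<xi>\<in>S. near_int (1 / 16) (\<xi> \<bullet> x)}"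
  using meyer_extension[OF assms(3)] by blast
 have "0 < (1 / 32 :: real)" "(1 / 32 :: real) \<le> 1 / 8" by simp_all
 then obtain a :: "nat \<Rightarrow> complex" and n :: "nat \<Rightarrow> int" where a: "summable (\<lambda>k. norm (a k))"
  and near: "\<And>(\<theta>::real) (m::int). \<bar>\<theta> - m\<bar> \<le> 1 / 32 \<Longrightarrow> (\<lambda>k. a k * cis (2 * pi * (n k * \<theta>))) sums 0"
  and far: "\<And>\<theta>::real. (\<And>m::int. 2 * (1 / 32) \<le> \<bar>\<theta> - m\<bar>) \<Longrightarrow> (\<lambda>k. a k * cis (2 * pi * (n k * \<theta>))) sums (- 1)"
  using trapezoid_series[of "1 / 32"] by blast
 have rel: "AE y in lborel. (\<lambda>k. a k * f (y - of_int (n k) *\<^sub>R \<xi>)) sums 0" if \<xi>: "\<xi> \<in> S" for \<xi>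
 proof (rule density_translate_relation[OF assms(1) ft a _ f tb N fN])
  show "AE x in total_variation \<mu>. (\<lambda>k. a k * wave (of_int (n k) *\<^sub>R \<xi>) x) sums 0"
   using AE_in_radon_support[OF assms(1)]
  proof eventually_elim
   case (elim x)
   then have "near_int (1 / 32) (\<xi> \<bullet> x)" using S[OF \<xi>] assms(4) by blast
   then obtain m :: int where "\<bar>\<xi> \<bullet> x - m\<bar> \<le> 1 / 32" unfolding near_int_def by blast
   from near[OF this] show ?case by (simp add: wave_def mult_ac)
  qed
 qed
 have far': "(\<lambda>k. a k * cis (2 * pi * (n k * \<theta>))) sums (- 1)" if "\<And>m::int. 1 / 16 \<le> \<bar>\<theta> - m\<bar>" for \<theta> :: real
  by (rule far) (use that in simp)
 interpret almost_periodic_density f S a n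
 proof (rule almost_periodic_density.intro)
  show "(\<lambda>k. a k * cis (2 * pi * (n k * \<theta>))) sums (- 1)" if "\<And>m::int. 1 / 16 \<le> \<bar>\<theta> - m\<bar>" for \<theta> :: real
   using that by (rule far')
  show "AE y in lborel. (\<lambda>k. a k * f (y - of_int (n k) *\<^sub>R \<xi>)) sums 0" if "\<xi> \<in> S" for \<xi>
   using that by (rule rel)
 qed (rule f tb a meyer)+
 obtain r :: real where r: "0 < r" "r \<le> 1"
  and sep: "\<And>x y. x \<in> carrier \<Longrightarrow> y \<in> carrier \<Longrightarrow> x \<noteq> y \<Longrightarrow> tent r (x - y) = 0"
  using separation by blast
 show ?thesis
 proof (intro exI[of _ carrier] exI[of _ "coefficient r f"] conjI impI)
  show "meyer_set carrier" using meyer by (simp add: carrier_def)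
  show "bounded (coefficient r f ` carrier)" by (rule coefficients_bounded[OF r])
  show "distribution_is_comb (mu_0a \<mu>) carrier (coefficient r f)"
   unfolding distribution_is_comb_def
  proof (intro allI impI)
   fix \<phi> :: "'a \<Rightarrow> complex" assume s: "schwartz \<phi>"
   obtain B where B: "\<And>x. norm (\<phi> x) \<le> B * decay x" using schwartz_le_decay[OF s] by blast
   obtain B' where B': "0 \<le> B'" "\<And>y. norm (inv_fourier \<phi> y) \<le> B' * decay y"
    using schwartz_le_decay[OF schwartz_inv_fourier[OF s]] by blast
   have "integrable lborel (\<lambda>y. inv_fourier \<phi> y * f y)"
    using translation_bounded_pairing[OF f tb] borel_measurable_schwartz[OF schwartz_inv_fourier[OF s]] B' by metis
   then have "testable \<phi>" unfolding testable_def using continuous_schwartz[OF s] B by blast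
   from comb_has_sum[OF r sep this]
   show "((\<lambda>x. coefficient r f x * \<phi> x) has_sum mu_0a \<mu> \<phi>) carrier"
    unfolding mu_0a_eq[OF f tb ac s] pairing_def[symmetric] coefficient_eq_pairing[OF r(1)] .
  qed
  show "((\<lambda>x. norm (coefficient r f x)) \<longlongrightarrow> 0) (inf at_infinity (principal carrier))"
   by (rule coefficients_vanish[OF r sep])
  assume "\<exists>g. locally_integrable g \<and> essentially_bounded g \<and> ac_part (fourier_measure \<mu>) = lebesgue_density g"
  then obtain g M where g: "locally_integrable g" "ac_part (fourier_measure \<mu>) = lebesgue_density g"
   and M: "AE x in lborel. norm (g x) \<le> M" unfolding essentially_bounded_def by blast
  have "AE x in lborel. f x = g x" by (rule lebesgue_density_eq_AE[OF f g(1)]) (use ac g(2) in simp)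
  then have "AE x in lborel. norm (f x) \<le> M" using M by eventually_elim simp
  from coefficients_square_summable[OF r(1) _ this] sep
  show "(\<lambda>x. (norm (coefficient r f x))\<^sup>2) summable_on carrier" by blast
 qed
qed

end
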